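(* Let $(M,g_M)$ and $(N,g_N)$ be Riemannian manifolds and $p\in[1,\infty)$. Let $d$ be a continuous distance on the total space $T^*M\otimes TN$, let $\mu$ be a finite positive absolutely continuous measure on $M$, and for $u,v\in\dot W^{1,p}(M,N)$ put $$\dot\delta_{1,p}(u,v)=\int_M\frac{d(Du,Dv)}{1+d(Du,Dv)}\,d\mu+\bigl\|\,|Du|_{g_M^*\otimes g_N}-|Dv|_{g_M^*\otimes g_N}\bigr\|_{L^p(M)}.$$ If for almost every $x\in M$ the metric space $(\{x\}\times N,d)$ is complete and if the projection $\pi_{M\times N}\colon T^*M\otimes TN\to M\times N\subset T^*M\otimes TN$ is nonexpansive with respect to $d$, then the metric space $(\dot W^{1,p}(M,N),\dot\delta_{1,p})$ is complete.
   Context: Manifolds are Hausdorff and have a countable basis; measure-theoretic notions on $M$ are defined via local charts. A map $u\colon M\to N$ is colocally weakly differentiable if $u$ is measurable and $f\circ u$ is weakly differentiable for every $f\in C^1_c(N,\mathbb{R})$. Its colocal weak derivative is the (existing and almost everywhere unique) measurable bundle morphism $Du\colon TM\to TN$ covering $u$ such that for every $f\in C^1_c(N,\mathbb{R})$, $D(f\circ u)=Df\circ Du$ almost everywhere in $M$. For linear $\xi\colon T_xM\to T_yN$, $|\xi|_{g_M^*\otimes g_N}^2=\sum_i g_N(\xi(e_i),\xi(e_i))$ with $(e_i)$ a $g_M$-orthonormal basis of $T_xM$. $\dot W^{1,p}(M,N)$ is the set of (almost everywhere classes of) colocally weakly differentiable $u\colon M\to N$ with $|Du|_{g_M^*\otimes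 g_N}\in L^p(M)$, with respect to the Riemannian measure. $T^*M\otimes TN$ is the vector bundle over $M\times N$ with fiber $\mathcal{L}(T_xM,T_yN)$ over $(x,y)$; $M\times N$ is identified with its zero section. $Du$ is viewed as a map $x\mapsto Du(x)\in T^*M\otimes TN$, and $d(Du,Dv)$ is the function $x\mapsto d(Du(x),Dv(x))$. "Continuous distance" means a distance inducing the manifold topology. A Radon measure $\mu$ on $M$ is positive absolutely continuous if in local charts $\mu$ and Lebesgue measure are mutually absolutely continuous. *)

theory Defs
  imports "HOL-Analysis.Analysis"
begin

text \<open>
  Manifolds are of class C^1 with continuous Riemannian metrics; this is all the regularity that
  colocal weak differentiability requires, and smooth manifolds are the special case of a smooth
  atlas and a smooth metric. The underlying space is a Hausdorff, second countable type, the charts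
  take values in \<open>real ^ 'k\<close>, so that the dimension is \<open>CARD('k)\<close>.
\<close>

section \<open>Manifolds\<close>

definition C1_on :: "'a::real_normed_vector set \<Rightarrow> ('a \<Rightarrow> 'b::real_normed_vector) \<Rightarrow> bool" where
  "C1_on S f \<longleftrightarrow> (\<exists>f' :: 'a \<Rightarrow> 'a \<Rightarrow>\<^sub>L 'b.
     (\<forall>x\<in>S. (f has_derivative blinfun_apply (f' x)) (at x)) \<and> continuous_on S f')"

type_synonym ('m, 'k) chart = "'m set \<times> ('m \<Rightarrow> (real, 'k) vec)"

abbreviation cdom :: "('m, 'k::finite) chart \<Rightarrow> 'm set" where "cdom \<equiv> fst"

abbreviation cmap :: "('m, 'k::finite) chart \<Rightarrow> 'm \<Rightarrow> real ^ 'k" where "cmap \<equiv> snd"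

definition cinv :: "('m, 'k::finite) chart \<Rightarrow> real ^ 'k \<Rightarrow> 'm" where
  "cinv c = inv_into (cdom c) (cmap c)"

definition C1_atlas ::
  "('m::{second_countable_topology, t2_space}, 'k::finite) chart set \<Rightarrow> bool" where
  "C1_atlas A \<longleftrightarrow>
     (\<Union>c\<in>A. cdom c) = UNIV \<and>
     (\<forall>c\<in>A. open (cdom c) \<and> open (cmap c ` cdom c) \<and>
        homeomorphism (cdom c) (cmap c ` cdom c) (cmap c) (cinv c)) \<and>
     (\<forall>c\<in>A. \<forall>c'\<in>A. C1_on (cmap c ` (cdom c \<inter> cdom c')) (cmap c' \<circ> cinv c))"

definition C1_fun ::
  "('m::{second_countable_topology, t2_space}, 'k::finite) chart set \<Rightarrow> ('m \<Rightarrow> real) \<Rightarrow> bool" where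
  "C1_fun A f \<longleftrightarrow> (\<forall>c\<in>A. C1_on (cmap c ` cdom c) (f \<circ> cinv c))"

definition C1_compact_support ::
  "('m::{second_countable_topology, t2_space}, 'k::finite) chart set \<Rightarrow> ('m \<Rightarrow> real) set" where
  "C1_compact_support A = {f. C1_fun A f \<and> compact (closure {x. f x \<noteq> 0})}"


section \<open>Tangent spaces\<close>

text \<open>
  A tangent vector at \<open>x\<close> is the family of its coordinates in all charts around \<open>x\<close>, transforming
  by the derivatives of the transition maps. The value 0 at charts that do not contain \<open>x\<close> makes
  the representation unique; the vector space operations are the chartwise ones.
\<close>

type_synonym ('m, 'k) tvec = "('m, 'k) chart \<Rightarrow> (real, 'k) vec"

definition transition_deriv ::
  "('m, 'k::finite) chart \<Rightarrow> ('m, 'k) chart \<Rightarrow> 'm \<Rightarrow> real ^ 'k \<Rightarrow> real ^ 'k" where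
  "transition_deriv c c' x = frechet_derivative (cmap c' \<circ> cinv c) (at (cmap c x))"

definition tangent_space ::
  "('m, 'k::finite) chart set \<Rightarrow> 'm \<Rightarrow> ('m, 'k) tvec set" where
  "tangent_space A x =
     {v. (\<forall>c. \<not> (c \<in> A \<and> x \<in> cdom c) \<longrightarrow> v c = 0) \<and>
         (\<forall>c\<in>A. \<forall>c'\<in>A. x \<in> cdom c \<and> x \<in> cdom c' \<longrightarrow> v c' = transition_deriv c c' x (v c))}"

text \<open>The tangent vector at \<open>x\<close> whose coordinates in the chart \<open>c\<close> are \<open>h\<close>.\<close>

definition tvec_of ::
  "('m, 'k::finite) chart set \<Rightarrow> ('m, 'k) chart \<Rightarrow> 'm \<Rightarrow> real ^ 'k \<Rightarrow> ('m, 'k) tvec" where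
  "tvec_of A c x h = (\<lambda>c'. if c' \<in> A \<and> x \<in> cdom c' then transition_deriv c c' x h else 0)"

definition tzero :: "('m, 'k::finite) tvec" where
  "tzero = (\<lambda>c. 0)"

definition tadd :: "('m, 'k::finite) tvec \<Rightarrow> ('m, 'k) tvec \<Rightarrow> ('m, 'k) tvec" where
  "tadd v w = (\<lambda>c. v c + w c)"

definition tscale :: "real \<Rightarrow> ('m, 'k::finite) tvec \<Rightarrow> ('m, 'k) tvec" where
  "tscale r v = (\<lambda>c. r *\<^sub>R v c)"

text \<open>The differential at \<open>y\<close> of a C^1 function; it does not depend on the chart.\<close>

definition differential ::
  "('n, 'l::finite) chart set \<Rightarrow> ('n \<Rightarrow> real) \<Rightarrow> 'n \<Rightarrow> ('n, 'l) tvec \<Rightarrow> real" where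
  "differential B f y v =
     (let c = (SOME c. c \<in> B \<and> y \<in> cdom c)
      in frechet_derivative (f \<circ> cinv c) (at (cmap c y)) (v c))"


section \<open>Riemannian metrics\<close>

definition inner_product_on ::
  "('m, 'k::finite) tvec set \<Rightarrow> (('m, 'k) tvec \<Rightarrow> ('m, 'k) tvec \<Rightarrow> real) \<Rightarrow> bool" where
  "inner_product_on T b \<longleftrightarrow>
     (\<forall>v\<in>T. \<forall>w\<in>T. b v w = b w v) \<and>
     (\<forall>u\<in>T. \<forall>v\<in>T. \<forall>w\<in>T. b (tadd u v) w = b u w + b v w) \<and>
     (\<forall>r. \<forall>v\<in>T. \<forall>w\<in>T. b (tscale r v) w = r * b v w) \<and>
     (\<forall>v\<in>T. v \<noteq> tzero \<longrightarrow> b v v > 0)"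

definition riemannian_manifold ::
  "('m::{second_countable_topology, t2_space}, 'k::finite) chart set \<Rightarrow>
   ('m \<Rightarrow> ('m, 'k) tvec \<Rightarrow> ('m, 'k) tvec \<Rightarrow> real) \<Rightarrow> bool" where
  "riemannian_manifold A g \<longleftrightarrow>
     C1_atlas A \<and>
     (\<forall>x. inner_product_on (tangent_space A x) (g x)) \<and>
     (\<forall>c\<in>A. \<forall>h k. continuous_on (cdom c) (\<lambda>x. g x (tvec_of A c x h) (tvec_of A c x k)))"

definition orthonormal_basis ::
  "('m, 'k::finite) chart set \<Rightarrow> ('m \<Rightarrow> ('m, 'k) tvec \<Rightarrow> ('m, 'k) tvec \<Rightarrow> real) \<Rightarrow> 'm \<Rightarrow>
   ('m, 'k) tvec set \<Rightarrow> bool" where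
  "orthonormal_basis A g x E \<longleftrightarrow>
     finite E \<and> E \<subseteq> tangent_space A x \<and>
     (\<forall>e\<in>E. \<forall>e'\<in>E. g x e e' = (if e = e' then 1 else 0)) \<and>
     (\<forall>v\<in>tangent_space A x. \<exists>a. v = (\<lambda>c. \<Sum>e\<in>E. a e *\<^sub>R e c))"


section \<open>Measure theory on manifolds\<close>

definition AE_manifold :: "('m, 'k::finite) chart set \<Rightarrow> ('m \<Rightarrow> bool) \<Rightarrow> bool" where
  "AE_manifold A P \<longleftrightarrow> (\<forall>c\<in>A. cmap c ` {x \<in> cdom c. \<not> P x} \<in> null_sets lebesgue)"

text \<open>The sets that are Lebesgue measurable in charts; only the sigma-algebra is of interest.\<close>

definition lebesgue_algebra :: "('m, 'k::finite) chart set \<Rightarrow> 'm measure" where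
  "lebesgue_algebra A = sigma UNIV {E. \<forall>c\<in>A. cmap c ` (E \<inter> cdom c) \<in> sets lebesgue}"

text \<open>
  Finite Borel measures on a manifold are automatically Radon measures.
\<close>

definition finite_positive_abs_cont ::
  "('m::{second_countable_topology, t2_space}, 'k::finite) chart set \<Rightarrow> 'm measure \<Rightarrow> bool" where
  "finite_positive_abs_cont A \<mu> \<longleftrightarrow>
     sets \<mu> = sets borel \<and> finite_measure \<mu> \<and>
     (\<forall>c\<in>A. \<forall>E\<in>sets borel. E \<subseteq> cdom c \<longrightarrow>
        (emeasure \<mu> E = 0 \<longleftrightarrow> emeasure lborel (cmap c ` E) = 0))"

definition gram_matrix ::
  "('m, 'k::finite) chart set \<Rightarrow> ('m \<Rightarrow> ('m, 'k) tvec \<Rightarrow> ('m, 'k) tvec \<Rightarrow> real) \<Rightarrow>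
   ('m, 'k) chart \<Rightarrow> 'm \<Rightarrow> real ^ 'k ^ 'k" where
  "gram_matrix A g c x = (\<chi> i j. g x (tvec_of A c x (axis i 1)) (tvec_of A c x (axis j 1)))"

text \<open>
  The unique Borel measure that has density \<open>sqrt (det g)\<close> in each chart, and its completion,
  which is defined on all sets that are Lebesgue measurable in charts.
\<close>

definition riemannian_borel_measure ::
  "('m::{second_countable_topology, t2_space}, 'k::finite) chart set \<Rightarrow>
   ('m \<Rightarrow> ('m, 'k) tvec \<Rightarrow> ('m, 'k) tvec \<Rightarrow> real) \<Rightarrow> 'm measure" where
  "riemannian_borel_measure A g =
     (THE \<nu>. sets \<nu> = sets borel \<and>
        (\<forall>c\<in>A. \<forall>E\<in>sets borel. E \<subseteq> cdom c \<longrightarrow>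
           emeasure \<nu> E =
             (\<integral>\<^sup>+z. ennreal (sqrt (det (gram_matrix A g c (cinv c z)))) * indicator (cmap c ` E) z
                \<partial>lborel)))"

definition riemannian_measure ::
  "('m::{second_countable_topology, t2_space}, 'k::finite) chart set \<Rightarrow>
   ('m \<Rightarrow> ('m, 'k) tvec \<Rightarrow> ('m, 'k) tvec \<Rightarrow> real) \<Rightarrow> 'm measure" where
  "riemannian_measure A g = completion (riemannian_borel_measure A g)"

definition in_Lp :: "'a measure \<Rightarrow> real \<Rightarrow> ('a \<Rightarrow> real) \<Rightarrow> bool" where
  "in_Lp M p f \<longleftrightarrow> f \<in> borel_measurable M \<and> integrable M (\<lambda>x. \<bar>f x\<bar> powr p)"

definition Lp_norm :: "'a measure \<Rightarrow> real \<Rightarrow> ('a \<Rightarrow> real) \<Rightarrow> real" where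
  "Lp_norm M p f = (\<integral>x. \<bar>f x\<bar> powr p \<partial>M) powr (1 / p)"


section \<open>Weakly differentiable real-valued functions\<close>

definition locally_integrable_on ::
  "(real ^ 'k::finite) set \<Rightarrow> (real ^ 'k \<Rightarrow> real) \<Rightarrow> bool" where
  "locally_integrable_on \<Omega> f \<longleftrightarrow> (\<forall>K. compact K \<and> K \<subseteq> \<Omega> \<longrightarrow> f absolutely_integrable_on K)"

text \<open>\<open>f' z h\<close> is the weak derivative of \<open>f\<close> at \<open>z\<close> in the direction \<open>h\<close>.\<close>

definition has_weak_derivative_on ::
  "(real ^ 'k::finite) set \<Rightarrow> (real ^ 'k \<Rightarrow> real) \<Rightarrow> (real ^ 'k \<Rightarrow> real ^ 'k \<Rightarrow> real) \<Rightarrow> bool" where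
  "has_weak_derivative_on \<Omega> f f' \<longleftrightarrow>
     locally_integrable_on \<Omega> f \<and>
     (\<forall>z\<in>\<Omega>. linear (f' z)) \<and>
     (\<forall>h. locally_integrable_on \<Omega> (\<lambda>z. f' z h)) \<and>
     (\<forall>\<phi> :: real ^ 'k \<Rightarrow> real. \<forall>h.
        C1_on UNIV \<phi> \<and> compact (closure {z. \<phi> z \<noteq> 0}) \<and> closure {z. \<phi> z \<noteq> 0} \<subseteq> \<Omega> \<longrightarrow>
        (LINT z:\<Omega>|lebesgue. f z * frechet_derivative \<phi> (at z) h) =
        - (LINT z:\<Omega>|lebesgue. f' z h * \<phi> z))"

definition has_weak_derivative ::
  "('m, 'k::finite) chart set \<Rightarrow> ('m \<Rightarrow> real) \<Rightarrow> ('m \<Rightarrow> ('m, 'k) tvec \<Rightarrow> real) \<Rightarrow> bool" where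
  "has_weak_derivative A w \<omega> \<longleftrightarrow>
     (\<forall>c\<in>A. has_weak_derivative_on (cmap c ` cdom c) (w \<circ> cinv c)
        (\<lambda>z h. \<omega> (cinv c z) (tvec_of A c (cinv c z) h)))"

definition weakly_differentiable ::
  "('m, 'k::finite) chart set \<Rightarrow> ('m \<Rightarrow> real) \<Rightarrow> bool" where
  "weakly_differentiable A w \<longleftrightarrow> (\<exists>\<omega>. has_weak_derivative A w \<omega>)"


section \<open>The bundle of linear maps between tangent spaces\<close>

text \<open>
  Linear maps are restricted to the tangent space (\<open>undefined\<close> elsewhere), so that distinct
  functions are distinct linear maps.
\<close>

definition hom_space ::
  "('m, 'k::finite) chart set \<Rightarrow> ('n, 'l::finite) chart set \<Rightarrow> 'm \<Rightarrow> 'n \<Rightarrow>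
   (('m, 'k) tvec \<Rightarrow> ('n, 'l) tvec) set" where
  "hom_space A B x y =
     {\<xi> \<in> tangent_space A x \<rightarrow>\<^sub>E tangent_space B y.
        (\<forall>v\<in>tangent_space A x. \<forall>w\<in>tangent_space A x. \<xi> (tadd v w) = tadd (\<xi> v) (\<xi> w)) \<and>
        (\<forall>r. \<forall>v\<in>tangent_space A x. \<xi> (tscale r v) = tscale r (\<xi> v))}"

type_synonym ('m, 'k, 'n, 'l) hom_elem = "'m \<times> 'n \<times> (('m, 'k) tvec \<Rightarrow> ('n, 'l) tvec)"

definition hom_bundle ::
  "('m, 'k::finite) chart set \<Rightarrow> ('n, 'l::finite) chart set \<Rightarrow> ('m, 'k, 'n, 'l) hom_elem set" where
  "hom_bundle A B = {(x, y, \<xi>). \<xi> \<in> hom_space A B x y}"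

text \<open>The inverse of the local trivialization over \<open>cdom c \<times> cdom c'\<close>.\<close>

definition hom_bundle_param ::
  "('m, 'k::finite) chart set \<Rightarrow> ('n, 'l::finite) chart set \<Rightarrow> ('m, 'k) chart \<Rightarrow> ('n, 'l) chart \<Rightarrow>
   'm \<times> 'n \<times> ((real ^ 'k) \<Rightarrow>\<^sub>L (real ^ 'l)) \<Rightarrow> ('m, 'k, 'n, 'l) hom_elem" where
  "hom_bundle_param A B c c' =
     (\<lambda>(x, y, L). (x, y, \<lambda>v\<in>tangent_space A x. tvec_of B c' y (blinfun_apply L (v c))))"

definition hom_bundle_open ::
  "('m::{second_countable_topology, t2_space}, 'k::finite) chart set \<Rightarrow>
   ('n::{second_countable_topology, t2_space}, 'l::finite) chart set \<Rightarrow>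
   ('m, 'k, 'n, 'l) hom_elem set \<Rightarrow> bool" where
  "hom_bundle_open A B W \<longleftrightarrow>
     W \<subseteq> hom_bundle A B \<and>
     (\<forall>c\<in>A. \<forall>c'\<in>B. open {q \<in> cdom c \<times> cdom c' \<times> UNIV. hom_bundle_param A B c c' q \<in> W})"

definition hom_bundle_topology ::
  "('m::{second_countable_topology, t2_space}, 'k::finite) chart set \<Rightarrow>
   ('n::{second_countable_topology, t2_space}, 'l::finite) chart set \<Rightarrow>
   ('m, 'k, 'n, 'l) hom_elem topology" where
  "hom_bundle_topology A B = topology (hom_bundle_open A B)"

lemma istopology_hom_bundle_open: "istopology (hom_bundle_open A B)"
proof -
  let ?S = "\<lambda>c c' W. {q \<in> cdom c \<times> cdom c' \<times> UNIV. hom_bundle_param A B c c' q \<in> W}"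
  have "hom_bundle_open A B (V \<inter> W)" if "hom_bundle_open A B V" "hom_bundle_open A B W" for V W
  proof -
    have "?S c c' (V \<inter> W) = ?S c c' V \<inter> ?S c c' W" for c c' by auto
    with that show ?thesis by (auto simp: hom_bundle_open_def intro!: open_Int)
  qed
  moreover have "hom_bundle_open A B (\<Union>\<K>)" if "\<forall>K\<in>\<K>. hom_bundle_open A B K" for \<K>
  proof -
    have "?S c c' (\<Union>\<K>) = (\<Union>K\<in>\<K>. ?S c c' K)" for c c' by auto
    with that show ?thesis by (auto simp: hom_bundle_open_def intro!: open_UN)
  qed
  ultimately show ?thesis by (simp add: istopology_def)
qed

lemma openin_hom_bundle_topology: "openin (hom_bundle_topology A B) = hom_bundle_open A B"
  by (simp add: hom_bundle_topology_def istopology_hom_bundle_open topology_inverse')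

definition zero_hom ::
  "('m, 'k::finite) chart set \<Rightarrow> ('n, 'l::finite) chart set \<Rightarrow> 'm \<Rightarrow> 'n \<Rightarrow>
   ('m, 'k, 'n, 'l) hom_elem" where
  "zero_hom A B x y = (x, y, \<lambda>v\<in>tangent_space A x. tzero)"

text \<open>The projection to \<open>M \<times> N\<close>, identified with the zero section.\<close>

definition hom_bundle_proj ::
  "('m, 'k::finite) chart set \<Rightarrow> ('n, 'l::finite) chart set \<Rightarrow>
   ('m, 'k, 'n, 'l) hom_elem \<Rightarrow> ('m, 'k, 'n, 'l) hom_elem" where
  "hom_bundle_proj A B = (\<lambda>(x, y, \<xi>). zero_hom A B x y)"

definition continuous_distance ::
  "('m::{second_countable_topology, t2_space}, 'k::finite) chart set \<Rightarrow>
   ('n::{second_countable_topology, t2_space}, 'l::finite) chart set \<Rightarrow>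
   (('m, 'k, 'n, 'l) hom_elem \<Rightarrow> ('m, 'k, 'n, 'l) hom_elem \<Rightarrow> real) \<Rightarrow> bool" where
  "continuous_distance A B d \<longleftrightarrow>
     Metric_space (hom_bundle A B) d \<and>
     Metric_space.mtopology (hom_bundle A B) d = hom_bundle_topology A B"

text \<open>The norm \<open>|\<xi>|\<close>; it does not depend on the orthonormal basis.\<close>

definition hom_norm ::
  "('m, 'k::finite) chart set \<Rightarrow> ('m \<Rightarrow> ('m, 'k) tvec \<Rightarrow> ('m, 'k) tvec \<Rightarrow> real) \<Rightarrow>
   ('n \<Rightarrow> ('n, 'l::finite) tvec \<Rightarrow> ('n, 'l) tvec \<Rightarrow> real) \<Rightarrow> ('m, 'k, 'n, 'l) hom_elem \<Rightarrow> real" where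
  "hom_norm A gM gN = (\<lambda>(x, y, \<xi>).
     sqrt (\<Sum>e\<in>(SOME E. orthonormal_basis A gM x E). gN y (\<xi> e) (\<xi> e)))"


section \<open>Colocal weak derivatives and Sobolev maps\<close>

definition colocally_weakly_differentiable ::
  "('m::{second_countable_topology, t2_space}, 'k::finite) chart set \<Rightarrow>
   ('n::{second_countable_topology, t2_space}, 'l::finite) chart set \<Rightarrow> ('m \<Rightarrow> 'n) \<Rightarrow> bool" where
  "colocally_weakly_differentiable A B u \<longleftrightarrow>
     u \<in> borel_measurable (lebesgue_algebra A) \<and>
     (\<forall>f\<in>C1_compact_support B. weakly_differentiable A (f \<circ> u))"

text \<open>
  A bundle morphism from \<open>TM\<close> to \<open>TN\<close> covering \<open>u\<close> is represented by the map
  \<open>x \<mapsto> (x, u x, U x)\<close> into the bundle of linear maps.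
\<close>

definition is_colocal_weak_derivative ::
  "('m::{second_countable_topology, t2_space}, 'k::finite) chart set \<Rightarrow>
   ('n::{second_countable_topology, t2_space}, 'l::finite) chart set \<Rightarrow> ('m \<Rightarrow> 'n) \<Rightarrow>
   ('m \<Rightarrow> ('m, 'k, 'n, 'l) hom_elem) \<Rightarrow> bool" where
  "is_colocal_weak_derivative A B u D \<longleftrightarrow>
     (\<exists>U. (\<forall>x. D x = (x, u x, U x)) \<and>
        (\<forall>x. U x \<in> hom_space A B x (u x)) \<and>
        D \<in> measurable (lebesgue_algebra A)
              (sigma (hom_bundle A B) {W. openin (hom_bundle_topology A B) W}) \<and>
        (\<forall>f\<in>C1_compact_support B. \<forall>\<omega>. has_weak_derivative A (f \<circ> u) \<omega> \<longrightarrow>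
           AE_manifold A (\<lambda>x. \<forall>v\<in>tangent_space A x. \<omega> x v = differential B f (u x) (U x v))))"

text \<open>
  For colocally weakly differentiable \<open>u\<close> the derivative exists and is unique almost everywhere.
\<close>

definition colocal_weak_derivative ::
  "('m::{second_countable_topology, t2_space}, 'k::finite) chart set \<Rightarrow>
   ('n::{second_countable_topology, t2_space}, 'l::finite) chart set \<Rightarrow> ('m \<Rightarrow> 'n) \<Rightarrow>
   'm \<Rightarrow> ('m, 'k, 'n, 'l) hom_elem" where
  "colocal_weak_derivative A B u = (SOME D. is_colocal_weak_derivative A B u D)"

definition sobolev_maps ::
  "('m::{second_countable_topology, t2_space}, 'k::finite) chart set \<Rightarrow>
   ('m \<Rightarrow> ('m, 'k) tvec \<Rightarrow> ('m, 'k) tvec \<Rightarrow> real) \<Rightarrow>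
   ('n::{second_countable_topology, t2_space}, 'l::finite) chart set \<Rightarrow>
   ('n \<Rightarrow> ('n, 'l) tvec \<Rightarrow> ('n, 'l) tvec \<Rightarrow> real) \<Rightarrow> real \<Rightarrow> ('m \<Rightarrow> 'n) set" where
  "sobolev_maps A gM B gN p =
     {u. colocally_weakly_differentiable A B u \<and>
         in_Lp (riemannian_measure A gM) p
           (\<lambda>x. hom_norm A gM gN (colocal_weak_derivative A B u x))}"

definition sobolev_space ::
  "('m::{second_countable_topology, t2_space}, 'k::finite) chart set \<Rightarrow>
   ('m \<Rightarrow> ('m, 'k) tvec \<Rightarrow> ('m, 'k) tvec \<Rightarrow> real) \<Rightarrow>
   ('n::{second_countable_topology, t2_space}, 'l::finite) chart set \<Rightarrow>
   ('n \<Rightarrow> ('n, 'l) tvec \<Rightarrow> ('n, 'l) tvec \<Rightarrow> real) \<Rightarrow> real \<Rightarrow> ('m \<Rightarrow> 'n) set set" where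
  "sobolev_space A gM B gN p =
     sobolev_maps A gM B gN p //
       {(u, v). u \<in> sobolev_maps A gM B gN p \<and> v \<in> sobolev_maps A gM B gN p \<and>
                AE_manifold A (\<lambda>x. u x = v x)}"

definition sobolev_delta ::
  "('m::{second_countable_topology, t2_space}, 'k::finite) chart set \<Rightarrow>
   ('m \<Rightarrow> ('m, 'k) tvec \<Rightarrow> ('m, 'k) tvec \<Rightarrow> real) \<Rightarrow>
   ('n::{second_countable_topology, t2_space}, 'l::finite) chart set \<Rightarrow>
   ('n \<Rightarrow> ('n, 'l) tvec \<Rightarrow> ('n, 'l) tvec \<Rightarrow> real) \<Rightarrow> real \<Rightarrow>
   (('m, 'k, 'n, 'l) hom_elem \<Rightarrow> ('m, 'k, 'n, 'l) hom_elem \<Rightarrow> real) \<Rightarrow> 'm measure \<Rightarrow>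
   ('m \<Rightarrow> 'n) \<Rightarrow> ('m \<Rightarrow> 'n) \<Rightarrow> real" where
  "sobolev_delta A gM B gN p d \<mu> u v =
     (let Du = colocal_weak_derivative A B u; Dv = colocal_weak_derivative A B v
      in (\<integral>x. d (Du x) (Dv x) / (1 + d (Du x) (Dv x)) \<partial>completion \<mu>) +
         Lp_norm (riemannian_measure A gM) p
           (\<lambda>x. hom_norm A gM gN (Du x) - hom_norm A gM gN (Dv x)))"

text \<open>The distance on almost everywhere classes, evaluated on arbitrary representatives.\<close>

definition sobolev_dist ::
  "('m::{second_countable_topology, t2_space}, 'k::finite) chart set \<Rightarrow>
   ('m \<Rightarrow> ('m, 'k) tvec \<Rightarrow> ('m, 'k) tvec \<Rightarrow> real) \<Rightarrow>
   ('n::{second_countable_topology, t2_space}, 'l::finite) chart set \<Rightarrow>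
   ('n \<Rightarrow> ('n, 'l) tvec \<Rightarrow> ('n, 'l) tvec \<Rightarrow> real) \<Rightarrow> real \<Rightarrow>
   (('m, 'k, 'n, 'l) hom_elem \<Rightarrow> ('m, 'k, 'n, 'l) hom_elem \<Rightarrow> real) \<Rightarrow> 'm measure \<Rightarrow>
   ('m \<Rightarrow> 'n) set \<Rightarrow> ('m \<Rightarrow> 'n) set \<Rightarrow> real" where
  "sobolev_dist A gM B gN p d \<mu> X Y =
     sobolev_delta A gM B gN p d \<mu> (SOME u. u \<in> X) (SOME v. v \<in> Y)"

end

theory Submission
  imports Defs
begin

text \<open>
  A Cauchy sequence has a subsequence \<open>u n\<close> such that, almost everywhere, \<open>Du n x\<close> is a Cauchy sequence
  for \<open>d\<close> and \<open>|Du n x|\<close> converges. As the projection is nonexpansive, \<open>u n x\<close> is a Cauchy sequence in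
  \<open>{x} \<times> N\<close> and converges; since the norms are bounded, \<open>Du n x\<close> stays in a compact part of the bundle,
  and a Cauchy sequence with a convergent subsequence converges. By Fatou's lemma the norms converge
  in \<open>L\<^sup>p(M)\<close>. They dominate the weak derivatives of \<open>f \<circ> u n\<close> for every test function \<open>f\<close>, so that one can
  pass to the limit in the definition of the weak derivative: the limit of \<open>Du n\<close> is the colocal weak
  derivative of the limit of \<open>u n\<close>.

  That every colocally weakly differentiable map \<open>u\<close> has an almost everywhere unique colocal weak
  derivative is seen from difference quotients. Cut-off coordinates of \<open>N\<close> give countably many test
  functions; for any finitely many of them, the difference quotients of their compositions with \<open>u\<close> in
  chart directions converge almost everywhere along a common sequence of step sizes. The chain rule along this sequence
  expresses the weak derivative of \<open>f \<circ> u\<close> by those of the coordinates.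
\<close>

section \<open>Functions of class C1 on Euclidean spaces\<close>

text \<open>The proof separates two questions. \<open>Lp_sections_complete\<close> concerns
  arbitrary measurable sections of the bundle and ignores that they are derivatives;
  \<open>has_weak_derivative_limit\<close> then shows that a limit of derivatives is a derivative.
  The second step works also for p = 1, where bounded sequences need not have weakly convergent
  subsequences, because the second summand of the distance forces the norms to converge strongly and
  so excludes concentration. The first summand yields only convergence in measure for \<mu>; but
  \<mu>, the Riemannian measure and Lebesgue measure in charts have the same null sets, so that
  "almost everywhere" means the same for all of them. The Riemannian measure and the colocal
  derivative are given by the descriptions \<open>THE\<close> and \<open>SOME\<close>, hence each
  statement about them rests on existence and uniqueness: change of variables for the former,
  difference quotients for the latter. Difference quotients suit maps u that are merely measurable:
  near a point u need not stay in one chart of N, so coordinates cannot be composed with u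
  directly.\<close>

lemma C1_onI:
  assumes "\<And>x. x \<in> S \<Longrightarrow> (f has_derivative blinfun_apply (f' x)) (at x)" "continuous_on S f'"
  shows "C1_on S f"
  using assms unfolding C1_on_def by blast

lemma C1_on_imp_continuous_on: "C1_on S f \<Longrightarrow> continuous_on S f"
  unfolding C1_on_def
  by (metis continuous_at_imp_continuous_on has_derivative_continuous)

lemma C1_on_has_derivative:
  "C1_on S f \<Longrightarrow> x \<in> S \<Longrightarrow> (f has_derivative frechet_derivative f (at x)) (at x)"
  unfolding C1_on_def by (auto simp: frechet_derivative_works[symmetric] differentiable_def)

lemma C1_on_frechet_continuous:
  assumes "C1_on S f"
  shows "continuous_on S (\<lambda>x. frechet_derivative f (at x) h)"
proof -
  from assms obtain f' where f': "\<And>x. x \<in> S \<Longrightarrow> (f has_derivative blinfun_apply (f' x)) (at x)"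
    "continuous_on S f'" unfolding C1_on_def by blast
  have "frechet_derivative f (at x) h = f' x h" if "x \<in> S" for x
    using frechet_derivative_at[OF f'(1)[OF that]] by simp
  moreover have "continuous_on S (\<lambda>x. f' x h)" using f'(2) by (intro continuous_intros)
  ultimately show ?thesis by (subst continuous_on_cong[OF refl]) auto
qed

lemma C1_on_const [simp]: "C1_on S (\<lambda>x. c)"
  by (rule C1_onI[where f'="\<lambda>_. 0"]) (auto simp: zero_blinfun.rep_eq)

lemma C1_on_bounded_linear: "bounded_linear f \<Longrightarrow> C1_on S f"
  by (rule C1_onI[where f'="\<lambda>_. Blinfun f"]) (auto simp: bounded_linear_Blinfun_apply bounded_linear_imp_has_derivative)

lemma C1_on_add:
  assumes "C1_on S f" "C1_on S g" shows "C1_on S (\<lambda>x. f x + g x)"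
proof -
  obtain f' g' where "\<And>x. x \<in> S \<Longrightarrow> (f has_derivative blinfun_apply (f' x)) (at x)" "continuous_on S f'"
    "\<And>x. x \<in> S \<Longrightarrow> (g has_derivative blinfun_apply (g' x)) (at x)" "continuous_on S g'"
    using assms unfolding C1_on_def by blast
  then show ?thesis
    by (intro C1_onI[where f'="\<lambda>x. f' x + g' x"])
       (auto intro!: derivative_eq_intros continuous_intros simp: blinfun.bilinear_simps)
qed

lemma C1_on_mult:
  fixes f g :: "'a::real_normed_vector \<Rightarrow> real"
  assumes "C1_on S f" "C1_on S g" shows "C1_on S (\<lambda>x. f x * g x)"
proof -
  obtain f' g' where d: "\<And>x. x \<in> S \<Longrightarrow> (f has_derivative blinfun_apply (f' x)) (at x)" "continuous_on S f'"
    "\<And>x. x \<in> S \<Longrightarrow> (g has_derivative blinfun_apply (g' x)) (at x)" "continuous_on S g'"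
    using assms unfolding C1_on_def by blast
  have c: "continuous_on S f" "continuous_on S g" using assms C1_on_imp_continuous_on by auto
  show ?thesis
    by (intro C1_onI[where f'="\<lambda>x. f x *\<^sub>R g' x + g x *\<^sub>R f' x"])
       (use d c in \<open>auto intro!: derivative_eq_intros continuous_intros simp: blinfun.bilinear_simps\<close>)
qed

lemma C1_on_compose:
  assumes "C1_on S f" "C1_on T g" "f ` S \<subseteq> T" shows "C1_on S (g \<circ> f)"
proof -
  obtain f' g' where d: "\<And>x. x \<in> S \<Longrightarrow> (f has_derivative blinfun_apply (f' x)) (at x)" "continuous_on S f'"
    "\<And>x. x \<in> T \<Longrightarrow> (g has_derivative blinfun_apply (g' x)) (at x)" "continuous_on T g'"
    using assms unfolding C1_on_def by blast
  have c: "continuous_on S f" using assms C1_on_imp_continuous_on by auto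
  show ?thesis
  proof (rule C1_onI[where f'="\<lambda>x. g' (f x) o\<^sub>L f' x"])
    fix x assume "x \<in> S"
    then have "(g \<circ> f has_derivative blinfun_apply (g' (f x)) \<circ> blinfun_apply (f' x)) (at x)"
      using d assms(3) by (intro diff_chain_at) auto
    moreover have "blinfun_apply (g' (f x)) \<circ> blinfun_apply (f' x) = blinfun_apply (g' (f x) o\<^sub>L f' x)"
      by (auto simp: fun_eq_iff)
    ultimately show "(g \<circ> f has_derivative blinfun_apply (g' (f x) o\<^sub>L f' x)) (at x)" by simp
  next
    have "continuous_on S (\<lambda>x. g' (f x))"
      using d(4) c assms(3) continuous_on_compose2 by blast
    then show "continuous_on S (\<lambda>x. g' (f x) o\<^sub>L f' x)" using d(2) by (intro continuous_intros)
  qed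
qed

lemma C1_on_real_deriv:
  fixes f :: "real \<Rightarrow> real"
  assumes "\<And>x. x \<in> S \<Longrightarrow> (f has_real_derivative f' x) (at x)" "continuous_on S f'"
  shows "C1_on S f"
proof (rule C1_onI[where f'="\<lambda>x. blinfun_scaleR_left (f' x)"])
  fix x assume "x \<in> S"
  then have "(f has_derivative (*) (f' x)) (at x)"
    using assms(1)[of x] by (simp add: has_field_derivative_def)
  moreover have "(*) (f' x) = blinfun_apply (blinfun_scaleR_left (f' x))"
    by (auto simp: fun_eq_iff)
  ultimately show "(f has_derivative blinfun_apply (blinfun_scaleR_left (f' x))) (at x)" by simp
next
  show "continuous_on S (\<lambda>x. blinfun_scaleR_left (f' x))" using assms(2) by (intro continuous_intros)
qed

lemma C1_on_divide:
  fixes f g :: "'a::real_normed_vector \<Rightarrow> real"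
  assumes "C1_on S f" "C1_on S g" "\<And>x. x \<in> S \<Longrightarrow> g x \<noteq> 0" shows "C1_on S (\<lambda>x. f x / g x)"
proof -
  have "C1_on (- {0::real}) inverse"
    by (rule C1_on_real_deriv[where f'="\<lambda>x. - (inverse x ^ Suc (Suc 0))"])
       (auto intro!: DERIV_inverse continuous_intros simp del: power_Suc)
  moreover have "g ` S \<subseteq> - {0}" using assms(3) by auto
  ultimately have "C1_on S (inverse \<circ> g)" by (rule C1_on_compose[OF assms(2)])
  then have "C1_on S (\<lambda>x. inverse (g x))" by (simp add: o_def)
  from C1_on_mult[OF assms(1) this] show ?thesis by (simp add: divide_inverse)
qed

section \<open>Cut-off functions of class C1\<close>

lemma C1_on_max0_square: "C1_on UNIV (\<lambda>t::real. (max 0 t)\<^sup>2)"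
proof (rule C1_on_real_deriv[where f'="\<lambda>t. 2 * max 0 t"])
  fix x :: real
  consider "x < 0" | "x > 0" | "x = 0" by linarith
  then show "((\<lambda>t. (max 0 t)\<^sup>2) has_real_derivative 2 * max 0 x) (at x)"
  proof cases
    case 1
    have "((\<lambda>t. 0) has_real_derivative 2 * max 0 x) (at x)" using 1 by simp
    then show ?thesis
      by (rule DERIV_cong_ev[THEN iffD1, rotated 3]) (use 1 in \<open>auto intro!: eventually_mono[OF eventually_nhds_in_open[of "{..<0}"]]\<close>)
  next
    case 2
    have "((\<lambda>t. t\<^sup>2) has_real_derivative 2 * max 0 x) (at x)" using 2 by (auto intro!: derivative_eq_intros)
    then show ?thesis
      by (rule DERIV_cong_ev[THEN iffD1, rotated 3]) (use 2 in \<open>auto intro!: eventually_mono[OF eventually_nhds_in_open[of "{0<..}"]]\<close>)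
  next
    case 3
    have "((\<lambda>y. (max 0 y)\<^sup>2 / y) \<longlongrightarrow> 0) (at (0::real))"
    proof (rule Lim_null_comparison)
      show "\<forall>\<^sub>F y in at (0::real). norm ((max 0 y)\<^sup>2 / y) \<le> \<bar>y\<bar>"
        by (auto simp: max_def power2_eq_square)
      show "((\<lambda>y::real. \<bar>y\<bar>) \<longlongrightarrow> 0) (at 0)" by (auto intro!: tendsto_eq_intros)
    qed
    then show ?thesis using 3 by (simp add: has_field_derivative_iff)
  qed
qed (auto intro!: continuous_intros)

lemma C1_on_norm_square: "C1_on UNIV (\<lambda>x::'a::real_inner. (norm (x - a))\<^sup>2)"
proof (rule C1_onI[where f'="\<lambda>x. 2 *\<^sub>R blinfun_inner_left (x - a)"])
  fix x :: 'a
  have "((\<lambda>x. (x - a) \<bullet> (x - a)) has_derivative (\<lambda>h. 2 * ((x - a) \<bullet> h))) (at x)"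
    by (auto intro!: derivative_eq_intros simp: inner_commute algebra_simps)
  then show "((\<lambda>x. (norm (x - a))\<^sup>2) has_derivative blinfun_apply (2 *\<^sub>R blinfun_inner_left (x - a))) (at x)"
    unfolding power2_norm_eq_inner
    by (rule has_derivative_eq_rhs) (auto simp: fun_eq_iff blinfun.bilinear_simps inner_commute)
qed (auto intro!: continuous_intros)

text \<open>The building block q is C1, vanishes for t \<le> 0 and is positive for t > 0.
  \<open>A\<close> is positive exactly inside the ball of radius R and \<open>B\<close> exactly
  outside the closed ball of radius r. As r < R, at each point one of them is positive, so the
  denominator of q(A) / (q(A) + q(B)) never vanishes.\<close>

lemma C1_cutoff:
  fixes a :: "'a::real_inner"
  assumes "0 < r" "r < R"
  obtains \<eta> :: "'a \<Rightarrow> real" where "C1_on UNIV \<eta>" "\<And>x. 0 \<le> \<eta> x" "\<And>x. \<eta> x \<le> 1"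
    "\<And>x. x \<in> cball a r \<Longrightarrow> \<eta> x = 1" "\<And>x. x \<notin> ball a R \<Longrightarrow> \<eta> x = 0"
proof -
  define q where "q = (\<lambda>t::real. (max 0 t)\<^sup>2)"
  define A where "A = (\<lambda>x. R\<^sup>2 - (norm (x - a))\<^sup>2)"
  define B where "B = (\<lambda>x. (norm (x - a))\<^sup>2 - r\<^sup>2)"
  have rR: "r\<^sup>2 < R\<^sup>2" using assms by (simp add: power_strict_mono)
  have q0: "q t = 0 \<longleftrightarrow> t \<le> 0" "q t \<ge> 0" for t by (auto simp: q_def)
  have pos: "q (A x) + q (B x) > 0" for x
  proof -
    have "A x > 0 \<or> B x > 0" unfolding A_def B_def using rR by linarith
    then show ?thesis using q0(1)[of "A x"] q0(1)[of "B x"] q0(2)[of "A x"] q0(2)[of "B x"] by linarith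
  qed
  have "C1_on UNIV A" unfolding A_def
    using C1_on_add[OF C1_on_const C1_on_mult[OF C1_on_const C1_on_norm_square[of a]], of "R\<^sup>2" "-1"] by simp
  then have CA: "C1_on UNIV (\<lambda>x. q (A x))"
    using C1_on_compose[OF _ C1_on_max0_square] by (auto simp: q_def o_def)
  have "C1_on UNIV B" unfolding B_def
    using C1_on_add[OF C1_on_norm_square[of a] C1_on_const[of _ "- r\<^sup>2"]] by simp
  then have CB: "C1_on UNIV (\<lambda>x. q (B x))"
    using C1_on_compose[OF _ C1_on_max0_square] by (auto simp: q_def o_def)
  show ?thesis
  proof
    show "C1_on UNIV (\<lambda>x. q (A x) / (q (A x) + q (B x)))"
      by (intro C1_on_divide C1_on_add CA CB) (use pos in \<open>force simp: less_le\<close>)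
    fix x
    show "0 \<le> q (A x) / (q (A x) + q (B x))" "q (A x) / (q (A x) + q (B x)) \<le> 1"
      using pos[of x] q0(2)[of "A x"] q0(2)[of "B x"] by auto
    { assume "x \<in> cball a r"
      then have "(norm (x - a))\<^sup>2 \<le> r\<^sup>2" using assms by (intro power_mono) (auto simp: dist_norm norm_minus_commute)
      then have "q (B x) = 0" using q0(1)[of "B x"] by (auto simp: B_def)
      then show "q (A x) / (q (A x) + q (B x)) = 1" using pos[of x] by auto }
    { assume "x \<notin> ball a R"
      then have "(norm (x - a))\<^sup>2 \<ge> R\<^sup>2" using assms by (intro power_mono) (auto simp: dist_norm norm_minus_commute)
      then show "q (A x) / (q (A x) + q (B x)) = 0" using q0(1)[of "A x"] by (auto simp: A_def) }
  qed
qed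

text \<open>Lets the Stone-Weierstrass theorem supply C1 approximants, in place of
  mollification.\<close>

lemma C1_on_real_polynomial_function:
  "real_polynomial_function f \<Longrightarrow> C1_on S f"
  by (induction rule: real_polynomial_function.induct)
     (auto intro: C1_on_bounded_linear C1_on_add C1_on_mult)

section \<open>Approximation in the space of integrable functions\<close>

lemma lebesgue_distr_translate:
  fixes a :: "'a::euclidean_space"
  shows "distr lebesgue lebesgue (\<lambda>x. x + a) = lebesgue"
    and lebesgue_measurable_translate: "(\<lambda>x. x + a) \<in> lebesgue \<rightarrow>\<^sub>M lebesgue"
  using lebesgue_affine_euclidean[of "\<lambda>_. 1" a] lebesgue_affine_measurable[of "\<lambda>_. 1" a]
  by (simp_all add: euclidean_representation density_1 add.commute)

lemma
  fixes f :: "'a::euclidean_space \<Rightarrow> real"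
  shows integrable_lebesgue_translate: "integrable lebesgue f \<Longrightarrow> integrable lebesgue (\<lambda>x. f (x + a))"
    and integral_lebesgue_translate:
      "f \<in> borel_measurable lebesgue \<Longrightarrow> (\<integral>x. f (x + a) \<partial>lebesgue) = (\<integral>x. f x \<partial>lebesgue)"
proof -
  show "integrable lebesgue (\<lambda>x. f (x + a))" if "integrable lebesgue f"
    using integrable_distr_eq[OF lebesgue_measurable_translate[of a], of f] that
    by (simp add: lebesgue_distr_translate)
  show "(\<integral>x. f (x + a) \<partial>lebesgue) = (\<integral>x. f x \<partial>lebesgue)" if "f \<in> borel_measurable lebesgue"
    using integral_distr[OF lebesgue_measurable_translate[of a], of f] that
    by (simp add: lebesgue_distr_translate)
qed

lemma borel_measurable_lebesgue_AE_limit_continuous: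
  fixes f :: "'a::euclidean_space \<Rightarrow> real"
  assumes "f \<in> borel_measurable lebesgue"
  obtains g where "\<And>n::nat. continuous_on UNIV (g n)" "AE x in lebesgue. (\<lambda>n. g n x) \<longlonglongrightarrow> f x"
proof -
  have "f measurable_on UNIV"
    using assms by (intro lebesgue_measurable_imp_measurable_on_real) auto
  then obtain N g where N: "negligible N" "\<And>n. continuous_on UNIV (g n)"
    "\<And>x. x \<notin> N \<Longrightarrow> (\<lambda>n. g n x) \<longlonglongrightarrow> f x"
    unfolding measurable_on_def by auto
  have "AE x in lebesgue. (\<lambda>n. g n x) \<longlonglongrightarrow> f x"
    by (rule AE_I'[of N]) (use N in \<open>auto simp: negligible_iff_null_sets\<close>)
  then show ?thesis using that N by blast
qed

lemma continuous_imp_borel_measurable_lebesgue: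
  fixes f :: "'a::euclidean_space \<Rightarrow> 'b::topological_space"
  shows "continuous_on UNIV f \<Longrightarrow> f \<in> borel_measurable lebesgue"
  by (simp add: borel_measurable_continuous_onI measurable_completion)

lemma integrable_indicator_compact:
  fixes K :: "'a::euclidean_space set"
  shows "compact K \<Longrightarrow> integrable lebesgue (indicator K :: _ \<Rightarrow> real)"
  using lmeasurable_compact[of K] by (auto simp: integrable_indicator_iff fmeasurable_def)

text \<open>Two dominated convergences. Cutting off the values by \<open>cl n\<close> and the domain
  by \<open>\<eta> n\<close> costs little for large n. With this n fixed, continuous functions that
  converge to f almost everywhere are cut off in the same way; they are then bounded by n times the
  indicator of a ball.\<close>

lemma L1_dense_continuous:
  fixes f :: "'a::euclidean_space \<Rightarrow> real"
  assumes f: "integrable lebesgue f" and "e > 0"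
  obtains g R where "continuous_on UNIV g" "\<And>x. norm x > R \<Longrightarrow> g x = 0" "integrable lebesgue g"
    "(\<integral>x. \<bar>f x - g x\<bar> \<partial>lebesgue) < e"
proof -
  have [measurable]: "f \<in> borel_measurable lebesgue" using f by auto
  define \<eta> where "\<eta> = (\<lambda>n (x::'a). max 0 (min 1 (real n + 1 - norm x)))"
  define cl where "cl = (\<lambda>n t. max (- real n) (min (real n) t))"
  have chi_cont: "continuous_on UNIV (\<eta> n)" for n unfolding \<eta>_def by (intro continuous_intros)
  have [measurable]: "\<eta> n \<in> borel_measurable lebesgue" for n
    by (rule continuous_imp_borel_measurable_lebesgue[OF chi_cont])
  have chi: "0 \<le> \<eta> n x" "\<eta> n x \<le> 1" "norm x > real n + 1 \<Longrightarrow> \<eta> n x = 0" for n x by (auto simp: \<eta>_def)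
  have cl: "\<bar>cl n t\<bar> \<le> \<bar>t\<bar>" "\<bar>cl n t\<bar> \<le> real n" for n t by (auto simp: cl_def)
  have [measurable]: "cl n \<in> borel_measurable borel" for n unfolding cl_def by measurable
  have cl_cont: "continuous_on UNIV (cl n)" for n unfolding cl_def by (intro continuous_intros)
  have le: "\<bar>cl n t * \<eta> n x\<bar> \<le> \<bar>t\<bar>" for n t x
    using mult_mono[OF cl(1)[of n t], of "\<eta> n x" 1] chi(1,2)[of n x] by (simp add: abs_mult)
  have "(\<lambda>n. \<integral>x. \<bar>f x - cl n (f x) * \<eta> n x\<bar> \<partial>lebesgue) \<longlonglongrightarrow> (\<integral>x. 0 \<partial>(lebesgue::'a measure))"
  proof (rule integral_dominated_convergence[where w="\<lambda>x. 2 * \<bar>f x\<bar>"])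
    show "AE x in lebesgue. (\<lambda>n. \<bar>f x - cl n (f x) * \<eta> n x\<bar>) \<longlonglongrightarrow> 0"
    proof (rule AE_I2)
      fix x
      obtain N :: nat where N: "real N > \<bar>f x\<bar> + norm x" using reals_Archimedean2 by blast
      have "f x - cl n (f x) * \<eta> n x = 0" if "n \<ge> N" for n
      proof -
        have "real n \<ge> real N" using that by simp
        then have "real n > \<bar>f x\<bar>" "real n > norm x" using N norm_ge_zero[of x] by linarith+
        then show ?thesis by (auto simp: cl_def \<eta>_def)
      qed
      then show "(\<lambda>n. \<bar>f x - cl n (f x) * \<eta> n x\<bar>) \<longlonglongrightarrow> 0"
        by (intro tendsto_eventually) (auto simp: eventually_sequentially)
    qed
    show "AE x in lebesgue. norm \<bar>f x - cl n (f x) * \<eta> n x\<bar> \<le> 2 * \<bar>f x\<bar>" for n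
      using le[of n "f _"] by (intro AE_I2) (smt (verit) real_norm_def)
  qed (use f in \<open>auto\<close>)
  then have "\<forall>\<^sub>F n in sequentially. (\<integral>x. \<bar>f x - cl n (f x) * \<eta> n x\<bar> \<partial>lebesgue) < e / 2"
    using \<open>e > 0\<close> by (intro order_tendstoD) auto
  then obtain n where n: "(\<integral>x. \<bar>f x - cl n (f x) * \<eta> n x\<bar> \<partial>lebesgue) < e / 2"
    using eventually_happens by fastforce
  obtain g where g: "\<And>m::nat. continuous_on UNIV (g m)" "AE x in lebesgue. (\<lambda>m. g m x) \<longlonglongrightarrow> f x"
    using borel_measurable_lebesgue_AE_limit_continuous[of f] by auto
  have [measurable]: "g m \<in> borel_measurable lebesgue" for m by (rule continuous_imp_borel_measurable_lebesgue[OF g(1)])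
  have ci: "integrable lebesgue (\<lambda>x. c * indicator (cball (0::'a) (real n + 1)) x)" for c :: real
    by (intro integrable_mult_right) (simp add: integrable_indicator_compact)
  have bnd: "\<bar>cl n t * \<eta> n x\<bar> \<le> real n * indicator (cball (0::'a) (real n + 1)) x" for t x
    using mult_mono[OF cl(2)[of n t], of "\<eta> n x" 1] chi[of n x] by (auto simp: abs_mult indicator_def)
  have "(\<lambda>m. \<integral>x. \<bar>cl n (f x) * \<eta> n x - cl n (g m x) * \<eta> n x\<bar> \<partial>lebesgue) \<longlonglongrightarrow> (\<integral>x. 0 \<partial>(lebesgue::'a measure))"
  proof (rule integral_dominated_convergence[where w="\<lambda>x. 2 * (real n * indicator (cball (0::'a) (real n + 1)) x)"])
    show "AE x in lebesgue. (\<lambda>m. \<bar>cl n (f x) * \<eta> n x - cl n (g m x) * \<eta> n x\<bar>) \<longlonglongrightarrow> 0"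
      using g(2)
    proof (rule eventually_mono)
      fix x assume "(\<lambda>m. g m x) \<longlonglongrightarrow> f x"
      then have "(\<lambda>m. cl n (g m x)) \<longlonglongrightarrow> cl n (f x)"
        using cl_cont[of n] by (intro continuous_on_tendsto_compose[OF cl_cont]) auto
      then have "(\<lambda>m. \<bar>cl n (f x) * \<eta> n x - cl n (g m x) * \<eta> n x\<bar>) \<longlonglongrightarrow> \<bar>cl n (f x) * \<eta> n x - cl n (f x) * \<eta> n x\<bar>"
        by (intro tendsto_intros)
      then show "(\<lambda>m. \<bar>cl n (f x) * \<eta> n x - cl n (g m x) * \<eta> n x\<bar>) \<longlonglongrightarrow> 0" by simp
    qed
    show "AE x in lebesgue. norm \<bar>cl n (f x) * \<eta> n x - cl n (g m x) * \<eta> n x\<bar> \<le> 2 * (real n * indicator (cball 0 (real n + 1)) x)" for m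
    proof (rule AE_I2)
      fix x show "norm \<bar>cl n (f x) * \<eta> n x - cl n (g m x) * \<eta> n x\<bar> \<le> 2 * (real n * indicator (cball 0 (real n + 1)) x)"
        using bnd[of "f x" x] bnd[of "g m x" x] by simp
    qed
    show "integrable lebesgue (\<lambda>x. 2 * (real n * indicator (cball (0::'a) (real n + 1)) x))"
      using ci[of "real n"] by (rule integrable_mult_right)
  qed auto
  then have "\<forall>\<^sub>F m in sequentially. (\<integral>x. \<bar>cl n (f x) * \<eta> n x - cl n (g m x) * \<eta> n x\<bar> \<partial>lebesgue) < e / 2"
    using \<open>e > 0\<close> by (intro order_tendstoD) auto
  then obtain m where m: "(\<integral>x. \<bar>cl n (f x) * \<eta> n x - cl n (g m x) * \<eta> n x\<bar> \<partial>lebesgue) < e / 2"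
    using eventually_happens by fastforce
  define G where "G = (\<lambda>x. cl n (g m x) * \<eta> n x)"
  have Gi: "integrable lebesgue G"
    unfolding G_def
    by (rule Bochner_Integration.integrable_bound[OF ci[of "real n"]]) (use bnd in auto)
  have Fi: "integrable lebesgue (\<lambda>x. cl n (f x) * \<eta> n x)"
    by (rule Bochner_Integration.integrable_bound[OF f]) (use le in auto)
  have "(\<integral>x. \<bar>f x - G x\<bar> \<partial>lebesgue) \<le> (\<integral>x. \<bar>f x - cl n (f x) * \<eta> n x\<bar> + \<bar>cl n (f x) * \<eta> n x - G x\<bar> \<partial>lebesgue)"
    using f Gi Fi by (intro integral_mono) auto
  also have "\<dots> = (\<integral>x. \<bar>f x - cl n (f x) * \<eta> n x\<bar> \<partial>lebesgue) + (\<integral>x. \<bar>cl n (f x) * \<eta> n x - G x\<bar> \<partial>lebesgue)"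
    using f Gi Fi by (intro Bochner_Integration.integral_add) auto
  also have "\<dots> < e" using n m by (simp add: G_def)
  finally have "(\<integral>x. \<bar>f x - G x\<bar> \<partial>lebesgue) < e" .
  moreover have "continuous_on UNIV G" unfolding G_def
    by (intro continuous_intros chi_cont continuous_on_compose2[OF cl_cont g(1)]) auto
  moreover have "G x = 0" if "norm x > real n + 1" for x using chi(3)[OF that] by (simp add: G_def)
  ultimately show ?thesis using that Gi by blast
qed

lemma L1_translate_continuous:
  fixes f :: "'a::euclidean_space \<Rightarrow> real"
  assumes f: "integrable lebesgue f" and "e > 0"
  obtains \<delta> where "\<delta> > 0" "\<And>t. norm t < \<delta> \<Longrightarrow> (\<integral>x. \<bar>f (x + t) - f x\<bar> \<partial>lebesgue) < e"
proof -
  obtain g R where g: "continuous_on UNIV g" "\<And>x. norm x > R \<Longrightarrow> g x = 0" "integrable lebesgue g"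
    and fg: "(\<integral>x. \<bar>f x - g x\<bar> \<partial>lebesgue) < e / 3"
    using L1_dense_continuous[OF f, of "e/3"] \<open>e > 0\<close> by auto
  define R' where "R' = max R 0"
  define K where "K = cball (0::'a) (R' + 1)"
  have K: "integrable lebesgue (indicator K :: _ \<Rightarrow> real)" unfolding K_def by (intro integrable_indicator_compact) simp
  define m where "m = measure lebesgue K"
  have m: "(\<integral>x. indicator K x \<partial>lebesgue) = m" "m \<ge> 0" unfolding m_def by auto
  \<comment> \<open>The difference g (x + t) - g x vanishes off K, so a pointwise bound e' costs e'
    times the measure m of K; the + 1 keeps the denominator positive.\<close>
  define e' where "e' = e / 3 / (m + 1)"
  have e': "e' > 0" using \<open>e > 0\<close> m by (simp add: e'_def)
  \<comment> \<open>For |t| < 1 the ball of radius R' + 2 contains x and x + t for every x in K,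
    while for x outside K both points lie where g is zero.\<close>
  have "uniformly_continuous_on (cball (0::'a) (R' + 2)) g"
    by (intro compact_uniformly_continuous continuous_on_subset[OF g(1)]) auto
  then obtain \<delta> where \<delta>: "\<delta> > 0" "\<And>x y. x \<in> cball 0 (R' + 2) \<Longrightarrow> y \<in> cball 0 (R' + 2) \<Longrightarrow> dist y x < \<delta> \<Longrightarrow> dist (g y) (g x) < e'"
    unfolding uniformly_continuous_on_def using e' by meson
  have *: "(\<integral>x. \<bar>f (x + t) - f x\<bar> \<partial>lebesgue) < e" if t: "norm t < min \<delta> 1" for t
  proof -
    have fi: "integrable lebesgue (\<lambda>x. f (x + t))" and gi: "integrable lebesgue (\<lambda>x. g (x + t))"
      using f g(3) by (auto intro: integrable_lebesgue_translate)
    have "\<bar>g (x + t) - g x\<bar> \<le> e' * indicator K x" for x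
    proof (cases "x \<in> K")
      case True
      then have "norm x \<le> R' + 1" by (simp add: K_def)
      then have "norm x \<le> R' + 2" "norm (x + t) \<le> R' + 2" using t norm_triangle_ineq[of x t] by linarith+
      then have "x \<in> cball 0 (R' + 2)" "x + t \<in> cball 0 (R' + 2)" by (simp_all only: mem_cball_0)
      moreover have "dist (x + t) x < \<delta>" using t by (simp add: dist_norm)
      ultimately have "dist (g (x + t)) (g x) < e'" by (rule \<delta>(2))
      then show ?thesis using True by (simp add: dist_norm)
    next
      case False
      then have "norm x > R' + 1" "norm (x + t) > R'" using t norm_triangle_ineq4[of "x + t" t] by (auto simp: K_def)
      then have "g x = 0" "g (x + t) = 0" using g(2) by (auto simp: R'_def)
      then show ?thesis using e' by (simp add: indicator_def)
    qed
    then have "(\<integral>x. \<bar>g (x + t) - g x\<bar> \<partial>lebesgue) \<le> (\<integral>x. e' * indicator K x \<partial>lebesgue)"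
      using g(3) gi K by (intro integral_mono) auto
    also have "\<dots> = e' * m" using m by simp
    also have "\<dots> < e / 3" using \<open>e > 0\<close> m unfolding e'_def by (simp add: field_simps)
    finally have 1: "(\<integral>x. \<bar>g (x + t) - g x\<bar> \<partial>lebesgue) < e / 3" .
    have 2: "(\<integral>x. \<bar>f (x + t) - g (x + t)\<bar> \<partial>lebesgue) = (\<integral>x. \<bar>f x - g x\<bar> \<partial>lebesgue)"
      using integral_lebesgue_translate[of "\<lambda>x. \<bar>f x - g x\<bar>" t] f g(3) by auto
    have "(\<integral>x. \<bar>f (x + t) - f x\<bar> \<partial>lebesgue) \<le>
      (\<integral>x. \<bar>f (x + t) - g (x + t)\<bar> + (\<bar>g (x + t) - g x\<bar> + \<bar>f x - g x\<bar>) \<partial>lebesgue)"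
      using f fi g(3) gi by (intro integral_mono) auto
    also have "\<dots> = (\<integral>x. \<bar>f (x + t) - g (x + t)\<bar> \<partial>lebesgue) + ((\<integral>x. \<bar>g (x + t) - g x\<bar> \<partial>lebesgue) + (\<integral>x. \<bar>f x - g x\<bar> \<partial>lebesgue))"
      using f fi g(3) gi by (subst Bochner_Integration.integral_add; simp)+
    also have "\<dots> < e" using 1 2 fg by linarith
    finally show ?thesis .
  qed
  show ?thesis by (rule that[of "min \<delta> 1"]) (use \<delta>(1) * in auto)
qed

text \<open>Duality: integrating H against C1 approximations of its sign recovers the L1 norm on the
  smaller ball. An integration by parts formula speaks only of integrals against test functions;
  this turns bounds for those, uniform in the test function, into L1 bounds.\<close>

lemma L1_norm_ball_le_of_test:
  fixes H :: "'a::euclidean_space \<Rightarrow> real"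
  assumes H: "integrable lebesgue H" and "0 < r" "r < R"
    and test: "\<And>\<phi>. C1_on UNIV \<phi> \<Longrightarrow> (\<And>x. \<bar>\<phi> x\<bar> \<le> 1) \<Longrightarrow> (\<And>x. x \<notin> ball a R \<Longrightarrow> \<phi> x = 0) \<Longrightarrow>
       (\<integral>x. H x * \<phi> x \<partial>lebesgue) \<le> M"
  shows "(\<integral>x. indicator (cball a r) x * \<bar>H x\<bar> \<partial>lebesgue) \<le> M"
proof -
  have [measurable]: "H \<in> borel_measurable lebesgue" using H by auto
  obtain \<eta> :: "'a \<Rightarrow> real" where \<eta>: "C1_on UNIV \<eta>" "\<And>x. 0 \<le> \<eta> x" "\<And>x. \<eta> x \<le> 1"
    "\<And>x. x \<in> cball a r \<Longrightarrow> \<eta> x = 1" "\<And>x. x \<notin> ball a R \<Longrightarrow> \<eta> x = 0"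
    using C1_cutoff[OF assms(2,3)] by blast
  have [measurable]: "\<eta> \<in> borel_measurable lebesgue"
    using C1_on_imp_continuous_on[OF \<eta>(1)] by (rule continuous_imp_borel_measurable_lebesgue)
  have "(\<lambda>x. sgn (H x)) \<in> borel_measurable lebesgue" by simp
  then obtain g where g: "\<And>n::nat. continuous_on UNIV (g n)" "AE x in lebesgue. (\<lambda>n. g n x) \<longlonglongrightarrow> sgn (H x)"
    using borel_measurable_lebesgue_AE_limit_continuous by metis
  define g' where "g' n x = max (-1) (min 1 (g n x))" for n x
  have "\<exists>p. real_polynomial_function p \<and> (\<forall>x\<in>cball a R. \<bar>g' n x - p x\<bar> < 1 / (real n + 1))" for n
  proof -
    have "continuous_on (cball a R) (g' n)" unfolding g'_def
      by (intro continuous_intros continuous_on_subset[OF g(1)]) auto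
    from Stone_Weierstrass_polynomial_function[OF _ this, of "1 / (real n + 1)"]
    show ?thesis by (auto simp: real_polynomial_function_eq)
  qed
  then obtain p where p: "\<And>n. real_polynomial_function (p n)" "\<And>n x. x \<in> cball a R \<Longrightarrow> \<bar>g' n x - p n x\<bar> < 1 / (real n + 1)"
    by metis
  \<comment> \<open>\<open>p n\<close> lies within 1 / (n + 1) of a function with values in [-1, 1];
    dividing by 1 + 1 / (n + 1) restores the bound 1, and the factor \<eta> restores the
    support.\<close>
  define \<phi> where "\<phi> n x = \<eta> x * (p n x * (1 / (1 + 1 / (real n + 1))))" for n x
  have \<phi>C: "C1_on UNIV (\<phi> n)" for n unfolding \<phi>_def
    by (intro C1_on_mult \<eta>(1) C1_on_real_polynomial_function[OF p(1)] C1_on_const)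
  have \<phi>0: "\<phi> n x = 0" if "x \<notin> ball a R" for n x using \<eta>(5)[OF that] by (simp add: \<phi>_def)
  have \<phi>1: "\<bar>\<phi> n x\<bar> \<le> 1" for n x
  proof (cases "x \<in> ball a R")
    case True
    have c: "1 + 1 / (real n + 1) > 0" by (simp add: add_pos_nonneg)
    have "\<bar>g' n x\<bar> \<le> 1" by (auto simp: g'_def)
    then have "\<bar>p n x\<bar> \<le> 1 + 1 / (real n + 1)" using p(2)[of x n] True by auto
    then have "\<bar>p n x * (1 / (1 + 1 / (real n + 1)))\<bar> \<le> 1" using c by (simp add: abs_mult)
    then have "\<bar>\<eta> x\<bar> * \<bar>p n x * (1 / (1 + 1 / (real n + 1)))\<bar> \<le> 1 * 1"
      using \<eta>(2,3)[of x] by (intro mult_mono) auto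
    then show ?thesis by (simp add: \<phi>_def abs_mult)
  qed (simp add: \<phi>0)
  have [measurable]: "\<phi> n \<in> borel_measurable lebesgue" for n
    using C1_on_imp_continuous_on[OF \<phi>C] by (rule continuous_imp_borel_measurable_lebesgue)
  have lim: "(\<lambda>n. \<integral>x. H x * \<phi> n x \<partial>lebesgue) \<longlonglongrightarrow> (\<integral>x. \<eta> x * \<bar>H x\<bar> \<partial>lebesgue)"
  proof (rule integral_dominated_convergence[where w="\<lambda>x. \<bar>H x\<bar>"])
    show "AE x in lebesgue. (\<lambda>n. H x * \<phi> n x) \<longlonglongrightarrow> \<eta> x * \<bar>H x\<bar>"
      using g(2)
    proof (rule eventually_mono)
      fix x assume gx: "(\<lambda>n. g n x) \<longlonglongrightarrow> sgn (H x)"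
      show "(\<lambda>n. H x * \<phi> n x) \<longlonglongrightarrow> \<eta> x * \<bar>H x\<bar>"
      proof (cases "x \<in> ball a R")
        case True
        have s: "max (-1) (min 1 (sgn (H x))) = sgn (H x)" by (auto simp: sgn_if)
        have "(\<lambda>n. g' n x) \<longlonglongrightarrow> max (-1) (min 1 (sgn (H x)))"
          unfolding g'_def by (intro tendsto_intros gx)
        then have g'x: "(\<lambda>n. g' n x) \<longlonglongrightarrow> sgn (H x)" using s by simp
        have z: "(\<lambda>n. 1 / (real n + 1)) \<longlonglongrightarrow> 0"
          using LIMSEQ_inverse_real_of_nat by (simp add: inverse_eq_divide add.commute)
        have "(\<lambda>n. p n x - g' n x) \<longlonglongrightarrow> 0"
          by (rule Lim_null_comparison[OF _ z]) (use p(2)[of x] True in \<open>auto intro!: always_eventually less_imp_le simp: abs_minus_commute\<close>)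
        from tendsto_add[OF this g'x] have "(\<lambda>n. p n x) \<longlonglongrightarrow> sgn (H x)" by simp
        then have "(\<lambda>n. H x * \<phi> n x) \<longlonglongrightarrow> H x * (\<eta> x * (sgn (H x) * (1 / (1 + 0))))"
          unfolding \<phi>_def by (intro tendsto_intros z) auto
        then show ?thesis by (simp add: abs_sgn mult_ac)
      qed (use \<phi>0 \<eta>(5) in auto)
    qed
    show "AE x in lebesgue. norm (H x * \<phi> n x) \<le> \<bar>H x\<bar>" for n
      using mult_left_mono[OF \<phi>1 abs_ge_zero, of "H _"] by (intro AE_I2) (auto simp: abs_mult)
  qed (use H in auto)
  have "(\<integral>x. indicator (cball a r) x * \<bar>H x\<bar> \<partial>lebesgue) \<le> (\<integral>x. \<eta> x * \<bar>H x\<bar> \<partial>lebesgue)"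
  proof (rule integral_mono)
    show "integrable lebesgue (\<lambda>x. indicator (cball a r) x * \<bar>H x\<bar>)"
      using integrable_mult_indicator[of "cball a r" lebesgue "\<lambda>x. \<bar>H x\<bar>"] H by simp
    show "integrable lebesgue (\<lambda>x. \<eta> x * \<bar>H x\<bar>)"
      by (rule Bochner_Integration.integrable_bound[OF H]) (use \<eta>(2,3) in \<open>auto simp: abs_mult intro!: mult_left_le_one_le\<close>)
    show "indicator (cball a r) x * \<bar>H x\<bar> \<le> \<eta> x * \<bar>H x\<bar>" for x
      using \<eta>(2,4)[of x] by (auto simp: indicator_def)
  qed
  also have "\<dots> \<le> M"
    by (rule LIMSEQ_le_const2[OF lim]) (use test[OF \<phi>C \<phi>1 \<phi>0] in auto)
  finally show ?thesis .
qed

section \<open>Difference quotients of weakly differentiable functions\<close>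

lemma C1_compact_support_Lipschitz:
  fixes \<phi> :: "'a::euclidean_space \<Rightarrow> real"
  assumes C: "C1_on UNIV \<phi>" and 0: "\<And>x. x \<notin> cball a R \<Longrightarrow> \<phi> x = 0"
  obtains L where "\<And>x y. \<bar>\<phi> x - \<phi> y\<bar> \<le> L * norm (x - y)" "L \<ge> 0"
    "\<And>x. x \<notin> cball a R \<Longrightarrow> frechet_derivative \<phi> (at x) h = 0"
proof -
  from C obtain f' where f': "\<And>x. (\<phi> has_derivative blinfun_apply (f' x)) (at x)" "continuous_on UNIV f'"
    unfolding C1_on_def by auto
  have z: "f' x = 0" if "x \<notin> cball a R" for x
  proof -
    have "((\<lambda>x. 0) has_derivative blinfun_apply (f' x)) (at x)"
      by (rule has_derivative_transform_within_open[OF f'(1), of "- cball a R"]) (use that 0 in auto)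
    from has_derivative_unique[OF this has_derivative_const] show ?thesis by (intro blinfun_eqI) (auto simp: fun_eq_iff)
  qed
  have "compact (f' ` cball a R)"
    by (intro compact_continuous_image continuous_on_subset[OF f'(2)]) auto
  then obtain L where L: "\<And>x. x \<in> cball a R \<Longrightarrow> norm (f' x) \<le> L"
    using compact_imp_bounded[THEN bounded_pos[THEN iffD1]] by (metis imageI)
  have L': "norm (f' x) \<le> max L 0" for x using L[of x] z[of x] by (cases "x \<in> cball a R") auto
  have "norm (\<phi> x - \<phi> y) \<le> max L 0 * norm (x - y)" for x y
    by (rule differentiable_bound[of UNIV \<phi> "\<lambda>x. blinfun_apply (f' x)"])
       (use f'(1) L' in \<open>auto simp: norm_blinfun.rep_eq[symmetric] intro: has_derivative_at_withinI\<close>)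
  moreover have "frechet_derivative \<phi> (at x) h = 0" if "x \<notin> cball a R" for x
    using frechet_derivative_at[OF f'(1)[of x]] z[OF that] by (metis zero_blinfun.rep_eq)
  ultimately show ?thesis using that[of "max L 0"] by auto
qed

text \<open>Differentiation under the integral sign: the difference quotients in t are dominated by
  |W| times the Lipschitz constant of the test function and the length of h.\<close>

lemma DERIV_integral_translate:
  fixes \<phi> W :: "'a::euclidean_space \<Rightarrow> real"
  assumes W: "integrable lebesgue W" and C: "C1_on UNIV \<phi>" and 0: "\<And>x. x \<notin> cball a R \<Longrightarrow> \<phi> x = 0"
  shows "((\<lambda>t. \<integral>z. W z * \<phi> (z - t *\<^sub>R h) \<partial>lebesgue) has_real_derivative
           - (\<integral>z. W z * frechet_derivative \<phi> (at (z - t *\<^sub>R h)) h \<partial>lebesgue)) (at t)"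
proof -
  obtain L where L: "\<And>x y. \<bar>\<phi> x - \<phi> y\<bar> \<le> L * norm (x - y)" "L \<ge> 0"
    using C1_compact_support_Lipschitz[OF C 0] by metis
  have [measurable]: "W \<in> borel_measurable lebesgue" using W by auto
  have cont: "continuous_on UNIV \<phi>" using C by (rule C1_on_imp_continuous_on)
  have [measurable]: "(\<lambda>z. \<phi> (z - v)) \<in> borel_measurable lebesgue" for v
    by (intro continuous_imp_borel_measurable_lebesgue continuous_on_compose2[OF cont] continuous_intros) auto
  have [measurable]: "(\<lambda>z. frechet_derivative \<phi> (at (z - v)) h) \<in> borel_measurable lebesgue" for v
    by (intro continuous_imp_borel_measurable_lebesgue continuous_on_compose2[OF C1_on_frechet_continuous[OF C]] continuous_intros) auto
  have "bounded (\<phi> ` cball a R)"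
    by (intro compact_imp_bounded compact_continuous_image continuous_on_subset[OF cont]) auto
  then obtain b where b: "\<And>x. x \<in> cball a R \<Longrightarrow> \<bar>\<phi> x\<bar> \<le> b"
    unfolding bounded_iff by (metis imageI real_norm_def)
  have b': "\<bar>\<phi> x\<bar> \<le> max b 0" for x using b[of x] 0[of x] by (cases "x \<in> cball a R") auto
  have I: "integrable lebesgue (\<lambda>z. W z * \<phi> (z - v))" for v
  proof (rule Bochner_Integration.integrable_bound[where f="\<lambda>z. W z * max b 0"])
    show "AE x in lebesgue. norm (W x * \<phi> (x - v)) \<le> norm (W x * max b 0)"
      using b' by (intro AE_I2) (auto simp: abs_mult intro!: mult_left_mono)
  qed (use W in auto)
  show ?thesis
    unfolding DERIV_def tendsto_at_iff_sequentially
  proof (intro allI impI)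
    fix X :: "nat \<Rightarrow> real" assume X: "\<forall>i. X i \<in> UNIV - {0}" and X0: "X \<longlonglongrightarrow> 0"
    have Xn: "X i \<noteq> 0" for i using X by auto
    have lim: "(\<lambda>i. \<integral>z. W z * ((\<phi> (z - (t + X i) *\<^sub>R h) - \<phi> (z - t *\<^sub>R h)) / X i) \<partial>lebesgue) \<longlonglongrightarrow>
      (\<integral>z. W z * - frechet_derivative \<phi> (at (z - t *\<^sub>R h)) h \<partial>lebesgue)"
    proof (rule integral_dominated_convergence[where w="\<lambda>z. \<bar>W z\<bar> * (L * norm h)"])
      show "AE z in lebesgue. (\<lambda>i. W z * ((\<phi> (z - (t + X i) *\<^sub>R h) - \<phi> (z - t *\<^sub>R h)) / X i)) \<longlonglongrightarrow>
         W z * - frechet_derivative \<phi> (at (z - t *\<^sub>R h)) h"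
      proof (intro AE_I2 tendsto_mult tendsto_const)
        fix z
        let ?D = "frechet_derivative \<phi> (at (z - t *\<^sub>R h))"
        have D: "(\<phi> has_derivative ?D) (at (z - t *\<^sub>R h))" by (rule C1_on_has_derivative[OF C]) simp
        have "((\<lambda>s. z - s *\<^sub>R h) has_derivative (\<lambda>s. - (s *\<^sub>R h))) (at t)"
          by (auto intro!: derivative_eq_intros)
        from diff_chain_at[OF this D] have "((\<lambda>s. \<phi> (z - s *\<^sub>R h)) has_derivative (\<lambda>s. ?D (- (s *\<^sub>R h)))) (at t)"
          by (simp add: o_def)
        moreover have "(\<lambda>s. ?D (- (s *\<^sub>R h))) = (*) (- ?D h)"
          using has_derivative_linear[OF D] by (auto simp: fun_eq_iff linear_neg linear_cmul)
        ultimately have "((\<lambda>s. \<phi> (z - s *\<^sub>R h)) has_real_derivative - ?D h) (at t)"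
          by (simp only: has_field_derivative_def)
        then have "((\<lambda>y. (\<phi> (z - (t + y) *\<^sub>R h) - \<phi> (z - t *\<^sub>R h)) / y) \<longlongrightarrow> - ?D h) (at 0)"
          by (simp add: DERIV_def)
        then show "(\<lambda>i. (\<phi> (z - (t + X i) *\<^sub>R h) - \<phi> (z - t *\<^sub>R h)) / X i) \<longlonglongrightarrow> - ?D h"
          using X X0 unfolding tendsto_at_iff_sequentially o_def by blast
      qed
      show "AE z in lebesgue. norm (W z * ((\<phi> (z - (t + X i) *\<^sub>R h) - \<phi> (z - t *\<^sub>R h)) / X i)) \<le> \<bar>W z\<bar> * (L * norm h)" for i
      proof (rule AE_I2)
        fix z
        have "\<bar>\<phi> (z - (t + X i) *\<^sub>R h) - \<phi> (z - t *\<^sub>R h)\<bar> \<le> L * norm (- X i *\<^sub>R h)"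
          using L(1)[of "z - (t + X i) *\<^sub>R h" "z - t *\<^sub>R h"] by (simp add: algebra_simps)
        then have "\<bar>\<phi> (z - (t + X i) *\<^sub>R h) - \<phi> (z - t *\<^sub>R h)\<bar> / \<bar>X i\<bar> \<le> L * norm h"
          using Xn[of i] by (simp add: divide_le_eq mult_ac)
        then have "\<bar>W z\<bar> * (\<bar>\<phi> (z - (t + X i) *\<^sub>R h) - \<phi> (z - t *\<^sub>R h)\<bar> / \<bar>X i\<bar>) \<le> \<bar>W z\<bar> * (L * norm h)"
          by (rule mult_left_mono) simp
        then show "norm (W z * ((\<phi> (z - (t + X i) *\<^sub>R h) - \<phi> (z - t *\<^sub>R h)) / X i)) \<le> \<bar>W z\<bar> * (L * norm h)"
          by (simp add: abs_mult)
      qed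
    qed (use W in auto)
    have eq: "(\<integral>z. W z * ((\<phi> (z - (t + X i) *\<^sub>R h) - \<phi> (z - t *\<^sub>R h)) / X i) \<partial>lebesgue) =
      ((\<integral>z. W z * \<phi> (z - (t + X i) *\<^sub>R h) \<partial>lebesgue) - (\<integral>z. W z * \<phi> (z - t *\<^sub>R h) \<partial>lebesgue)) / X i" for i
      by (subst Bochner_Integration.integral_diff[symmetric, OF I I], subst integral_divide_zero[symmetric])
         (simp add: right_diff_distrib)
    have *: "(\<lambda>i. ((\<integral>z. W z * \<phi> (z - (t + X i) *\<^sub>R h) \<partial>lebesgue) - (\<integral>z. W z * \<phi> (z - t *\<^sub>R h) \<partial>lebesgue)) / X i) \<longlonglongrightarrow>
      (\<integral>z. W z * - frechet_derivative \<phi> (at (z - t *\<^sub>R h)) h \<partial>lebesgue)"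
      unfolding eq[symmetric] by (rule lim)
    have e: "(\<integral>z. W z * - frechet_derivative \<phi> (at (z - t *\<^sub>R h)) h \<partial>lebesgue) =
      - (\<integral>z. W z * frechet_derivative \<phi> (at (z - t *\<^sub>R h)) h \<partial>lebesgue)" by simp
    show "((\<lambda>y. ((\<integral>z. W z * \<phi> (z - (t + y) *\<^sub>R h) \<partial>lebesgue) - (\<integral>z. W z * \<phi> (z - t *\<^sub>R h) \<partial>lebesgue)) / y) \<circ> X) \<longlonglongrightarrow>
       - (\<integral>z. W z * frechet_derivative \<phi> (at (z - t *\<^sub>R h)) h \<partial>lebesgue)"
      unfolding o_def by (rule *[unfolded e])
  qed
qed

text \<open>As the test function lives in the ball, w and w' may be cut off there. The cut-off
  functions are integrable on the whole space and can be translated freely.\<close>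

lemma has_weak_derivative_on_test:
  fixes w :: "real^'k \<Rightarrow> real"
  assumes wd: "has_weak_derivative_on \<Omega> w w'" and sub: "cball a R \<subseteq> \<Omega>"
    and C: "C1_on UNIV \<phi>" and 0: "\<And>x. x \<notin> cball a R \<Longrightarrow> \<phi> x = 0"
  shows "(\<integral>z. (indicator (cball a R) z * w z) * frechet_derivative \<phi> (at z) h \<partial>lebesgue) =
    - (\<integral>z. (indicator (cball a R) z * w' z h) * \<phi> z \<partial>lebesgue)"
proof -
  have d0: "frechet_derivative \<phi> (at x) h = 0" if "x \<notin> cball a R" for x
    using C1_compact_support_Lipschitz[OF C 0] that by metis
  have "{z. \<phi> z \<noteq> 0} \<subseteq> cball a R" using 0 by blast
  then have cl: "closure {z. \<phi> z \<noteq> 0} \<subseteq> cball a R" by (rule closure_minimal) simp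
  moreover have "compact (closure {z. \<phi> z \<noteq> 0})"
    using compact_Int_closed[OF compact_cball closed_closure, of a R] cl by (metis inf.absorb2)
  ultimately have "(LINT z:\<Omega>|lebesgue. w z * frechet_derivative \<phi> (at z) h) = - (LINT z:\<Omega>|lebesgue. w' z h * \<phi> z)"
    using wd C sub unfolding has_weak_derivative_on_def by blast
  moreover have "(\<lambda>z. indicator \<Omega> z *\<^sub>R (w z * frechet_derivative \<phi> (at z) h)) =
     (\<lambda>z. (indicator (cball a R) z * w z) * frechet_derivative \<phi> (at z) h)"
    using d0 sub by (fastforce simp: fun_eq_iff indicator_def)
  moreover have "(\<lambda>z. indicator \<Omega> z *\<^sub>R (w' z h * \<phi> z)) = (\<lambda>z. (indicator (cball a R) z * w' z h) * \<phi> z)"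
    using 0 sub by (fastforce simp: fun_eq_iff indicator_def)
  ultimately show ?thesis unfolding set_lebesgue_integral_def by simp
qed

lemma locally_integrable_on_cball:
  assumes "locally_integrable_on \<Omega> f" "cball a R \<subseteq> \<Omega>"
  shows "integrable lebesgue (\<lambda>z. indicator (cball a R) z * f z)"
proof -
  have "f absolutely_integrable_on cball a R" using assms by (simp add: locally_integrable_on_def)
  then show ?thesis by (simp add: set_integrable_def)
qed

lemma C1_on_translate: "C1_on UNIV \<phi> \<Longrightarrow> C1_on UNIV (\<lambda>z. \<phi> (z - v))"
  using C1_on_compose[of UNIV "\<lambda>z. z - v" UNIV \<phi>] C1_on_add[OF C1_on_bounded_linear[OF bounded_linear_ident] C1_on_const[of _ "- v"], of UNIV]
  by (simp add: o_def)

lemma frechet_derivative_translate: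
  assumes "C1_on UNIV \<phi>"
  shows "frechet_derivative (\<lambda>z. \<phi> (z - v)) (at z) = frechet_derivative \<phi> (at (z - v))"
proof -
  have "((\<lambda>z. z - v) has_derivative (\<lambda>h. h)) (at z)" by (auto intro!: derivative_eq_intros)
  from diff_chain_at[OF this C1_on_has_derivative[OF assms UNIV_I]]
  have "((\<lambda>z. \<phi> (z - v)) has_derivative frechet_derivative \<phi> (at (z - v))) (at z)" by (simp add: o_def)
  then show ?thesis by (metis frechet_derivative_at)
qed

text \<open>Put \<psi> t for the integral of W z * \<phi> (z - t h). Integration by parts identifies
  the derivative of \<psi>, and the mean value theorem turns the tested difference quotient into the
  integral of G against \<phi> translated by \<xi> h for some 0 < \<xi> < s n. Moving the
  translation to G, the error is at most the L1 distance of G from its translate, whatever \<phi>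
  is; duality then gives L1 convergence.\<close>

lemma weak_derivative_quotient_L1:
  fixes w :: "real^'k \<Rightarrow> real" and h :: "real^'k"
  assumes wd: "has_weak_derivative_on \<Omega> w w'" and r: "0 < r" "r < R" and sub: "cball a R \<subseteq> \<Omega>"
    and s: "\<And>n. s n > 0" "s \<longlonglongrightarrow> 0"
  defines "W \<equiv> \<lambda>z. indicator (cball a R) z * w z" and "G \<equiv> \<lambda>z. indicator (cball a R) z * w' z h"
  shows "(\<lambda>n. \<integral>z. indicator (cball a r) z * \<bar>(W (z + s n *\<^sub>R h) - W z) / s n - G z\<bar> \<partial>lebesgue) \<longlonglongrightarrow> 0"
    and "integrable lebesgue W" and "integrable lebesgue G"
proof -
  show Wi: "integrable lebesgue W" and Gi: "integrable lebesgue G"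
    using wd sub by (auto simp: W_def G_def has_weak_derivative_on_def intro!: locally_integrable_on_cball)
  have [measurable]: "W \<in> borel_measurable lebesgue" "G \<in> borel_measurable lebesgue" using Wi Gi by auto
  \<comment> \<open>An intermediate radius: the duality argument takes test functions supported in
    the ball of radius r' > r, and R - r' is the room in which they can be translated without
    leaving the ball of radius R.\<close>
  define r' where "r' = (r + R) / 2"
  have r': "r < r'" "r' < R" "0 < r'" using r by (auto simp: r'_def)
  show "(\<lambda>n. \<integral>z. indicator (cball a r) z * \<bar>(W (z + s n *\<^sub>R h) - W z) / s n - G z\<bar> \<partial>lebesgue) \<longlonglongrightarrow> 0"
  proof (rule LIMSEQ_I)
    fix e :: real assume "e > 0"
    then obtain \<delta> where \<delta>: "\<delta> > 0" "\<And>t. norm t < \<delta> \<Longrightarrow> (\<integral>x. \<bar>G (x + t) - G x\<bar> \<partial>lebesgue) < e / 2"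
      using L1_translate_continuous[OF Gi, of "e/2"] by auto
    have "(\<lambda>n. s n * norm h) \<longlonglongrightarrow> 0 * norm h" by (intro tendsto_intros s)
    then have "\<forall>\<^sub>F n in sequentially. s n * norm h < min \<delta> (R - r')"
      using \<delta>(1) r' by (intro order_tendstoD) auto
    then obtain N where N: "\<And>n. n \<ge> N \<Longrightarrow> s n * norm h < min \<delta> (R - r')" by (auto simp: eventually_sequentially)
    have "(\<integral>z. indicator (cball a r) z * \<bar>(W (z + s n *\<^sub>R h) - W z) / s n - G z\<bar> \<partial>lebesgue) \<le> e / 2" if "n \<ge> N" for n
    proof (rule L1_norm_ball_le_of_test[OF _ r(1) r'(1)])
      have Wti: "integrable lebesgue (\<lambda>z. W (z + s n *\<^sub>R h))" by (rule integrable_lebesgue_translate[OF Wi])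
      then show Hi: "integrable lebesgue (\<lambda>z. (W (z + s n *\<^sub>R h) - W z) / s n - G z)" using Wi Gi by auto
      fix \<phi> :: "real^'k \<Rightarrow> real"
      assume C: "C1_on UNIV \<phi>" and \<phi>1: "\<And>x. \<bar>\<phi> x\<bar> \<le> 1" and \<phi>0: "\<And>x. x \<notin> ball a r' \<Longrightarrow> \<phi> x = 0"
      have cont: "continuous_on UNIV \<phi>" using C by (rule C1_on_imp_continuous_on)
      have [measurable]: "(\<lambda>z. \<phi> (z - v)) \<in> borel_measurable lebesgue" for v
        by (intro continuous_imp_borel_measurable_lebesgue continuous_on_compose2[OF cont] continuous_intros) auto
      have [measurable]: "\<phi> \<in> borel_measurable lebesgue"
        by (intro continuous_imp_borel_measurable_lebesgue cont)
      have bi: "integrable lebesgue (\<lambda>z. F z * \<phi> (z - v))" if "integrable lebesgue F" for F v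
      proof (rule Bochner_Integration.integrable_bound[OF that])
        show "AE x in lebesgue. norm (F x * \<phi> (x - v)) \<le> norm (F x)"
          using \<phi>1 by (intro AE_I2) (auto simp: abs_mult intro!: mult_right_le_one_le)
      qed (use that in auto)
      define \<psi> where "\<psi> t = (\<integral>z. W z * \<phi> (z - t *\<^sub>R h) \<partial>lebesgue)" for t
      have D: "(\<psi> has_real_derivative (\<integral>z. G z * \<phi> (z - t *\<^sub>R h) \<partial>lebesgue)) (at t)" if t: "0 \<le> t" "t \<le> s n" for t
      proof -
        have "norm (t *\<^sub>R h) \<le> s n * norm h" using t by (simp add: mult_right_mono)
        then have th: "norm (t *\<^sub>R h) < R - r'" using N[OF \<open>n \<ge> N\<close>] by auto
        have 0: "\<phi> (z - t *\<^sub>R h) = 0" if "z \<notin> cball a R" for z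
        proof (rule \<phi>0)
          have "dist a z \<le> dist a (z - t *\<^sub>R h) + norm (t *\<^sub>R h)"
            using dist_triangle[of a z "z - t *\<^sub>R h"] by (simp add: dist_norm)
          then show "z - t *\<^sub>R h \<notin> ball a r'" using that th by auto
        qed
        have "(\<integral>z. W z * frechet_derivative \<phi> (at (z - t *\<^sub>R h)) h \<partial>lebesgue) = - (\<integral>z. G z * \<phi> (z - t *\<^sub>R h) \<partial>lebesgue)"
          using has_weak_derivative_on_test[OF wd sub C1_on_translate[OF C] 0, where h=h]
          by (simp add: W_def G_def frechet_derivative_translate[OF C])
        then show ?thesis using DERIV_integral_translate[OF Wi C, of a r' h t] \<phi>0
          by (simp add: \<psi>_def[abs_def])
      qed
      have "\<exists>z>0. z < s n \<and> \<psi> (s n) - \<psi> 0 = (s n - 0) * (\<integral>x. G x * \<phi> (x - z *\<^sub>R h) \<partial>lebesgue)"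
        by (rule MVT2[OF s(1) D])
      then obtain \<xi> where \<xi>: "0 < \<xi>" "\<xi> < s n" "\<psi> (s n) - \<psi> 0 = s n * (\<integral>x. G x * \<phi> (x - \<xi> *\<^sub>R h) \<partial>lebesgue)" by auto
      have n\<xi>: "norm (\<xi> *\<^sub>R h) < \<delta>"
        using N[OF \<open>n \<ge> N\<close>] \<xi>(1,2) mult_right_mono[of \<xi> "s n" "norm h"] by auto
      have sh: "(\<integral>z. F (z + v) * \<phi> z \<partial>lebesgue) = (\<integral>z. F z * \<phi> (z - v) \<partial>lebesgue)"
        if [measurable]: "F \<in> borel_measurable lebesgue" for F v
        using integral_lebesgue_translate[of "\<lambda>z. F z * \<phi> (z - v)" v] by auto
      have Gti: "integrable lebesgue (\<lambda>z. G (z + \<xi> *\<^sub>R h))" by (rule integrable_lebesgue_translate[OF Gi])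
      have "(\<integral>z. ((W (z + s n *\<^sub>R h) - W z) / s n - G z) * \<phi> z \<partial>lebesgue) =
        (\<integral>z. (W (z + s n *\<^sub>R h) * \<phi> z - W z * \<phi> z) / s n - G z * \<phi> z \<partial>lebesgue)"
        by (intro Bochner_Integration.integral_cong) (auto simp: field_simps diff_divide_distrib)
      also have "\<dots> = ((\<integral>z. W (z + s n *\<^sub>R h) * \<phi> z \<partial>lebesgue) - (\<integral>z. W z * \<phi> z \<partial>lebesgue)) / s n - (\<integral>z. G z * \<phi> z \<partial>lebesgue)"
        using bi[OF Wti, of 0] bi[OF Wi, of 0] bi[OF Gi, of 0] by simp
      also have "\<dots> = (\<integral>x. G x * \<phi> (x - \<xi> *\<^sub>R h) \<partial>lebesgue) - (\<integral>z. G z * \<phi> z \<partial>lebesgue)"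
        using \<xi>(3) s(1)[of n] sh[of W "s n *\<^sub>R h"] by (simp add: \<psi>_def)
      also have "\<dots> = (\<integral>x. G (x + \<xi> *\<^sub>R h) * \<phi> x - G x * \<phi> x \<partial>lebesgue)"
        using sh[of G "\<xi> *\<^sub>R h"] bi[OF Gi, of 0] bi[OF Gti, of 0] by simp
      also have "\<dots> \<le> (\<integral>x. \<bar>G (x + \<xi> *\<^sub>R h) - G x\<bar> \<partial>lebesgue)"
      proof (rule integral_mono)
        show "integrable lebesgue (\<lambda>x. G (x + \<xi> *\<^sub>R h) * \<phi> x - G x * \<phi> x)"
          using bi[OF Gi, of 0] bi[OF Gti, of 0] by simp
        show "integrable lebesgue (\<lambda>x. \<bar>G (x + \<xi> *\<^sub>R h) - G x\<bar>)" using Gi Gti by auto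
        fix x
        have "(G (x + \<xi> *\<^sub>R h) - G x) * \<phi> x \<le> \<bar>G (x + \<xi> *\<^sub>R h) - G x\<bar> * 1"
          by (rule order_trans[OF abs_ge_self]) (auto simp: abs_mult simp del: mult_1_right intro!: mult_left_mono \<phi>1)
        then show "G (x + \<xi> *\<^sub>R h) * \<phi> x - G x * \<phi> x \<le> \<bar>G (x + \<xi> *\<^sub>R h) - G x\<bar>" by (simp add: left_diff_distrib)
      qed
      also have "\<dots> \<le> e / 2" using \<delta>(2)[OF n\<xi>] by simp
      finally show "(\<integral>z. ((W (z + s n *\<^sub>R h) - W z) / s n - G z) * \<phi> z \<partial>lebesgue) \<le> e / 2" .
    qed
    moreover have "(\<integral>z. indicator (cball a r) z * \<bar>(W (z + s n *\<^sub>R h) - W z) / s n - G z\<bar> \<partial>lebesgue) \<ge> 0" for n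
      by (intro integral_nonneg_AE) auto
    ultimately show "\<exists>no. \<forall>n\<ge>no. norm ((\<integral>z. indicator (cball a r) z * \<bar>(W (z + s n *\<^sub>R h) - W z) / s n - G z\<bar> \<partial>lebesgue) - 0) < e"
      using \<open>e > 0\<close> by (intro exI[of _ N]) (smt (verit, best) field_sum_of_halves real_norm_def)
  qed
qed

text \<open>The sequence \<open>s\<close> is arbitrary, so that a common sequence of step sizes for finitely many functions
  can be found by successive refinement.\<close>

lemma weak_derivative_quotient_AE:
  fixes w :: "real^'k \<Rightarrow> real" and h :: "real^'k"
  assumes wd: "has_weak_derivative_on \<Omega> w w'" and r: "0 < r" "r < R" and sub: "cball a R \<subseteq> \<Omega>"
    and s: "\<And>n. s n > 0" "s \<longlonglongrightarrow> 0"
  obtains \<rho> :: "nat \<Rightarrow> nat" where "strict_mono \<rho>"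
    "AE z in lebesgue. z \<in> cball a r \<longrightarrow> (\<lambda>n. (w (z + s (\<rho> n) *\<^sub>R h) - w z) / s (\<rho> n)) \<longlonglongrightarrow> w' z h"
proof -
  define W where "W z = indicator (cball a R) z * w z" for z
  define G where "G z = indicator (cball a R) z * w' z h" for z
  note q = weak_derivative_quotient_L1(1)[OF wd r sub s, where h=h, folded W_def G_def]
    weak_derivative_quotient_L1(2)[OF wd r sub s, folded W_def]
    weak_derivative_quotient_L1(3)[OF wd r sub s, where h=h, folded G_def]
  define u where "u n z = indicator (cball a r) z * ((W (z + s n *\<^sub>R h) - W z) / s n - G z)" for n z
  have "integrable lebesgue (u n)" for n
  proof -
    have "integrable lebesgue (\<lambda>z. (W (z + s n *\<^sub>R h) - W z) / s n - G z)"
      using q(2,3) integrable_lebesgue_translate[OF q(2), of "s n *\<^sub>R h"] by auto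
    from integrable_mult_indicator[OF _ this, of "cball a r"] show ?thesis by (simp add: u_def[abs_def])
  qed
  moreover have "(\<lambda>n. \<integral>z. norm (u n z) \<partial>lebesgue) \<longlonglongrightarrow> 0"
    using q(1) by (simp add: u_def abs_mult)
  ultimately obtain \<rho> where \<rho>: "strict_mono \<rho>" "AE z in lebesgue. (\<lambda>n. u (\<rho> n) z) \<longlonglongrightarrow> 0"
    using tendsto_L1_AE_subseq[of lebesgue u] by blast
  have s\<rho>: "(\<lambda>n. s (\<rho> n)) \<longlonglongrightarrow> 0"
    using LIMSEQ_subseq_LIMSEQ[OF s(2) \<rho>(1)] by (simp add: o_def)
  show ?thesis
  proof (rule that[OF \<rho>(1)], use \<rho>(2) in \<open>rule eventually_mono\<close>, intro impI)
    fix z assume u: "(\<lambda>n. u (\<rho> n) z) \<longlonglongrightarrow> 0" and z: "z \<in> cball a r"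
    have zR: "z \<in> cball a R" using z r by auto
    have "(\<lambda>n. s (\<rho> n) * norm h) \<longlonglongrightarrow> 0 * norm h" by (intro tendsto_intros s\<rho>)
    then have "\<forall>\<^sub>F n in sequentially. s (\<rho> n) * norm h < R - r"
      using r by (intro order_tendstoD) auto
    \<comment> \<open>For small steps z and z + s h both lie in the larger ball, where W agrees with
      w and G with the weak derivative.\<close>
    then have ev: "\<forall>\<^sub>F n in sequentially. (w (z + s (\<rho> n) *\<^sub>R h) - w z) / s (\<rho> n) = u (\<rho> n) z + w' z h"
    proof eventually_elim
      case (elim n)
      have "dist a (z + s (\<rho> n) *\<^sub>R h) \<le> dist a z + norm (s (\<rho> n) *\<^sub>R h)"
        using dist_triangle[of a "z + s (\<rho> n) *\<^sub>R h" z] by (simp add: dist_norm)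
      then have "z + s (\<rho> n) *\<^sub>R h \<in> cball a R" using z elim s(1)[of "\<rho> n"] by auto
      then show ?case using z zR by (simp add: u_def W_def G_def)
    qed
    have "(\<lambda>n. u (\<rho> n) z + w' z h) \<longlonglongrightarrow> 0 + w' z h" by (intro tendsto_intros u)
    then show "(\<lambda>n. (w (z + s (\<rho> n) *\<^sub>R h) - w z) / s (\<rho> n)) \<longlonglongrightarrow> w' z h"
      using tendsto_cong[OF ev] by simp
  qed
qed

section \<open>Charts and tangent vectors\<close>

text \<open>Replaces the existential derivative by a canonical one. Two C1 statements on open sets
  then speak of the same derivative and can be glued.\<close>

lemma C1_on_Blinfun:
  "C1_on S f \<longleftrightarrow> (\<forall>x\<in>S. f differentiable (at x)) \<and> continuous_on S (\<lambda>x. Blinfun (frechet_derivative f (at x)))"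
  (is "?l \<longleftrightarrow> ?r")
proof
  assume ?l
  then obtain f' where f': "\<And>x. x \<in> S \<Longrightarrow> (f has_derivative blinfun_apply (f' x)) (at x)" "continuous_on S f'"
    unfolding C1_on_def by blast
  have "Blinfun (frechet_derivative f (at x)) = f' x" if "x \<in> S" for x
    using frechet_derivative_at[OF f'(1)[OF that]] by (simp add: blinfun_apply_inverse flip: \<open>_ = frechet_derivative f (at x)\<close>)
  then have "continuous_on S (\<lambda>x. Blinfun (frechet_derivative f (at x)))" using f'(2) by (simp cong: continuous_on_cong)
  then show ?r using f'(1) by (auto simp: differentiable_def)
next
  assume r: ?r
  show ?l
  proof (rule C1_onI)
    fix x assume "x \<in> S"
    then have "(f has_derivative frechet_derivative f (at x)) (at x)" using r frechet_derivative_works by blast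
    then show "(f has_derivative blinfun_apply (Blinfun (frechet_derivative f (at x)))) (at x)"
      by (simp add: bounded_linear_Blinfun_apply has_derivative_bounded_linear)
  qed (use r in blast)
qed

lemma C1_on_Un:
  assumes "C1_on S f" "C1_on T f" "open S" "open T" shows "C1_on (S \<union> T) f"
  using assms unfolding C1_on_Blinfun by (auto intro: continuous_on_open_Un)

lemma C1_on_cong_open:
  assumes "C1_on S f" "open S" "\<And>x. x \<in> S \<Longrightarrow> f x = g x" shows "C1_on S g"
proof -
  obtain f' where f': "\<And>x. x \<in> S \<Longrightarrow> (f has_derivative blinfun_apply (f' x)) (at x)" "continuous_on S f'"
    using assms(1) unfolding C1_on_def by blast
  show ?thesis
    by (rule C1_onI[OF _ f'(2)]) (use assms f' in \<open>blast intro: has_derivative_transform_within_open\<close>)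
qed

locale C1_manifold =
  fixes A :: "('m::{second_countable_topology, t2_space}, 'k::finite) chart set"
  assumes atlas: "C1_atlas A"
begin

lemma obtain_chart: obtains c where "c \<in> A" "x \<in> cdom c"
  using atlas unfolding C1_atlas_def by blast

lemma open_cdom: "c \<in> A \<Longrightarrow> open (cdom c)"
  and open_cimage: "c \<in> A \<Longrightarrow> open (cmap c ` cdom c)"
  and chart_homeomorphism: "c \<in> A \<Longrightarrow> homeomorphism (cdom c) (cmap c ` cdom c) (cmap c) (cinv c)"
  using atlas unfolding C1_atlas_def by blast+

lemma continuous_on_cmap: "c \<in> A \<Longrightarrow> continuous_on (cdom c) (cmap c)"
  and continuous_on_cinv: "c \<in> A \<Longrightarrow> continuous_on (cmap c ` cdom c) (cinv c)"
  and cinv_cmap [simp]: "c \<in> A \<Longrightarrow> x \<in> cdom c \<Longrightarrow> cinv c (cmap c x) = x"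
  and cmap_cinv [simp]: "c \<in> A \<Longrightarrow> z \<in> cmap c ` cdom c \<Longrightarrow> cmap c (cinv c z) = z"
  and cinv_in [simp]: "c \<in> A \<Longrightarrow> z \<in> cmap c ` cdom c \<Longrightarrow> cinv c z \<in> cdom c"
  using chart_homeomorphism unfolding homeomorphism_def by blast+

lemma cmap_image_eq:
  "c \<in> A \<Longrightarrow> cmap c ` (E \<inter> cdom c) = {z \<in> cmap c ` cdom c. cinv c z \<in> E}"
  by auto

lemma cmap_image_eq': "c \<in> A \<Longrightarrow> E \<subseteq> cdom c \<Longrightarrow> cmap c ` E = {z \<in> cmap c ` cdom c. cinv c z \<in> E}"
  using cmap_image_eq[of c E] by (simp add: Int_absorb2)

lemma cmap_Collect_eq: "c \<in> A \<Longrightarrow> cmap c ` {x \<in> cdom c. P x} = {z \<in> cmap c ` cdom c. P (cinv c z)}"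
  by auto

lemma inj_on_cmap: "c \<in> A \<Longrightarrow> inj_on (cmap c) (cdom c)"
  by (intro inj_onI) (metis cinv_cmap)

lemma open_cmap_image:
  assumes "c \<in> A" "open U" shows "open (cmap c ` (U \<inter> cdom c))"
proof -
  have "open (cinv c -` U \<inter> cmap c ` cdom c)"
    using continuous_on_open_vimage[OF open_cimage] continuous_on_cinv assms by blast
  moreover have "cmap c ` (U \<inter> cdom c) = cinv c -` U \<inter> cmap c ` cdom c"
    using cmap_image_eq[OF assms(1)] by auto
  ultimately show ?thesis by simp
qed

lemma open_cmap_vimage:
  assumes "c \<in> A" "open V" shows "open {x \<in> cdom c. cmap c x \<in> V}"
proof -
  have "open (cmap c -` V \<inter> cdom c)"
    using continuous_on_open_vimage[OF open_cdom] continuous_on_cmap assms by blast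
  then show ?thesis by (simp add: vimage_def Int_def conj_commute)
qed

section \<open>Derivatives of transition maps and tangent vectors\<close>

lemma C1_on_transition:
  "c \<in> A \<Longrightarrow> c' \<in> A \<Longrightarrow> C1_on (cmap c ` (cdom c \<inter> cdom c')) (cmap c' \<circ> cinv c)"
  using atlas unfolding C1_atlas_def by blast

lemma transition_has_derivative:
  assumes "c \<in> A" "c' \<in> A" "x \<in> cdom c" "x \<in> cdom c'"
  shows "(cmap c' \<circ> cinv c has_derivative transition_deriv c c' x) (at (cmap c x))"
  unfolding transition_deriv_def
  by (rule C1_on_has_derivative[OF C1_on_transition[OF assms(1,2)]]) (use assms in auto)

lemma linear_transition:
  assumes "c \<in> A" "c' \<in> A" "x \<in> cdom c" "x \<in> cdom c'"
  shows "linear (transition_deriv c c' x)"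
  using transition_has_derivative[OF assms] has_derivative_linear by blast

lemma transition_deriv_refl:
  assumes "c \<in> A" "x \<in> cdom c" shows "transition_deriv c c x h = h"
proof -
  have "(cmap c \<circ> cinv c has_derivative (\<lambda>h. h)) (at (cmap c x))"
    by (rule has_derivative_transform_within_open[of "\<lambda>z. z" _ _ _ "cmap c ` cdom c"])
       (use assms open_cimage[of c] in auto)
  from has_derivative_unique[OF this transition_has_derivative[OF assms(1,1,2,2)]] show ?thesis by metis
qed

lemma transition_deriv_trans:
  assumes A: "c \<in> A" "c' \<in> A" "c'' \<in> A" and x: "x \<in> cdom c" "x \<in> cdom c'" "x \<in> cdom c''"
  shows "transition_deriv c' c'' x (transition_deriv c c' x h) = transition_deriv c c'' x h"
proof -
  have 1: "(cmap c' \<circ> cinv c has_derivative transition_deriv c c' x) (at (cmap c x))"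
    by (rule transition_has_derivative) (use assms in auto)
  have e: "(cmap c' \<circ> cinv c) (cmap c x) = cmap c' x" using cinv_cmap assms by simp
  have 2: "(cmap c'' \<circ> cinv c' has_derivative transition_deriv c' c'' x) (at ((cmap c' \<circ> cinv c) (cmap c x)))"
    unfolding e by (rule transition_has_derivative) (use assms in auto)
  have "((cmap c'' \<circ> cinv c') \<circ> (cmap c' \<circ> cinv c) has_derivative transition_deriv c' c'' x \<circ> transition_deriv c c' x) (at (cmap c x))"
    by (rule diff_chain_at[OF 1 2])
  then have "(cmap c'' \<circ> cinv c has_derivative transition_deriv c' c'' x \<circ> transition_deriv c c' x) (at (cmap c x))"
  proof (rule has_derivative_transform_within_open)
    show "open (cmap c ` (cdom c' \<inter> cdom c))" using A open_cdom by (intro open_cmap_image) auto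
  qed (use assms in auto)
  from has_derivative_unique[OF this transition_has_derivative[OF A(1,3) x(1,3)]] show ?thesis by (simp add: fun_eq_iff)
qed

lemma tvec_of_in_tangent_space [intro, simp]:
  "c \<in> A \<Longrightarrow> x \<in> cdom c \<Longrightarrow> tvec_of A c x h \<in> tangent_space A x"
  unfolding tangent_space_def tvec_of_def by (simp add: transition_deriv_trans)

lemma tvec_of_apply: "c' \<in> A \<Longrightarrow> x \<in> cdom c' \<Longrightarrow> tvec_of A c x h c' = transition_deriv c c' x h"
  by (simp add: tvec_of_def)

lemma tvec_of_apply_self [simp]: "c \<in> A \<Longrightarrow> x \<in> cdom c \<Longrightarrow> tvec_of A c x h c = h"
  by (simp add: tvec_of_apply transition_deriv_refl)

lemma tangent_space_apply:
  assumes "v \<in> tangent_space A x" "c \<in> A" "x \<in> cdom c" "c' \<in> A" "x \<in> cdom c'"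
  shows "v c' = transition_deriv c c' x (v c)"
  using assms unfolding tangent_space_def by blast

lemma tvec_of_coordinates:
  assumes "v \<in> tangent_space A x" "c \<in> A" "x \<in> cdom c" shows "tvec_of A c x (v c) = v"
proof
  fix c' show "tvec_of A c x (v c) c' = v c'"
  proof (cases "c' \<in> A \<and> x \<in> cdom c'")
    case True
    then show ?thesis using tangent_space_apply[OF assms, of c'] by (simp add: tvec_of_apply)
  next
    case False
    moreover have "v c' = 0" using assms(1) False unfolding tangent_space_def by blast
    ultimately show ?thesis by (auto simp: tvec_of_def)
  qed
qed

lemma tvec_of_change_chart:
  assumes "c \<in> A" "c' \<in> A" "x \<in> cdom c" "x \<in> cdom c'"
  shows "tvec_of A c' x (transition_deriv c c' x h) = tvec_of A c x h"
  using tvec_of_coordinates[of "tvec_of A c x h" x c'] assms by (simp add: tvec_of_apply)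

lemma tvec_of_add:
  assumes "c \<in> A" "x \<in> cdom c"
  shows "tvec_of A c x (h + k) = tadd (tvec_of A c x h) (tvec_of A c x k)"
  using linear_transition[OF assms(1) _ assms(2)] by (auto simp: tvec_of_def tadd_def fun_eq_iff linear_add)

lemma tvec_of_scaleR:
  assumes "c \<in> A" "x \<in> cdom c"
  shows "tvec_of A c x (r *\<^sub>R h) = tscale r (tvec_of A c x h)"
  using linear_transition[OF assms(1) _ assms(2)] by (auto simp: tvec_of_def tscale_def fun_eq_iff linear_cmul)

lemma tvec_of_0:
  assumes "c \<in> A" "x \<in> cdom c"
  shows "tvec_of A c x 0 = tzero"
  using linear_transition[OF assms(1) _ assms(2)] by (auto simp: tvec_of_def tzero_def fun_eq_iff linear_0)

lemma tadd_in:
  assumes "v \<in> tangent_space A x" "w \<in> tangent_space A x" shows "tadd v w \<in> tangent_space A x"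
proof -
  obtain c where c: "c \<in> A" "x \<in> cdom c" by (rule obtain_chart)
  have "tadd v w = tvec_of A c x (v c + w c)"
    unfolding tvec_of_add[OF c] tvec_of_coordinates[OF assms(1) c] tvec_of_coordinates[OF assms(2) c] ..
  then show ?thesis using c by simp
qed

lemma tscale_in:
  assumes "v \<in> tangent_space A x" shows "tscale r v \<in> tangent_space A x"
proof -
  obtain c where c: "c \<in> A" "x \<in> cdom c" by (rule obtain_chart)
  have "tscale r v = tvec_of A c x (r *\<^sub>R v c)"
    unfolding tvec_of_scaleR[OF c] tvec_of_coordinates[OF assms c] ..
  then show ?thesis using c by simp
qed

lemma continuous_on_transition_deriv:
  assumes "c \<in> A" "c' \<in> A"
  shows "continuous_on (cdom c \<inter> cdom c') (\<lambda>x. transition_deriv c c' x h)"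
  unfolding transition_deriv_def
  by (rule continuous_on_compose2[OF C1_on_frechet_continuous[OF C1_on_transition[OF assms]]])
     (use assms continuous_on_subset[OF continuous_on_cmap[OF assms(1)], of "cdom c \<inter> cdom c'"] in auto)

subsection \<open>The differential of a function\<close>

lemma C1_fun_has_derivative:
  assumes "C1_fun A f" "c \<in> A" "x \<in> cdom c"
  shows "(f \<circ> cinv c has_derivative frechet_derivative (f \<circ> cinv c) (at (cmap c x))) (at (cmap c x))"
  using assms unfolding C1_fun_def by (intro C1_on_has_derivative) auto

text \<open>The chain rule for transition maps removes the arbitrary choice of a chart from the
  definition of \<open>differential\<close>.\<close>

lemma differential_eq:
  assumes f: "C1_fun A f" and c: "c \<in> A" "x \<in> cdom c" and v: "v \<in> tangent_space A x"
  shows "differential A f x v = frechet_derivative (f \<circ> cinv c) (at (cmap c x)) (v c)"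
proof -
  define c' where "c' = (SOME c. c \<in> A \<and> x \<in> cdom c)"
  have c': "c' \<in> A" "x \<in> cdom c'"
    using someI[of "\<lambda>c. c \<in> A \<and> x \<in> cdom c" c] c unfolding c'_def by blast+
  have 1: "(cmap c' \<circ> cinv c has_derivative transition_deriv c c' x) (at (cmap c x))"
    by (rule transition_has_derivative) (use c c' in auto)
  have e: "(cmap c' \<circ> cinv c) (cmap c x) = cmap c' x" using cinv_cmap c by simp
  have 2: "(f \<circ> cinv c' has_derivative frechet_derivative (f \<circ> cinv c') (at (cmap c' x))) (at ((cmap c' \<circ> cinv c) (cmap c x)))"
    unfolding e by (rule C1_fun_has_derivative[OF f c'])
  have "((f \<circ> cinv c') \<circ> (cmap c' \<circ> cinv c) has_derivative frechet_derivative (f \<circ> cinv c') (at (cmap c' x)) \<circ> transition_deriv c c' x) (at (cmap c x))"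
    by (rule diff_chain_at[OF 1 2])
  then have "(f \<circ> cinv c has_derivative frechet_derivative (f \<circ> cinv c') (at (cmap c' x)) \<circ> transition_deriv c c' x) (at (cmap c x))"
  proof (rule has_derivative_transform_within_open)
    show "open (cmap c ` (cdom c' \<inter> cdom c))" using c c' open_cdom by (intro open_cmap_image) auto
  qed (use c c' in auto)
  from has_derivative_unique[OF this C1_fun_has_derivative[OF f c]]
  have "frechet_derivative (f \<circ> cinv c') (at (cmap c' x)) (transition_deriv c c' x (v c)) = frechet_derivative (f \<circ> cinv c) (at (cmap c x)) (v c)"
    by (simp add: fun_eq_iff)
  then show ?thesis
    unfolding differential_def Let_def c'_def[symmetric] tangent_space_apply[OF v c c', symmetric] .
qed

lemma C1_fun_imp_continuous: "C1_fun A f \<Longrightarrow> continuous_on UNIV f"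
proof -
  assume f: "C1_fun A f"
  have "continuous (at x) f" for x
  proof -
    obtain c where c: "c \<in> A" "x \<in> cdom c" by (rule obtain_chart)
    have "continuous_on (cmap c ` cdom c) (f \<circ> cinv c)"
      using f c C1_on_imp_continuous_on unfolding C1_fun_def by blast
    then have "continuous_on (cdom c) ((f \<circ> cinv c) \<circ> cmap c)"
      by (rule continuous_on_compose[OF continuous_on_cmap[OF c(1)]])
    then have "continuous_on (cdom c) f"
      by (rule continuous_on_eq) (use c in auto)
    then show ?thesis using open_cdom c continuous_on_eq_continuous_at by blast
  qed
  then show ?thesis by (simp add: continuous_at_imp_continuous_on)
qed

lemma C1_compact_support_bounded:
  assumes "f \<in> C1_compact_support A" obtains b where "\<And>x. \<bar>f x\<bar> \<le> b" "b \<ge> 0"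
proof -
  have f: "C1_fun A f" "compact (closure {x. f x \<noteq> 0})" using assms by (auto simp: C1_compact_support_def)
  have "compact (f ` closure {x. f x \<noteq> 0})"
    by (intro compact_continuous_image f(2) continuous_on_subset[OF C1_fun_imp_continuous[OF f(1)]]) auto
  then obtain b where b: "\<And>x. x \<in> closure {x. f x \<noteq> 0} \<Longrightarrow> \<bar>f x\<bar> \<le> b"
    by (metis compact_imp_bounded bounded_iff imageI real_norm_def)
  have "\<bar>f x\<bar> \<le> max b 0" for x using b[of x] closure_subset[of "{x. f x \<noteq> 0}"] by (cases "f x = 0") auto
  then show ?thesis using that[of "max b 0"] by auto
qed

lemma differential_outside_support:
  assumes "C1_fun A f" "x \<notin> closure {x. f x \<noteq> 0}" "v \<in> tangent_space A x"
  shows "differential A f x v = 0"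
proof -
  obtain c where c: "c \<in> A" "x \<in> cdom c" by (rule obtain_chart)
  let ?U = "- closure {x. f x \<noteq> 0}"
  have f0: "f y = 0" if "y \<in> ?U" for y using that closure_subset[of "{x. f x \<noteq> 0}"] by auto
  have "(f \<circ> cinv c has_derivative (\<lambda>h. 0)) (at (cmap c x))"
  proof (rule has_derivative_transform_within_open[of "\<lambda>z. 0"])
    show "open (cmap c ` (?U \<inter> cdom c))" by (intro open_cmap_image c) auto
    show "cmap c x \<in> cmap c ` (?U \<inter> cdom c)" using c assms(2) by blast
    show "0 = (f \<circ> cinv c) z" if z: "z \<in> cmap c ` (?U \<inter> cdom c)" for z
    proof -
      obtain y where y: "y \<in> ?U" "y \<in> cdom c" "z = cmap c y" using z by blast
      then show ?thesis using f0[OF y(1)] c by simp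
    qed
  qed simp
  from has_derivative_unique[OF this C1_fun_has_derivative[OF assms(1) c]] show ?thesis
    by (simp add: differential_eq[OF assms(1) c assms(3)] fun_eq_iff)
qed

text \<open>Extension by zero out of a chart. The function is C1 on the chart domain and zero off
  the compact set K; K lies in the chart domain, so the domain and the complement of K cover the
  manifold. The complement is open because compact sets are closed in a Hausdorff space.\<close>

lemma C1_fun_pullback:
  assumes c: "c \<in> A" and \<phi>: "C1_on UNIV \<phi>" "\<And>z. z \<notin> ball a R \<Longrightarrow> \<phi> z = 0" and sub: "cball a R \<subseteq> cmap c ` cdom c"
  shows "(\<lambda>x. if x \<in> cdom c then \<phi> (cmap c x) else 0) \<in> C1_compact_support A" (is "?g \<in> _")
proof -
  define K where "K = cinv c ` cball a R"
  have K: "compact K" unfolding K_def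
    by (intro compact_continuous_image continuous_on_subset[OF continuous_on_cinv[OF c] sub]) auto
  have Kc: "K \<subseteq> cdom c" unfolding K_def using sub cinv_in[OF c] by blast
  have cl: "closed K" using K by (rule compact_imp_closed)
  have g0: "?g x = 0" if "x \<notin> K" for x
  proof (cases "x \<in> cdom c")
    case True
    then have "cmap c x \<notin> cball a R" using that cinv_cmap[OF c True] unfolding K_def by (metis imageI)
    then have "cmap c x \<notin> ball a R" by auto
    then show ?thesis using \<phi>(2) by simp
  qed simp
  have g0': "\<phi> (cmap c x) = 0" if "x \<notin> K" "x \<in> cdom c" for x using g0[OF that(1)] that(2) by simp
  have "{x. ?g x \<noteq> 0} \<subseteq> K" using g0 by blast
  then have "closure {x. ?g x \<noteq> 0} \<subseteq> K" by (rule closure_minimal[OF _ cl])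
  then have 1: "compact (closure {x. ?g x \<noteq> 0})"
    using compact_Int_closed[OF K closed_closure, of "{x. ?g x \<noteq> 0}"] by (simp only: Int_absorb1)
  have "C1_on (cmap c' ` cdom c') (?g \<circ> cinv c')" if c': "c' \<in> A" for c'
  proof -
    have o1: "open (cmap c' ` (cdom c \<inter> cdom c'))" using c c' open_cdom by (intro open_cmap_image) auto
    have o2: "open (cmap c' ` (- K \<inter> cdom c'))" using c' cl by (intro open_cmap_image) auto
    have T: "C1_on (cmap c' ` (cdom c \<inter> cdom c')) (\<phi> \<circ> (cmap c \<circ> cinv c'))"
      using C1_on_compose[OF C1_on_transition[OF c' c] \<phi>(1)] by (simp only: Int_commute subset_UNIV)
    have 1: "C1_on (cmap c' ` (cdom c \<inter> cdom c')) (?g \<circ> cinv c')"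
      by (rule C1_on_cong_open[OF T o1], erule imageE) (simp add: c')
    have 2: "C1_on (cmap c' ` (- K \<inter> cdom c')) (?g \<circ> cinv c')"
      by (rule C1_on_cong_open[OF C1_on_const[of _ 0] o2], erule imageE) (use g0' c' in simp)
    have "cmap c' ` cdom c' = cmap c' ` (cdom c \<inter> cdom c') \<union> cmap c' ` (- K \<inter> cdom c')" using Kc by blast
    then show ?thesis using C1_on_Un[OF 1 2 o1 o2] by (simp only:)
  qed
  then show ?thesis using 1 by (simp add: C1_compact_support_def C1_fun_def)
qed

text \<open>Chart coordinates become test functions only after multiplication with a cut-off. The
  cut-off itself is kept as a further test function: where it is nonzero, the point lies in the
  chart and division by it returns the coordinates.\<close>

lemma local_coordinates:
  assumes c: "c \<in> A" "y \<in> cdom c"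
  obtains V \<eta> F where "open V" "y \<in> V" "V \<subseteq> cdom c" "\<eta> \<in> C1_compact_support A"
    "\<And>i. F i \<in> C1_compact_support A" "\<And>x. x \<in> V \<Longrightarrow> \<eta> x = 1" "\<And>x. \<eta> x \<noteq> 0 \<Longrightarrow> x \<in> cdom c"
    "\<And>x i. x \<in> cdom c \<Longrightarrow> F i x = \<eta> x * cmap c x $ i"
proof -
  obtain R where R: "R > 0" "cball (cmap c y) R \<subseteq> cmap c ` cdom c"
    using open_cimage[OF c(1)] c by (meson imageI open_contains_cball)
  obtain \<eta> where \<eta>: "C1_on UNIV \<eta>" "\<And>x. x \<in> cball (cmap c y) (R/2) \<Longrightarrow> \<eta> x = 1" "\<And>x. x \<notin> ball (cmap c y) R \<Longrightarrow> \<eta> x = (0::real)"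
    using C1_cutoff[of "R/2" R "cmap c y"] R(1) by (metis half_gt_zero field_sum_of_halves less_add_same_cancel1)
  let ?\<eta> = "\<lambda>x. if x \<in> cdom c then \<eta> (cmap c x) else 0"
  let ?F = "\<lambda>i x. if x \<in> cdom c then \<eta> (cmap c x) * cmap c x $ i else 0"
  show ?thesis
  proof (rule that[of "{x \<in> cdom c. cmap c x \<in> ball (cmap c y) (R/2)}" ?\<eta> ?F])
    show "open {x \<in> cdom c. cmap c x \<in> ball (cmap c y) (R/2)}" by (intro open_cmap_vimage c) auto
    show "?\<eta> \<in> C1_compact_support A" by (rule C1_fun_pullback[OF c(1) \<eta>(1,3) R(2)])
    show "?F i \<in> C1_compact_support A" for i
      by (rule C1_fun_pullback[OF c(1) _ _ R(2), where \<phi>="\<lambda>z. \<eta> z * z $ i"])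
         (use \<eta> in \<open>auto intro!: C1_on_mult C1_on_bounded_linear[of "\<lambda>z. z $ i"] bounded_linear_vec_nth\<close>)
  qed (use c R \<eta>(2) in \<open>auto split: if_splits\<close>)
qed

text \<open>The atlas may be uncountable, while null sets and measurable sets only allow countable
  unions; the Lindelof property bridges the gap.\<close>

lemma countable_subatlas:
  obtains A0 where "A0 \<subseteq> A" "countable A0" "(\<Union>c\<in>A0. cdom c) = UNIV"
proof -
  obtain F where F: "F \<subseteq> cdom ` A" "countable F" "\<Union>F = \<Union>(cdom ` A)"
    using Lindelof[of "cdom ` A"] open_cdom by blast
  from F(1,2) obtain A0 where "A0 \<subseteq> A" "countable A0" "F = cdom ` A0"
    by (metis countable_subset_image)
  moreover have "\<Union>(cdom ` A) = UNIV" using atlas unfolding C1_atlas_def by blast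
  ultimately show ?thesis using that F(3) by auto
qed

subsection \<open>Measurability and null sets\<close>

lemma cimage_lebesgue: "c \<in> A \<Longrightarrow> cmap c ` cdom c \<in> sets lebesgue"
  using open_cimage by (simp add: borel_open)

text \<open>The generating family is already a sigma-algebra: charts are injective on their domains,
  so forming images commutes with complements as well as with unions.\<close>

lemma sets_lebesgue_algebra: "sets (lebesgue_algebra A) = {E. \<forall>c\<in>A. cmap c ` (E \<inter> cdom c) \<in> sets lebesgue}"
proof -
  let ?S = "{E. \<forall>c\<in>A. cmap c ` (E \<inter> cdom c) \<in> sets lebesgue}"
  have "sigma_algebra UNIV ?S"
  proof (rule sigma_algebra_iff2[THEN iffD2], intro conjI ballI allI impI)
    show "?S \<subseteq> Pow UNIV" by simp
    show "{} \<in> ?S" by simp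
    fix E assume E: "E \<in> ?S"
    have "cmap c ` ((UNIV - E) \<inter> cdom c) \<in> sets lebesgue" if "c \<in> A" for c
    proof -
      have "cmap c ` ((UNIV - E) \<inter> cdom c) = cmap c ` cdom c - cmap c ` (E \<inter> cdom c)"
        using inj_on_cmap[OF that] by (auto simp: inj_on_def)
      also have "\<dots> \<in> sets lebesgue" using E that cimage_lebesgue[OF that] by (intro sets.Diff) auto
      finally show ?thesis .
    qed
    then show "UNIV - E \<in> ?S" by blast
  next
    fix E :: "nat \<Rightarrow> 'm set" assume E: "range E \<subseteq> ?S"
    have "cmap c ` (\<Union>(range E) \<inter> cdom c) \<in> sets lebesgue" if "c \<in> A" for c
    proof -
      have "cmap c ` (\<Union>(range E) \<inter> cdom c) = (\<Union>n. cmap c ` (E n \<inter> cdom c))" by auto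
      also have "\<dots> \<in> sets lebesgue" using E that by (intro sets.countable_UN) auto
      finally show ?thesis .
    qed
    then show "\<Union>(range E) \<in> ?S" by blast
  qed
  then show ?thesis unfolding lebesgue_algebra_def by (simp add: sigma_algebra.sets_measure_of_eq sigma_algebra.sigma_sets_eq)
qed

lemma space_lebesgue_algebra [simp]: "space (lebesgue_algebra A) = UNIV"
  unfolding lebesgue_algebra_def by simp

lemma open_in_lebesgue_algebra: "open U \<Longrightarrow> U \<in> sets (lebesgue_algebra A)"
  unfolding sets_lebesgue_algebra using open_cmap_image by (auto intro: borel_open)

lemma borel_subset_lebesgue_algebra: "sets borel \<subseteq> sets (lebesgue_algebra A)"
  unfolding borel_def
proof (subst sets_measure_of)
  show "sigma_sets UNIV {S. open S} \<subseteq> sets (lebesgue_algebra A)"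
    using open_in_lebesgue_algebra sets.sigma_sets_subset[of "{S. open S}" "lebesgue_algebra A"] by auto
qed auto

lemma differentiable_on_transition:
  assumes "c \<in> A" "c' \<in> A" shows "(cmap c' \<circ> cinv c) differentiable_on (cmap c ` (cdom c \<inter> cdom c'))"
  unfolding differentiable_on_def
proof
  fix z assume "z \<in> cmap c ` (cdom c \<inter> cdom c')"
  from differentiableI[OF C1_on_has_derivative[OF C1_on_transition[OF assms] this]]
  show "(cmap c' \<circ> cinv c) differentiable (at z within cmap c ` (cdom c \<inter> cdom c'))"
    by (rule differentiable_at_withinI)
qed

lemma transition_image:
  assumes "c \<in> A" "c' \<in> A" "E \<subseteq> cdom c"
  shows "cmap c' ` (E \<inter> cdom c') = (cmap c' \<circ> cinv c) ` (cmap c ` E \<inter> cmap c ` (cdom c' \<inter> cdom c))"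
proof -
  have "cmap c ` E \<inter> cmap c ` (cdom c' \<inter> cdom c) = cmap c ` (E \<inter> cdom c')"
    using inj_on_cmap[OF assms(1)] assms(3) by (auto simp: inj_on_def)
  moreover have "(cmap c' \<circ> cinv c) ` cmap c ` (E \<inter> cdom c') = cmap c' ` (E \<inter> cdom c')"
    unfolding image_image o_def by (rule image_cong[OF refl]) (use cinv_cmap[OF assms(1)] assms(3) in auto)
  ultimately show ?thesis by simp
qed

text \<open>A homeomorphism need not preserve Lebesgue measurability. Transition maps do, since a
  differentiable map between spaces of equal dimension maps null sets to null sets.\<close>

lemma lebesgue_change_chart:
  assumes c: "c \<in> A" "c' \<in> A" and E: "E \<subseteq> cdom c" "cmap c ` E \<in> sets lebesgue"
  shows "cmap c' ` (E \<inter> cdom c') \<in> sets lebesgue"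
proof -
  have o: "cmap c ` (cdom c' \<inter> cdom c) \<in> sets lebesgue"
    using open_cmap_image[OF c(1) open_cdom[OF c(2)]] by (simp add: borel_open)
  show ?thesis
    unfolding transition_image[OF c E(1)]
  proof (rule differentiable_image_in_sets_lebesgue)
    show "cmap c ` E \<inter> cmap c ` (cdom c' \<inter> cdom c) \<in> sets lebesgue" using o E(2) by (rule sets.Int[rotated])
    show "cmap c' \<circ> cinv c differentiable_on cmap c ` E \<inter> cmap c ` (cdom c' \<inter> cdom c)"
      by (rule differentiable_on_subset[OF differentiable_on_transition[OF c]]) (simp add: Int_commute)
  qed simp
qed

lemma AE_manifold_iff:
  "AE_manifold A P \<longleftrightarrow> (\<forall>c\<in>A. AE z in lebesgue. z \<in> cmap c ` cdom c \<longrightarrow> P (cinv c z))"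
proof -
  have "cmap c ` {x \<in> cdom c. \<not> P x} \<in> null_sets lebesgue \<longleftrightarrow> (AE z in lebesgue. z \<in> cmap c ` cdom c \<longrightarrow> P (cinv c z))"
    if c: "c \<in> A" for c
  proof -
    have "cmap c ` {x \<in> cdom c. \<not> P x} = {z \<in> space lebesgue. \<not> (z \<in> cmap c ` cdom c \<longrightarrow> P (cinv c z))}"
      unfolding cmap_Collect_eq[OF c] by auto
    then show ?thesis
      by (auto simp: eventually_ae_filter intro: null_sets_completion_subset)
  qed
  then show ?thesis unfolding AE_manifold_def by blast
qed

lemma AE_manifold_mono: "AE_manifold A P \<Longrightarrow> (\<And>x. P x \<Longrightarrow> Q x) \<Longrightarrow> AE_manifold A Q"
  unfolding AE_manifold_iff by (blast intro: eventually_mono)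

lemma AE_manifold_conj: "AE_manifold A P \<Longrightarrow> AE_manifold A Q \<Longrightarrow> AE_manifold A (\<lambda>x. P x \<and> Q x)"
  unfolding AE_manifold_iff by (blast intro: eventually_elim2)

lemma AE_manifold_countable:
  "countable I \<Longrightarrow> (\<And>i. i \<in> I \<Longrightarrow> AE_manifold A (P i)) \<Longrightarrow> AE_manifold A (\<lambda>x. \<forall>i\<in>I. P i x)"
  unfolding AE_manifold_def
proof
  fix c assume I: "countable I" "\<And>i. i \<in> I \<Longrightarrow> \<forall>c\<in>A. cmap c ` {x \<in> cdom c. \<not> P i x} \<in> null_sets lebesgue" and "c \<in> A"
  then have "(\<Union>i\<in>I. cmap c ` {x \<in> cdom c. \<not> P i x}) \<in> null_sets lebesgue"
    by (intro null_sets_UN') auto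
  moreover have "cmap c ` {x \<in> cdom c. \<not> (\<forall>i\<in>I. P i x)} = (\<Union>i\<in>I. cmap c ` {x \<in> cdom c. \<not> P i x})" by blast
  ultimately show "cmap c ` {x \<in> cdom c. \<not> (\<forall>i\<in>I. P i x)} \<in> null_sets lebesgue" by simp
qed

text \<open>Completeness of Lebesgue measure: a set with null complement in all charts is
  measurable, however P is given.\<close>

lemma AE_manifold_sets: "AE_manifold A P \<Longrightarrow> {x. P x} \<in> sets (lebesgue_algebra A)"
proof -
  assume P: "AE_manifold A P"
  have "{x. \<not> P x} \<in> sets (lebesgue_algebra A)"
    unfolding sets_lebesgue_algebra
  proof (rule CollectI, rule ballI)
    fix c assume "c \<in> A"
    then have "cmap c ` {x \<in> cdom c. \<not> P x} \<in> null_sets lebesgue" using P unfolding AE_manifold_def by blast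
    moreover have "{x. \<not> P x} \<inter> cdom c = {x \<in> cdom c. \<not> P x}" by blast
    ultimately show "cmap c ` ({x. \<not> P x} \<inter> cdom c) \<in> sets lebesgue" by (simp add: null_setsD2)
  qed
  then have "UNIV - {x. \<not> P x} \<in> sets (lebesgue_algebra A)"
    using sets.compl_sets[of _ "lebesgue_algebra A"] by simp
  then show ?thesis by (simp add: Diff_eq Compl_eq)
qed

lemma measurable_lebesgue_algebra_cinv:
  assumes "f \<in> measurable (lebesgue_algebra A) N" "c \<in> A"
  shows "(\<lambda>z. f (cinv c z)) \<in> measurable (lebesgue_on (cmap c ` cdom c)) N"
proof (rule measurableI)
  fix z show "f (cinv c z) \<in> space N" using measurable_space[OF assms(1)] by simp
next
  fix S assume "S \<in> sets N"
  then have "f -` S \<in> sets (lebesgue_algebra A)" using measurable_sets[OF assms(1)] by simp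
  then have "cmap c ` (f -` S \<inter> cdom c) \<in> sets lebesgue" using assms(2) by (simp add: sets_lebesgue_algebra)
  moreover have "(\<lambda>z. f (cinv c z)) -` S \<inter> space (lebesgue_on (cmap c ` cdom c)) = cmap c ` (f -` S \<inter> cdom c)"
    unfolding cmap_image_eq[OF assms(2)] by (auto simp: space_restrict_space)
  ultimately show "(\<lambda>z. f (cinv c z)) -` S \<inter> space (lebesgue_on (cmap c ` cdom c)) \<in> sets (lebesgue_on (cmap c ` cdom c))"
    using cimage_lebesgue[OF assms(2)] by (auto simp: sets_restrict_space_iff)
qed

text \<open>In any other chart the set is a countable union of images, under transition maps, of the
  pieces that were tested.\<close>

lemma lebesgue_algebra_subatlas:
  assumes A0: "A0 \<subseteq> A" "countable A0" "(\<Union>c\<in>A0. cdom c) = UNIV"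
    and E: "\<And>c. c \<in> A0 \<Longrightarrow> cmap c ` (E \<inter> cdom c) \<in> sets lebesgue"
  shows "E \<in> sets (lebesgue_algebra A)"
  unfolding sets_lebesgue_algebra
proof safe
  fix c' assume c': "c' \<in> A"
  have "(\<Union>c\<in>A0. cmap c' ` ((E \<inter> cdom c) \<inter> cdom c')) \<in> sets lebesgue"
  proof (rule sets.countable_UN'[OF A0(2)])
    show "(\<lambda>c. cmap c' ` ((E \<inter> cdom c) \<inter> cdom c')) ` A0 \<subseteq> sets lebesgue"
    proof (rule image_subsetI)
      fix c assume "c \<in> A0"
      then show "cmap c' ` ((E \<inter> cdom c) \<inter> cdom c') \<in> sets lebesgue"
        using A0(1) E by (intro lebesgue_change_chart[OF _ c']) blast+
    qed
  qed
  moreover have "cmap c' ` (E \<inter> cdom c') = (\<Union>c\<in>A0. cmap c' ` ((E \<inter> cdom c) \<inter> cdom c'))"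
    using A0(3) by blast
  ultimately show "cmap c' ` (E \<inter> cdom c') \<in> sets lebesgue" by simp
qed

end

text \<open>\<open>finite_positive_abs_cont\<close> with finiteness dropped, so that the same lemmas
  serve \<mu> and the Riemannian measure, which may be infinite.\<close>

definition chartwise_abs_cont :: "('m::{second_countable_topology, t2_space}, 'k::finite) chart set \<Rightarrow> 'm measure \<Rightarrow> bool" where
  "chartwise_abs_cont A \<mu> \<longleftrightarrow> sets \<mu> = sets borel \<and>
     (\<forall>c\<in>A. \<forall>E\<in>sets borel. E \<subseteq> cdom c \<longrightarrow>
        (emeasure \<mu> E = 0 \<longleftrightarrow> emeasure lborel (cmap c ` E) = 0))"

context C1_manifold begin

section \<open>Measures with the null sets of Lebesgue measure in charts\<close>

lemma cinv_image_borel: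
  assumes "c \<in> A" "S \<in> sets borel" shows "{x \<in> cdom c. cmap c x \<in> S} \<in> sets borel"
proof -
  have "cmap c \<in> borel_measurable (restrict_space borel (cdom c))"
    by (rule borel_measurable_continuous_on_restrict[OF continuous_on_cmap[OF assms(1)]])
  from measurable_sets[OF this assms(2)] have "cmap c -` S \<inter> cdom c \<in> sets (restrict_space borel (cdom c))"
    by (simp add: space_restrict_space)
  then have "cmap c -` S \<inter> cdom c \<in> sets borel"
    using open_cdom[OF assms(1)] by (subst (asm) sets_restrict_space_iff) auto
  then show ?thesis by (simp add: vimage_def Int_def conj_commute)
qed

context
  fixes \<mu> :: "'m measure" assumes \<mu>: "chartwise_abs_cont A \<mu>"
begin

lemma sets_ac: "sets \<mu> = sets borel" and space_ac: "space \<mu> = UNIV"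
  using \<mu> sets_eq_imp_space_eq[of \<mu> borel] by (auto simp: chartwise_abs_cont_def)

lemma ac_null_iff: "c \<in> A \<Longrightarrow> E \<in> sets borel \<Longrightarrow> E \<subseteq> cdom c \<Longrightarrow> emeasure \<mu> E = 0 \<longleftrightarrow> emeasure lborel (cmap c ` E) = 0"
  using \<mu> by (auto simp: chartwise_abs_cont_def)

lemma ac_null_chart:
  assumes c: "c \<in> A" and N: "N \<in> null_sets lborel"
  shows "{x \<in> cdom c. cmap c x \<in> N} \<in> null_sets \<mu>"
proof -
  have b: "{x \<in> cdom c. cmap c x \<in> N} \<in> sets borel" by (rule cinv_image_borel[OF c]) (use N in auto)
  have "cmap c ` {x \<in> cdom c. cmap c x \<in> N} \<subseteq> N" by auto
  moreover have "cmap c ` {x \<in> cdom c. cmap c x \<in> N} = N \<inter> cmap c ` cdom c" by auto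
  then have "cmap c ` {x \<in> cdom c. cmap c x \<in> N} \<in> sets lborel" using N open_cimage[OF c] by auto
  ultimately have "emeasure lborel (cmap c ` {x \<in> cdom c. cmap c x \<in> N}) = 0"
    using N null_sets_subset by blast
  then show ?thesis using ac_null_iff[OF c b] b by (auto simp: sets_ac null_sets_def)
qed

text \<open>In a chart, a Lebesgue set is a Borel set up to part of a Borel null set. Pulled back to
  the manifold, the Borel part stays Borel and the null set becomes a null set of \<mu>.\<close>

lemma lebesgue_algebra_subset_completion: "sets (lebesgue_algebra A) \<subseteq> sets (completion \<mu>)"
proof
  fix E assume E: "E \<in> sets (lebesgue_algebra A)"
  obtain A0 where A0: "A0 \<subseteq> A" "countable A0" "(\<Union>c\<in>A0. cdom c) = UNIV" by (rule countable_subatlas)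
  have "E \<inter> cdom c \<in> sets (completion \<mu>)" if "c \<in> A0" for c
  proof -
    have c: "c \<in> A" using that A0 by auto
    have "cmap c ` (E \<inter> cdom c) \<in> sets (completion lborel)" using E c by (simp add: sets_lebesgue_algebra)
    then obtain S N N' where S: "cmap c ` (E \<inter> cdom c) = S \<union> N" "N \<subseteq> N'" "N' \<in> null_sets lborel" "S \<in> sets lborel"
      by (rule sets_completionE)
    show ?thesis
    proof (rule sets_completionI)
      show "E \<inter> cdom c = {x \<in> cdom c. cmap c x \<in> S} \<union> {x \<in> cdom c. cmap c x \<in> N}"
        using S(1) inj_on_cmap[OF c] by (auto simp: inj_on_def)
      show "{x \<in> cdom c. cmap c x \<in> N} \<subseteq> {x \<in> cdom c. cmap c x \<in> N'}" using S by auto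
      show "{x \<in> cdom c. cmap c x \<in> N'} \<in> null_sets \<mu>" by (rule ac_null_chart[OF c S(3)])
      show "{x \<in> cdom c. cmap c x \<in> S} \<in> sets \<mu>" unfolding sets_ac using S(4) by (intro cinv_image_borel c) simp
    qed
  qed
  then have "(\<Union>c\<in>A0. E \<inter> cdom c) \<in> sets (completion \<mu>)" using A0(2) by (intro sets.countable_UN') auto
  moreover have "E = (\<Union>c\<in>A0. E \<inter> cdom c)" using A0(3) by auto
  ultimately show "E \<in> sets (completion \<mu>)" by simp
qed

lemma measurable_lebesgue_algebra_completion:
  "f \<in> measurable (lebesgue_algebra A) N \<Longrightarrow> f \<in> measurable (completion \<mu>) N"
  using lebesgue_algebra_subset_completion unfolding measurable_def by (auto simp: space_ac)

text \<open>The passage between charts and measures on the manifold. One direction collects the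
  exceptional null sets of countably many charts, the other restricts a Borel null set of \<mu> to a
  single chart.\<close>

lemma AE_manifold_iff_AE_completion: "AE_manifold A P \<longleftrightarrow> (AE x in completion \<mu>. P x)"
proof
  assume P: "AE_manifold A P"
  obtain A0 where A0: "A0 \<subseteq> A" "countable A0" "(\<Union>c\<in>A0. cdom c) = UNIV" by (rule countable_subatlas)
  have "\<exists>N\<in>null_sets \<mu>. {x \<in> cdom c. \<not> P x} \<subseteq> N" if "c \<in> A0" for c
  proof -
    have c: "c \<in> A" using that A0 by auto
    have "cmap c ` {x \<in> cdom c. \<not> P x} \<in> null_sets (completion lborel)" using P c by (simp add: AE_manifold_def)
    then obtain N where "N \<in> null_sets lborel" "cmap c ` {x \<in> cdom c. \<not> P x} \<subseteq> N" by (auto simp: null_sets_completion_iff2)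
    then show ?thesis using ac_null_chart[OF c, of N] by (intro bexI[of _ "{x \<in> cdom c. cmap c x \<in> N}"]) auto
  qed
  then obtain N where N: "\<And>c. c \<in> A0 \<Longrightarrow> N c \<in> null_sets \<mu>" "\<And>c. c \<in> A0 \<Longrightarrow> {x \<in> cdom c. \<not> P x} \<subseteq> N c" by metis
  have "(\<Union>c\<in>A0. N c) \<in> null_sets \<mu>" using A0(2) N(1) by (intro null_sets_UN') auto
  moreover have "{x. \<not> P x} \<subseteq> (\<Union>c\<in>A0. N c)" using N(2) A0(3) by blast
  ultimately have "AE x in \<mu>. P x" by (intro AE_I') auto
  then show "AE x in completion \<mu>. P x" by (rule AE_completion)
next
  assume "AE x in completion \<mu>. P x"
  then have "AE x in \<mu>. P x" by (simp add: AE_completion_iff)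
  then obtain N where N: "N \<in> null_sets \<mu>" "{x. \<not> P x} \<subseteq> N" by (auto simp: eventually_ae_filter space_ac)
  show "AE_manifold A P" unfolding AE_manifold_def
  proof
    fix c assume c: "c \<in> A"
    have Nb: "N \<inter> cdom c \<in> sets borel" using N open_cdom[OF c] sets_ac by auto
    have "emeasure \<mu> (N \<inter> cdom c) = 0" using N Nb by (metis Int_lower1 null_sets_subset null_setsD1 null_setsD2 sets_ac)
    then have z: "emeasure lborel (cmap c ` (N \<inter> cdom c)) = 0" using ac_null_iff[OF c Nb] by simp
    have "cmap c ` (N \<inter> cdom c) \<in> sets lborel"
    proof -
      have "cinv c \<in> borel_measurable (restrict_space borel (cmap c ` cdom c))"
        by (rule borel_measurable_continuous_on_restrict[OF continuous_on_cinv[OF c]])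
      from measurable_sets[OF this Nb] have "cinv c -` (N \<inter> cdom c) \<inter> cmap c ` cdom c \<in> sets (restrict_space borel (cmap c ` cdom c))"
        by (simp add: space_restrict_space)
      then have "cinv c -` (N \<inter> cdom c) \<inter> cmap c ` cdom c \<in> sets borel"
        using open_cimage[OF c] by (subst (asm) sets_restrict_space_iff) auto
      moreover have "cmap c ` (N \<inter> cdom c) = cinv c -` (N \<inter> cdom c) \<inter> cmap c ` cdom c"
        unfolding cmap_image_eq[OF c] using cinv_in[OF c] by auto
      ultimately show ?thesis by simp
    qed
    then have "cmap c ` (N \<inter> cdom c) \<in> null_sets lborel" using z by (auto simp: null_sets_def)
    moreover have "cmap c ` {x \<in> cdom c. \<not> P x} \<subseteq> cmap c ` (N \<inter> cdom c)" using N(2) by auto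
    ultimately show "cmap c ` {x \<in> cdom c. \<not> P x} \<in> null_sets lebesgue" by (auto simp: null_sets_completion_iff2)
  qed
qed

end

end

section \<open>Inner products in coordinates\<close>

text \<open>Orthonormal sets are independent, so their cardinalities are bounded and one of maximal
  cardinality exists. It spans: otherwise a vector outside the span, reduced by its projection and
  normalized, could be added.\<close>

lemma orthonormal_set_exists:
  fixes b :: "'a::euclidean_space \<Rightarrow> 'a \<Rightarrow> real"
  assumes sym: "\<And>u v. b u v = b v u"
    and add: "\<And>u v w. b (u + v) w = b u w + b v w"
    and scale: "\<And>r v w. b (r *\<^sub>R v) w = r * b v w"
    and pos: "\<And>v. v \<noteq> 0 \<Longrightarrow> b v v > 0"
  obtains E where "finite E" "\<And>e e'. e \<in> E \<Longrightarrow> e' \<in> E \<Longrightarrow> b e e' = (if e = e' then 1 else 0)" "span E = UNIV"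
proof -
  define on where "on E \<longleftrightarrow> finite E \<and> (\<forall>e\<in>E. \<forall>e'\<in>E. b e e' = (if e = e' then 1 else 0))" for E
  have zero: "b 0 w = 0" for w using scale[of 0 0 w] by simp
  have sumb: "b (\<Sum>v\<in>E. u v *\<^sub>R v) w = (\<Sum>v\<in>E. u v * b v w)" if "finite E" for E u w
    using that by (induction E) (auto simp: zero add scale)
  have indep: "independent E" if E: "on E" for E
  proof
    assume "dependent E"
    then obtain u v where u: "v \<in> E" "u v \<noteq> 0" "(\<Sum>v\<in>E. u v *\<^sub>R v) = 0"
      using E unfolding on_def by (metis dependent_finite)
    have "0 = b (\<Sum>v\<in>E. u v *\<^sub>R v) v" using u(3) zero by simp
    also have "\<dots> = (\<Sum>w\<in>E. u w * b w v)" using E by (intro sumb) (simp add: on_def)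
    also have "\<dots> = (\<Sum>w\<in>E. if w = v then u v else 0)"
      using E u(1) by (intro sum.cong) (auto simp: on_def)
    also have "\<dots> = u v" using E u(1) by (simp add: on_def)
    finally show False using u(2) by simp
  qed
  have card: "card E \<le> DIM('a)" if "on E" for E using independent_bound[OF indep[OF that]] by simp
  have "\<exists>E. on E \<and> (\<forall>F. on F \<longrightarrow> card F \<le> card E)"
    by (rule ex_has_greatest_nat[of on "{}" card "Suc (DIM('a))"]) (simp add: on_def, simp add: card less_Suc_eq_le)
  then obtain E where E: "on E" "\<And>F. on F \<Longrightarrow> card F \<le> card E" by (elim exE conjE) (simp add: that)
  have fin: "finite E" using E by (simp add: on_def)
  have "span E = UNIV"
  proof (rule ccontr)
    assume "span E \<noteq> UNIV"
    then obtain v where v: "v \<notin> span E" by auto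
    define w where "w = v - (\<Sum>e\<in>E. b v e *\<^sub>R e)"
    have w0: "w \<noteq> 0"
    proof
      assume "w = 0"
      then have "v = (\<Sum>e\<in>E. b v e *\<^sub>R e)" by (simp add: w_def)
      then show False using v by (metis (no_types, lifting) span_base span_scale span_sum)
    qed
    have we: "b w e = 0" if "e \<in> E" for e
    proof -
      have "b v e = b (w + (\<Sum>e\<in>E. b v e *\<^sub>R e)) e" by (simp add: w_def)
      also have "\<dots> = b w e + (\<Sum>e'\<in>E. b v e' * b e' e)" by (simp only: add sumb[OF fin])
      also have "(\<Sum>e'\<in>E. b v e' * b e' e) = (\<Sum>e'\<in>E. if e' = e then b v e else 0)"
        using E(1) that by (intro sum.cong) (auto simp: on_def)
      also have "\<dots> = b v e" using fin that by simp
      finally show ?thesis by simp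
    qed
    define u where "u = (1 / sqrt (b w w)) *\<^sub>R w"
    have "b w w > 0" by (rule pos[OF w0])
    then have uu: "b u u = 1"
      by (simp add: u_def scale sym[of w "_ *\<^sub>R _"] real_sqrt_mult_self flip: real_sqrt_mult)
    have ue: "b u e = 0" if "e \<in> E" for e using we[OF that] by (simp add: u_def scale)
    have "u \<notin> E" using ue uu by force
    have "on (insert u E)" unfolding on_def
    proof (intro conjI ballI)
      fix e e' assume "e \<in> insert u E" "e' \<in> insert u E"
      then show "b e e' = (if e = e' then 1 else 0)"
        using E(1) uu ue \<open>u \<notin> E\<close> sym[of e u] unfolding on_def by auto
    qed (use fin in simp)
    from E(2)[OF this] show False using \<open>u \<notin> E\<close> fin by simp
  qed
  then show ?thesis using that[of E] E(1) unfolding on_def by blast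
qed

lemma continuous_on_det:
  fixes M :: "'a::topological_space \<Rightarrow> real^'n^'n"
  assumes "\<And>i j. continuous_on S (\<lambda>x. M x $ i $ j)"
  shows "continuous_on S (\<lambda>x. det (M x))"
  unfolding det_def by (intro continuous_intros assms)

text \<open>On the segment from the identity to G all matrices have a positive quadratic form and
  hence trivial kernel. The determinant never vanishes there and keeps the sign it has at the
  identity.\<close>

lemma det_pos_definite:
  fixes G :: "real^'n^'n"
  assumes pos: "\<And>v. v \<noteq> 0 \<Longrightarrow> v \<bullet> (G *v v) > 0"
  shows "det G > 0"
proof -
  define H where "H t = (1 - t) *\<^sub>R mat 1 + t *\<^sub>R G" for t :: real
  have nz: "det (H t) \<noteq> 0" if "0 \<le> t" "t \<le> 1" for t
  proof
    assume "det (H t) = 0"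
    then obtain v where v: "v \<noteq> 0" "H t *v v = 0"
      using invertible_det_nz[of "H t"] matrix_left_invertible_ker[of "H t"] by (metis invertible_left_inverse)
    have "v \<bullet> (H t *v v) = (1 - t) * (v \<bullet> v) + t * (v \<bullet> (G *v v))"
      by (simp add: H_def matrix_vector_mult_add_rdistrib inner_add_right scaleR_matrix_vector_assoc[symmetric])
    moreover have "(1 - t) * (v \<bullet> v) + t * (v \<bullet> (G *v v)) > 0"
    proof (cases "t = 0")
      case False
      then show ?thesis using pos[OF v(1)] that v(1) by (intro add_nonneg_pos) auto
    qed (use v in simp)
    ultimately show False using v(2) by simp
  qed
  have cont: "continuous_on {0..1} (\<lambda>t. det (H t))"
    unfolding H_def by (intro continuous_on_det) (auto intro!: continuous_intros)
  have H0: "det (H 0) = 1" and H1: "det (H 1) = det G" by (simp_all add: H_def)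
  show ?thesis
  proof (rule ccontr)
    assume "\<not> det G > 0"
    then have "\<exists>t\<ge>0. t \<le> 1 \<and> det (H t) = 0"
      using cont H0 H1 by (intro IVT2') auto
    then show False using nz by auto
  qed
qed

locale riemannian =
  fixes A :: "('m::{second_countable_topology, t2_space}, 'k::finite) chart set"
    and g :: "'m \<Rightarrow> ('m, 'k) tvec \<Rightarrow> ('m, 'k) tvec \<Rightarrow> real"
  assumes riemannian: "riemannian_manifold A g"

sublocale riemannian \<subseteq> C1_manifold A
  using riemannian by unfold_locales (simp add: riemannian_manifold_def)

context riemannian begin

lemma metric_inner_product: "inner_product_on (tangent_space A x) (g x)"
  using riemannian by (simp add: riemannian_manifold_def)

lemma metric_sym: "v \<in> tangent_space A x \<Longrightarrow> w \<in> tangent_space A x \<Longrightarrow> g x v w = g x w v"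
  and metric_add: "u \<in> tangent_space A x \<Longrightarrow> v \<in> tangent_space A x \<Longrightarrow> w \<in> tangent_space A x \<Longrightarrow>
    g x (tadd u v) w = g x u w + g x v w"
  and metric_scale: "v \<in> tangent_space A x \<Longrightarrow> w \<in> tangent_space A x \<Longrightarrow> g x (tscale r v) w = r * g x v w"
  and metric_pos: "v \<in> tangent_space A x \<Longrightarrow> v \<noteq> tzero \<Longrightarrow> g x v v > 0"
  using metric_inner_product[of x] unfolding inner_product_on_def by blast+

definition gc where "gc c x h k = g x (tvec_of A c x h) (tvec_of A c x k)"

context
  fixes c x assumes c: "c \<in> A" "x \<in> cdom c"
begin

lemma gc_sym: "gc c x h k = gc c x k h"
  unfolding gc_def using c by (intro metric_sym) auto

lemma gc_add: "gc c x (h + h') k = gc c x h k + gc c x h' k"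
  unfolding gc_def tvec_of_add[OF c] using c by (intro metric_add) auto

lemma gc_scale: "gc c x (r *\<^sub>R h) k = r * gc c x h k"
  unfolding gc_def tvec_of_scaleR[OF c] using c by (intro metric_scale) auto

lemma gc_pos: "h \<noteq> 0 \<Longrightarrow> gc c x h h > 0"
  unfolding gc_def
proof (rule metric_pos)
  assume "h \<noteq> 0"
  then show "tvec_of A c x h \<noteq> tzero" using tvec_of_apply_self[OF c, of h] by (auto simp: tzero_def)
qed (rule tvec_of_in_tangent_space[OF c])

lemma gc_zero: "gc c x 0 k = 0" using gc_scale[of 0 0 k] by simp

lemma gc_nonneg: "gc c x h h \<ge> 0" using gc_pos[of h] gc_zero[of 0] by (cases "h = 0") auto

lemma gc_sum: "gc c x (\<Sum>i\<in>I. u i) k = (\<Sum>i\<in>I. gc c x (u i) k)"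
  by (induction I rule: infinite_finite_induct) (auto simp: gc_zero gc_add)

lemma gc_expand: "gc c x h k = (\<Sum>i\<in>UNIV. \<Sum>j\<in>UNIV. h $ i * k $ j * gram_matrix A g c x $ i $ j)"
proof -
  have e: "h = (\<Sum>i\<in>UNIV. h $ i *\<^sub>R axis i 1)" for h :: "real^'k"
    using basis_expansion[of h] by (simp add: scalar_mult_eq_scaleR)
  have l: "gc c x h k = (\<Sum>i\<in>UNIV. h $ i * gc c x (axis i 1) k)" for h k
    by (subst e[of h]) (simp only: gc_sum gc_scale)
  have "gc c x h k = (\<Sum>i\<in>UNIV. h $ i * gc c x (axis i 1) k)" by (rule l)
  also have "\<dots> = (\<Sum>i\<in>UNIV. h $ i * (\<Sum>j\<in>UNIV. k $ j * gc c x (axis i 1) (axis j 1)))"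
  proof (intro sum.cong refl arg_cong2[where f="(*)"])
    fix i
    have "gc c x (axis i 1) k = gc c x k (axis i 1)" by (rule gc_sym)
    also have "\<dots> = (\<Sum>j\<in>UNIV. k $ j * gc c x (axis j 1) (axis i 1))" by (rule l)
    also have "\<dots> = (\<Sum>j\<in>UNIV. k $ j * gc c x (axis i 1) (axis j 1))"
      by (intro sum.cong refl arg_cong2[where f="(*)"]) (rule gc_sym)
    finally show "gc c x (axis i 1) k = (\<Sum>j\<in>UNIV. k $ j * gc c x (axis i 1) (axis j 1))" .
  qed
  finally show ?thesis by (simp add: gram_matrix_def gc_def sum_distrib_left mult.assoc)
qed

lemma gc_gram: "gc c x h k = h \<bullet> (gram_matrix A g c x *v k)"
  unfolding gc_expand inner_vec_def matrix_vector_mult_def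
  by (simp add: sum_distrib_left mult_ac)

lemma det_gram_pos: "det (gram_matrix A g c x) > 0"
  using gc_pos by (intro det_pos_definite) (simp add: gc_gram)

end

lemma continuous_on_gram: "c \<in> A \<Longrightarrow> continuous_on (cdom c) (\<lambda>x. gram_matrix A g c x $ i $ j)"
  using riemannian by (simp add: gram_matrix_def riemannian_manifold_def)

lemma continuous_on_gc:
  assumes c: "c \<in> A" and X: "continuous_on S X" "X ` S \<subseteq> cdom c" and h: "continuous_on S h" "continuous_on S k"
  shows "continuous_on S (\<lambda>s. gc c (X s) (h s) (k s))"
proof -
  have "continuous_on S (\<lambda>s. \<Sum>i\<in>UNIV. \<Sum>j\<in>UNIV. h s $ i * k s $ j * gram_matrix A g c (X s) $ i $ j)"
    by (intro continuous_intros h continuous_on_compose2[OF continuous_on_gram[OF c] X])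
  then show ?thesis
    by (rule continuous_on_eq) (use X(2) gc_expand[OF c] in auto)
qed

text \<open>The metric attains its extremes on the compact set of unit coordinate vectors over K;
  homogeneity extends the bounds to all vectors. These constants compare Riemannian with coordinate
  norms, and this is a point where continuity of the metric enters.\<close>

lemma gc_bounds:
  assumes c: "c \<in> A" and K: "compact K" "K \<subseteq> cdom c"
  obtains lo hi where "lo > 0" "\<And>x h. x \<in> K \<Longrightarrow> lo * (norm h)\<^sup>2 \<le> gc c x h h" "\<And>x h. x \<in> K \<Longrightarrow> gc c x h h \<le> hi * (norm h)\<^sup>2"
proof (cases "K = {}")
  case True then show ?thesis using that[of 1 1] by auto
next
  case False
  let ?S = "K \<times> sphere (0::real^'k) 1"
  have S: "compact ?S" using K by (intro compact_Times) auto
  have "norm (axis undefined 1 :: real^'k) = 1" by simp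
  then have "axis undefined 1 \<in> sphere (0::real^'k) 1" by (simp only: mem_sphere_0)
  then have ne: "?S \<noteq> {}" using False by auto
  have cont: "continuous_on ?S (\<lambda>s. gc c (fst s) (snd s) (snd s))"
    by (intro continuous_on_gc[OF c] continuous_intros) (use K in auto)
  obtain s where s: "s \<in> ?S" "\<And>t. t \<in> ?S \<Longrightarrow> gc c (fst s) (snd s) (snd s) \<le> gc c (fst t) (snd t) (snd t)"
    using continuous_attains_inf[OF S ne cont] by blast
  obtain s' where s': "s' \<in> ?S" "\<And>t. t \<in> ?S \<Longrightarrow> gc c (fst t) (snd t) (snd t) \<le> gc c (fst s') (snd s') (snd s')"
    using continuous_attains_sup[OF S ne cont] by blast
  define lo where "lo = gc c (fst s) (snd s) (snd s)"
  define hi where "hi = gc c (fst s') (snd s') (snd s')"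
  have lo: "lo > 0" unfolding lo_def
  proof (rule gc_pos[OF c])
    show "fst s \<in> cdom c" using s(1) K(2) by auto
    have "norm (snd s) = 1" using s(1) by (cases s) (simp add: mem_sphere_0)
    then show "snd s \<noteq> 0" by auto
  qed
  have "lo * (norm h)\<^sup>2 \<le> gc c x h h \<and> gc c x h h \<le> hi * (norm h)\<^sup>2" if x: "x \<in> K" for x h
  proof (cases "h = 0")
    case True
    then show ?thesis using gc_zero[OF c, of x] x K(2) by auto
  next
    case False
    have xc: "x \<in> cdom c" using x K(2) by auto
    define u where "u = (1 / norm h) *\<^sub>R h"
    have hu: "h = norm h *\<^sub>R u" using False by (simp add: u_def)
    have "norm u = 1" using False by (simp add: u_def)
    then have "(x, u) \<in> ?S" using x by (simp only: mem_sphere_0 mem_Times_iff fst_conv snd_conv)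
    then have b: "lo \<le> gc c x u u" "gc c x u u \<le> hi" using s(2) s'(2) unfolding lo_def hi_def by fastforce+
    have "gc c x h h = (norm h)\<^sup>2 * gc c x u u"
      by (subst (1 2) hu) (simp only: gc_scale[OF c xc] gc_sym[OF c xc, of u "_ *\<^sub>R u"] power2_eq_square mult.assoc)
    then show ?thesis using b by (simp add: mult.commute[of _ "(norm h)\<^sup>2"] mult_left_mono)
  qed
  then show ?thesis using that lo by blast
qed

lemma orthonormal_basis_exists: "\<exists>E. orthonormal_basis A g x E"
proof -
  obtain c where c: "c \<in> A" "x \<in> cdom c" by (rule obtain_chart)
  obtain E where E: "finite E" "\<And>e e'. e \<in> E \<Longrightarrow> e' \<in> E \<Longrightarrow> gc c x e e' = (if e = e' then 1 else 0)" "span E = UNIV"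
    using orthonormal_set_exists[of "gc c x"] gc_sym[OF c] gc_add[OF c] gc_scale[OF c] gc_pos[OF c] by metis
  have inj: "inj_on (tvec_of A c x) E" by (intro inj_onI) (metis tvec_of_apply_self c)
  have "orthonormal_basis A g x (tvec_of A c x ` E)"
    unfolding orthonormal_basis_def
  proof (intro conjI ballI)
    show "finite (tvec_of A c x ` E)" "tvec_of A c x ` E \<subseteq> tangent_space A x" using E(1) c by auto
    fix e e' assume "e \<in> tvec_of A c x ` E" "e' \<in> tvec_of A c x ` E"
    then obtain h h' where h: "h \<in> E" "h' \<in> E" "e = tvec_of A c x h" "e' = tvec_of A c x h'" by blast
    have "e = e' \<longleftrightarrow> h = h'" using inj h by (auto simp: inj_on_def)
    then show "g x e e' = (if e = e' then 1 else 0)" using E(2)[OF h(1,2)] h by (simp add: gc_def)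
  next
    fix v assume v: "v \<in> tangent_space A x"
    have "v c \<in> span E" using E(3) by simp
    then obtain u where u: "v c = (\<Sum>e\<in>E. u e *\<^sub>R e)" using span_finite[OF E(1)] by auto
    have "v c' = (\<Sum>e\<in>tvec_of A c x ` E. u (e c) *\<^sub>R e c')" for c'
    proof -
      have "v c' = tvec_of A c x (v c) c'" using tvec_of_coordinates[OF v c] by simp
      also have "\<dots> = (\<Sum>h\<in>E. u h *\<^sub>R tvec_of A c x h c')"
        using linear_transition[OF c(1) _ c(2), of c'] by (auto simp: tvec_of_def u linear_sum linear_cmul)
      also have "\<dots> = (\<Sum>e\<in>tvec_of A c x ` E. u (e c) *\<^sub>R e c')"
        using c by (simp add: sum.reindex[OF inj])
      finally show ?thesis .
    qed
    then show "\<exists>a. v = (\<lambda>c'. \<Sum>e\<in>tvec_of A c x ` E. a e *\<^sub>R e c')" by (intro exI[of _ "\<lambda>e. u (e c)"]) auto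
  qed
  then show ?thesis by blast
qed

context
  fixes x E c assumes E: "orthonormal_basis A g x E" and c: "c \<in> A" "x \<in> cdom c"
begin

lemma E_props: "finite E" "\<And>e. e \<in> E \<Longrightarrow> e \<in> tangent_space A x" "\<And>e e'. e \<in> E \<Longrightarrow> e' \<in> E \<Longrightarrow> g x e e' = (if e = e' then 1 else 0)"
  using E unfolding orthonormal_basis_def by blast+

lemma orthonormal_expansion: "h = (\<Sum>e\<in>E. gc c x h (e c) *\<^sub>R e c)"
proof -
  obtain a where a: "tvec_of A c x h = (\<lambda>c'. \<Sum>e\<in>E. a e *\<^sub>R e c')"
    using E c tvec_of_in_tangent_space[OF c] unfolding orthonormal_basis_def by blast
  from fun_cong[OF this, of c] have h: "h = (\<Sum>e\<in>E. a e *\<^sub>R e c)" using c by simp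
  have "gc c x h (e c) = a e" if e: "e \<in> E" for e
  proof -
    have on: "gc c x (e' c) (e c) = (if e' = e then 1 else 0)" if "e' \<in> E" for e'
      using E_props(2,3) that e c by (simp add: gc_def tvec_of_coordinates)
    have "gc c x h (e c) = (\<Sum>e'\<in>E. a e' * gc c x (e' c) (e c))"
      by (subst h) (simp only: gc_sum[OF c] gc_scale[OF c])
    also have "\<dots> = (\<Sum>e'\<in>E. if e' = e then a e else 0)" using on by (intro sum.cong) auto
    finally show ?thesis using E_props(1) e by simp
  qed
  then show ?thesis using h by simp
qed

lemma orthonormal_norm: "gc c x h h = (\<Sum>e\<in>E. (gc c x h (e c))\<^sup>2)"
proof -
  have "gc c x h h = (\<Sum>e\<in>E. gc c x h (e c) * gc c x (e c) h)"
    by (subst (1) orthonormal_expansion[of h]) (simp only: gc_sum[OF c] gc_scale[OF c])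
  also have "\<dots> = (\<Sum>e\<in>E. (gc c x h (e c))\<^sup>2)"
    by (intro sum.cong refl) (simp add: gc_sym[OF c, of "_ c" h] power2_eq_square)
  finally show ?thesis .
qed

text \<open>The numbers on the left are the entries of the inverse Gram matrix: by the expansion in
  the basis, the Gram matrix maps their j-th column to the j-th unit vector. Cramer's rule rewrites
  them in a form that no longer mentions \<open>E\<close> and is visibly continuous in x. In this
  way \<open>hom_norm\<close>, whose basis is picked by \<open>SOME\<close> separately at every
  point, turns out to be continuous.\<close>

lemma orthonormal_gram_inverse:
  "(\<Sum>e\<in>E. e c $ i * e c $ j) =
     det (\<chi> a b. if b = i then axis j 1 $ a else gram_matrix A g c x $ a $ b) / det (gram_matrix A g c x)"
proof -
  let ?G = "gram_matrix A g c x"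
  define S where "S i = (\<Sum>e\<in>E. e c $ i * e c $ j)" for i
  have "(?G *v (\<chi> i. S i)) $ a = axis j 1 $ a" for a
  proof -
    have "(?G *v (\<chi> i. S i)) $ a = (\<Sum>e\<in>E. gc c x (axis a 1) (e c) * e c $ j)"
      unfolding gc_gram[OF c]
      by (simp add: matrix_vector_mult_def S_def inner_axis' sum_distrib_left sum_distrib_right mult.assoc) (rule sum.swap)
    also have "\<dots> = (\<Sum>e\<in>E. gc c x (axis a 1) (e c) *\<^sub>R e c) $ j" by simp
    also have "\<dots> = axis a 1 $ j" 
      by (rule arg_cong[where f="\<lambda>v. v $ j", OF orthonormal_expansion[symmetric]])
    also have "\<dots> = axis j 1 $ a" by (simp add: axis_def)
    finally show ?thesis .
  qed
  then have "?G *v (\<chi> i. S i) = axis j 1" by (simp add: vec_eq_iff)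
  then have "(\<chi> i. S i) = (\<chi> k. det (\<chi> a b. if b = k then axis j 1 $ a else ?G $ a $ b) / det ?G)"
    using cramer[of ?G "\<chi> i. S i" "axis j 1"] det_gram_pos[OF c] by simp
  from arg_cong[where f="\<lambda>v. v $ i", OF this]
  have "S i = det (\<chi> a b. if b = i then axis j 1 $ a else ?G $ a $ b) / det ?G"
    by simp
  then show ?thesis by (simp add: S_def)
qed

end

definition gram_inverse where
  "gram_inverse c x i j = det (\<chi> a b. if b = i then axis j 1 $ a else gram_matrix A g c x $ a $ b) / det (gram_matrix A g c x)"

lemma continuous_on_gram_inverse: "c \<in> A \<Longrightarrow> continuous_on (cdom c) (\<lambda>x. gram_inverse c x i j)"
  unfolding gram_inverse_def
proof (intro continuous_on_divide continuous_on_det ballI)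
  show "det (gram_matrix A g c x) \<noteq> 0" if "c \<in> A" "x \<in> cdom c" for x
    using det_gram_pos[OF that] by simp
  show "continuous_on (cdom c) (\<lambda>x. (\<chi> a b. if b = i then axis j 1 $ a else gram_matrix A g c x $ a $ b) $ k $ l)"
    if "c \<in> A" for k l
    using continuous_on_gram[OF that, of k l] by (cases "l = i") simp_all
qed (rule continuous_on_gram)

text \<open>Only finitely many coordinate balls are needed to cover the support of \<open>f\<close>.\<close>

lemma differential_bound:
  assumes f: "f \<in> C1_compact_support A"
  obtains C where "C \<ge> 0" "\<And>x v. v \<in> tangent_space A x \<Longrightarrow> \<bar>differential A f x v\<bar> \<le> C * sqrt (g x v v)"
proof -
  have fC: "C1_fun A f" and K: "compact (closure {x. f x \<noteq> 0})" using f by (auto simp: C1_compact_support_def)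
  let ?K = "closure {x. f x \<noteq> 0}"
  define P where "P U C \<longleftrightarrow> open U \<and> C \<ge> 0 \<and> (\<forall>x\<in>U. \<forall>v\<in>tangent_space A x. \<bar>differential A f x v\<bar> \<le> C * sqrt (g x v v))" for U :: "'m set" and C :: real
  have "\<exists>U C. P U C \<and> y \<in> U" for y
  proof -
    obtain c where c: "c \<in> A" "y \<in> cdom c" by (rule obtain_chart)
    obtain R where R: "R > 0" "cball (cmap c y) R \<subseteq> cmap c ` cdom c"
      using open_cimage[OF c(1)] c by (meson imageI open_contains_cball)
    define L where "L = cinv c ` cball (cmap c y) R"
    have L: "compact L" unfolding L_def
      by (intro compact_continuous_image continuous_on_subset[OF continuous_on_cinv[OF c(1)] R(2)]) auto
    have Lc: "L \<subseteq> cdom c" unfolding L_def using R(2) cinv_in[OF c(1)] by blast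
    obtain lo hi where lo: "lo > 0" "\<And>x h. x \<in> L \<Longrightarrow> lo * (norm h)\<^sup>2 \<le> gc c x h h"
      using gc_bounds[OF c(1) L Lc] by metis
    have "C1_on (cmap c ` cdom c) (f \<circ> cinv c)" using fC c by (auto simp: C1_fun_def)
    then obtain f' where f': "\<And>z. z \<in> cmap c ` cdom c \<Longrightarrow> ((f \<circ> cinv c) has_derivative blinfun_apply (f' z)) (at z)"
      "continuous_on (cmap c ` cdom c) f'" unfolding C1_on_def by blast
    have "compact (f' ` cball (cmap c y) R)"
      by (intro compact_continuous_image continuous_on_subset[OF f'(2) R(2)]) auto
    then obtain b where b: "\<And>z. z \<in> cball (cmap c y) R \<Longrightarrow> norm (f' z) \<le> b"
      by (metis compact_imp_bounded bounded_iff imageI)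
    define U where "U = {x \<in> cdom c. cmap c x \<in> ball (cmap c y) R}"
    \<comment> \<open>b bounds the coordinate derivative of f on a compact ball, and 1 / sqrt lo
      converts the coordinate norm into the Riemannian norm.\<close>
    have "P U (max b 0 / sqrt lo)" unfolding P_def
    proof (intro conjI ballI)
      show "open U" unfolding U_def by (intro open_cmap_vimage c) auto
      show "max b 0 / sqrt lo \<ge> 0" using lo by simp
      fix x v assume x: "x \<in> U" and v: "v \<in> tangent_space A x"
      have xc: "x \<in> cdom c" "cmap c x \<in> cball (cmap c y) R" using x by (auto simp: U_def)
      have xL: "x \<in> L" unfolding L_def using xc cinv_cmap[OF c(1) xc(1)] by (metis imageI)
      have "differential A f x v = f' (cmap c x) (v c)"
        using frechet_derivative_at[OF f'(1)[of "cmap c x"]] xc by (simp add: differential_eq[OF fC c(1) xc(1) v])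
      also have "\<bar>\<dots>\<bar> \<le> max b 0 * norm (v c)"
      proof -
        have "norm (f' (cmap c x)) * norm (v c) \<le> max b 0 * norm (v c)"
          using b[OF xc(2)] by (intro mult_right_mono) auto
        then show ?thesis using norm_blinfun[of "f' (cmap c x)" "v c"] by simp
      qed
      also have "norm (v c) \<le> sqrt (g x v v) / sqrt lo"
      proof -
        have "lo * (norm (v c))\<^sup>2 \<le> g x v v"
          using lo(2)[OF xL, of "v c"] tvec_of_coordinates[OF v c(1) xc(1)] by (simp add: gc_def)
        then have "sqrt (lo * (norm (v c))\<^sup>2) \<le> sqrt (g x v v)" by simp
        then show ?thesis using lo by (simp add: real_sqrt_mult field_simps)
      qed
      finally show "\<bar>differential A f x v\<bar> \<le> max b 0 / sqrt lo * sqrt (g x v v)" by (simp add: mult_left_mono)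
    qed
    moreover have "y \<in> U" using c R by (simp add: U_def)
    ultimately show ?thesis by blast
  qed
  then obtain U C where UC: "\<And>y. P (U y) (C y)" "\<And>y. y \<in> U y" by metis
  obtain I where I: "finite I" "?K \<subseteq> (\<Union>y\<in>I. U y)"
    using compactE_image[OF K, of ?K U] UC by (metis P_def UN_I subsetI)
  show ?thesis
  \<comment> \<open>The sum dominates each of the finitely many local constants and, unlike a
    maximum, makes sense for an empty cover.\<close>
  proof (rule that[of "\<Sum>y\<in>I. C y"])
    show nn: "(\<Sum>y\<in>I. C y) \<ge> 0" using UC by (auto simp: P_def intro: sum_nonneg)
    fix x v assume v: "v \<in> tangent_space A x"
    obtain c where c: "c \<in> A" "x \<in> cdom c" by (rule obtain_chart)
    have gv: "g x v v \<ge> 0" using gc_nonneg[OF c, of "v c"] tvec_of_coordinates[OF v c] by (simp add: gc_def)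
    show "\<bar>differential A f x v\<bar> \<le> (\<Sum>y\<in>I. C y) * sqrt (g x v v)"
    proof (cases "x \<in> ?K")
      case True
      then obtain y where y: "y \<in> I" "x \<in> U y" using I by blast
      then have "\<bar>differential A f x v\<bar> \<le> C y * sqrt (g x v v)" using UC v by (auto simp: P_def)
      also have "C y \<le> (\<Sum>y\<in>I. C y)" using y I(1) UC by (intro member_le_sum) (auto simp: P_def)
      finally show ?thesis using gv by (simp add: mult_right_mono)
    next
      case False
      then show ?thesis using differential_outside_support[OF fC False v] nn gv by simp
    qed
  qed
qed

end

section \<open>Change of variables\<close>

text \<open>The change of variables theorems of the library require a well-ordered index type; every finite
  type is in bijection with one.\<close>

typedef ('k::finite) idx = "{..<CARD('k)}"
  by (rule exI[of _ 0]) (simp add: zero_less_card_finite)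

instantiation idx :: (finite) wellorder
begin
definition less_eq_idx :: "'a idx \<Rightarrow> 'a idx \<Rightarrow> bool" where "less_eq_idx i j \<longleftrightarrow> Rep_idx i \<le> Rep_idx j"
definition less_idx :: "'a idx \<Rightarrow> 'a idx \<Rightarrow> bool" where "less_idx i j \<longleftrightarrow> Rep_idx i < Rep_idx j"
instance
proof
  fix P :: "'a idx \<Rightarrow> bool" and a
  assume "\<And>x. (\<And>y. y < x \<Longrightarrow> P y) \<Longrightarrow> P x"
  then show "P a" unfolding less_idx_def by (rule measure_induct_rule[of Rep_idx])
qed (auto simp: less_eq_idx_def less_idx_def Rep_idx_inject)
end

lemma card_idx: "card (UNIV :: 'k idx set) = CARD('k::finite)"
  using type_definition.card[OF type_definition_idx] by simp

instance idx :: (finite) finite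
proof
  have "inj (Rep_idx :: 'a idx \<Rightarrow> nat)" by (simp add: inj_def Rep_idx_inject)
  moreover have "range (Rep_idx :: 'a idx \<Rightarrow> nat) \<subseteq> {..<CARD('a)}" using Rep_idx by auto
  ultimately show "finite (UNIV :: 'a idx set)" by (metis finite_lessThan finite_subset finite_imageD)
qed

section \<open>Relabelling of coordinates\<close>

definition reindex_vec :: "('b::finite \<Rightarrow> 'a::finite) \<Rightarrow> real^'a \<Rightarrow> real^'b" where
  "reindex_vec f v = (\<chi> i. v $ f i)"

lemma linear_reindex_vec: "linear (reindex_vec f)"
  by (rule linearI) (auto simp: reindex_vec_def vec_eq_iff)

lemma continuous_on_reindex_vec: "continuous_on S (reindex_vec f)"
  by (intro linear_continuous_on linear_linear[THEN iffD2] linear_reindex_vec)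

lemma borel_measurable_reindex_vec [measurable]: "reindex_vec f \<in> borel_measurable borel"
  by (intro borel_measurable_continuous_onI continuous_on_reindex_vec)

lemma reindex_vec_inv:
  "bij f \<Longrightarrow> reindex_vec f (reindex_vec (inv f) v) = v" "bij f \<Longrightarrow> reindex_vec (inv f) (reindex_vec f w) = w"
  by (auto simp: reindex_vec_def vec_eq_iff bij_is_inj bij_is_surj surj_f_inv_f)

lemma prod_Basis_vec: "(\<Prod>b\<in>(Basis :: (real^'n) set). f b) = (\<Prod>i\<in>UNIV. f (axis i 1))"
proof -
  have B: "(Basis :: (real^'n) set) = range (\<lambda>i. axis i 1)" by (auto simp: Basis_vec_def)
  have inj: "inj (\<lambda>i::'n. axis i (1::real))" by (auto simp: inj_def axis_eq_axis)
  show ?thesis unfolding B prod.reindex[OF inj] o_def ..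
qed

text \<open>A permutation of coordinates maps boxes to boxes with the same side lengths, and the
  values on boxes determine Lebesgue measure.\<close>

lemma lborel_distr_reindex_vec:
  fixes f :: "'b::finite \<Rightarrow> 'a::finite"
  assumes f: "bij f"
  shows "distr lborel borel (reindex_vec f) = lborel"
proof (rule lborel_eqI[symmetric])
  fix l u :: "real^'b" assume lu: "\<And>b. b \<in> Basis \<Longrightarrow> l \<bullet> b \<le> u \<bullet> b"
  have le: "l $ i \<le> u $ i" for i using lu[of "axis i 1"] by (simp add: inner_axis axis_in_Basis_iff)
  have fi: "f (inv f a) = a" "inv f (f i) = i" for a i
    using f by (auto simp: bij_is_inj bij_is_surj surj_f_inv_f)
  have "reindex_vec f -` box l u = box (reindex_vec (inv f) l) (reindex_vec (inv f) u)"
    unfolding set_eq_iff vimage_eq mem_box_cart reindex_vec_def vec_lambda_beta by (metis fi)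
  then have "emeasure (distr lborel borel (reindex_vec f)) (box l u) =
    emeasure lborel (box (reindex_vec (inv f) l) (reindex_vec (inv f) u))"
    by (subst emeasure_distr) auto
  also have "\<dots> = (\<Prod>b\<in>Basis. (reindex_vec (inv f) u - reindex_vec (inv f) l) \<bullet> b)"
  proof (rule emeasure_lborel_box)
    fix b :: "real^'a" assume "b \<in> Basis"
    then obtain i where "b = axis i 1" by (auto simp: Basis_vec_def)
    then show "reindex_vec (inv f) l \<bullet> b \<le> reindex_vec (inv f) u \<bullet> b"
      using le by (simp add: inner_axis reindex_vec_def)
  qed
  also have "(\<Prod>b\<in>Basis. (reindex_vec (inv f) u - reindex_vec (inv f) l) \<bullet> b) = (\<Prod>a\<in>UNIV. (u - l) $ inv f a)"
    by (simp add: prod_Basis_vec inner_axis reindex_vec_def)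
  also have "\<dots> = (\<Prod>i\<in>UNIV. (u - l) $ i)"
    by (rule prod.reindex_bij_betw[OF bij_imp_bij_inv[OF f]])
  also have "\<dots> = (\<Prod>b\<in>Basis. (u - l) \<bullet> b)" by (simp add: prod_Basis_vec inner_axis)
  finally show "emeasure (distr lborel borel (reindex_vec f)) (box l u) = ennreal (\<Prod>b\<in>Basis. (u - l) \<bullet> b)" .
qed simp

text \<open>Conjugating a transposition by f gives the transposition of the images. A permutation
  and its conjugate are therefore products of equally many transpositions, although they act on
  different types, and have the same sign in the determinant.\<close>

lemma swapidseq_conj:
  assumes "bij f" "swapidseq n p" shows "swapidseq n (f \<circ> p \<circ> inv f)"
  using assms(2)
proof (induction rule: swapidseq.induct)
  case id
  have e: "f \<circ> id \<circ> inv f = id"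
    by (rule ext) (use assms(1) in \<open>simp add: bij_is_surj surj_f_inv_f\<close>)
  show ?case unfolding e by (rule swapidseq.id)
next
  case (comp_Suc n p a b)
  have eq: "f \<circ> (Transposition.transpose a b \<circ> p) \<circ> inv f = Transposition.transpose (f a) (f b) \<circ> (f \<circ> p \<circ> inv f)"
    using bij_is_inj[OF assms(1)] by (auto simp: fun_eq_iff Transposition.transpose_def inj_eq)
  have ne: "f a \<noteq> f b" using comp_Suc.hyps bij_is_inj[OF assms(1)] by (simp add: inj_eq)
  show ?case unfolding eq by (rule swapidseq.comp_Suc[OF comp_Suc.IH ne])
qed

lemma sign_conj:
  fixes f :: "'a::finite \<Rightarrow> 'b::finite"
  assumes "bij f" "p permutes UNIV" shows "sign (f \<circ> p \<circ> inv f) = sign p"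
proof -
  have "permutation p" unfolding permutation_permutes by (rule exI[of _ UNIV]) (simp add: assms(2))
  then obtain n where n: "swapidseq n p" unfolding permutation_def by blast
  have "evenperm p = even n" by (rule evenperm_unique[OF n refl])
  moreover have "evenperm (f \<circ> p \<circ> inv f) = even n" by (rule evenperm_unique[OF swapidseq_conj[OF assms(1) n] refl])
  ultimately show ?thesis by (simp add: sign_def)
qed

lemma permutes_UNIV_iff_bij: "p permutes UNIV \<longleftrightarrow> bij p"
  by (auto simp: permutes_bij intro: bij_imp_permutes)

lemma det_reindex:
  fixes M :: "real^'a^'a" and f :: "'b::finite \<Rightarrow> 'a::finite"
  assumes f: "bij f"
  shows "det (\<chi> i j. M $ f i $ f j) = det M"
proof -
  have fi: "f (inv f a) = a" "inv f (f i) = i" for a i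
    using f by (auto simp: bij_is_inj bij_is_surj surj_f_inv_f)
  have bi: "bij (inv f)" using f by (rule bij_imp_bij_inv)
  have ii: "inv (inv f) = f" using f by (rule inv_inv_eq)
  have bb: "bij_betw (\<lambda>p. f \<circ> p \<circ> inv f) {p. p permutes (UNIV::'b set)} {p. p permutes (UNIV::'a set)}"
  proof (rule bij_betwI[where g="\<lambda>q. inv f \<circ> q \<circ> f"])
    show "(\<lambda>p. f \<circ> p \<circ> inv f) \<in> {p. p permutes UNIV} \<rightarrow> {p. p permutes UNIV}"
      using f bi by (auto simp: permutes_UNIV_iff_bij intro!: bij_comp)
    show "(\<lambda>q. inv f \<circ> q \<circ> f) \<in> {p. p permutes UNIV} \<rightarrow> {p. p permutes UNIV}"
      using f bi by (auto simp: permutes_UNIV_iff_bij intro!: bij_comp)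
  qed (auto simp: fun_eq_iff fi)
  have "det M = (\<Sum>p | p permutes UNIV. of_int (sign p) * (\<Prod>i\<in>UNIV. M $ i $ p i))" by (simp add: det_def)
  also have "\<dots> = (\<Sum>p | p permutes (UNIV::'b set). of_int (sign (f \<circ> p \<circ> inv f)) * (\<Prod>i\<in>UNIV. M $ i $ (f \<circ> p \<circ> inv f) i))"
    by (rule sum.reindex_bij_betw[OF bb, symmetric])
  also have "\<dots> = (\<Sum>p | p permutes (UNIV::'b set). of_int (sign p) * (\<Prod>i\<in>UNIV. M $ f i $ f (p i)))"
  proof (rule sum.cong[OF refl])
    fix p assume p: "p \<in> {p. p permutes (UNIV::'b set)}"
    have "(\<Prod>i\<in>UNIV. M $ i $ (f \<circ> p \<circ> inv f) i) = (\<Prod>i\<in>UNIV. M $ f i $ (f \<circ> p \<circ> inv f) (f i))"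
      by (rule prod.reindex_bij_betw[OF f, symmetric])
    then show "of_int (sign (f \<circ> p \<circ> inv f)) * (\<Prod>i\<in>UNIV. M $ i $ (f \<circ> p \<circ> inv f) i) = of_int (sign p) * (\<Prod>i\<in>UNIV. M $ f i $ f (p i))"
      using sign_conj[OF f] p by (simp add: fi)
  qed
  also have "\<dots> = det (\<chi> i j. M $ f i $ f j)" by (simp add: det_def)
  finally show ?thesis by simp
qed

text \<open>The change of variables formula with values in [0, \<infinity>]. The image has finite
  measure exactly if the Jacobian is integrable, so outside the integrable case both sides are
  infinite.\<close>

lemma emeasure_differentiable_image_wellorder:
  fixes \<phi> :: "real^'k::{finite,wellorder} \<Rightarrow> real^'k::_"
  assumes S: "S \<in> sets borel" and im: "\<phi> ` S \<in> sets borel" and inj: "inj_on \<phi> S"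
    and der: "\<And>x. x \<in> S \<Longrightarrow> (\<phi> has_derivative \<phi>' x) (at x)"
    and [measurable]: "(\<lambda>x. indicator S x * \<bar>det (matrix (\<phi>' x))\<bar>) \<in> borel_measurable borel"
  shows "emeasure lborel (\<phi> ` S) = (\<integral>\<^sup>+x. ennreal (indicator S x * \<bar>det (matrix (\<phi>' x))\<bar>) \<partial>lborel)"
proof -
  let ?h = "\<lambda>x. indicator S x * \<bar>det (matrix (\<phi>' x))\<bar>"
  have SL: "S \<in> sets lebesgue" using S by simp
  have der': "(\<phi> has_derivative \<phi>' x) (at x within S)" if "x \<in> S" for x using der[OF that] by (rule has_derivative_at_withinI)
  have hm: "?h \<in> borel_measurable lebesgue" by (rule measurable_completion) simp
  have iff: "\<phi> ` S \<in> lmeasurable \<longleftrightarrow> integrable lebesgue ?h"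
    using measurable_differentiable_image_alt[OF SL der' inj] by (simp add: set_integrable_def)
  have nn: "(\<integral>\<^sup>+x. ennreal (?h x) \<partial>lborel) = (\<integral>\<^sup>+x. ennreal (?h x) \<partial>lebesgue)"
    by (simp add: nn_integral_completion)
  have em: "emeasure lborel (\<phi> ` S) = emeasure lebesgue (\<phi> ` S)" using im by simp
  show ?thesis
  proof (cases "\<phi> ` S \<in> lmeasurable")
    case True
    then have i: "integrable lebesgue ?h" using iff by simp
    have ai: "(\<lambda>x. \<bar>det (matrix (\<phi>' x))\<bar>) absolutely_integrable_on S"
      using i by (simp add: set_integrable_def)
    have "measure lebesgue (\<phi> ` S) = integral S (\<lambda>x. \<bar>det (matrix (\<phi>' x))\<bar>)"
      using measure_differentiable_image_eq[OF SL der' inj] set_lebesgue_integral_eq_integral(1)[OF ai] by simp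
    also have "\<dots> = (\<integral>x. ?h x \<partial>lebesgue)"
      using set_lebesgue_integral_eq_integral(2)[OF ai] by (simp add: set_lebesgue_integral_def)
    finally have "ennreal (measure lebesgue (\<phi> ` S)) = (\<integral>\<^sup>+x. ennreal (?h x) \<partial>lebesgue)"
      using nn_integral_eq_integral[OF i] by simp
    then show ?thesis using True unfolding nn em by (simp add: emeasure_eq_measure2)
  next
    case False
    have "emeasure lebesgue (\<phi> ` S) = \<infinity>" using False im by (auto simp: fmeasurable_def less_top[symmetric])
    moreover have "(\<integral>\<^sup>+x. ennreal (?h x) \<partial>lebesgue) = \<infinity>"
    proof (rule ccontr)
      assume "(\<integral>\<^sup>+x. ennreal (?h x) \<partial>lebesgue) \<noteq> \<infinity>"
      then have "integrable lebesgue ?h" using hm by (intro integrableI_nonneg) (auto simp: less_top[symmetric])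
      then show False using iff False by simp
    qed
    ultimately show ?thesis unfolding nn em by simp
  qed
qed

text \<open>Conjugation with the relabelling P carries the formula over from the well-ordered index
  type \<open>'k idx\<close>; it changes neither volumes nor the Jacobian determinant.\<close>

lemma emeasure_differentiable_image:
  fixes \<phi> :: "real^'k::finite \<Rightarrow> real^'k"
  assumes S: "S \<in> sets borel" and im: "\<phi> ` S \<in> sets borel" and inj: "inj_on \<phi> S"
    and der: "\<And>x. x \<in> S \<Longrightarrow> (\<phi> has_derivative \<phi>' x) (at x)"
    and m [measurable]: "(\<lambda>x. indicator S x * \<bar>det (matrix (\<phi>' x))\<bar>) \<in> borel_measurable borel"
  shows "emeasure lborel (\<phi> ` S) = (\<integral>\<^sup>+x. ennreal (indicator S x * \<bar>det (matrix (\<phi>' x))\<bar>) \<partial>lborel)"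
proof -
  obtain f :: "'k idx \<Rightarrow> 'k" where f: "bij f"
    using finite_same_card_bij[of "UNIV :: 'k idx set" "UNIV :: 'k set"] card_idx[where 'k='k] by auto
  define P where "P = reindex_vec f"
  define Q where "Q = reindex_vec (inv f)"
  have PQ: "P (Q v) = v" and QP: "Q (P w) = w" for v w
    unfolding P_def Q_def using reindex_vec_inv[OF f] by auto
  have lin: "linear P" "linear Q" unfolding P_def Q_def by (rule linear_reindex_vec)+
  have dP: "(P has_derivative P) (at x)" and dQ: "(Q has_derivative Q) (at y)" for x y
    using lin by (auto intro!: linear_imp_has_derivative)
  have [measurable]: "P \<in> borel_measurable borel" "Q \<in> borel_measurable borel" unfolding P_def Q_def by auto
  have dPl: "distr lborel borel P = lborel" unfolding P_def by (rule lborel_distr_reindex_vec[OF f])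
  have dQl: "distr lborel borel Q = lborel" unfolding Q_def by (rule lborel_distr_reindex_vec[OF bij_imp_bij_inv[OF f]])
  have imP: "P ` X = Q -` X" for X
  proof (intro set_eqI iffI)
    fix y assume "y \<in> Q -` X"
    then have "y = P (Q y)" "Q y \<in> X" using PQ by auto
    then show "y \<in> P ` X" by blast
  qed (auto simp: QP)
  have bP: "P ` X \<in> sets borel" if "X \<in> sets borel" for X
    unfolding imP using measurable_sets[of Q borel borel X] that by simp
  have eP: "emeasure lborel (P ` X) = emeasure lborel X" if "X \<in> sets borel" for X
  proof -
    have "emeasure lborel X = emeasure (distr lborel borel Q) X" by (simp add: dQl)
    also have "\<dots> = emeasure lborel (Q -` X)" using that by (subst emeasure_distr) auto
    finally show ?thesis by (simp add: imP)
  qed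
  define \<psi> where "\<psi> = P \<circ> \<phi> \<circ> Q"
  define \<psi>' where "\<psi>' y = P \<circ> \<phi>' (Q y) \<circ> Q" for y
  have imS: "\<psi> ` (P ` S) = P ` (\<phi> ` S)" by (auto simp: \<psi>_def image_image QP)
  have det: "det (matrix (\<psi>' y)) = det (matrix (\<phi>' (Q y)))" for y
  proof -
    have ax: "Q (axis j 1) = axis (f j) 1" for j
      using f by (auto simp: Q_def reindex_vec_def vec_eq_iff axis_def bij_is_surj surj_f_inv_f bij_is_inj)
    have "matrix (\<psi>' y) = (\<chi> i j. matrix (\<phi>' (Q y)) $ f i $ f j)"
      by (simp add: matrix_def \<psi>'_def ax) (simp add: P_def reindex_vec_def)
    then show ?thesis using det_reindex[OF f] by simp
  qed
  have h: "indicator (P ` S) y * \<bar>det (matrix (\<psi>' y))\<bar> = indicator S (Q y) * \<bar>det (matrix (\<phi>' (Q y)))\<bar>" for y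
    by (simp add: det imP indicator_def)
  have "emeasure lborel (\<phi> ` S) = emeasure lborel (\<psi> ` (P ` S))"
    unfolding imS by (rule eP[OF im, symmetric])
  also have "\<dots> = (\<integral>\<^sup>+y. ennreal (indicator (P ` S) y * \<bar>det (matrix (\<psi>' y))\<bar>) \<partial>lborel)"
  proof (rule emeasure_differentiable_image_wellorder)
    show "P ` S \<in> sets borel" by (rule bP[OF S])
    show "\<psi> ` (P ` S) \<in> sets borel" unfolding imS by (rule bP[OF im])
    show "inj_on \<psi> (P ` S)" using inj by (auto simp: inj_on_def \<psi>_def QP) (metis QP)
    show "(\<psi> has_derivative \<psi>' y) (at y)" if "y \<in> P ` S" for y
    proof -
      have "Q y \<in> S" using that by (simp add: imP)
      then show ?thesis unfolding \<psi>_def \<psi>'_def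
        using dP dQ der by (auto intro!: diff_chain_at)
    qed
    show "(\<lambda>y. indicator (P ` S) y * \<bar>det (matrix (\<psi>' y))\<bar>) \<in> borel_measurable borel"
      unfolding h using measurable_compose[OF \<open>Q \<in> borel_measurable borel\<close> m] by simp
  qed
  also have "\<dots> = (\<integral>\<^sup>+y. ennreal (indicator S (Q y) * \<bar>det (matrix (\<phi>' (Q y)))\<bar>) \<partial>lborel)"
    by (simp only: h)
  also have "\<dots> = (\<integral>\<^sup>+x. ennreal (indicator S x * \<bar>det (matrix (\<phi>' x))\<bar>) \<partial>distr lborel borel Q)"
    by (subst nn_integral_distr) auto
  finally show ?thesis by (simp add: dQl)
qed

section \<open>The Riemannian measure\<close>

lemma (in C1_manifold) cmap_image_borel:
  assumes c: "c \<in> A" and E: "E \<in> sets borel" "E \<subseteq> cdom c"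
  shows "cmap c ` E \<in> sets borel"
proof -
  have "cinv c \<in> borel_measurable (restrict_space borel (cmap c ` cdom c))"
    by (rule borel_measurable_continuous_on_restrict[OF continuous_on_cinv[OF c]])
  from measurable_sets[OF this E(1)] have "cinv c -` E \<inter> cmap c ` cdom c \<in> sets (restrict_space borel (cmap c ` cdom c))"
    by (simp add: space_restrict_space)
  then have "cinv c -` E \<inter> cmap c ` cdom c \<in> sets borel"
    using open_cimage[OF c] by (subst (asm) sets_restrict_space_iff) auto
  moreover have "cmap c ` E = cinv c -` E \<inter> cmap c ` cdom c"
    unfolding cmap_image_eq'[OF c E(2)] by auto
  ultimately show ?thesis by simp
qed

context riemannian begin

text \<open>Cut off outside the chart image, where \<open>cinv\<close> is arbitrary, so that the
  density is Borel measurable on the whole coordinate space.\<close>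

definition dens where "dens c z = indicator (cmap c ` cdom c) z * sqrt (det (gram_matrix A g c (cinv c z)))"

text \<open>Literally the integral in the description of \<open>riemannian_borel_measure\<close>, so
  that results about it apply to the \<open>THE\<close> term without rewriting.\<close>

definition vol where
  "vol c E = (\<integral>\<^sup>+z. ennreal (sqrt (det (gram_matrix A g c (cinv c z)))) * indicator (cmap c ` E) z \<partial>lborel)"

lemma continuous_on_sqrt_det_gram:
  "c \<in> A \<Longrightarrow> continuous_on (cmap c ` cdom c) (\<lambda>z. sqrt (det (gram_matrix A g c (cinv c z))))"
  by (intro continuous_on_real_sqrt continuous_on_det
      continuous_on_compose2[OF continuous_on_gram continuous_on_cinv]) auto

lemma dens_measurable: "c \<in> A \<Longrightarrow> dens c \<in> borel_measurable borel"
  unfolding dens_def[abs_def]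
  using borel_measurable_continuous_on_indicator[OF _ continuous_on_sqrt_det_gram, of c] open_cimage[of c]
  by simp

lemma dens_pos: "c \<in> A \<Longrightarrow> z \<in> cmap c ` cdom c \<Longrightarrow> dens c z > 0"
  using det_gram_pos[of c "cinv c z"] by (simp add: dens_def)

lemma vol_eq:
  assumes "c \<in> A" "E \<in> sets borel" "E \<subseteq> cdom c"
  shows "vol c E = emeasure (density lborel (\<lambda>z. ennreal (dens c z))) (cmap c ` E)"
proof -
  have "emeasure (density lborel (\<lambda>z. ennreal (dens c z))) (cmap c ` E) = (\<integral>\<^sup>+z. ennreal (dens c z) * indicator (cmap c ` E) z \<partial>lborel)"
    using cmap_image_borel[OF assms] dens_measurable[OF assms(1)] by (intro emeasure_density) auto
  also have "\<dots> = vol c E"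
    unfolding vol_def by (intro nn_integral_cong) (use assms(3) in \<open>auto simp: dens_def indicator_def\<close>)
  finally show ?thesis by simp
qed

lemma gram_change_chart:
  assumes c: "c \<in> A" "c' \<in> A" and x: "x \<in> cdom c" "x \<in> cdom c'"
  shows "gram_matrix A g c x = transpose (matrix (transition_deriv c c' x)) ** gram_matrix A g c' x ** matrix (transition_deriv c c' x)"
proof -
  let ?J = "matrix (transition_deriv c c' x)" let ?G = "gram_matrix A g c' x"
  have entry: "M $ i $ j = axis i 1 \<bullet> (M *v axis j 1)" for M :: "real^'k^'k" and i j
    by (simp add: matrix_vector_mult_basis column_def inner_axis')
  have J: "?J *v h = transition_deriv c c' x h" for h
    using linear_transition[OF c x] by (simp add: matrix_works)
  have "gram_matrix A g c x $ i $ j = (transpose ?J ** ?G ** ?J) $ i $ j" for i j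
  proof -
    have "gram_matrix A g c x $ i $ j = gc c x (axis i 1) (axis j 1)" by (simp add: gram_matrix_def gc_def)
    also have "\<dots> = gc c' x (transition_deriv c c' x (axis i 1)) (transition_deriv c c' x (axis j 1))"
      unfolding gc_def tvec_of_change_chart[OF c x] ..
    also have "\<dots> = (?J *v axis i 1) \<bullet> (?G *v (?J *v axis j 1))" by (simp only: gc_gram[OF c(2) x(2)] J)
    also have "\<dots> = axis i 1 \<bullet> (transpose ?J *v (?G *v (?J *v axis j 1)))"
      by (metis dot_lmul_matrix inner_commute transpose_matrix_vector)
    also have "\<dots> = axis i 1 \<bullet> ((transpose ?J ** ?G ** ?J) *v axis j 1)" by (simp only: matrix_vector_mul_assoc matrix_mul_assoc)
    also have "\<dots> = (transpose ?J ** ?G ** ?J) $ i $ j" by (rule entry[symmetric])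
    finally show ?thesis .
  qed
  then show ?thesis by (simp add: vec_eq_iff)
qed

lemma sqrt_det_gram_change_chart:
  assumes "c \<in> A" "c' \<in> A" and "x \<in> cdom c" "x \<in> cdom c'"
  shows "sqrt (det (gram_matrix A g c x)) = \<bar>det (matrix (transition_deriv c c' x))\<bar> * sqrt (det (gram_matrix A g c' x))"
proof -
  let ?J = "matrix (transition_deriv c c' x)"
  have "det (gram_matrix A g c x) = (det ?J)\<^sup>2 * det (gram_matrix A g c' x)"
    unfolding gram_change_chart[OF assms] by (simp add: det_mul power2_eq_square)
  then show ?thesis by (simp only: real_sqrt_mult real_sqrt_abs)
qed

text \<open>The Jacobian of the transition map is exactly the quotient of the two densities, by
  \<open>sqrt_det_gram_change_chart\<close>.\<close>

lemma vol_change_chart: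
  assumes c: "c \<in> A" "c' \<in> A" and E: "E \<in> sets borel" "E \<subseteq> cdom c" "E \<subseteq> cdom c'"
  shows "vol c E = vol c' E"
proof -
  define U where "U = cmap c ` (cdom c' \<inter> cdom c)"
  define \<phi> where "\<phi> = cmap c' \<circ> cinv c"
  define J where "J z = \<bar>det (matrix (transition_deriv c c' (cinv c z)))\<bar>" for z
  \<comment> \<open>\<psi> and D extend the transition map and its Jacobian by 0 to the whole space,
    as image measures and densities require.\<close>
  define \<psi> where "\<psi> z = (if z \<in> U then \<phi> z else 0)" for z
  define D where "D z = indicator U z * J z" for z
  have Uo: "open U" unfolding U_def by (intro open_cmap_image c open_cdom)
  have Uin: "cinv c z \<in> cdom c" "cinv c z \<in> cdom c'" "cmap c (cinv c z) = z" if "z \<in> U" for z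
    using that c unfolding U_def by auto
  have UE: "cmap c x \<in> U" if "x \<in> cdom c" "x \<in> cdom c'" for x using that unfolding U_def by blast
  have der: "(\<phi> has_derivative transition_deriv c c' (cinv c z)) (at z)" if "z \<in> U" for z
    using transition_has_derivative[OF c Uin(1,2)[OF that]] unfolding \<phi>_def Uin(3)[OF that] .
  have cont\<phi>: "continuous_on U \<phi>"
    by (rule has_derivative_continuous_on[of _ _ "\<lambda>z. transition_deriv c c' (cinv c z)"]) (use der has_derivative_at_withinI in blast)
  have \<psi>m [measurable]: "\<psi> \<in> borel_measurable borel"
  proof -
    have "(\<lambda>z. indicator U z *\<^sub>R \<phi> z) \<in> borel_measurable borel"
      using Uo by (intro borel_measurable_continuous_on_indicator cont\<phi>) auto
    moreover have "(\<lambda>z. indicator U z *\<^sub>R \<phi> z) = \<psi>" by (auto simp: \<psi>_def fun_eq_iff indicator_def)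
    ultimately show ?thesis by simp
  qed
  have contJ: "continuous_on U J" unfolding J_def
  proof (rule continuous_on_rabs, rule continuous_on_det)
    fix i j
    have "continuous_on U (\<lambda>z. transition_deriv c c' (cinv c z) (axis j 1) $ i)"
    proof (intro continuous_intros continuous_on_compose2[OF continuous_on_transition_deriv[OF c]])
      show "continuous_on U (cinv c)"
        by (rule continuous_on_subset[OF continuous_on_cinv[OF c(1)]]) (auto simp: U_def)
    qed (use Uin in auto)
    then show "continuous_on U (\<lambda>z. matrix (transition_deriv c c' (cinv c z)) $ i $ j)"
      by (simp add: matrix_def)
  qed
  have Dm [measurable]: "D \<in> borel_measurable borel"
    using borel_measurable_continuous_on_indicator[OF _ contJ] Uo by (simp add: D_def[abs_def])
  have inj: "inj_on \<phi> U"
  proof (rule inj_onI)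
    fix z w assume zw: "z \<in> U" "w \<in> U" "\<phi> z = \<phi> w"
    then have "cinv c z = cinv c w" using inj_on_cmap[OF c(2)] Uin by (auto simp: \<phi>_def inj_on_def)
    then show "z = w" using Uin(3)[OF zw(1)] Uin(3)[OF zw(2)] by metis
  qed
  have im: "\<phi> ` S \<in> sets borel" if S: "S \<in> sets borel" "S \<subseteq> U" for S
  proof -
    have "\<phi> ` S = cmap c' ` {x \<in> cdom c. cmap c x \<in> S}"
    proof (intro set_eqI iffI)
      fix w assume "w \<in> \<phi> ` S"
      then obtain z where z: "z \<in> S" "w = cmap c' (cinv c z)" by (auto simp: \<phi>_def)
      then show "w \<in> cmap c' ` {x \<in> cdom c. cmap c x \<in> S}"
        using S(2) Uin[of z] by (intro image_eqI[of _ _ "cinv c z"]) auto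
    next
      fix w assume "w \<in> cmap c' ` {x \<in> cdom c. cmap c x \<in> S}"
      then obtain x where "x \<in> cdom c" "cmap c x \<in> S" "w = cmap c' x" by blast
      then show "w \<in> \<phi> ` S" using c by (intro image_eqI[of _ _ "cmap c x"]) (auto simp: \<phi>_def)
    qed
    also have "\<dots> \<in> sets borel"
    proof (intro cmap_image_borel c cinv_image_borel S(1))
      show "{x \<in> cdom c. cmap c x \<in> S} \<subseteq> cdom c'"
      proof
        fix x assume "x \<in> {x \<in> cdom c. cmap c x \<in> S}"
        then have "x \<in> cdom c" "cmap c x \<in> U" using S(2) by auto
        then show "x \<in> cdom c'" using Uin(2)[of "cmap c x"] c by simp
      qed
    qed
    finally show ?thesis .
  qed
  have \<phi>U: "\<phi> ` U \<in> sets borel" using Uo by (intro im) auto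
  \<comment> \<open>The area formula for sets, packaged as an equality of measures. Integrals of
    arbitrary nonnegative functions then transform by the general rules for densities and image
    measures.\<close>
  have \<kappa>: "distr (density lborel (\<lambda>z. ennreal (D z))) borel \<psi> = density lborel (indicator (\<phi> ` U))" (is "?\<kappa> = ?\<kappa>'")
  proof (rule measure_eqI)
    fix B assume "B \<in> sets ?\<kappa>"
    then have B [measurable]: "B \<in> sets borel" by simp
    define S where "S = \<psi> -` B \<inter> U"
    have S: "S \<in> sets borel" unfolding S_def using measurable_sets[OF \<psi>m B] Uo by auto
    have SU: "S \<subseteq> U" by (auto simp: S_def)
    have "emeasure ?\<kappa> B = emeasure (density lborel (\<lambda>z. ennreal (D z))) (\<psi> -` B)" by (subst emeasure_distr) auto
    also have "\<dots> = (\<integral>\<^sup>+z. ennreal (D z) * indicator (\<psi> -` B) z \<partial>lborel)"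
      using measurable_sets[OF \<psi>m B] by (intro emeasure_density) auto
    also have "\<dots> = (\<integral>\<^sup>+z. ennreal (indicator S z * \<bar>det (matrix (transition_deriv c c' (cinv c z)))\<bar>) \<partial>lborel)"
      by (intro nn_integral_cong) (auto simp: D_def S_def J_def indicator_def)
    also have "\<dots> = emeasure lborel (\<phi> ` S)"
    proof (rule emeasure_differentiable_image[symmetric, OF S im[OF S SU]])
      show "inj_on \<phi> S" using inj SU by (rule inj_on_subset)
      show "(\<phi> has_derivative transition_deriv c c' (cinv c z)) (at z)" if "z \<in> S" for z using der that SU by blast
      have "(\<lambda>z. indicator S z * \<bar>det (matrix (transition_deriv c c' (cinv c z)))\<bar>) = (\<lambda>z. indicator S z * D z)"
        using SU by (auto simp: D_def J_def indicator_def fun_eq_iff)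
      then show "(\<lambda>z. indicator S z * \<bar>det (matrix (transition_deriv c c' (cinv c z)))\<bar>) \<in> borel_measurable borel"
        using S by simp
    qed
    also have "\<phi> ` S = B \<inter> \<phi> ` U" by (auto simp: S_def \<psi>_def)
    also have "emeasure lborel (B \<inter> \<phi> ` U) = emeasure ?\<kappa>' B"
      using \<phi>U B by (subst emeasure_density) (auto simp: indicator_inter_arith[symmetric] Int_commute)
    finally show "emeasure ?\<kappa> B = emeasure ?\<kappa>' B" .
  qed simp
  have imE: "cmap c' ` E \<in> sets borel" using cmap_image_borel[OF c(2) E(1,3)] .
  define F where "F w = ennreal (dens c' w) * indicator (cmap c' ` E) w" for w
  have Fm [measurable]: "F \<in> borel_measurable borel" unfolding F_def using imE dens_measurable[OF c(2)] by measurable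
  have "vol c' E = (\<integral>\<^sup>+w. F w \<partial>lborel)"
    unfolding vol_def F_def by (intro nn_integral_cong) (use E(3) in \<open>auto simp: dens_def indicator_def\<close>)
  also have "\<dots> = (\<integral>\<^sup>+w. indicator (\<phi> ` U) w * F w \<partial>lborel)"
  proof (intro nn_integral_cong)
    fix w
    have "w \<in> \<phi> ` U" if w: "w \<in> cmap c' ` E"
    proof -
      obtain x where x: "x \<in> E" "w = cmap c' x" using w by blast
      then have xc: "x \<in> cdom c" "x \<in> cdom c'" using E by auto
      show ?thesis using UE[OF xc] x xc c by (intro image_eqI[of _ _ "cmap c x"]) (auto simp: \<phi>_def)
    qed
    then show "F w = indicator (\<phi> ` U) w * F w" by (auto simp: F_def indicator_def)
  qed
  also have "\<dots> = (\<integral>\<^sup>+w. F w \<partial>?\<kappa>)"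
    unfolding \<kappa> using \<phi>U by (subst nn_integral_density) auto
  also have "\<dots> = (\<integral>\<^sup>+z. ennreal (D z) * F (\<psi> z) \<partial>lborel)"
    by (subst nn_integral_distr, simp, simp, subst nn_integral_density) auto
  also have "\<dots> = vol c E" unfolding vol_def
  proof (intro nn_integral_cong)
    fix z
    show "ennreal (D z) * F (\<psi> z) = ennreal (sqrt (det (gram_matrix A g c (cinv c z)))) * indicator (cmap c ` E) z"
    proof (cases "z \<in> U")
      case True
      note u = Uin[OF True]
      have m: "\<phi> z \<in> cmap c' ` E \<longleftrightarrow> z \<in> cmap c ` E"
      proof
        assume "\<phi> z \<in> cmap c' ` E"
        then obtain x where x: "x \<in> E" "cmap c' (cinv c z) = cmap c' x" by (auto simp: \<phi>_def)
        then have "cinv c z = x" using inj_on_cmap[OF c(2)] u E(3) by (auto simp: inj_on_def)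
        then show "z \<in> cmap c ` E" using u(3) x(1) by (intro image_eqI[of _ _ x]) auto
      next
        assume "z \<in> cmap c ` E"
        then obtain x where x: "x \<in> E" "z = cmap c x" by blast
        then show "\<phi> z \<in> cmap c' ` E" using E(2) c by (intro image_eqI[of _ _ x]) (auto simp: \<phi>_def)
      qed
      have "J z * dens c' (\<phi> z) = sqrt (det (gram_matrix A g c (cinv c z)))"
        unfolding J_def dens_def \<phi>_def sqrt_det_gram_change_chart[OF c u(1,2)] using u c by simp
      then show ?thesis using True m
        by (simp add: D_def \<psi>_def F_def indicator_def ennreal_mult'[symmetric] J_def)
    next
      case False
      then have "z \<notin> cmap c ` E" using UE E by auto
      then show ?thesis using False by (simp add: D_def)
    qed
  qed
  finally show ?thesis by simp
qed

text \<open>The manifold is partitioned into countably many Borel sets \<open>P n\<close>, each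
  inside one chart, and the chart volumes of the pieces are added. By
  \<open>vol_change_chart\<close> the sum agrees with \<open>vol c\<close> inside the domain of any
  chart c. Uniqueness is countable additivity over the same partition.\<close>

lemma riemannian_borel_measure_unique:
  "\<exists>!\<nu>. sets \<nu> = sets borel \<and> (\<forall>c\<in>A. \<forall>E\<in>sets borel. E \<subseteq> cdom c \<longrightarrow> emeasure \<nu> E = vol c E)"
proof -
  obtain A0 where A0: "A0 \<subseteq> A" "countable A0" "(\<Union>c\<in>A0. cdom c) = UNIV" by (rule countable_subatlas)
  have "A0 \<noteq> {}" using A0(3) by auto
  define cs where "cs = from_nat_into A0"
  have cs: "range cs = A0" unfolding cs_def using A0(2) \<open>A0 \<noteq> {}\<close> by simp
  have csA: "cs n \<in> A" for n using cs A0(1) by blast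
  define P where "P = disjointed (\<lambda>n. cdom (cs n))"
  have PU: "(\<Union>n. P n) = UNIV" unfolding P_def UN_disjointed_eq using A0(3) cs by blast
  have Pd: "disjoint_family P" unfolding P_def by (rule disjoint_family_disjointed)
  have Ps: "P n \<subseteq> cdom (cs n)" for n unfolding P_def by (rule disjointed_subset)
  have Pb: "P n \<in> sets borel" for n unfolding P_def disjointed_def
    by (intro sets.Diff sets.finite_UN borel_open open_cdom csA) auto
  define m where "m E = (\<Sum>n. vol (cs n) (E \<inter> P n))" for E
  define \<nu> where "\<nu> = measure_of UNIV (sets borel) m"
  have \<nu>: "emeasure \<nu> E = m E" if "E \<in> sets borel" for E
    unfolding \<nu>_def
  proof (rule emeasure_measure_of_sigma)
    show "sigma_algebra UNIV (sets (borel :: 'm measure))" using sets.sigma_algebra_axioms[of "borel :: 'm measure"] by simp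
    show "positive (sets borel) m" by (simp add: positive_def m_def vol_def)
    show "countably_additive (sets borel) m"
    proof (rule countably_additiveI)
      fix F :: "nat \<Rightarrow> 'm set" assume F: "range F \<subseteq> sets borel" "disjoint_family F"
      have b: "F i \<inter> P n \<in> sets borel" for i n using F(1) Pb by auto
      have s: "F i \<inter> P n \<subseteq> cdom (cs n)" for i n using Ps by blast
      have v: "vol (cs n) (\<Union>(range F) \<inter> P n) = (\<Sum>i. vol (cs n) (F i \<inter> P n))" for n
      proof -
        let ?M = "density lborel (\<lambda>z. ennreal (dens (cs n) z))"
        have b': "\<Union>(range F) \<inter> P n \<in> sets borel" using F(1) Pb by auto
        have s': "\<Union>(range F) \<inter> P n \<subseteq> cdom (cs n)" using Ps by blast
        have "(\<Sum>i. emeasure ?M (cmap (cs n) ` (F i \<inter> P n))) = emeasure ?M (\<Union>i. cmap (cs n) ` (F i \<inter> P n))"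
        proof (rule suminf_emeasure)
          show "range (\<lambda>i. cmap (cs n) ` (F i \<inter> P n)) \<subseteq> sets ?M"
            using cmap_image_borel[OF csA b s] by auto
          show "disjoint_family (\<lambda>i. cmap (cs n) ` (F i \<inter> P n))"
            unfolding disjoint_family_on_def
          proof (intro ballI impI)
            fix i j :: nat assume "i \<noteq> j"
            then have "F i \<inter> F j = {}" using F(2) by (auto simp: disjoint_family_on_def)
            moreover have "cmap (cs n) ` (F i \<inter> P n) \<inter> cmap (cs n) ` (F j \<inter> P n) = cmap (cs n) ` ((F i \<inter> P n) \<inter> (F j \<inter> P n))"
              by (rule inj_on_image_Int[OF inj_on_cmap[OF csA] s s, symmetric])
            ultimately show "cmap (cs n) ` (F i \<inter> P n) \<inter> cmap (cs n) ` (F j \<inter> P n) = {}" by auto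
          qed
        qed
        moreover have "(\<Union>i. cmap (cs n) ` (F i \<inter> P n)) = cmap (cs n) ` (\<Union>(range F) \<inter> P n)" by auto
        ultimately show ?thesis by (simp add: vol_eq[OF csA b s] vol_eq[OF csA b' s'])
      qed
      \<comment> \<open>Tonelli for a double series: one of the sums is read as an integral over the
        counting measure.\<close>
      have "(\<Sum>i. m (F i)) = (\<Sum>i. \<integral>\<^sup>+n. vol (cs n) (F i \<inter> P n) \<partial>count_space UNIV)"
        by (simp add: m_def nn_integral_count_space_nat)
      also have "\<dots> = (\<integral>\<^sup>+n. (\<Sum>i. vol (cs n) (F i \<inter> P n)) \<partial>count_space UNIV)"
        by (rule nn_integral_suminf[symmetric]) simp
      also have "\<dots> = m (\<Union>(range F))" by (simp only: m_def v nn_integral_count_space_nat)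
      finally show "(\<Sum>i. m (F i)) = m (\<Union>(range F))" .
    qed
    show "E \<in> sets borel" by fact
  qed
  have s\<nu>: "sets \<nu> = sets borel" unfolding \<nu>_def using sets.sigma_algebra_axioms[of "borel :: 'm measure"]
    by (simp add: sigma_algebra.sets_measure_of_eq sigma_algebra.sigma_sets_eq)
  have decomp: "emeasure \<nu>' E = (\<Sum>n. emeasure \<nu>' (E \<inter> P n))" if "sets \<nu>' = sets borel" "E \<in> sets borel" for \<nu>' :: "'m measure" and E
  proof -
    have "(\<Sum>n. emeasure \<nu>' (E \<inter> P n)) = emeasure \<nu>' (\<Union>n. E \<inter> P n)"
    proof (rule suminf_emeasure)
      show "range (\<lambda>n. E \<inter> P n) \<subseteq> sets \<nu>'" using that Pb by auto
      show "disjoint_family (\<lambda>n. E \<inter> P n)" using Pd by (auto simp: disjoint_family_on_def)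
    qed
    moreover have "(\<Union>n. E \<inter> P n) = E" using PU by auto
    ultimately show ?thesis by simp
  qed
  show ?thesis
  proof (rule ex1I[of _ \<nu>])
    show "sets \<nu> = sets borel \<and> (\<forall>c\<in>A. \<forall>E\<in>sets borel. E \<subseteq> cdom c \<longrightarrow> emeasure \<nu> E = vol c E)"
    proof (intro conjI ballI impI s\<nu>)
      fix c E assume c: "c \<in> A" and E: "E \<in> sets borel" "E \<subseteq> cdom c"
      have "emeasure \<nu> E = (\<Sum>n. vol (cs n) (E \<inter> P n))" by (simp add: \<nu>[OF E(1)] m_def)
      also have "\<dots> = (\<Sum>n. vol c (E \<inter> P n))"
      proof (rule arg_cong[where f=suminf], rule ext)
        fix n show "vol (cs n) (E \<inter> P n) = vol c (E \<inter> P n)"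
          using E Pb[of n] Ps[of n] by (intro vol_change_chart csA c) auto
      qed
      also have "\<dots> = (\<Sum>n. emeasure (density lborel (\<lambda>z. ennreal (dens c z))) (cmap c ` (E \<inter> P n)))"
        using E Pb by (subst vol_eq[OF c]) auto
      also have "\<dots> = emeasure (density lborel (\<lambda>z. ennreal (dens c z))) (\<Union>n. cmap c ` (E \<inter> P n))"
      proof (rule suminf_emeasure)
        show "range (\<lambda>n. cmap c ` (E \<inter> P n)) \<subseteq> sets (density lborel (\<lambda>z. ennreal (dens c z)))"
        proof (rule image_subsetI)
          fix n show "cmap c ` (E \<inter> P n) \<in> sets (density lborel (\<lambda>z. ennreal (dens c z)))"
            using cmap_image_borel[OF c, of "E \<inter> P n"] E Pb by auto
        qed
        show "disjoint_family (\<lambda>n. cmap c ` (E \<inter> P n))"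
          unfolding disjoint_family_on_def
        proof (intro ballI impI)
          fix i j :: nat assume "i \<noteq> j"
          then have "P i \<inter> P j = {}" using Pd by (auto simp: disjoint_family_on_def)
          moreover have "cmap c ` (E \<inter> P i) \<inter> cmap c ` (E \<inter> P j) = cmap c ` ((E \<inter> P i) \<inter> (E \<inter> P j))"
            by (rule inj_on_image_Int[OF inj_on_cmap[OF c], symmetric]) (use E in auto)
          ultimately show "cmap c ` (E \<inter> P i) \<inter> cmap c ` (E \<inter> P j) = {}" by auto
        qed
      qed
      also have "(\<Union>n. cmap c ` (E \<inter> P n)) = cmap c ` (E \<inter> (\<Union>n. P n))"
        by (simp only: image_UN[symmetric] Int_UN_distrib)
      also have "E \<inter> (\<Union>n. P n) = E" using PU by simp
      finally show "emeasure \<nu> E = vol c E" by (simp add: vol_eq[OF c E])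
    qed
  next
    fix \<nu>' assume \<nu>': "sets \<nu>' = sets borel \<and> (\<forall>c\<in>A. \<forall>E\<in>sets borel. E \<subseteq> cdom c \<longrightarrow> emeasure \<nu>' E = vol c E)"
    show "\<nu>' = \<nu>"
    proof (rule measure_eqI)
      show "sets \<nu>' = sets \<nu>" using \<nu>' s\<nu> by simp
      fix E assume "E \<in> sets \<nu>'"
      then have E: "E \<in> sets borel" using \<nu>' by simp
      have "emeasure \<nu>' E = (\<Sum>n. emeasure \<nu>' (E \<inter> P n))" using \<nu>' E by (intro decomp) auto
      also have "\<dots> = m E" unfolding m_def
      proof (rule arg_cong[where f=suminf], rule ext)
        fix n
        have "E \<inter> P n \<in> sets borel" "E \<inter> P n \<subseteq> cdom (cs n)" using E Pb Ps[of n] by auto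
        then show "emeasure \<nu>' (E \<inter> P n) = vol (cs n) (E \<inter> P n)" using \<nu>' csA by blast
      qed
      finally show "emeasure \<nu>' E = emeasure \<nu> E" by (simp add: \<nu>[OF E])
    qed
  qed
qed

abbreviation "\<nu> \<equiv> riemannian_borel_measure A g"

lemma sets_riemannian_borel_measure: "sets \<nu> = sets borel"
  and emeasure_riemannian_borel_measure:
    "c \<in> A \<Longrightarrow> E \<in> sets borel \<Longrightarrow> E \<subseteq> cdom c \<Longrightarrow> emeasure \<nu> E = vol c E"
  using theI'[OF riemannian_borel_measure_unique] unfolding riemannian_borel_measure_def vol_def by blast+

text \<open>A density that is positive on the whole chart image leaves the null sets
  unchanged.\<close>

lemma chartwise_abs_cont_riemannian: "chartwise_abs_cont A \<nu>"
  unfolding chartwise_abs_cont_def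
proof (intro conjI ballI impI sets_riemannian_borel_measure)
  fix c E assume c: "c \<in> A" and E: "E \<in> sets borel" "E \<subseteq> cdom c"
  have im: "cmap c ` E \<in> sets borel" by (rule cmap_image_borel[OF c E])
  have "emeasure \<nu> E = (\<integral>\<^sup>+z. ennreal (dens c z) * indicator (cmap c ` E) z \<partial>lborel)"
    unfolding emeasure_riemannian_borel_measure[OF c E] vol_eq[OF c E]
    using im dens_measurable[OF c] by (intro emeasure_density) auto
  also have "\<dots> = 0 \<longleftrightarrow> (AE z in lborel. ennreal (dens c z) * indicator (cmap c ` E) z = 0)"
    using im dens_measurable[OF c] by (intro nn_integral_0_iff_AE) auto
  also have "\<dots> \<longleftrightarrow> (AE z in lborel. z \<notin> cmap c ` E)"
    using E(2) dens_pos[OF c] by (intro AE_cong) (force simp: indicator_def)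
  also have "\<dots> \<longleftrightarrow> cmap c ` E \<in> null_sets lborel"
    using im by (subst AE_iff_null_sets) auto
  also have "\<dots> \<longleftrightarrow> emeasure lborel (cmap c ` E) = 0" using im by (auto simp: null_sets_def)
  finally show "emeasure \<nu> E = 0 \<longleftrightarrow> emeasure lborel (cmap c ` E) = 0" .
qed

text \<open>On a compact part of a chart the Riemannian density is at least some m > 0, so Lebesgue
  integrals are at most 1 / m times Riemannian ones. This brings integrability over M to the charts,
  where weak derivatives are tested.\<close>

lemma nn_integral_chart_le:
  assumes c: "c \<in> A" and K: "compact K" "K \<subseteq> cmap c ` cdom c"
  obtains C :: real where "C > 0"
    "\<And>F :: 'm \<Rightarrow> ennreal. F \<in> borel_measurable (lebesgue_algebra A) \<Longrightarrow>
      (\<integral>\<^sup>+z. F (cinv c z) * indicator K z \<partial>lebesgue) \<le> ennreal C * (\<integral>\<^sup>+x. F x \<partial>riemannian_measure A g)"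
proof -
  obtain x0 :: 'm where True by simp
  \<comment> \<open>The inverse chart, extended by a constant to a Borel map on the whole space; the
    Riemannian measure of the chart domain is then the image measure of the chart density.\<close>
  define ci where "ci z = (if z \<in> cmap c ` cdom c then cinv c z else x0)" for z
  have cim [measurable]: "ci \<in> borel_measurable borel"
  proof (rule measurableI)
    fix B :: "'m set" assume "B \<in> sets borel"
    have "cinv c \<in> borel_measurable (restrict_space borel (cmap c ` cdom c))"
      by (rule borel_measurable_continuous_on_restrict[OF continuous_on_cinv[OF c]])
    from measurable_sets[OF this \<open>B \<in> sets borel\<close>] have "cinv c -` B \<inter> cmap c ` cdom c \<in> sets (restrict_space borel (cmap c ` cdom c))"
      by (simp add: space_restrict_space)
    then have 1: "cinv c -` B \<inter> cmap c ` cdom c \<in> sets borel"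
      using open_cimage[OF c] by (subst (asm) sets_restrict_space_iff) auto
    have 2: "- (cmap c ` cdom c) \<in> sets borel" using open_cimage[OF c] by auto
    have "ci -` B \<inter> space borel = (cinv c -` B \<inter> cmap c ` cdom c) \<union> (if x0 \<in> B then - (cmap c ` cdom c) else {})"
      by (auto simp: ci_def split: if_splits)
    also have "\<dots> \<in> sets borel" using 1 2 by auto
    finally show "ci -` B \<inter> space borel \<in> sets borel" .
  qed simp
  have dm [measurable]: "dens c \<in> borel_measurable borel" by (rule dens_measurable[OF c])
  have dc: "cdom c \<in> sets borel" using open_cdom[OF c] by auto
  have eq: "distr (density lborel (\<lambda>z. ennreal (dens c z))) borel ci = density \<nu> (indicator (cdom c))" (is "?l = ?r")
  proof (rule measure_eqI)
    show "sets ?l = sets ?r" by (simp add: sets_riemannian_borel_measure)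
    fix B assume "B \<in> sets ?l"
    then have B: "B \<in> sets borel" by simp
    have BE: "B \<inter> cdom c \<in> sets borel" using B dc by auto
    have "emeasure ?l B = emeasure (density lborel (\<lambda>z. ennreal (dens c z))) (ci -` B)"
      using B by (subst emeasure_distr) auto
    also have "\<dots> = (\<integral>\<^sup>+z. ennreal (dens c z) * indicator (ci -` B) z \<partial>lborel)"
      using measurable_sets[OF cim B] by (intro emeasure_density) auto
    also have "\<dots> = (\<integral>\<^sup>+z. ennreal (dens c z) * indicator (cmap c ` (B \<inter> cdom c)) z \<partial>lborel)"
      unfolding cmap_image_eq[OF c]
      by (intro nn_integral_cong) (auto simp: dens_def ci_def indicator_def)
    also have "\<dots> = emeasure \<nu> (B \<inter> cdom c)"
      unfolding emeasure_riemannian_borel_measure[OF c BE Int_lower2] vol_eq[OF c BE Int_lower2]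
      using cmap_image_borel[OF c BE Int_lower2] by (intro emeasure_density[symmetric]) auto
    also have "\<dots> = (\<integral>\<^sup>+x. indicator (B \<inter> cdom c) x \<partial>\<nu>)"
      using BE by (simp add: sets_riemannian_borel_measure)
    also have "\<dots> = (\<integral>\<^sup>+x. indicator (cdom c) x * indicator B x \<partial>\<nu>)"
      by (intro nn_integral_cong) (auto simp: indicator_def)
    also have "\<dots> = emeasure ?r B"
      using B dc by (intro emeasure_density[symmetric] borel_measurable_indicator) (simp_all add: sets_riemannian_borel_measure)
    finally show "emeasure ?l B = emeasure ?r B" .
  qed
  have "\<exists>m>0. \<forall>z\<in>K. m \<le> dens c z"
  proof (cases "K = {}")
    case True then show ?thesis by (intro exI[of _ 1]) auto
  next
    case False
    have "continuous_on K (\<lambda>z. sqrt (det (gram_matrix A g c (cinv c z))))"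
      by (rule continuous_on_subset[OF continuous_on_sqrt_det_gram[OF c] K(2)])
    then obtain z0 where z0: "z0 \<in> K" "\<And>z. z \<in> K \<Longrightarrow> sqrt (det (gram_matrix A g c (cinv c z0))) \<le> sqrt (det (gram_matrix A g c (cinv c z)))"
      using continuous_attains_inf[OF K(1) False] by blast
    have e: "dens c z = sqrt (det (gram_matrix A g c (cinv c z)))" if "z \<in> K" for z
      using K(2) that unfolding dens_def by (auto simp: indicator_def)
    show ?thesis
    proof (intro exI[of _ "dens c z0"] conjI ballI)
      show "dens c z0 > 0" using z0(1) K(2) by (intro dens_pos[OF c]) auto
      show "dens c z0 \<le> dens c z" if "z \<in> K" for z using z0(2)[OF that] e[OF that] e[OF z0(1)] by simp
    qed
  qed
  then obtain m where m: "m > 0" "\<And>z. z \<in> K \<Longrightarrow> m \<le> dens c z" by blast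
  have borel: "(\<integral>\<^sup>+z. F (cinv c z) * indicator K z \<partial>lborel) \<le> ennreal (1 / m) * (\<integral>\<^sup>+x. F x \<partial>\<nu>)"
    if F [measurable]: "F \<in> borel_measurable borel" for F :: "'m \<Rightarrow> ennreal"
  proof -
    have "(\<integral>\<^sup>+z. F (cinv c z) * indicator K z \<partial>lborel) \<le> (\<integral>\<^sup>+z. ennreal (1 / m) * (ennreal (dens c z) * F (ci z)) \<partial>lborel)"
    proof (rule nn_integral_mono)
      fix z
      show "F (cinv c z) * indicator K z \<le> ennreal (1 / m) * (ennreal (dens c z) * F (ci z))"
      proof (cases "z \<in> K")
        case True
        have "1 \<le> ennreal (1 / m) * ennreal (dens c z)"
          using m(1) m(2)[OF True] by (simp add: ennreal_mult'[symmetric] field_simps)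
        then have "1 * F (ci z) \<le> (ennreal (1 / m) * ennreal (dens c z)) * F (ci z)" by (rule mult_right_mono) simp
        moreover have "ci z = cinv c z" using K(2) True by (auto simp: ci_def)
        ultimately show ?thesis using True by (simp add: mult.assoc)
      qed simp
    qed
    also have "\<dots> = ennreal (1 / m) * (\<integral>\<^sup>+z. ennreal (dens c z) * F (ci z) \<partial>lborel)"
      by (rule nn_integral_cmult) simp
    also have "(\<integral>\<^sup>+z. ennreal (dens c z) * F (ci z) \<partial>lborel) = (\<integral>\<^sup>+x. F x \<partial>density \<nu> (indicator (cdom c)))"
      unfolding eq[symmetric] by (subst nn_integral_distr, simp, simp, subst nn_integral_density) auto
    also have "\<dots> = (\<integral>\<^sup>+x. indicator (cdom c) x * F x \<partial>\<nu>)"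
      using dc F by (intro nn_integral_density) (auto simp: measurable_cong_sets[OF sets_riemannian_borel_measure refl])
    also have "\<dots> \<le> (\<integral>\<^sup>+x. F x \<partial>\<nu>)" by (intro nn_integral_mono) (auto simp: indicator_def)
    finally show ?thesis by (simp add: mult_left_mono)
  qed
  show ?thesis
  proof (rule that[of "1 / m"])
    show "1 / m > 0" using m by simp
    fix F :: "'m \<Rightarrow> ennreal" assume "F \<in> borel_measurable (lebesgue_algebra A)"
    then have "F \<in> borel_measurable (completion \<nu>)"
      by (rule measurable_lebesgue_algebra_completion[OF chartwise_abs_cont_riemannian])
    then obtain F' where F': "F' \<in> borel_measurable \<nu>" "AE x in \<nu>. F x = F' x"
      using completion_ex_borel_measurable by blast
    have F'm: "F' \<in> borel_measurable borel" using F'(1) by (simp add: measurable_cong_sets[OF sets_riemannian_borel_measure refl])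
    have "AE_manifold A (\<lambda>x. F x = F' x)"
      unfolding AE_manifold_iff_AE_completion[OF chartwise_abs_cont_riemannian] using F'(2) by (rule AE_completion)
    then have ae: "AE z in lebesgue. z \<in> cmap c ` cdom c \<longrightarrow> F (cinv c z) = F' (cinv c z)"
      using c by (simp add: AE_manifold_iff)
    have "(\<integral>\<^sup>+z. F (cinv c z) * indicator K z \<partial>lebesgue) = (\<integral>\<^sup>+z. F' (cinv c z) * indicator K z \<partial>lebesgue)"
      by (rule nn_integral_cong_AE, use ae in \<open>rule eventually_mono\<close>) (use K(2) in \<open>auto simp: indicator_def\<close>)
    also have "\<dots> = (\<integral>\<^sup>+z. F' (cinv c z) * indicator K z \<partial>lborel)" by (rule nn_integral_completion)
    also have "\<dots> \<le> ennreal (1 / m) * (\<integral>\<^sup>+x. F' x \<partial>\<nu>)" by (rule borel[OF F'm])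
    also have "(\<integral>\<^sup>+x. F' x \<partial>\<nu>) = (\<integral>\<^sup>+x. F x \<partial>\<nu>)"
      by (rule nn_integral_cong_AE, use F'(2) in \<open>rule eventually_mono\<close>) simp
    also have "\<dots> = (\<integral>\<^sup>+x. F x \<partial>riemannian_measure A g)"
      unfolding riemannian_measure_def by (rule nn_integral_completion[symmetric])
    finally show "(\<integral>\<^sup>+z. F (cinv c z) * indicator K z \<partial>lebesgue) \<le> ennreal (1 / m) * (\<integral>\<^sup>+x. F x \<partial>riemannian_measure A g)" .
  qed
qed

end

section \<open>The bundle of linear maps\<close>

locale riemannian_pair = M: riemannian A gM + N: riemannian B gN
  for A :: "('m::{second_countable_topology, t2_space}, 'k::finite) chart set"
    and gM :: "'m \<Rightarrow> ('m, 'k) tvec \<Rightarrow> ('m, 'k) tvec \<Rightarrow> real"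
    and B :: "('n::{second_countable_topology, t2_space}, 'l::finite) chart set"
    and gN :: "'n \<Rightarrow> ('n, 'l) tvec \<Rightarrow> ('n, 'l) tvec \<Rightarrow> real"
begin

abbreviation "bundle \<equiv> hom_bundle A B"
abbreviation "btop \<equiv> hom_bundle_topology A B"
abbreviation "param \<equiv> hom_bundle_param A B"
abbreviation "hnorm \<equiv> hom_norm A gM gN"
abbreviation "bborel \<equiv> sigma bundle {W. openin btop W}"

lemma param_in:
  assumes "c \<in> A" "c' \<in> B" "x \<in> cdom c" "y \<in> cdom c'"
  shows "param c c' (x, y, L) \<in> bundle"
proof -
  have "(\<lambda>v\<in>tangent_space A x. tvec_of B c' y (blinfun_apply L (v c))) \<in> hom_space A B x y"
    unfolding hom_space_def
  proof (intro CollectI conjI ballI allI)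
    show "(\<lambda>v\<in>tangent_space A x. tvec_of B c' y (blinfun_apply L (v c))) \<in> tangent_space A x \<rightarrow>\<^sub>E tangent_space B y"
      using N.tvec_of_in_tangent_space[OF assms(2,4)] by simp
    fix v assume v: "v \<in> tangent_space A x"
    show "(\<lambda>v\<in>tangent_space A x. tvec_of B c' y (blinfun_apply L (v c))) (tscale r v) = tscale r ((\<lambda>v\<in>tangent_space A x. tvec_of B c' y (blinfun_apply L (v c))) v)" for r
    proof -
      have "tscale r v c = r *\<^sub>R v c" by (simp add: tscale_def)
      then show ?thesis using v M.tscale_in[OF v, of r] by (simp add: blinfun.scaleR_right N.tvec_of_scaleR[OF assms(2,4)])
    qed
    fix w assume w: "w \<in> tangent_space A x"
    have "tadd v w c = v c + w c" by (simp add: tadd_def)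
    then show "(\<lambda>v\<in>tangent_space A x. tvec_of B c' y (blinfun_apply L (v c))) (tadd v w) =
      tadd ((\<lambda>v\<in>tangent_space A x. tvec_of B c' y (blinfun_apply L (v c))) v) ((\<lambda>v\<in>tangent_space A x. tvec_of B c' y (blinfun_apply L (v c))) w)"
      using v w M.tadd_in[OF v w] by (simp add: blinfun.add_right N.tvec_of_add[OF assms(2,4)])
  qed
  then show ?thesis by (simp add: hom_bundle_def hom_bundle_param_def)
qed

lemma hom_space_in: "\<xi> \<in> hom_space A B x y \<Longrightarrow> v \<in> tangent_space A x \<Longrightarrow> \<xi> v \<in> tangent_space B y"
  unfolding hom_space_def by (auto simp: PiE_iff)

lemma linear_hom_coord:
  assumes \<xi>: "\<xi> \<in> hom_space A B x y" and c: "c \<in> A" "x \<in> cdom c"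
  shows "linear (\<lambda>h. \<xi> (tvec_of A c x h) c')"
proof (rule linearI)
  have T: "tvec_of A c x h \<in> tangent_space A x" for h using M.tvec_of_in_tangent_space[OF c] .
  show "\<xi> (tvec_of A c x (h + k)) c' = \<xi> (tvec_of A c x h) c' + \<xi> (tvec_of A c x k) c'" for h k
  proof -
    have "\<xi> (tadd (tvec_of A c x h) (tvec_of A c x k)) = tadd (\<xi> (tvec_of A c x h)) (\<xi> (tvec_of A c x k))"
      using \<xi> T unfolding hom_space_def by blast
    then show ?thesis by (simp add: M.tvec_of_add[OF c] tadd_def)
  qed
  show "\<xi> (tvec_of A c x (r *\<^sub>R h)) c' = r *\<^sub>R \<xi> (tvec_of A c x h) c'" for r h
  proof -
    have "\<xi> (tscale r (tvec_of A c x h)) = tscale r (\<xi> (tvec_of A c x h))"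
      using \<xi> T unfolding hom_space_def by blast
    then show ?thesis by (simp add: M.tvec_of_scaleR[OF c] tscale_def)
  qed
qed

lemma param_surj:
  assumes \<xi>: "\<xi> \<in> hom_space A B x y" and c: "c \<in> A" "c' \<in> B" "x \<in> cdom c" "y \<in> cdom c'"
  obtains L where "(x, y, \<xi>) = param c c' (x, y, L)"
proof -
  define L where "L = Blinfun (\<lambda>h. \<xi> (tvec_of A c x h) c')"
  have L: "blinfun_apply L h = \<xi> (tvec_of A c x h) c'" for h
    unfolding L_def using linear_hom_coord[OF \<xi> c(1,3), of c'] by (simp add: bounded_linear_Blinfun_apply linear_linear)
  have "\<xi> = (\<lambda>v\<in>tangent_space A x. tvec_of B c' y (blinfun_apply L (v c)))"
  proof
    fix v
    show "\<xi> v = (\<lambda>v\<in>tangent_space A x. tvec_of B c' y (blinfun_apply L (v c))) v"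
    proof (cases "v \<in> tangent_space A x")
      case True
      have "tvec_of B c' y (\<xi> v c') = \<xi> v"
        by (rule N.tvec_of_coordinates[OF hom_space_in[OF \<xi> True] c(2,4)])
      then show ?thesis using True by (simp add: L M.tvec_of_coordinates[OF True c(1,3)])
    next
      case False
      then show ?thesis using \<xi> unfolding hom_space_def by (auto simp: PiE_iff extensional_def)
    qed
  qed
  then show ?thesis using that[of L] by (simp add: hom_bundle_param_def)
qed

lemma fst_param [simp]: "fst (param c c' q) = fst q" "fst (snd (param c c' q)) = fst (snd q)"
  by (auto simp: hom_bundle_param_def split: prod.splits)

lemma openin_btop: "openin btop W \<longleftrightarrow> W \<subseteq> bundle \<and>
     (\<forall>c\<in>A. \<forall>c'\<in>B. open {q \<in> cdom c \<times> cdom c' \<times> UNIV. param c c' q \<in> W})"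
  by (simp add: openin_hom_bundle_topology hom_bundle_open_def)

text \<open>The bundle carries its topology as a \<open>topology\<close> value, so openness is
  checked by continuity in all trivializations. The condition \<open>fst P \<in> U\<close> admits
  functions that make sense only over part of M, such as those that refer to a fixed chart.\<close>

lemma openin_bundle_Collect:
  assumes U: "open U" and V: "open V"
    and F: "\<And>c c'. c \<in> A \<Longrightarrow> c' \<in> B \<Longrightarrow> continuous_on ((cdom c \<inter> U) \<times> cdom c' \<times> UNIV) (\<lambda>q. F (param c c' q))"
  shows "openin btop {P \<in> bundle. fst P \<in> U \<and> F P \<in> V}"
  unfolding openin_btop
proof (intro conjI ballI)
  fix c c' assume c: "c \<in> A" "c' \<in> B"
  have op: "open ((cdom c \<inter> U) \<times> cdom c' \<times> (UNIV :: ((real, 'k) vec \<Rightarrow>\<^sub>L (real, 'l) vec) set))"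
    using M.open_cdom[OF c(1)] N.open_cdom[OF c(2)] U by (intro open_Times open_Int) auto
  have "{q \<in> cdom c \<times> cdom c' \<times> UNIV. param c c' q \<in> {P \<in> bundle. fst P \<in> U \<and> F P \<in> V}} =
     (\<lambda>q. F (param c c' q)) -` V \<inter> ((cdom c \<inter> U) \<times> cdom c' \<times> UNIV)"
    using param_in[OF c] by (intro set_eqI) (simp add: mem_Times_iff conj_ac split_paired_all, blast)
  also have "open \<dots>" by (rule continuous_on_open_vimage[OF op, THEN iffD1, rule_format, OF F[OF c] V])
  finally show "open {q \<in> cdom c \<times> cdom c' \<times> UNIV. param c c' q \<in> {P \<in> bundle. fst P \<in> U \<and> F P \<in> V}}" .
qed simp

lemma topspace_btop: "topspace btop = bundle"
proof -
  have "openin btop {P \<in> bundle. fst P \<in> UNIV \<and> (0::real) \<in> UNIV}"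
    by (rule openin_bundle_Collect[where F="\<lambda>_. 0"]) auto
  then have "bundle \<subseteq> topspace btop" using openin_subset by fastforce
  moreover have "topspace btop \<subseteq> bundle"
    using openin_topspace[of btop] unfolding openin_btop by blast
  ultimately show ?thesis by blast
qed

lemma bundle_cases:
  assumes "P \<in> bundle"
  obtains c c' x y L where "c \<in> A" "c' \<in> B" "x \<in> cdom c" "y \<in> cdom c'" "P = param c c' (x, y, L)"
proof -
  obtain x y \<xi> where P: "P = (x, y, \<xi>)" "\<xi> \<in> hom_space A B x y" using assms by (auto simp: hom_bundle_def)
  obtain c where c: "c \<in> A" "x \<in> cdom c" by (rule M.obtain_chart)
  obtain c' where c': "c' \<in> B" "y \<in> cdom c'" by (rule N.obtain_chart)
  obtain L where "(x, y, \<xi>) = param c c' (x, y, L)" using param_surj[OF P(2) c(1) c'(1) c(2) c'(2)] by blast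
  then show ?thesis using that c c' P(1) by blast
qed

lemma limitin_param:
  assumes c: "c \<in> A" "c' \<in> B" and q: "q \<in> cdom c \<times> cdom c' \<times> UNIV" and lim: "(f \<longlongrightarrow> q) F"
  shows "limitin btop (\<lambda>n. param c c' (f n)) (param c c' q) F"
  unfolding limitin_def
proof (intro conjI allI impI)
  show "param c c' q \<in> topspace btop" unfolding topspace_btop using q by (cases q) (simp add: param_in[OF c])
  fix W assume W: "openin btop W \<and> param c c' q \<in> W"
  then have "open {q \<in> cdom c \<times> cdom c' \<times> UNIV. param c c' q \<in> W}" using c unfolding openin_btop by blast
  moreover have "q \<in> {q \<in> cdom c \<times> cdom c' \<times> UNIV. param c c' q \<in> W}" using q W by blast
  ultimately have "\<forall>\<^sub>F n in F. f n \<in> {q \<in> cdom c \<times> cdom c' \<times> UNIV. param c c' q \<in> W}"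
    using lim by (rule topological_tendstoD[rotated])
  then show "\<forall>\<^sub>F n in F. param c c' (f n) \<in> W" by (rule eventually_mono) blast
qed

lemma zero_hom_param:
  assumes c: "c \<in> A" "c' \<in> B" "x \<in> cdom c" "y \<in> cdom c'"
  shows "zero_hom A B x y = param c c' (x, y, 0)"
  unfolding zero_hom_def hom_bundle_param_def by (simp add: N.tvec_of_0[OF c(2,4)])

lemma zero_hom_in: "zero_hom A B x y \<in> bundle"
proof -
  obtain c where c: "c \<in> A" "x \<in> cdom c" by (rule M.obtain_chart)
  obtain c' where c': "c' \<in> B" "y \<in> cdom c'" by (rule N.obtain_chart)
  show ?thesis unfolding zero_hom_param[OF c(1) c'(1) c(2) c'(2)] by (intro param_in c c')
qed

text \<open>Gives measurability of the default value that a limit section takes where the sequence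
  does not converge.\<close>

lemma open_zero_section:
  assumes W: "openin btop W" shows "open {x. zero_hom A B x y \<in> W}"
proof -
  obtain c' where c': "c' \<in> B" "y \<in> cdom c'" by (rule N.obtain_chart)
  have "open {x \<in> cdom c. zero_hom A B x y \<in> W}" if c: "c \<in> A" for c
  proof -
    let ?S = "{q \<in> cdom c \<times> cdom c' \<times> UNIV. param c c' q \<in> W}"
    have "open ?S" using W c c' unfolding openin_btop by blast
    then have "open ((\<lambda>x. (x, y, 0)) -` ?S)" by (intro open_vimage) (auto intro!: continuous_intros)
    moreover have "(\<lambda>x. (x, y, 0)) -` ?S = {x \<in> cdom c. zero_hom A B x y \<in> W}"
      using zero_hom_param[OF c c'(1) _ c'(2)] c'(2) by (auto simp del: split_paired_All)
    ultimately show ?thesis by simp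
  qed
  then have "open (\<Union>c\<in>A. {x \<in> cdom c. zero_hom A B x y \<in> W})" by blast
  moreover have "(\<Union>c\<in>A. {x \<in> cdom c. zero_hom A B x y \<in> W}) = {x. zero_hom A B x y \<in> W}"
    using M.obtain_chart by blast
  ultimately show ?thesis by simp
qed

subsection \<open>The norm\<close>

lemma hnorm_param_basis:
  assumes c: "c \<in> A" "c' \<in> B" "x \<in> cdom c" "y \<in> cdom c'"
  obtains E where "orthonormal_basis A gM x E"
    "\<And>L. hnorm (param c c' (x, y, L)) = sqrt (\<Sum>e\<in>E. N.gc c' y (blinfun_apply L (e c)) (blinfun_apply L (e c)))"
    "\<And>\<xi>. hnorm (x, y, \<xi>) = sqrt (\<Sum>e\<in>E. gN y (\<xi> e) (\<xi> e))"
proof -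
  define E where "E = (SOME E. orthonormal_basis A gM x E)"
  have E: "orthonormal_basis A gM x E" unfolding E_def by (rule someI_ex[OF M.orthonormal_basis_exists])
  have ET: "e \<in> tangent_space A x" if "e \<in> E" for e using E that unfolding orthonormal_basis_def by blast
  have n: "hnorm (x, y, \<xi>) = sqrt (\<Sum>e\<in>E. gN y (\<xi> e) (\<xi> e))" for \<xi>
    by (simp add: hom_norm_def E_def)
  have "hnorm (param c c' (x, y, L)) = sqrt (\<Sum>e\<in>E. N.gc c' y (blinfun_apply L (e c)) (blinfun_apply L (e c)))" for L
    unfolding hom_bundle_param_def prod.case n N.gc_def
    by (rule arg_cong[where f=sqrt], rule sum.cong[OF refl]) (simp add: ET)
  then show ?thesis by (rule that[OF E _ n])
qed

text \<open>Expanding the basis vectors in coordinates collects their products into the inverse Gram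
  matrix. The norm becomes an explicit continuous function of the points and the matrix.\<close>

lemma hnorm_param:
  assumes c: "c \<in> A" "c' \<in> B" "x \<in> cdom c" "y \<in> cdom c'"
  shows "hnorm (param c c' (x, y, L)) =
    sqrt (\<Sum>i\<in>UNIV. \<Sum>j\<in>UNIV. M.gram_inverse c x i j * N.gc c' y (blinfun_apply L (axis i 1)) (blinfun_apply L (axis j 1)))"
proof -
  obtain E where E: "orthonormal_basis A gM x E"
    "\<And>L. hnorm (param c c' (x, y, L)) = sqrt (\<Sum>e\<in>E. N.gc c' y (blinfun_apply L (e c)) (blinfun_apply L (e c)))"
    by (rule hnorm_param_basis[OF c]) blast
  have ex: "blinfun_apply L h = (\<Sum>i\<in>UNIV. h $ i *\<^sub>R blinfun_apply L (axis i 1))" for h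
  proof -
    have "h = (\<Sum>i\<in>UNIV. h $ i *\<^sub>R axis i 1)" using basis_expansion[of h] by (simp add: scalar_mult_eq_scaleR)
    then have "blinfun_apply L h = blinfun_apply L (\<Sum>i\<in>UNIV. h $ i *\<^sub>R axis i 1)" by simp
    then show ?thesis by (simp add: blinfun.sum_right blinfun.scaleR_right)
  qed
  let ?b = "N.gc c' y" let ?L = "\<lambda>i. blinfun_apply L (axis i 1)"
  have b1: "?b (\<Sum>i\<in>UNIV. h $ i *\<^sub>R ?L i) k = (\<Sum>i\<in>UNIV. h $ i * ?b (?L i) k)" for h k
    by (simp only: N.gc_sum[OF c(2,4)] N.gc_scale[OF c(2,4)])
  have b2: "?b k (\<Sum>i\<in>UNIV. h $ i *\<^sub>R ?L i) = (\<Sum>i\<in>UNIV. h $ i * ?b k (?L i))" for h k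
    unfolding N.gc_sym[OF c(2,4), of k] by (rule b1)
  have "(\<Sum>e\<in>E. ?b (blinfun_apply L (e c)) (blinfun_apply L (e c))) =
    (\<Sum>e\<in>E. \<Sum>i\<in>UNIV. \<Sum>j\<in>UNIV. (e c $ i * e c $ j) * ?b (?L i) (?L j))"
    unfolding ex[of "_ c"] b1 b2
    by (simp add: sum_distrib_left mult.assoc, intro sum.cong refl arg_cong2[where f="(*)"], rule N.gc_sym[OF c(2,4)])
  also have "\<dots> = (\<Sum>i\<in>UNIV. \<Sum>j\<in>UNIV. \<Sum>e\<in>E. (e c $ i * e c $ j) * ?b (?L i) (?L j))"
    by (subst sum.swap, intro sum.cong refl, subst sum.swap, rule refl)
  also have "\<dots> = (\<Sum>i\<in>UNIV. \<Sum>j\<in>UNIV. M.gram_inverse c x i j * ?b (?L i) (?L j))"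
    unfolding sum_distrib_right[symmetric] M.orthonormal_gram_inverse[OF E(1) c(1,3)] M.gram_inverse_def ..
  finally show ?thesis by (simp only: E(2))
qed

lemma hnorm_nonneg: "P \<in> bundle \<Longrightarrow> hnorm P \<ge> 0"
proof (erule bundle_cases)
  fix c c' x y L assume c: "c \<in> A" "c' \<in> B" "x \<in> cdom c" "y \<in> cdom c'" and P: "P = param c c' (x, y, L)"
  obtain E where "\<And>L. hnorm (param c c' (x, y, L)) = sqrt (\<Sum>e\<in>E. N.gc c' y (blinfun_apply L (e c)) (blinfun_apply L (e c)))"
    by (rule hnorm_param_basis[OF c]) blast
  then show "hnorm P \<ge> 0" unfolding P using N.gc_nonneg[OF c(2,4)] by (simp add: sum_nonneg)
qed

lemma continuous_on_hnorm_param: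
  assumes c: "c \<in> A" "c' \<in> B"
  shows "continuous_on (cdom c \<times> cdom c' \<times> UNIV) (\<lambda>q. hnorm (param c c' q))"
proof -
  let ?f = "\<lambda>q. sqrt (\<Sum>i\<in>UNIV. \<Sum>j\<in>UNIV. M.gram_inverse c (fst q) i j *
    N.gc c' (fst (snd q)) (blinfun_apply (snd (snd q)) (axis i 1)) (blinfun_apply (snd (snd q)) (axis j 1)))"
  have "continuous_on (cdom c \<times> cdom c' \<times> UNIV) ?f"
    by (intro continuous_on_real_sqrt continuous_on_sum continuous_on_mult
         continuous_on_compose2[OF M.continuous_on_gram_inverse[OF c(1)]] N.continuous_on_gc[OF c(2)] continuous_intros) auto
  then show ?thesis
    by (rule continuous_on_eq) (use hnorm_param[OF c] in auto)
qed

lemma openin_hnorm: "open V \<Longrightarrow> openin btop {P \<in> bundle. hnorm P \<in> V}"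
  using openin_bundle_Collect[of UNIV V hnorm] continuous_on_hnorm_param by simp

text \<open>From this openness follow both the measurability of the candidate weak derivative and
  its convergence along convergent bundle elements. Base points are confined to the domain of c
  because h is a coordinate vector of that chart.\<close>

lemma openin_differential:
  assumes f: "C1_fun B f" and c: "c \<in> A" and V: "open V"
  shows "openin btop {P \<in> bundle. fst P \<in> cdom c \<and>
     differential B f (fst (snd P)) (snd (snd P) (tvec_of A c (fst P) h)) \<in> V}"
proof (rule openin_bundle_Collect[OF M.open_cdom[OF c] V])
  fix c2 c2' assume c2: "c2 \<in> A" "c2' \<in> B"
  have "C1_on (cmap c2' ` cdom c2') (f \<circ> cinv c2')" using f c2 by (auto simp: C1_fun_def)
  then obtain f' where f': "\<And>z. z \<in> cmap c2' ` cdom c2' \<Longrightarrow> ((f \<circ> cinv c2') has_derivative blinfun_apply (f' z)) (at z)"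
    "continuous_on (cmap c2' ` cdom c2') f'" unfolding C1_on_def by blast
  let ?S = "(cdom c2 \<inter> cdom c) \<times> cdom c2' \<times> (UNIV :: ((real, 'k) vec \<Rightarrow>\<^sub>L (real, 'l) vec) set)"
  let ?g = "\<lambda>q. blinfun_apply (f' (cmap c2' (fst (snd q)))) (blinfun_apply (snd (snd q)) (transition_deriv c c2 (fst q) h))"
  have 1: "continuous_on ?S (\<lambda>q. cmap c2' (fst (snd q)))"
    by (rule continuous_on_compose2[OF N.continuous_on_cmap[OF c2(2)]]) (auto intro!: continuous_intros)
  have 2: "continuous_on ?S (\<lambda>q. f' (cmap c2' (fst (snd q))))"
    by (rule continuous_on_compose2[OF f'(2) 1]) auto
  have 3: "continuous_on ?S (\<lambda>q. transition_deriv c c2 (fst q) h)"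
    by (rule continuous_on_compose2[OF M.continuous_on_transition_deriv[OF c c2(1)]]) (auto intro!: continuous_intros)
  have "continuous_on ?S ?g"
    by (intro continuous_intros 2 3)
  then show "continuous_on ?S (\<lambda>q. differential B f (fst (snd (param c2 c2' q))) (snd (snd (param c2 c2' q)) (tvec_of A c (fst (param c2 c2' q)) h)))"
  proof (rule continuous_on_eq)
    fix q assume "q \<in> ?S"
    then obtain x y L where q: "q = (x, y, L)" "x \<in> cdom c2" "x \<in> cdom c" "y \<in> cdom c2'" by auto
    have v: "tvec_of A c x h \<in> tangent_space A x" by (rule M.tvec_of_in_tangent_space[OF c q(3)])
    have "snd (snd (param c2 c2' q)) (tvec_of A c x h) = tvec_of B c2' y (blinfun_apply L (transition_deriv c c2 x h))"
      unfolding q(1) hom_bundle_param_def using v by (simp add: M.tvec_of_apply[OF c2(1) q(2)])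
    moreover have "differential B f y (tvec_of B c2' y k) = blinfun_apply (f' (cmap c2' y)) k" for k
      using frechet_derivative_at[OF f'(1)[of "cmap c2' y"]] q(4)
      by (simp add: N.differential_eq[OF f c2(2) q(4) N.tvec_of_in_tangent_space[OF c2(2) q(4)]] N.tvec_of_apply_self[OF c2(2) q(4)])
    ultimately show "?g q = differential B f (fst (snd (param c2 c2' q))) (snd (snd (param c2 c2' q)) (tvec_of A c (fst (param c2 c2' q)) h))"
      using q(1) by simp
  qed
qed

text \<open>The differential of f is bounded with respect to the metric since f has compact support.
  Expanding v in an orthonormal basis, the Cauchy-Schwarz inequality leaves the length of v times
  the norm of \<xi>.\<close>

lemma differential_comp_bound:
  assumes f: "f \<in> C1_compact_support B"
  obtains C where "C \<ge> 0" "\<And>x y \<xi> v. \<xi> \<in> hom_space A B x y \<Longrightarrow> v \<in> tangent_space A x \<Longrightarrow>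
    \<bar>differential B f y (\<xi> v)\<bar> \<le> C * sqrt (gM x v v) * hnorm (x, y, \<xi>)"
proof -
  obtain C where C: "C \<ge> 0" "\<And>y w. w \<in> tangent_space B y \<Longrightarrow> \<bar>differential B f y w\<bar> \<le> C * sqrt (gN y w w)"
    using N.differential_bound[OF f] by metis
  have fC: "C1_fun B f" using f by (simp add: C1_compact_support_def)
  have "\<bar>differential B f y (\<xi> v)\<bar> \<le> C * sqrt (gM x v v) * hnorm (x, y, \<xi>)"
    if \<xi>: "\<xi> \<in> hom_space A B x y" and v: "v \<in> tangent_space A x" for x y \<xi> v
  proof -
    obtain c where c: "c \<in> A" "x \<in> cdom c" by (rule M.obtain_chart)
    obtain c' where c': "c' \<in> B" "y \<in> cdom c'" by (rule N.obtain_chart)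
    obtain E where E: "orthonormal_basis A gM x E" and n: "\<And>\<xi>. hnorm (x, y, \<xi>) = sqrt (\<Sum>e\<in>E. gN y (\<xi> e) (\<xi> e))"
      by (rule hnorm_param_basis[OF c(1) c'(1) c(2) c'(2)]) blast
    have ET: "e \<in> tangent_space A x" if "e \<in> E" for e using E that unfolding orthonormal_basis_def by blast
    define l where "l h = differential B f y (\<xi> (tvec_of A c x h))" for h
    have ll: "linear l"
    proof -
      have "l = (\<lambda>w. frechet_derivative (f \<circ> cinv c') (at (cmap c' y)) w) \<circ> (\<lambda>h. \<xi> (tvec_of A c x h) c')"
        unfolding l_def o_def
        by (rule ext, rule N.differential_eq[OF fC c' hom_space_in[OF \<xi> M.tvec_of_in_tangent_space[OF c]], unfolded o_def])
      then show ?thesis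
        using linear_compose[OF linear_hom_coord[OF \<xi> c, of c'] has_derivative_linear[OF N.C1_fun_has_derivative[OF fC c']]]
        by simp
    qed
    have vv: "tvec_of A c x (v c) = v" by (rule M.tvec_of_coordinates[OF v c])
    have le: "\<bar>l (e c)\<bar> \<le> C * sqrt (gN y (\<xi> e) (\<xi> e))" if "e \<in> E" for e
      using C(2)[OF hom_space_in[OF \<xi> ET[OF that]]] M.tvec_of_coordinates[OF ET[OF that] c] by (simp add: l_def)
    have gnn: "gN y w w \<ge> 0" if "w \<in> tangent_space B y" for w
      using N.gc_nonneg[OF c', of "w c'"] N.tvec_of_coordinates[OF that c'] by (simp add: N.gc_def)
    let ?a = "\<lambda>e. M.gc c x (v c) (e c)"
    have "differential B f y (\<xi> v) = l (v c)" by (simp add: l_def vv)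
    also have "\<dots> = l (\<Sum>e\<in>E. ?a e *\<^sub>R e c)"
      using M.orthonormal_expansion[OF E c, of "v c"] by simp
    also have "\<dots> = (\<Sum>e\<in>E. ?a e * l (e c))"
      using ll by (simp add: linear_sum linear_cmul)
    finally have "\<bar>differential B f y (\<xi> v)\<bar> \<le> (\<Sum>e\<in>E. \<bar>?a e\<bar> * \<bar>l (e c)\<bar>)"
      by (simp add: abs_mult[symmetric] sum_abs)
    also have "\<dots> \<le> L2_set ?a E * L2_set (\<lambda>e. l (e c)) E" by (rule L2_set_mult_ineq)
    also have "L2_set ?a E = sqrt (gM x v v)"
      unfolding L2_set_def M.orthonormal_norm[OF E c, symmetric] by (simp add: M.gc_def vv)
    also have "sqrt (gM x v v) * L2_set (\<lambda>e. l (e c)) E \<le> sqrt (gM x v v) * (C * hnorm (x, y, \<xi>))"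
    proof (rule mult_left_mono)
      have "L2_set (\<lambda>e. l (e c)) E = L2_set (\<lambda>e. \<bar>l (e c)\<bar>) E" by (simp add: L2_set_def)
      also have "\<dots> \<le> L2_set (\<lambda>e. C * sqrt (gN y (\<xi> e) (\<xi> e))) E"
        by (rule L2_set_mono) (use le in auto)
      also have "\<dots> = C * L2_set (\<lambda>e. sqrt (gN y (\<xi> e) (\<xi> e))) E"
        by (rule L2_set_right_distrib[symmetric, OF C(1)])
      also have "L2_set (\<lambda>e. sqrt (gN y (\<xi> e) (\<xi> e))) E = hnorm (x, y, \<xi>)"
        unfolding L2_set_def n using gnn hom_space_in[OF \<xi> ET] by (simp cong: sum.cong)
      finally show "L2_set (\<lambda>e. l (e c)) E \<le> C * hnorm (x, y, \<xi>)" .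
      show "0 \<le> sqrt (gM x v v)" using M.gc_nonneg[OF c, of "v c"] by (simp add: M.gc_def vv)
    qed
    finally show ?thesis by (simp add: mult_ac)
  qed
  then show ?thesis using that C(1) by blast
qed

text \<open>Bounded norm means bounded coordinates in a trivialization, uniformly for targets near
  y0. The constant combines the upper bound of \<open>gM\<close> at the single point x with the
  lower bound of \<open>gN\<close> on a compact neighbourhood of y0.\<close>

lemma hnorm_param_lower_bound:
  assumes c: "c \<in> A" "c' \<in> B" "x \<in> cdom c" "y0 \<in> cdom c'"
  obtains V \<kappa> where "open V" "y0 \<in> V" "V \<subseteq> cdom c'" "\<kappa> \<ge> 0"
    "\<And>y L. y \<in> V \<Longrightarrow> norm L \<le> \<kappa> * hnorm (param c c' (x, y, L))"
proof -
  obtain R where R: "R > 0" "cball (cmap c' y0) R \<subseteq> cmap c' ` cdom c'"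
    using N.open_cimage[OF c(2)] c(4) by (meson imageI open_contains_cball)
  define K where "K = cinv c' ` cball (cmap c' y0) R"
  have K: "compact K" unfolding K_def
    by (intro compact_continuous_image continuous_on_subset[OF N.continuous_on_cinv[OF c(2)] R(2)]) auto
  have Kc: "K \<subseteq> cdom c'" unfolding K_def using R(2) N.cinv_in[OF c(2)] by blast
  obtain lo where lo: "lo > 0" "\<And>y h. y \<in> K \<Longrightarrow> lo * (norm h)\<^sup>2 \<le> N.gc c' y h h"
    using N.gc_bounds[OF c(2) K Kc] by metis
  obtain hi where hi: "\<And>h. M.gc c x h h \<le> hi * (norm h)\<^sup>2"
    using M.gc_bounds[OF c(1), of "{x}"] c(3) by (metis compact_sing empty_subsetI insert_subset singletonI)
  define V where "V = {y \<in> cdom c'. cmap c' y \<in> ball (cmap c' y0) R}"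
  show ?thesis
  proof (rule that[of V "sqrt (max hi 0) / sqrt lo"])
    show "open V" unfolding V_def by (intro N.open_cmap_vimage c) auto
    show "y0 \<in> V" "V \<subseteq> cdom c'" using c R by (auto simp: V_def)
    show "0 \<le> sqrt (max hi 0) / sqrt lo" using lo by simp
    fix y L assume y: "y \<in> V"
    then have yc: "y \<in> cdom c'" "cmap c' y \<in> cball (cmap c' y0) R" by (auto simp: V_def)
    have yK: "y \<in> K" unfolding K_def using yc N.cinv_cmap[OF c(2) yc(1)] by (metis imageI)
    obtain E where E: "orthonormal_basis A gM x E"
      and n: "\<And>L. hnorm (param c c' (x, y, L)) = sqrt (\<Sum>e\<in>E. N.gc c' y (blinfun_apply L (e c)) (blinfun_apply L (e c)))"
      by (rule hnorm_param_basis[OF c(1,2,3) yc(1)]) blast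
    show "norm L \<le> sqrt (max hi 0) / sqrt lo * hnorm (param c c' (x, y, L))"
    proof (rule norm_blinfun_bound)
      show "0 \<le> sqrt (max hi 0) / sqrt lo * hnorm (param c c' (x, y, L))"
        using lo hnorm_nonneg[OF param_in[OF c(1,2,3) yc(1)]] by simp
      fix h
      let ?a = "\<lambda>e. M.gc c x h (e c)"
      have "blinfun_apply L h = (\<Sum>e\<in>E. ?a e *\<^sub>R blinfun_apply L (e c))"
        by (subst M.orthonormal_expansion[OF E c(1,3), of h]) (simp add: blinfun.sum_right blinfun.scaleR_right)
      then have "norm (blinfun_apply L h) \<le> (\<Sum>e\<in>E. \<bar>?a e\<bar> * \<bar>norm (blinfun_apply L (e c))\<bar>)"
        using norm_sum[of "\<lambda>e. ?a e *\<^sub>R blinfun_apply L (e c)" E] by simp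
      also have "\<dots> \<le> L2_set ?a E * L2_set (\<lambda>e. norm (blinfun_apply L (e c))) E" by (rule L2_set_mult_ineq)
      also have "\<dots> \<le> (sqrt (max hi 0) * norm h) * (hnorm (param c c' (x, y, L)) / sqrt lo)"
      proof (rule mult_mono)
        have "L2_set ?a E = sqrt (M.gc c x h h)" unfolding L2_set_def M.orthonormal_norm[OF E c(1,3), symmetric] ..
        also have "\<dots> \<le> sqrt (max hi 0 * (norm h)\<^sup>2)"
          using hi[of h] mult_right_mono[of hi "max hi 0" "(norm h)\<^sup>2"] by (intro real_sqrt_le_mono) (auto intro: order_trans)
        also have "\<dots> = sqrt (max hi 0) * norm h" by (simp add: real_sqrt_mult)
        finally show "L2_set ?a E \<le> sqrt (max hi 0) * norm h" .
        have "(\<Sum>e\<in>E. (norm (blinfun_apply L (e c)))\<^sup>2) \<le> (\<Sum>e\<in>E. N.gc c' y (blinfun_apply L (e c)) (blinfun_apply L (e c)) / lo)"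
          using lo(1) lo(2)[OF yK] by (intro sum_mono) (simp add: field_simps)
        also have "\<dots> = (\<Sum>e\<in>E. N.gc c' y (blinfun_apply L (e c)) (blinfun_apply L (e c))) / lo"
          by (simp add: sum_divide_distrib)
        finally have "L2_set (\<lambda>e. norm (blinfun_apply L (e c))) E \<le> sqrt ((\<Sum>e\<in>E. N.gc c' y (blinfun_apply L (e c)) (blinfun_apply L (e c))) / lo)"
          unfolding L2_set_def by (rule real_sqrt_le_mono)
        then show "L2_set (\<lambda>e. norm (blinfun_apply L (e c))) E \<le> hnorm (param c c' (x, y, L)) / sqrt lo"
          by (simp add: n real_sqrt_divide)
      qed (auto intro: L2_set_nonneg)
      finally show "norm (blinfun_apply L h) \<le> sqrt (max hi 0) / sqrt lo * hnorm (param c c' (x, y, L)) * norm h"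
        by (simp add: mult_ac)
    qed
  qed
qed

text \<open>A tail of the sequence lies in one trivialization, where the linear maps form a bounded
  subset of a finite-dimensional space.\<close>

lemma bundle_bounded_subsequence:
  assumes y: "Y \<longlonglongrightarrow> y" and \<xi>: "\<And>n::nat. \<Xi> n \<in> hom_space A B x (Y n)" and bd: "\<And>n. hnorm (x, Y n, \<Xi> n) \<le> R"
  obtains r P where "strict_mono r" "limitin btop (\<lambda>n. (x, Y (r n), \<Xi> (r n))) P sequentially" "fst P = x" "fst (snd P) = y"
proof -
  obtain c where c: "c \<in> A" "x \<in> cdom c" by (rule M.obtain_chart)
  obtain c' where c': "c' \<in> B" "y \<in> cdom c'" by (rule N.obtain_chart)
  obtain V \<kappa> where V: "open V" "y \<in> V" "V \<subseteq> cdom c'" "\<kappa> \<ge> 0" "\<And>y L. y \<in> V \<Longrightarrow> norm L \<le> \<kappa> * hnorm (param c c' (x, y, L))"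
    using hnorm_param_lower_bound[OF c(1) c'(1) c(2) c'(2)] by metis
  have ev: "\<forall>\<^sub>F n in sequentially. Y n \<in> V" using topological_tendstoD[OF y V(1,2)] .
  \<comment> \<open>As long as \<open>Y n\<close> is outside V the trivialization says nothing; the
    default 0 keeps the whole sequence of coordinates bounded.\<close>
  have "\<exists>L. norm L \<le> \<kappa> * \<bar>R\<bar> \<and> (Y n \<in> V \<longrightarrow> (x, Y n, \<Xi> n) = param c c' (x, Y n, L))" for n
  proof (cases "Y n \<in> V")
    case True
    then have yc: "Y n \<in> cdom c'" using V(3) by blast
    obtain L where L: "(x, Y n, \<Xi> n) = param c c' (x, Y n, L)" using param_surj[OF \<xi> c(1) c'(1) c(2) yc] by blast
    have "norm L \<le> \<kappa> * hnorm (x, Y n, \<Xi> n)" using V(5)[OF True, of L] L by simp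
    also have "\<dots> \<le> \<kappa> * \<bar>R\<bar>" using bd[of n] V(4) by (intro mult_left_mono) auto
    finally show ?thesis using L by blast
  qed (use V(4) in \<open>auto intro!: exI[of _ 0]\<close>)
  then obtain L where L: "\<And>n. norm (L n) \<le> \<kappa> * \<bar>R\<bar>" "\<And>n. Y n \<in> V \<Longrightarrow> (x, Y n, \<Xi> n) = param c c' (x, Y n, L n)"
    by metis
  have "bounded (range L)" using L(1) by (auto simp: bounded_iff)
  then obtain l r where r: "strict_mono r" "(L \<circ> r) \<longlonglongrightarrow> l" using bounded_imp_convergent_subsequence by blast
  have Yr: "(\<lambda>n. Y (r n)) \<longlonglongrightarrow> y" using LIMSEQ_subseq_LIMSEQ[OF y r(1)] by (simp add: o_def)
  have "((\<lambda>n. (x, Y (r n), L (r n))) \<longlongrightarrow> (x, y, l)) sequentially"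
    by (intro tendsto_intros Yr r(2)[unfolded o_def])
  then have lim: "limitin btop (\<lambda>n. param c c' (x, Y (r n), L (r n))) (param c c' (x, y, l)) sequentially"
    by (rule limitin_param[OF c(1) c'(1), rotated]) (use c c' in auto)
  have "\<forall>\<^sub>F n in sequentially. Y (r n) \<in> V" using topological_tendstoD[OF Yr V(1,2)] .
  then have "\<forall>\<^sub>F n in sequentially. param c c' (x, Y (r n), L (r n)) = (x, Y (r n), \<Xi> (r n))"
    by (rule eventually_mono) (simp add: L(2))
  then have "limitin btop (\<lambda>n. (x, Y (r n), \<Xi> (r n))) (param c c' (x, y, l)) sequentially"
    by (rule limitin_transform_eventually[OF _ lim])
  then show ?thesis using that[OF r(1)] by simp
qed

subsection \<open>Separability and measurability\<close>

text \<open>Matrices parametrize the linear maps by a Euclidean space, with its countable basis and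
  its componentwise test for measurability.\<close>

lemma linear_Blinfun_matrix:
  "continuous_on UNIV (\<lambda>m :: real^'k^'l. Blinfun ((*v) m))" "blinfun_apply (Blinfun ((*v) (m :: real^'k^'l))) = (*v) m"
proof -
  have a: "blinfun_apply (Blinfun ((*v) m)) = (*v) m" for m :: "real^'k^'l"
    by (rule bounded_linear_Blinfun_apply) (rule matrix_vector_mul_bounded_linear)
  show "blinfun_apply (Blinfun ((*v) (m :: real^'k^'l))) = (*v) m" by (rule a)
  have "linear (\<lambda>m :: real^'k^'l. Blinfun ((*v) m))"
    by (rule linearI; rule blinfun_eqI)
       (simp_all add: a blinfun.bilinear_simps matrix_vector_mult_add_rdistrib scaleR_matrix_vector_assoc)
  then show "continuous_on UNIV (\<lambda>m :: real^'k^'l. Blinfun ((*v) m))"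
    by (rule linear_continuous_on[OF linear_conv_bounded_linear[THEN iffD1]])
qed

lemma Blinfun_matrix_surj: obtains m :: "real^'k^'l" where "L = Blinfun ((*v) m)"
proof -
  have "L = Blinfun ((*v) (matrix (blinfun_apply L)))"
    by (rule blinfun_eqI) (simp add: linear_Blinfun_matrix(2) matrix_works bounded_linear.linear[OF blinfun.bounded_linear_right] blinfun_apply_inverse)
  then show ?thesis by (rule that)
qed

text \<open>One point from each set of a countable basis of coordinate data, pushed through
  countably many trivializations. A countable dense set makes the distance of two measurable
  sections measurable.\<close>

lemma bundle_separable:
  obtains Q where "countable Q" "Q \<subseteq> bundle" "\<And>W. openin btop W \<Longrightarrow> W \<noteq> {} \<Longrightarrow> W \<inter> Q \<noteq> {}"
proof -
  obtain A0 where A0: "A0 \<subseteq> A" "countable A0" "(\<Union>c\<in>A0. cdom c) = UNIV" by (rule M.countable_subatlas)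
  obtain B0 where B0: "B0 \<subseteq> B" "countable B0" "(\<Union>c\<in>B0. cdom c) = UNIV" by (rule N.countable_subatlas)
  have "\<exists>BB :: ('m \<times> 'n \<times> (real^'k^'l)) set set. countable BB \<and> topological_basis BB"
    by (rule ex_countable_basis)
  then obtain BB :: "('m \<times> 'n \<times> (real^'k^'l)) set set" where BB: "countable BB" "topological_basis BB"
    by iprover
  define Z where "Z = (\<lambda>b. SOME z. z \<in> b) ` BB"
  have Zc: "countable Z" unfolding Z_def using BB(1) by simp
  have Z: "\<exists>z\<in>Z. z \<in> X" if X: "open X" "p \<in> X" for X p
  proof -
    obtain b where b: "b \<in> BB" "p \<in> b" "b \<subseteq> X" by (rule topological_basisE[OF BB(2) X])
    have "(SOME z. z \<in> b) \<in> b" by (rule someI[of "\<lambda>z. z \<in> b", OF b(2)])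
    then have "(SOME z. z \<in> b) \<in> X" by (rule subsetD[OF b(3)])
    moreover have "(SOME z. z \<in> b) \<in> Z" unfolding Z_def by (rule imageI[OF b(1)])
    ultimately show ?thesis by (rule bexI)
  qed
  define \<theta> where "\<theta> c c' = (\<lambda>(x, y, m :: real^'k^'l). param c c' (x, y, Blinfun ((*v) m)))" for c c'
  \<comment> \<open>A trivialization is evaluated also at points of Z outside its domain;
    intersecting with the bundle discards the meaningless values.\<close>
  define Q where "Q = (\<Union>c\<in>A0. \<Union>c'\<in>B0. \<theta> c c' ` Z) \<inter> bundle"
  show ?thesis
  proof (rule that[of Q])
    show "countable Q" unfolding Q_def using A0 B0 Zc by (intro countable_Int1 countable_UN) auto
    show "Q \<subseteq> bundle" by (simp add: Q_def)
    fix W assume W: "openin btop W" "W \<noteq> {}"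
    then have Wb: "W \<subseteq> bundle" unfolding openin_btop by blast
    obtain x y \<xi> where P: "(x, y, \<xi>) \<in> W" using W(2) by (metis ex_in_conv prod_cases3)
    then have \<xi>: "\<xi> \<in> hom_space A B x y" using Wb by (auto simp: hom_bundle_def)
    obtain c where c: "c \<in> A0" "x \<in> cdom c" using A0(3) by blast
    obtain c' where c': "c' \<in> B0" "y \<in> cdom c'" using B0(3) by blast
    have cA: "c \<in> A" "c' \<in> B" using c c' A0 B0 by auto
    obtain L where L: "(x, y, \<xi>) = param c c' (x, y, L)" using param_surj[OF \<xi> cA c(2) c'(2)] by blast
    obtain m where m: "L = Blinfun ((*v) m)" by (rule Blinfun_matrix_surj)
    let ?S = "{q \<in> cdom c \<times> cdom c' \<times> UNIV. param c c' q \<in> W}"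
    have op: "open ?S" using W(1) cA unfolding openin_btop by blast
    let ?T = "(\<lambda>z :: 'm \<times> 'n \<times> (real^'k^'l). (fst z, fst (snd z), Blinfun ((*v) (snd (snd z))))) -` ?S"
    have "open ?T"
    proof (rule open_vimage[OF op])
      have "continuous_on UNIV (\<lambda>z :: 'm \<times> 'n \<times> (real^'k^'l). Blinfun ((*v) (snd (snd z))))"
        by (rule continuous_on_compose2[OF linear_Blinfun_matrix(1)]) (auto intro!: continuous_intros)
      then show "continuous_on UNIV (\<lambda>z :: 'm \<times> 'n \<times> (real^'k^'l). (fst z, fst (snd z), Blinfun ((*v) (snd (snd z)))))"
        by (intro continuous_intros)
    qed
    moreover have "(x, y, m) \<in> ?T" using c c' L P m by simp
    ultimately obtain z where z: "z \<in> Z" "z \<in> ?T" using Z[of ?T] by blast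
    have "\<theta> c c' z \<in> W" using z(2) by (cases z) (simp add: \<theta>_def)
    then have "\<theta> c c' z \<in> W \<inter> Q" unfolding Q_def using Wb z(1) c c' by blast
    then show "W \<inter> Q \<noteq> {}" by blast
  qed
qed

lemma bborel_sets: "sets bborel = sigma_sets bundle {W. openin btop W}" "space bborel = bundle"
proof -
  have "{W. openin btop W} \<subseteq> Pow bundle" unfolding openin_btop by blast
  then show "sets bborel = sigma_sets bundle {W. openin btop W}" "space bborel = bundle"
    by (simp_all add: sets_measure_of space_measure_of)
qed

lemma measurable_bborelI:
  assumes "\<And>x. x \<in> space S \<Longrightarrow> D x \<in> bundle" "\<And>W. openin btop W \<Longrightarrow> D -` W \<inter> space S \<in> sets S"
  shows "D \<in> measurable S bborel"
proof (rule measurable_measure_of)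
  show "{W. openin btop W} \<subseteq> Pow bundle" unfolding openin_btop by blast
qed (use assms in auto)

lemma measurable_bborel_open:
  assumes "D \<in> measurable S bborel" "openin btop W" shows "{x \<in> space S. D x \<in> W} \<in> sets S"
proof -
  have "W \<in> sets bborel" unfolding bborel_sets using assms(2) by auto
  from measurable_sets[OF assms(1) this] show ?thesis by (simp add: vimage_def Int_def conj_commute)
qed

lemma hnorm_measurable:
  assumes D: "D \<in> measurable S bborel" shows "(\<lambda>x. hnorm (D x)) \<in> borel_measurable S"
proof (rule borel_measurableI)
  fix V :: "real set" assume "open V"
  from measurable_bborel_open[OF D openin_hnorm[OF this]]
  have "{x \<in> space S. D x \<in> bundle \<and> hnorm (D x) \<in> V} \<in> sets S" by simp
  moreover have "D x \<in> bundle" if "x \<in> space S" for x using measurable_space[OF D that] by (simp add: bborel_sets)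
  ultimately show "(\<lambda>x. hnorm (D x)) -` V \<inter> space S \<in> sets S"
    by (simp add: vimage_def Int_def conj_commute cong: conj_cong)
qed

context
  fixes d assumes d: "continuous_distance A B d"
begin

lemma metric_d: "Metric_space bundle d"
  and mtopology_d: "Metric_space.mtopology bundle d = btop"
  using d by (auto simp: continuous_distance_def)

interpretation Md: Metric_space "bundle" d by (rule metric_d)

text \<open>By density, d (D x) (E x) < r holds exactly if some q in a countable dense set and some
  rational s satisfy d q (D x) < s and d q (E x) < r - s. For the forward direction, q is taken
  closer to D x than half of the slack r - d (D x) (E x).\<close>

lemma distance_measurable:
  assumes D: "D \<in> measurable S bborel" and E: "E \<in> measurable S bborel"
  shows "(\<lambda>x. d (D x) (E x)) \<in> borel_measurable S"
proof (rule borel_measurableI_less)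
  fix r :: real
  obtain Q where Q: "countable Q" "Q \<subseteq> bundle" "\<And>W. openin btop W \<Longrightarrow> W \<noteq> {} \<Longrightarrow> W \<inter> Q \<noteq> {}"
    using bundle_separable by metis
  have Db: "D x \<in> bundle" "E x \<in> bundle" if "x \<in> space S" for x
    using measurable_space[OF D that] measurable_space[OF E that] by (simp_all add: bborel_sets)
  have ball: "openin btop (Md.mball q s)" for q s unfolding mtopology_d[symmetric] by (rule Md.openin_mball)
  have "{x \<in> space S. d (D x) (E x) < r} =
     (\<Union>q\<in>Q. \<Union>s\<in>\<rat>. {x \<in> space S. D x \<in> Md.mball q s} \<inter> {x \<in> space S. E x \<in> Md.mball q (r - s)})"
  proof (intro set_eqI iffI)
    fix x assume "x \<in> {x \<in> space S. d (D x) (E x) < r}"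
    then have x: "x \<in> space S" "d (D x) (E x) < r" by auto
    define e where "e = (r - d (D x) (E x)) / 2"
    have e: "e > 0" using x by (simp add: e_def)
    have "Md.mball (D x) e \<noteq> {}" using Md.centre_in_mball_iff[of "D x" e] Db(1)[OF x(1)] e by blast
    then obtain q where q: "q \<in> Md.mball (D x) e" "q \<in> Q" using Q(3)[OF ball] by blast
    have qb: "q \<in> bundle" using q Q by blast
    have dq: "d q (D x) < e" using q(1) Md.commute by auto
    obtain s where s: "s \<in> \<rat>" "d q (D x) < s" "s < e" using Rats_dense_in_real[OF dq] by blast
    have "d q (E x) \<le> d q (D x) + d (D x) (E x)" by (rule Md.triangle[OF qb Db[OF x(1)]])
    also have "\<dots> < r - s" using s dq by (simp add: e_def field_simps)
    finally show "x \<in> (\<Union>q\<in>Q. \<Union>s\<in>\<rat>. {x \<in> space S. D x \<in> Md.mball q s} \<inter> {x \<in> space S. E x \<in> Md.mball q (r - s)})"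
      using x(1) q(2) qb s Db[OF x(1)] by (auto simp: Md.in_mball)
  next
    fix x assume "x \<in> (\<Union>q\<in>Q. \<Union>s\<in>\<rat>. {x \<in> space S. D x \<in> Md.mball q s} \<inter> {x \<in> space S. E x \<in> Md.mball q (r - s)})"
    then obtain q s where q: "x \<in> space S" "D x \<in> Md.mball q s" "E x \<in> Md.mball q (r - s)" by blast
    then have "d (D x) (E x) \<le> d (D x) q + d q (E x)" by (intro Md.triangle) auto
    also have "\<dots> < r" using q Md.commute[of q "D x"] by (auto simp: Md.in_mball)
    finally show "x \<in> {x \<in> space S. d (D x) (E x) < r}" using q(1) by simp
  qed
  also have "\<dots> \<in> sets S"
    using Q(1) countable_rat by (intro sets.countable_UN'' sets.Int measurable_bborel_open[OF D ball] measurable_bborel_open[OF E ball])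
  finally show "{x \<in> space S. d (D x) (E x) < r} \<in> sets S" .
qed

end

end

section \<open>Weak derivatives on manifolds\<close>

text \<open>Induction over I: each new function passes to a subsequence of the step sizes, along
  which the limits already obtained persist.\<close>

lemma weak_derivative_quotient_AE_finite:
  fixes a h :: "real^'k"
  assumes fin: "finite I" and wd: "\<And>p. p \<in> I \<Longrightarrow> has_weak_derivative_on \<Omega> (fst p) (snd p)"
    and r: "0 < r" "r < R" and sub: "cball a R \<subseteq> \<Omega>"
  shows "\<exists>s :: nat \<Rightarrow> real. (\<forall>n. s n > 0) \<and> s \<longlonglongrightarrow> 0 \<and>
    (\<forall>p\<in>I. AE z in lebesgue. z \<in> cball a r \<longrightarrow> (\<lambda>n. (fst p (z + s n *\<^sub>R h) - fst p z) / s n) \<longlonglongrightarrow> snd p z h)"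
  using fin wd
proof (induction I rule: finite_induct)
    case empty
    show ?case
      by (rule exI[of _ "\<lambda>n. inverse (real (Suc n))"]) (use LIMSEQ_inverse_real_of_nat in auto)
  next
    case (insert p I)
    from insert.IH insert.prems obtain s :: "nat \<Rightarrow> real" where s: "\<And>n. s n > 0" "s \<longlonglongrightarrow> 0"
      "\<And>p. p \<in> I \<Longrightarrow> AE z in lebesgue. z \<in> cball a r \<longrightarrow> (\<lambda>n. (fst p (z + s n *\<^sub>R h) - fst p z) / s n) \<longlonglongrightarrow> snd p z h"
      by blast
    have "has_weak_derivative_on \<Omega> (fst p) (snd p)" using insert.prems[of p] by simp
    from weak_derivative_quotient_AE[OF this r sub s(1,2), where h=h]
    obtain \<rho> :: "nat \<Rightarrow> nat" where \<rho>: "strict_mono \<rho>"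
      "AE z in lebesgue. z \<in> cball a r \<longrightarrow> (\<lambda>n. (fst p (z + s (\<rho> n) *\<^sub>R h) - fst p z) / s (\<rho> n)) \<longlonglongrightarrow> snd p z h"
      by blast
    have sub: "AE z in lebesgue. z \<in> cball a r \<longrightarrow> (\<lambda>n. (fst q (z + s (\<rho> n) *\<^sub>R h) - fst q z) / s (\<rho> n)) \<longlonglongrightarrow> snd q z h"
      if "q \<in> I" for q
      using s(3)[OF that]
    proof (rule eventually_mono, intro impI)
      fix z assume "z \<in> cball a r \<longrightarrow> (\<lambda>n. (fst q (z + s n *\<^sub>R h) - fst q z) / s n) \<longlonglongrightarrow> snd q z h" "z \<in> cball a r"
      then have "(\<lambda>n. (fst q (z + s n *\<^sub>R h) - fst q z) / s n) \<longlonglongrightarrow> snd q z h" by blast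
      from LIMSEQ_subseq_LIMSEQ[OF this \<rho>(1)]
      show "(\<lambda>n. (fst q (z + s (\<rho> n) *\<^sub>R h) - fst q z) / s (\<rho> n)) \<longlonglongrightarrow> snd q z h" by (simp add: o_def)
    qed
    have "(\<lambda>n. s (\<rho> n)) \<longlonglongrightarrow> 0" using LIMSEQ_subseq_LIMSEQ[OF s(2) \<rho>(1)] by (simp add: o_def)
    then show ?case using s(1) \<rho>(2) sub by (intro exI[of _ "\<lambda>n. s (\<rho> n)"]) auto
  qed
text \<open>Difference quotients are controlled only on balls with some room around them. By the
  Lindelof property countably many balls of half the admissible radius cover \<Omega>, so the local
  null sets add up to one.\<close>

lemma AE_open_locally:
  fixes \<Omega> :: "'a::euclidean_space set"
  assumes "open \<Omega>" and P: "\<And>a R. R > 0 \<Longrightarrow> cball a R \<subseteq> \<Omega> \<Longrightarrow> AE z in lebesgue. z \<in> cball a (R / 2) \<longrightarrow> P z"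
  shows "AE z in lebesgue. z \<in> \<Omega> \<longrightarrow> P z"
proof -
  have "\<exists>R>0. cball a R \<subseteq> \<Omega>" if "a \<in> \<Omega>" for a
    using open_contains_cball[THEN iffD1, OF assms(1), rule_format, OF that] .
  then have "\<forall>a\<in>\<Omega>. \<exists>R>0. cball a R \<subseteq> \<Omega>" by blast
  from bchoice[OF this] obtain R where R: "\<And>a. a \<in> \<Omega> \<Longrightarrow> R a > 0" "\<And>a. a \<in> \<Omega> \<Longrightarrow> cball a (R a) \<subseteq> \<Omega>"
    by auto
  have ob: "open b" if "b \<in> (\<lambda>a. ball a (R a / 2)) ` \<Omega>" for b using that by auto
  obtain F where F: "F \<subseteq> (\<lambda>a. ball a (R a / 2)) ` \<Omega>" "countable F" "\<Union>F = \<Union>((\<lambda>a. ball a (R a / 2)) ` \<Omega>)"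
    by (rule Lindelof[OF ob])
  have "countable F \<and> F \<subseteq> (\<lambda>a. ball a (R a / 2)) ` \<Omega>" using F(1,2) by simp
  then obtain C where C: "C \<subseteq> \<Omega>" "countable C" "F = (\<lambda>a. ball a (R a / 2)) ` C"
    unfolding countable_subset_image by (elim exE conjE)
  have "AE z in lebesgue. \<forall>a\<in>C. z \<in> cball a (R a / 2) \<longrightarrow> P z"
  proof (subst AE_ball_countable[OF C(2)], rule ballI)
    fix a assume "a \<in> C"
    then have "a \<in> \<Omega>" by (rule subsetD[OF C(1)])
    then show "AE z in lebesgue. z \<in> cball a (R a / 2) \<longrightarrow> P z" by (intro P R)
  qed
  then show ?thesis
  proof (rule eventually_mono, intro impI)
    fix z assume z: "\<forall>a\<in>C. z \<in> cball a (R a / 2) \<longrightarrow> P z" "z \<in> \<Omega>"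
    have "z \<in> ball z (R z / 2)" using R(1)[OF z(2)] by simp
    then have "z \<in> \<Union>F" unfolding F(3) using z(2) by blast
    then obtain a where "a \<in> C" "z \<in> ball a (R a / 2)" unfolding C(3) by blast
    then have "z \<in> cball a (R a / 2)" using ball_subset_cball by blast
    then show "P z" using z(1) \<open>a \<in> C\<close> by blast
  qed
qed

text \<open>The chain rule along a sequence instead of a curve: it suffices that the rescaled
  increments of Z converge, whatever path the points take. The increments of u o cinv have no
  further structure.\<close>

lemma has_derivative_sequence:
  fixes g :: "'a::real_normed_vector \<Rightarrow> real"
  assumes g: "(g has_derivative D) (at z)" and t: "\<And>n. t n > 0" "t \<longlonglongrightarrow> 0"
    and k: "(\<lambda>n. (Z n - z) /\<^sub>R t n) \<longlonglongrightarrow> k"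
  shows "(\<lambda>n. (g (Z n) - g z) / t n) \<longlonglongrightarrow> D k"
proof -
  have D: "bounded_linear D" using g by (rule has_derivative_bounded_linear)
  \<comment> \<open>The relative remainder. Division by zero gives e 0 = 0, so differentiability of
    g says precisely that e is continuous at 0.\<close>
  define e where "e h = norm (g (z + h) - g z - D h) / norm h" for h
  have "isCont e 0" using g unfolding has_derivative_at isCont_def e_def by simp
  have "(\<lambda>n. t n *\<^sub>R ((Z n - z) /\<^sub>R t n)) \<longlonglongrightarrow> 0 *\<^sub>R k" by (intro tendsto_intros t k)
  moreover have "t n *\<^sub>R ((Z n - z) /\<^sub>R t n) = Z n - z" for n using t(1)[of n] by simp
  ultimately have "(\<lambda>n. Z n - z) \<longlonglongrightarrow> 0" by simp
  from isCont_tendsto_compose[OF \<open>isCont e 0\<close> this] have e: "(\<lambda>n. e (Z n - z)) \<longlonglongrightarrow> 0" by (simp add: e_def)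
  have nrm: "norm (g (Z n) - g z - D (Z n - z)) = e (Z n - z) * norm (Z n - z)" for n
    by (cases "Z n = z") (simp_all add: e_def linear_0[OF bounded_linear.linear[OF D]])
  have "(\<lambda>n. (g (Z n) - g z) / t n - D ((Z n - z) /\<^sub>R t n)) \<longlonglongrightarrow> 0"
  proof (rule Lim_null_comparison)
    show "\<forall>\<^sub>F n in sequentially. norm ((g (Z n) - g z) / t n - D ((Z n - z) /\<^sub>R t n)) \<le> e (Z n - z) * norm ((Z n - z) /\<^sub>R t n)"
    proof (rule always_eventually, rule allI)
      fix n
      have "(g (Z n) - g z) / t n - D ((Z n - z) /\<^sub>R t n) = (g (Z n) - g z - D (Z n - z)) /\<^sub>R t n"
        unfolding linear_cmul[OF bounded_linear.linear[OF D]] by (simp add: divide_inverse algebra_simps)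
      then show "norm ((g (Z n) - g z) / t n - D ((Z n - z) /\<^sub>R t n)) \<le> e (Z n - z) * norm ((Z n - z) /\<^sub>R t n)"
        using nrm[of n] by (simp only: norm_scaleR) (simp add: mult_ac)
    qed
    have "(\<lambda>n. e (Z n - z) * norm ((Z n - z) /\<^sub>R t n)) \<longlonglongrightarrow> 0 * norm k" by (intro tendsto_intros e k)
    then show "(\<lambda>n. e (Z n - z) * norm ((Z n - z) /\<^sub>R t n)) \<longlonglongrightarrow> 0" by simp
  qed
  moreover have "(\<lambda>n. D ((Z n - z) /\<^sub>R t n)) \<longlonglongrightarrow> D k" by (rule bounded_linear.tendsto[OF D k])
  ultimately have "(\<lambda>n. ((g (Z n) - g z) / t n - D ((Z n - z) /\<^sub>R t n)) + D ((Z n - z) /\<^sub>R t n)) \<longlonglongrightarrow> 0 + D k"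
    by (rule tendsto_add)
  then show ?thesis by simp
qed

context C1_manifold begin

lemma has_weak_derivativeD:
  assumes "has_weak_derivative A w \<omega>" "c \<in> A"
  shows "has_weak_derivative_on (cmap c ` cdom c) (w \<circ> cinv c) (\<lambda>z h. \<omega> (cinv c z) (tvec_of A c (cinv c z) h))"
  using assms unfolding has_weak_derivative_def by blast

lemma has_weak_derivative_linear:
  assumes w: "has_weak_derivative A w \<omega>" and c: "c \<in> A" "x \<in> cdom c"
  shows "linear (\<lambda>h. \<omega> x (tvec_of A c x h))"
proof -
  have "\<forall>z\<in>cmap c ` cdom c. linear (\<lambda>h. \<omega> (cinv c z) (tvec_of A c (cinv c z) h))"
    using has_weak_derivativeD[OF w c(1)] unfolding has_weak_derivative_on_def by blast
  from bspec[OF this imageI[OF c(2)]] show ?thesis by (simp only: cinv_cmap[OF c])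
qed

text \<open>The functions \<open>F i / \<eta>\<close> are local coordinates around \<open>y\<close>. Since \<open>\<eta>\<close> vanishes outside the chart, the
  convergence of the difference quotients of \<open>\<eta>\<close> already forces \<open>Y n\<close> into the chart; no continuity
  of \<open>Y\<close> is needed.\<close>

lemma quotient_local_coordinates:
  assumes c: "c \<in> A" "y \<in> cdom c"
    and \<eta>: "\<eta> y = 1" "\<And>x. \<eta> x \<noteq> (0::real) \<Longrightarrow> x \<in> cdom c" and F: "\<And>x i. x \<in> cdom c \<Longrightarrow> F i x = \<eta> x * cmap c x $ i"
    and f: "C1_fun A f" and t: "\<And>n. t n > 0" "t \<longlonglongrightarrow> 0"
    and b: "(\<lambda>n. (\<eta> (Y n) - \<eta> y) / t n) \<longlonglongrightarrow> b" and a: "\<And>i. (\<lambda>n. (F i (Y n) - F i y) / t n) \<longlonglongrightarrow> a i"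
    and l: "(\<lambda>n. (f (Y n) - f y) / t n) \<longlonglongrightarrow> l"
  shows "l = frechet_derivative (f \<circ> cinv c) (at (cmap c y)) (\<chi> i. a i - F i y * b)"
proof -
  have "(\<lambda>n. t n * ((\<eta> (Y n) - \<eta> y) / t n)) \<longlonglongrightarrow> 0 * b" by (intro tendsto_intros t b)
  moreover have "t n * ((\<eta> (Y n) - \<eta> y) / t n) = \<eta> (Y n) - 1" for n using t(1)[of n] \<eta>(1) by simp
  ultimately have "(\<lambda>n. \<eta> (Y n) - 1) \<longlonglongrightarrow> 0" by simp
  then have \<eta>lim: "(\<lambda>n. \<eta> (Y n)) \<longlonglongrightarrow> 1" by (simp add: LIM_zero_iff)
  have ev: "\<forall>\<^sub>F n in sequentially. \<eta> (Y n) > 0" by (rule order_tendstoD(1)[OF \<eta>lim]) simp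
  let ?Z = "\<lambda>n. cmap c (Y n)" let ?z = "cmap c y"
  have Fy: "F i y = ?z $ i" for i using F[OF c(2)] \<eta>(1) by simp
  have "(\<lambda>n. (?Z n - ?z) /\<^sub>R t n) \<longlonglongrightarrow> (\<chi> i. a i - F i y * b)"
  proof (rule vec_tendstoI)
    fix i
    \<comment> \<open>The quotient rule for F i / \<eta> at y, where the value of \<eta> is
      1.\<close>
    have "(\<lambda>n. ((F i (Y n) - F i y) / t n - F i y * ((\<eta> (Y n) - \<eta> y) / t n)) / \<eta> (Y n)) \<longlonglongrightarrow> (a i - F i y * b) / 1"
      by (intro tendsto_intros a b \<eta>lim) simp
    moreover have "\<forall>\<^sub>F n in sequentially. ((F i (Y n) - F i y) / t n - F i y * ((\<eta> (Y n) - \<eta> y) / t n)) / \<eta> (Y n) = ((?Z n - ?z) /\<^sub>R t n) $ i"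
      using ev
    proof eventually_elim
      case (elim n)
      then have "Y n \<in> cdom c" using \<eta>(2)[of "Y n"] by simp
      then have "F i (Y n) = \<eta> (Y n) * ?Z n $ i" by (rule F)
      then show ?case using elim t(1)[of n] unfolding Fy \<eta>(1) by (simp add: field_simps)
    qed
    ultimately have "(\<lambda>n. ((?Z n - ?z) /\<^sub>R t n) $ i) \<longlonglongrightarrow> (a i - F i y * b) / 1"
      by (rule Lim_transform_eventually)
    then show "(\<lambda>n. ((?Z n - ?z) /\<^sub>R t n) $ i) \<longlonglongrightarrow> (\<chi> i. a i - F i y * b) $ i" by simp
  qed
  from has_derivative_sequence[OF C1_fun_has_derivative[OF f c] t this]
  have "(\<lambda>n. ((f \<circ> cinv c) (?Z n) - (f \<circ> cinv c) ?z) / t n) \<longlonglongrightarrow> frechet_derivative (f \<circ> cinv c) (at ?z) (\<chi> i. a i - F i y * b)" .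
  moreover have "\<forall>\<^sub>F n in sequentially. ((f \<circ> cinv c) (?Z n) - (f \<circ> cinv c) ?z) / t n = (f (Y n) - f y) / t n"
    using ev
  proof eventually_elim
    case (elim n)
    then have "Y n \<in> cdom c" using \<eta>(2)[of "Y n"] by simp
    then show ?case using c by simp
  qed
  ultimately have "(\<lambda>n. (f (Y n) - f y) / t n) \<longlonglongrightarrow> frechet_derivative (f \<circ> cinv c) (at ?z) (\<chi> i. a i - F i y * b)"
    by (rule Lim_transform_eventually)
  then show ?thesis using l LIMSEQ_unique by blast
qed

lemma linear_eq_axis:
  fixes p q :: "real^'k \<Rightarrow> 'z::real_vector"
  assumes "linear p" "linear q" "\<And>j. p (axis j 1) = q (axis j 1)" shows "p h = q h"
proof -
  have e: "h = (\<Sum>i\<in>UNIV. h $ i *\<^sub>R axis i 1)" using basis_expansion[of h] by (simp add: scalar_mult_eq_scaleR)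
  show ?thesis by (subst (1 2) e) (simp only: linear_sum[OF assms(1)] linear_sum[OF assms(2)] linear_cmul[OF assms(1)] linear_cmul[OF assms(2)] assms(3))
qed

text \<open>Both derivatives are limits of the same difference quotients along a common sequence of
  step sizes. By linearity the coordinate directions suffice, so only finitely many exceptional null
  sets arise in a chart.\<close>

lemma weak_derivative_unique:
  assumes w: "has_weak_derivative A w \<omega>" and w': "has_weak_derivative A w \<omega>'"
  shows "AE_manifold A (\<lambda>x. \<forall>v\<in>tangent_space A x. \<omega> x v = \<omega>' x v)"
  unfolding AE_manifold_iff
proof
  fix c assume c: "c \<in> A"
  let ?\<Omega> = "cmap c ` cdom c"
  let ?w = "\<lambda>z h. \<omega> (cinv c z) (tvec_of A c (cinv c z) h)" let ?w' = "\<lambda>z h. \<omega>' (cinv c z) (tvec_of A c (cinv c z) h)"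
  have ax: "AE z in lebesgue. z \<in> ?\<Omega> \<longrightarrow> ?w z h = ?w' z h" for h
  proof (rule AE_open_locally[OF open_cimage[OF c]])
    fix a :: "real^'k" and R :: real assume R: "R > 0" "cball a R \<subseteq> ?\<Omega>"
    have r: "0 < R / 2" "R / 2 < R" using R by auto
    define I where "I = {(w \<circ> cinv c, ?w), (w \<circ> cinv c, ?w')}"
    have "has_weak_derivative_on ?\<Omega> (fst p) (snd p)" if "p \<in> I" for p
      using that has_weak_derivativeD[OF w c] has_weak_derivativeD[OF w' c]
      unfolding I_def by (elim insertE emptyE) (simp_all only: fst_conv snd_conv)
    moreover have "finite I" by (simp add: I_def)
    ultimately have "\<exists>s :: nat \<Rightarrow> real. (\<forall>n. s n > 0) \<and> s \<longlonglongrightarrow> 0 \<and>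
      (\<forall>p\<in>I. AE z in lebesgue. z \<in> cball a (R / 2) \<longrightarrow> (\<lambda>n. (fst p (z + s n *\<^sub>R h) - fst p z) / s n) \<longlonglongrightarrow> snd p z h)"
      by (intro weak_derivative_quotient_AE_finite[OF _ _ r R(2)])
    then obtain s :: "nat \<Rightarrow> real" where s: "\<forall>p\<in>I. AE z in lebesgue. z \<in> cball a (R / 2) \<longrightarrow>
       (\<lambda>n. (fst p (z + s n *\<^sub>R h) - fst p z) / s n) \<longlonglongrightarrow> snd p z h"
      by iprover
    have mem: "(w \<circ> cinv c, ?w) \<in> I" "(w \<circ> cinv c, ?w') \<in> I" by (simp_all add: I_def)
    have "AE z in lebesgue. z \<in> cball a (R / 2) \<longrightarrow> (\<lambda>n. ((w \<circ> cinv c) (z + s n *\<^sub>R h) - (w \<circ> cinv c) z) / s n) \<longlonglongrightarrow> ?w z h"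
      "AE z in lebesgue. z \<in> cball a (R / 2) \<longrightarrow> (\<lambda>n. ((w \<circ> cinv c) (z + s n *\<^sub>R h) - (w \<circ> cinv c) z) / s n) \<longlonglongrightarrow> ?w' z h"
      using s[rule_format, OF mem(1)] s[rule_format, OF mem(2)] by (simp_all only: fst_conv snd_conv)
    then show "AE z in lebesgue. z \<in> cball a (R / 2) \<longrightarrow> ?w z h = ?w' z h"
      by (rule eventually_elim2) (intro impI, rule LIMSEQ_unique, simp_all only: simp_thms)
  qed
  have "AE z in lebesgue. \<forall>j\<in>(UNIV::'k set). z \<in> ?\<Omega> \<longrightarrow> ?w z (axis j 1) = ?w' z (axis j 1)"
    using ax by (subst AE_ball_countable) (auto simp: countable_finite)
  then show "AE z in lebesgue. z \<in> ?\<Omega> \<longrightarrow> (\<forall>v\<in>tangent_space A (cinv c z). \<omega> (cinv c z) v = \<omega>' (cinv c z) v)"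
  proof (rule eventually_mono, intro impI ballI)
    fix z v assume z: "\<forall>j\<in>UNIV. z \<in> ?\<Omega> \<longrightarrow> ?w z (axis j 1) = ?w' z (axis j 1)" "z \<in> ?\<Omega>" and v: "v \<in> tangent_space A (cinv c z)"
    have x: "cinv c z \<in> cdom c" by (rule cinv_in[OF c z(2)])
    have "?w z (v c) = ?w' z (v c)"
      by (rule linear_eq_axis[OF has_weak_derivative_linear[OF w c x] has_weak_derivative_linear[OF w' c x]]) (use z in blast)
    then show "\<omega> (cinv c z) v = \<omega>' (cinv c z) v" by (simp only: tvec_of_coordinates[OF v c x])
  qed
qed

text \<open>The data of \<open>local_coordinates\<close>, indexed by natural numbers so that every
  point has a first index whose set V contains it.\<close>

lemma countable_coordinate_cover:
  obtains C :: "nat \<Rightarrow> ('m, 'k) chart" and V \<eta> F where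
    "\<And>j. C j \<in> A" "\<And>j. open (V j)" "\<And>j. V j \<subseteq> cdom (C j)" "(\<Union>j::nat. V j) = UNIV"
    "\<And>j. \<eta> j \<in> C1_compact_support A" "\<And>j i. F j i \<in> C1_compact_support A"
    "\<And>j x. x \<in> V j \<Longrightarrow> \<eta> j x = 1" "\<And>j x. \<eta> j x \<noteq> 0 \<Longrightarrow> x \<in> cdom (C j)"
    "\<And>j x i. x \<in> cdom (C j) \<Longrightarrow> F j i x = \<eta> j x * cmap (C j) x $ i"
proof -
  define good where "good y p \<longleftrightarrow> (case p of (c, V, \<eta>, F) \<Rightarrow> c \<in> A \<and> open V \<and> y \<in> V \<and> V \<subseteq> cdom c \<and>
     \<eta> \<in> C1_compact_support A \<and> (\<forall>i. F i \<in> C1_compact_support A) \<and> (\<forall>x\<in>V. \<eta> x = 1) \<and> (\<forall>x. \<eta> x \<noteq> 0 \<longrightarrow> x \<in> cdom c) \<and>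
     (\<forall>x\<in>cdom c. \<forall>i. F i x = \<eta> x * cmap c x $ i))"
    for y and p :: "('m, 'k) chart \<times> 'm set \<times> ('m \<Rightarrow> real) \<times> ('k \<Rightarrow> 'm \<Rightarrow> real)"
  have "\<exists>p. good y p" for y
  proof -
    obtain c where c: "c \<in> A" "y \<in> cdom c" by (rule obtain_chart)
    show ?thesis
    proof (rule local_coordinates[OF c])
      fix V \<eta> F assume "open V" "y \<in> V" "V \<subseteq> cdom c" "\<eta> \<in> C1_compact_support A"
        "\<And>i. F i \<in> C1_compact_support A" "\<And>x. x \<in> V \<Longrightarrow> \<eta> x = 1" "\<And>x. \<eta> x \<noteq> 0 \<Longrightarrow> x \<in> cdom c"
        "\<And>x i. x \<in> cdom c \<Longrightarrow> F i x = \<eta> x * cmap c x $ i"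
      then have "good y (c, V, \<eta>, F)" unfolding good_def prod.case using c(1) by (intro conjI allI ballI impI)
      then show "\<exists>p. good y p" ..
    qed
  qed
  then obtain p where p: "\<And>y. good y (p y)" by metis
  let ?V = "\<lambda>y. fst (snd (p y))"
  have V: "open (?V y)" "y \<in> ?V y" for y using p[of y] unfolding good_def by (simp_all add: case_prod_beta)
  have oV: "open b" if "b \<in> range ?V" for b using that V(1) by auto
  obtain G where G: "G \<subseteq> range ?V" "countable G" "\<Union>G = \<Union>(range ?V)"
    by (rule Lindelof[OF oV])
  have "countable G \<and> G \<subseteq> range ?V" using G(1,2) by simp
  then obtain Y where Y: "countable Y" "G = ?V ` Y"
    unfolding countable_subset_image by (elim exE conjE)
  have U: "(\<Union>y\<in>Y. ?V y) = UNIV" using G(3) Y(2) V(2) by blast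
  have "Y \<noteq> {}" using U by auto
  define q where "q j = p (from_nat_into Y j)" for j
  have g: "good (from_nat_into Y j) (q j)" for j unfolding q_def by (rule p)
  have UV: "(\<Union>j. fst (snd (q j))) = UNIV"
  proof -
    have "(\<Union>y\<in>range (from_nat_into Y). ?V y) = UNIV"
      unfolding range_from_nat_into[OF \<open>Y \<noteq> {}\<close> Y(1)] by (rule U)
    then show ?thesis unfolding q_def by (simp only: image_image)
  qed
  show ?thesis
    by (rule that[of "\<lambda>j. fst (q j)" "\<lambda>j. fst (snd (q j))" "\<lambda>j. fst (snd (snd (q j)))" "\<lambda>j. snd (snd (snd (q j)))"])
       (use g UV in \<open>simp_all add: good_def case_prod_beta\<close>)
qed

end

section \<open>Weak derivatives under changes on null sets\<close>

lemma set_lebesgue_integral_cong_test: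
  fixes f g \<psi> :: "real^'k \<Rightarrow> real"
  assumes f: "locally_integrable_on \<Omega> f" and g: "locally_integrable_on \<Omega> g"
    and eq: "AE z in lebesgue. z \<in> \<Omega> \<longrightarrow> f z = g z"
    and \<psi>: "\<psi> \<in> borel_measurable lebesgue" and K: "compact K" "K \<subseteq> \<Omega>" "\<And>z. z \<notin> K \<Longrightarrow> \<psi> z = 0"
  shows "(LINT z:\<Omega>|lebesgue. f z * \<psi> z) = (LINT z:\<Omega>|lebesgue. g z * \<psi> z)"
proof -
  have r: "(\<lambda>z. indicator \<Omega> z *\<^sub>R (F z * \<psi> z)) = (\<lambda>z. (indicator K z *\<^sub>R F z) * \<psi> z)" for F :: "real^'k \<Rightarrow> real"
    using K(2,3) by (fastforce simp: fun_eq_iff indicator_def)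
  have m: "(\<lambda>z. indicator K z *\<^sub>R F z) \<in> borel_measurable lebesgue" if "locally_integrable_on \<Omega> F" for F :: "real^'k \<Rightarrow> real"
    using that K(1,2) unfolding locally_integrable_on_def set_integrable_def by (meson borel_measurable_integrable)
  show ?thesis
    unfolding set_lebesgue_integral_def r
  proof (rule integral_cong_AE)
    show "(\<lambda>z. (indicator K z *\<^sub>R f z) * \<psi> z) \<in> borel_measurable lebesgue"
      by (rule borel_measurable_times[OF m[OF f] \<psi>])
    show "(\<lambda>z. (indicator K z *\<^sub>R g z) * \<psi> z) \<in> borel_measurable lebesgue"
      by (rule borel_measurable_times[OF m[OF g] \<psi>])
    show "AE z in lebesgue. (indicator K z *\<^sub>R f z) * \<psi> z = (indicator K z *\<^sub>R g z) * \<psi> z"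
      using eq by (rule eventually_mono) (use K(2) in \<open>auto simp: indicator_def\<close>)
  qed
qed

lemma has_weak_derivative_on_cong_AE:
  fixes f g :: "real^'k \<Rightarrow> real"
  assumes f: "has_weak_derivative_on \<Omega> f f'" and eq: "AE z in lebesgue. z \<in> \<Omega> \<longrightarrow> f z = g z"
  shows "has_weak_derivative_on \<Omega> g f'"
proof -
  obtain N where N: "N \<in> null_sets lebesgue" "{z. \<not> (z \<in> \<Omega> \<longrightarrow> f z = g z)} \<subseteq> N"
    using eq by (auto simp: eventually_ae_filter)
  have fl: "locally_integrable_on \<Omega> f" using f by (simp add: has_weak_derivative_on_def)
  have gl: "locally_integrable_on \<Omega> g"
    unfolding locally_integrable_on_def
  proof (intro allI impI)
    fix K assume K: "compact K \<and> K \<subseteq> \<Omega>"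
    then have "f absolutely_integrable_on K" using fl by (simp add: locally_integrable_on_def)
    then show "g absolutely_integrable_on K"
      by (rule absolutely_integrable_spike[of _ _ N]) (use N K in \<open>auto simp: negligible_iff_null_sets\<close>)
  qed
  have "(LINT z:\<Omega>|lebesgue. g z * frechet_derivative \<phi> (at z) h) = - (LINT z:\<Omega>|lebesgue. f' z h * \<phi> z)"
    if \<phi>: "C1_on UNIV \<phi>" "compact (closure {z. \<phi> z \<noteq> 0})" "closure {z. \<phi> z \<noteq> 0} \<subseteq> \<Omega>" for \<phi> :: "real^'k \<Rightarrow> real" and h
  proof -
    have "(LINT z:\<Omega>|lebesgue. f z * frechet_derivative \<phi> (at z) h) = (LINT z:\<Omega>|lebesgue. g z * frechet_derivative \<phi> (at z) h)"
    proof (rule set_lebesgue_integral_cong_test[OF fl gl eq _ \<phi>(2,3)])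
      show "(\<lambda>z. frechet_derivative \<phi> (at z) h) \<in> borel_measurable lebesgue"
        by (rule continuous_imp_borel_measurable_lebesgue[OF C1_on_frechet_continuous[OF \<phi>(1)]])
      fix z assume z: "z \<notin> closure {z. \<phi> z \<noteq> 0}"
      have "(\<phi> has_derivative (\<lambda>h. 0)) (at z)"
      proof (rule has_derivative_transform_within_open[of "\<lambda>_. 0"])
        show "open (- closure {z. \<phi> z \<noteq> 0})" by auto
        show "0 = \<phi> x" if "x \<in> - closure {z. \<phi> z \<noteq> 0}" for x
          using that closure_subset[of "{z. \<phi> z \<noteq> 0}"] by auto
      qed (use z in auto)
      from frechet_derivative_at[OF this] show "frechet_derivative \<phi> (at z) h = 0" by metis
    qed
    moreover have "(LINT z:\<Omega>|lebesgue. f z * frechet_derivative \<phi> (at z) h) = - (LINT z:\<Omega>|lebesgue. f' z h * \<phi> z)"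
      using f \<phi> unfolding has_weak_derivative_on_def by blast
    ultimately show ?thesis by simp
  qed
  then show ?thesis using f gl unfolding has_weak_derivative_on_def by blast
qed

lemma (in C1_manifold) has_weak_derivative_cong_AE:
  assumes w: "has_weak_derivative A w \<omega>" and eq: "AE_manifold A (\<lambda>x. w x = w' x)"
  shows "has_weak_derivative A w' \<omega>"
  unfolding has_weak_derivative_def
proof
  fix c assume c: "c \<in> A"
  show "has_weak_derivative_on (cmap c ` cdom c) (w' \<circ> cinv c) (\<lambda>z h. \<omega> (cinv c z) (tvec_of A c (cinv c z) h))"
    by (rule has_weak_derivative_on_cong_AE[OF has_weak_derivativeD[OF w c]])
       (use eq c in \<open>simp add: AE_manifold_iff\<close>)
qed

section \<open>Existence and uniqueness of the colocal weak derivative\<close>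

context riemannian_pair begin

text \<open>The chain rule for a merely measurable u. At almost every point the quotients of \<eta>
  o u, of all F i o u and of f o u converge along one sequence of step sizes, and
  \<open>quotient_local_coordinates\<close> expresses the last limit by the others. The term with
  \<open>\<omega>\<eta>\<close> stems from the quotient rule.\<close>

lemma weak_derivative_local_coordinates:
  assumes c': "c' \<in> B"
    and \<eta>: "\<And>y. y \<in> V \<Longrightarrow> \<eta> y = 1" "\<And>y. \<eta> y \<noteq> (0::real) \<Longrightarrow> y \<in> cdom c'" and F: "\<And>y i. y \<in> cdom c' \<Longrightarrow> F i y = \<eta> y * cmap c' y $ i"
    and V: "V \<subseteq> cdom c'"
    and f: "C1_fun B f"
    and \<omega>\<eta>: "has_weak_derivative A (\<eta> \<circ> u) \<omega>\<eta>" and \<omega>F: "\<And>i. has_weak_derivative A (F i \<circ> u) (\<omega>F i)" and \<omega>: "has_weak_derivative A (f \<circ> u) \<omega>"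
  shows "AE_manifold A (\<lambda>x. u x \<in> V \<longrightarrow> (\<forall>v\<in>tangent_space A x.
    \<omega> x v = frechet_derivative (f \<circ> cinv c') (at (cmap c' (u x))) (\<chi> i. \<omega>F i x v - F i (u x) * \<omega>\<eta> x v)))"
  unfolding M.AE_manifold_iff
proof
  fix c assume c: "c \<in> A"
  let ?\<Omega> = "cmap c ` cdom c"
  let ?W = "\<lambda>\<omega> z h. \<omega> (cinv c z) (tvec_of A c (cinv c z) h) :: real"
  let ?D = "\<lambda>x. frechet_derivative (f \<circ> cinv c') (at (cmap c' (u x)))"
  let ?rhs = "\<lambda>z h. ?D (cinv c z) (\<chi> i. ?W (\<omega>F i) z h - F i (u (cinv c z)) * ?W \<omega>\<eta> z h)"
  have ax: "AE z in lebesgue. z \<in> ?\<Omega> \<longrightarrow> u (cinv c z) \<in> V \<longrightarrow> ?W \<omega> z h = ?rhs z h" for h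
  proof (rule AE_open_locally[OF M.open_cimage[OF c]])
    fix a :: "real^'k" and R :: real assume R: "R > 0" "cball a R \<subseteq> ?\<Omega>"
    have r: "0 < R / 2" "R / 2 < R" using R by auto
    define I where "I = insert (\<eta> \<circ> u \<circ> cinv c, ?W \<omega>\<eta>) (insert (f \<circ> u \<circ> cinv c, ?W \<omega>) (range (\<lambda>i. (F i \<circ> u \<circ> cinv c, ?W (\<omega>F i)))))"
    have fin: "finite I" unfolding I_def by simp
    have wdI: "has_weak_derivative_on ?\<Omega> (fst p) (snd p)" if "p \<in> I" for p
      using that M.has_weak_derivativeD[OF \<omega>\<eta> c] M.has_weak_derivativeD[OF \<omega> c] M.has_weak_derivativeD[OF \<omega>F c]
      unfolding I_def by (elim insertE rangeE) (simp_all only: fst_conv snd_conv)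
    have "\<exists>s :: nat \<Rightarrow> real. (\<forall>n. s n > 0) \<and> s \<longlonglongrightarrow> 0 \<and>
      (\<forall>p\<in>I. AE z in lebesgue. z \<in> cball a (R / 2) \<longrightarrow> (\<lambda>n. (fst p (z + s n *\<^sub>R h) - fst p z) / s n) \<longlonglongrightarrow> snd p z h)"
      by (intro weak_derivative_quotient_AE_finite[OF fin _ r R(2)] wdI)
    then obtain s :: "nat \<Rightarrow> real" where s00: "\<forall>n. s n > 0" "s \<longlonglongrightarrow> 0" and s': "\<forall>p\<in>I. AE z in lebesgue. z \<in> cball a (R / 2) \<longrightarrow>
       (\<lambda>n. (fst p (z + s n *\<^sub>R h) - fst p z) / s n) \<longlonglongrightarrow> snd p z h"
      by (elim exE conjE)
    note s0 = s00(1)[rule_format] s00(2)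
    have mem: "(\<eta> \<circ> u \<circ> cinv c, ?W \<omega>\<eta>) \<in> I" "(f \<circ> u \<circ> cinv c, ?W \<omega>) \<in> I" "(F i \<circ> u \<circ> cinv c, ?W (\<omega>F i)) \<in> I" for i
      unfolding I_def by blast+
    have A1: "AE z in lebesgue. \<forall>i\<in>UNIV. z \<in> cball a (R / 2) \<longrightarrow> (\<lambda>n. ((F i \<circ> u \<circ> cinv c) (z + s n *\<^sub>R h) - (F i \<circ> u \<circ> cinv c) z) / s n) \<longlonglongrightarrow> ?W (\<omega>F i) z h"
      using s'[rule_format, OF mem(3), unfolded fst_conv snd_conv] by (subst AE_ball_countable) (simp_all add: countable_finite)
    show "AE z in lebesgue. z \<in> cball a (R / 2) \<longrightarrow> u (cinv c z) \<in> V \<longrightarrow> ?W \<omega> z h = ?rhs z h"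
      using A1 s'[rule_format, OF mem(1), unfolded fst_conv snd_conv] s'[rule_format, OF mem(2), unfolded fst_conv snd_conv]
    proof (eventually_elim, intro impI)
      fix z
      assume 1: "\<forall>i\<in>UNIV. z \<in> cball a (R / 2) \<longrightarrow> (\<lambda>n. ((F i \<circ> u \<circ> cinv c) (z + s n *\<^sub>R h) - (F i \<circ> u \<circ> cinv c) z) / s n) \<longlonglongrightarrow> ?W (\<omega>F i) z h"
        and 2: "z \<in> cball a (R / 2) \<longrightarrow> (\<lambda>n. ((\<eta> \<circ> u \<circ> cinv c) (z + s n *\<^sub>R h) - (\<eta> \<circ> u \<circ> cinv c) z) / s n) \<longlonglongrightarrow> ?W \<omega>\<eta> z h"
        and 3: "z \<in> cball a (R / 2) \<longrightarrow> (\<lambda>n. ((f \<circ> u \<circ> cinv c) (z + s n *\<^sub>R h) - (f \<circ> u \<circ> cinv c) z) / s n) \<longlonglongrightarrow> ?W \<omega> z h"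
        and z: "z \<in> cball a (R / 2)" and y: "u (cinv c z) \<in> V"
      have yc: "u (cinv c z) \<in> cdom c'" using y V by blast
      show "?W \<omega> z h = ?rhs z h"
        by (rule N.quotient_local_coordinates[OF c' yc \<eta>(1)[OF y] \<eta>(2) F f s0, where Y="\<lambda>n. u (cinv c (z + s n *\<^sub>R h))"])
           (use 1 2 3 z in \<open>simp_all only: o_def simp_thms ball_UNIV\<close>)
    qed
  qed
  have "AE z in lebesgue. \<forall>j\<in>(UNIV::'k set). z \<in> ?\<Omega> \<longrightarrow> u (cinv c z) \<in> V \<longrightarrow> ?W \<omega> z (axis j 1) = ?rhs z (axis j 1)"
    using ax by (subst AE_ball_countable) (simp_all add: countable_finite)
  then show "AE z in lebesgue. z \<in> ?\<Omega> \<longrightarrow> u (cinv c z) \<in> V \<longrightarrow> (\<forall>v\<in>tangent_space A (cinv c z).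
    \<omega> (cinv c z) v = ?D (cinv c z) (\<chi> i. \<omega>F i (cinv c z) v - F i (u (cinv c z)) * \<omega>\<eta> (cinv c z) v))"
  proof (rule eventually_mono, intro impI ballI)
    fix z v assume z: "\<forall>j\<in>(UNIV::'k set). z \<in> ?\<Omega> \<longrightarrow> u (cinv c z) \<in> V \<longrightarrow> ?W \<omega> z (axis j 1) = ?rhs z (axis j 1)"
      "z \<in> ?\<Omega>" "u (cinv c z) \<in> V" and v: "v \<in> tangent_space A (cinv c z)"
    have x: "cinv c z \<in> cdom c" by (rule M.cinv_in[OF c z(2)])
    have y: "u (cinv c z) \<in> cdom c'" using z(3) V by blast
    note l1 = M.has_weak_derivative_linear[OF \<omega>\<eta> c x] and l2 = M.has_weak_derivative_linear[OF \<omega>F c x]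
    have "linear (\<lambda>h. \<chi> i. ?W (\<omega>F i) z h - F i (u (cinv c z)) * ?W \<omega>\<eta> z h)"
      by (rule linearI) (simp_all add: vec_eq_iff linear_add[OF l1] linear_add[OF l2] linear_cmul[OF l1] linear_cmul[OF l2] algebra_simps)
    from linear_compose[OF this has_derivative_linear[OF N.C1_fun_has_derivative[OF f c' y]]]
    have "linear (?rhs z)" by (simp add: o_def)
    then have "?W \<omega> z (v c) = ?rhs z (v c)"
      by (rule M.linear_eq_axis[OF M.has_weak_derivative_linear[OF \<omega> c x]]) (use z in blast)
    then show "\<omega> (cinv c z) v = ?D (cinv c z) (\<chi> i. \<omega>F i (cinv c z) v - F i (u (cinv c z)) * \<omega>\<eta> (cinv c z) v)"
      by (simp only: M.tvec_of_coordinates[OF v c x])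
  qed
qed

end

text \<open>Integrability on a compact set includes measurability there; an exhaustion of \<Omega>
  by compact sets passes it on.\<close>

lemma locally_integrable_on_measurable:
  fixes f :: "real^'k \<Rightarrow> real"
  assumes "open \<Omega>" and f: "locally_integrable_on \<Omega> f"
  shows "f \<in> borel_measurable (lebesgue_on \<Omega>)"
proof -
  obtain C :: "nat \<Rightarrow> (real^'k) set" where C: "\<And>n. compact (C n)" "\<And>n. C n \<subseteq> \<Omega>" "\<And>n. C n \<subseteq> interior (C (Suc n))" "\<Union>(range C) = \<Omega>"
    using open_Union_compact_subsets[OF assms(1)] by metis
  have \<Omega>: "\<Omega> \<in> sets lebesgue" using assms(1) by (simp add: borel_open)
  have mono: "C m \<subseteq> C n" if "m \<le> n" for m n
    using that by (rule lift_Suc_mono_le[of C, rotated]) (use C(3) interior_subset in fast)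
  have m: "(\<lambda>z. indicator (C n) z *\<^sub>R f z) \<in> borel_measurable lebesgue" for n
    using f C(1,2)[of n] unfolding locally_integrable_on_def set_integrable_def by (intro borel_measurable_integrable) simp
  show ?thesis
  proof (rule borel_measurable_LIMSEQ_real)
    show "(\<lambda>z. indicator (C n) z *\<^sub>R f z) \<in> borel_measurable (lebesgue_on \<Omega>)" for n
      by (rule measurable_restrict_space1[OF m])
    fix z assume "z \<in> space (lebesgue_on \<Omega>)"
    then have "z \<in> \<Omega>" by (simp add: space_restrict_space)
    then obtain N where N: "z \<in> C N" using C(4) by auto
    have "indicator (C n) z *\<^sub>R f z = f z" if "n \<ge> N" for n using mono[OF that] N by (simp add: subset_iff)
    then show "(\<lambda>n. indicator (C n) z *\<^sub>R f z) \<longlonglongrightarrow> f z"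
      by (intro tendsto_eventually) (auto simp: eventually_sequentially)
  qed
qed

context C1_manifold begin

lemma lebesgue_algebra_borel_measurable_id: "(\<lambda>x. x) \<in> borel_measurable (lebesgue_algebra A)"
  by (rule measurableI) (use borel_subset_lebesgue_algebra in auto)

lemma weak_derivative_measurable:
  assumes "has_weak_derivative A w \<omega>" "c \<in> A"
  shows "(\<lambda>z. \<omega> (cinv c z) (tvec_of A c (cinv c z) h)) \<in> borel_measurable (lebesgue_on (cmap c ` cdom c))"
  by (rule locally_integrable_on_measurable[OF open_cimage[OF assms(2)]])
     (use has_weak_derivativeD[OF assms] in \<open>simp add: has_weak_derivative_on_def\<close>)

end

context riemannian_pair begin

lemma hom_space_PiE: "\<xi> \<in> hom_space A B x y \<Longrightarrow> \<xi> \<in> tangent_space A x \<rightarrow>\<^sub>E tangent_space B y"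
  unfolding hom_space_def by (erule CollectE) (erule conjunct1)

text \<open>If u x lies in V j, the coordinates of the derivative in the chart \<open>C j\<close>
  are forced: they are given by T j x, built from the weak derivatives of F j i o u and \<eta> j o
  u. Using the first such j at each point gives a section that is measurable piece by piece, and
  \<open>weak_derivative_local_coordinates\<close> confirms the defining identity for every test
  function.\<close>

lemma colocal_weak_derivative_exists:
  assumes u: "colocally_weakly_differentiable A B u"
  shows "\<exists>D. is_colocal_weak_derivative A B u D"
proof -
  have um: "u \<in> borel_measurable (lebesgue_algebra A)" using u by (simp add: colocally_weakly_differentiable_def)
  show ?thesis
  proof (rule N.countable_coordinate_cover)
  fix C :: "nat \<Rightarrow> ('n, 'l) chart" and V \<eta> F
  assume cov: "\<And>j::nat. C j \<in> B" "\<And>j. open (V j)" "\<And>j. V j \<subseteq> cdom (C j)" "(\<Union>j. V j) = UNIV"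
    and C1: "\<And>j. \<eta> j \<in> C1_compact_support B" "\<And>j i. F j i \<in> C1_compact_support B"
    and \<eta>: "\<And>j x. x \<in> V j \<Longrightarrow> \<eta> j x = 1" "\<And>j x. \<eta> j x \<noteq> 0 \<Longrightarrow> x \<in> cdom (C j)"
    and F: "\<And>j x i. x \<in> cdom (C j) \<Longrightarrow> F j i x = \<eta> j x * cmap (C j) x $ i"
  have wd: "\<exists>\<omega>. has_weak_derivative A (f \<circ> u) \<omega>" if "f \<in> C1_compact_support B" for f
    using u that by (simp add: colocally_weakly_differentiable_def weakly_differentiable_def)
  define \<omega>\<eta> where "\<omega>\<eta> j = (SOME \<omega>. has_weak_derivative A (\<eta> j \<circ> u) \<omega>)" for j
  have \<omega>\<eta>: "has_weak_derivative A (\<eta> j \<circ> u) (\<omega>\<eta> j)" for j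
    unfolding \<omega>\<eta>_def by (rule someI_ex[OF wd[OF C1(1)]])
  define \<omega>F where "\<omega>F j i = (SOME \<omega>. has_weak_derivative A (F j i \<circ> u) \<omega>)" for j i
  have \<omega>F: "has_weak_derivative A (F j i \<circ> u) (\<omega>F j i)" for j i
    unfolding \<omega>F_def by (rule someI_ex[OF wd[OF C1(2)]])
  \<comment> \<open>The least index makes the pieces on which J is constant disjoint and describes
    them by measurable conditions on u alone.\<close>
  define J where "J x = (LEAST j. u x \<in> V j)" for x
  have exj: "\<exists>j. u x \<in> V j" for x
  proof -
    have "u x \<in> (\<Union>j. V j)" by (simp only: cov(4) UNIV_I)
    then show ?thesis by (elim UN_E) (rule exI)
  qed
  have JV: "u x \<in> V (J x)" for x unfolding J_def by (rule LeastI_ex[OF exj])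
  have JI: "J x = j \<longleftrightarrow> u x \<in> V j \<and> (\<forall>i<j. u x \<notin> V i)" for x j
  proof
    assume j: "J x = j"
    have "u x \<notin> V i" if "i < j" for i
      using that unfolding j[symmetric] J_def by (rule not_less_Least)
    then show "u x \<in> V j \<and> (\<forall>i<j. u x \<notin> V i)" using JV[of x] j by simp
  next
    assume j: "u x \<in> V j \<and> (\<forall>i<j. u x \<notin> V i)"
    show "J x = j" unfolding J_def
    proof (rule Least_equality)
      show "u x \<in> V j" using j ..
      show "j \<le> i" if "u x \<in> V i" for i using j that by (simp add: linorder_not_less[symmetric]) (rule notI, simp)
    qed
  qed
  have JC: "u x \<in> cdom (C (J x))" for x using JV[of x] cov(3)[of "J x"] by (rule subsetD[rotated])
  define T where "T j x v = (\<chi> i. \<omega>F j i x v - F j i (u x) * \<omega>\<eta> j x v)" for j x v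
  define U where "U x = (\<lambda>v\<in>tangent_space A x. tvec_of B (C (J x)) (u x) (T (J x) x v))" for x
  define D where "D x = (x, u x, U x)" for x
  \<comment> \<open>The matrix of T j x in the chart c of M and the chart C j of N: finitely many
    entries, each measurable in the chart.\<close>
  define Mat where "Mat j c x = (\<chi> i k. \<omega>F j i x (tvec_of A c x (axis k 1)) - F j i (u x) * \<omega>\<eta> j x (tvec_of A c x (axis k 1)))" for j c x
  have lin: "linear (\<lambda>h. T j x (tvec_of A c x h))" if c: "c \<in> A" "x \<in> cdom c" for j c x
  proof -
    note l1 = M.has_weak_derivative_linear[OF \<omega>\<eta>[of j] c] and l2 = M.has_weak_derivative_linear[OF \<omega>F[of j] c]
    show ?thesis unfolding T_def
      by (rule linearI) (simp_all add: vec_eq_iff linear_add[OF l1] linear_add[OF l2] linear_cmul[OF l1] linear_cmul[OF l2] algebra_simps)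
  qed
  have MatT: "Mat j c x *v h = T j x (tvec_of A c x h)" if c: "c \<in> A" "x \<in> cdom c" for j c x h
  proof (rule M.linear_eq_axis[OF _ lin[OF c]])
    show "linear ((*v) (Mat j c x))" by simp
    show "Mat j c x *v axis k 1 = T j x (tvec_of A c x (axis k 1))" for k
      by (simp add: matrix_vector_mult_basis column_def Mat_def T_def)
  qed
  have Dp: "D x = param c (C (J x)) (x, u x, Blinfun ((*v) (Mat (J x) c x)))" if c: "c \<in> A" "x \<in> cdom c" for c x
  proof -
    have "U x = (\<lambda>v\<in>tangent_space A x. tvec_of B (C (J x)) (u x) (blinfun_apply (Blinfun ((*v) (Mat (J x) c x))) (v c)))"
      unfolding U_def by (rule restrict_ext) (simp add: linear_Blinfun_matrix(2) MatT[OF c] M.tvec_of_coordinates[OF _ c])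
    then show ?thesis by (simp add: D_def hom_bundle_param_def)
  qed
  have Db: "D x \<in> bundle" for x
  proof -
    obtain c where c: "c \<in> A" "x \<in> cdom c" by (rule M.obtain_chart)
    show ?thesis unfolding Dp[OF c] by (rule param_in[OF c(1) cov(1) c(2) JC])
  qed
  have Uh: "U x \<in> hom_space A B x (u x)" for x using Db[of x] by (simp add: D_def hom_bundle_def)
  have Dm: "D \<in> measurable (lebesgue_algebra A) bborel"
  proof (rule measurable_bborelI)
    show "D x \<in> bundle" for x by (rule Db)
    fix W assume W: "openin btop W"
    obtain A0 where A0: "A0 \<subseteq> A" "countable A0" "(\<Union>c\<in>A0. cdom c) = UNIV" by (rule M.countable_subatlas)
    have "D -` W \<in> sets (lebesgue_algebra A)"
    proof (rule M.lebesgue_algebra_subatlas[OF A0])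
      fix c assume "c \<in> A0"
      then have c: "c \<in> A" by (rule subsetD[OF A0(1)])
      let ?\<Omega> = "cmap c ` cdom c"
      define S where "S j = (\<lambda>q :: 'm \<times> 'n \<times> (real^'k^'l). (fst q, fst (snd q), Blinfun ((*v) (snd (snd q))))) -`
        {q \<in> cdom c \<times> cdom (C j) \<times> UNIV. param c (C j) q \<in> W}" for j
      have So: "open (S j)" for j
        unfolding S_def
      proof (rule open_vimage)
        show "open {q \<in> cdom c \<times> cdom (C j) \<times> UNIV. param c (C j) q \<in> W}"
          using W c cov(1)[of j] unfolding openin_btop by blast
        have "continuous_on UNIV (\<lambda>q :: 'm \<times> 'n \<times> (real^'k^'l). Blinfun ((*v) (snd (snd q))))"
          by (rule continuous_on_compose2[OF linear_Blinfun_matrix(1)]) (auto intro!: continuous_intros)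
        then show "continuous_on UNIV (\<lambda>q :: 'm \<times> 'n \<times> (real^'k^'l). (fst q, fst (snd q), Blinfun ((*v) (snd (snd q)))))"
          by (intro continuous_intros)
      qed
      define G where "G j z = (cinv c z, u (cinv c z), Mat j c (cinv c z))" for j z
      have um': "(\<lambda>z. u (cinv c z)) \<in> borel_measurable (lebesgue_on ?\<Omega>)" by (rule M.measurable_lebesgue_algebra_cinv[OF um c])
      have Gm: "G j \<in> borel_measurable (lebesgue_on ?\<Omega>)" for j
        unfolding G_def
      proof (intro borel_measurable_Pair um')
        show "cinv c \<in> borel_measurable (lebesgue_on ?\<Omega>)"
          using M.measurable_lebesgue_algebra_cinv[OF M.lebesgue_algebra_borel_measurable_id c] .
        have ent: "(\<lambda>z. \<omega>F j i (cinv c z) (tvec_of A c (cinv c z) (axis k 1)) - F j i (u (cinv c z)) * \<omega>\<eta> j (cinv c z) (tvec_of A c (cinv c z) (axis k 1)))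
           \<in> borel_measurable (lebesgue_on ?\<Omega>)" for i k
        proof -
          have "F j i \<in> borel_measurable borel"
            using C1(2)[of j i] by (intro borel_measurable_continuous_onI N.C1_fun_imp_continuous) (simp add: C1_compact_support_def)
          from measurable_compose[OF um' this] show ?thesis
            by (intro borel_measurable_diff borel_measurable_times M.weak_derivative_measurable[OF \<omega>F c] M.weak_derivative_measurable[OF \<omega>\<eta> c])
        qed
        show "(\<lambda>z. Mat j c (cinv c z)) \<in> borel_measurable (lebesgue_on ?\<Omega>)"
        proof (subst borel_measurable_euclidean_space, rule ballI)
          fix b :: "real^'k^'l" assume "b \<in> Basis"
          then obtain i b' where b': "b' \<in> Basis" "b = axis i b'" by (auto simp: Basis_vec_def)
          then obtain k where k: "b = axis i (axis k 1)" by (auto simp: Basis_vec_def)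
          have "(\<lambda>z. Mat j c (cinv c z) \<bullet> b) = (\<lambda>z. \<omega>F j i (cinv c z) (tvec_of A c (cinv c z) (axis k 1)) - F j i (u (cinv c z)) * \<omega>\<eta> j (cinv c z) (tvec_of A c (cinv c z) (axis k 1)))"
            by (simp add: k inner_axis Mat_def fun_eq_iff)
          then show "(\<lambda>z. Mat j c (cinv c z) \<bullet> b) \<in> borel_measurable (lebesgue_on ?\<Omega>)" using ent by simp
        qed
      qed
      have meas: "f -` X \<inter> ?\<Omega> \<in> sets lebesgue" if "f \<in> borel_measurable (lebesgue_on ?\<Omega>)" "open X" for f :: "_ \<Rightarrow> 'z::topological_space" and X
      proof -
        have "f -` X \<inter> space (lebesgue_on ?\<Omega>) \<in> sets (lebesgue_on ?\<Omega>)" using that by (intro measurable_sets[of f _ borel]) auto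
        then show ?thesis using M.cimage_lebesgue[OF c] by (simp add: space_restrict_space sets_restrict_space_iff)
      qed
      have Vm: "(\<lambda>z. u (cinv c z)) -` V j \<inter> ?\<Omega> \<in> sets lebesgue" for j by (rule meas[OF um' cov(2)])
      \<comment> \<open>By \<open>JI\<close>, J x = j says that u x is in V j but in no earlier V i.
        The preimage splits into countably many pieces, and on each of them D is given by a single
        measurable matrix function.\<close>
      have "cmap c ` (D -` W \<inter> cdom c) = (\<Union>j. (G j -` S j \<inter> ?\<Omega>) \<inter> (((\<lambda>z. u (cinv c z)) -` V j \<inter> ?\<Omega>) - (\<Union>i\<in>{..<j}. (\<lambda>z. u (cinv c z)) -` V i \<inter> ?\<Omega>)))"
        (is "?L = ?R")
      proof (intro set_eqI)
        fix z
        show "z \<in> ?L \<longleftrightarrow> z \<in> ?R"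
        proof (cases "z \<in> ?\<Omega>")
          case True
          let ?x = "cinv c z"
          have x: "?x \<in> cdom c" by (rule M.cinv_in[OF c True])
          have "z \<in> ?L \<longleftrightarrow> D ?x \<in> W" unfolding M.cmap_image_eq[OF c] using True by simp
          also have "\<dots> \<longleftrightarrow> G (J ?x) z \<in> S (J ?x)"
            unfolding Dp[OF c x] S_def G_def using x JC[of ?x] by simp
          also have "\<dots> \<longleftrightarrow> (\<exists>j. J ?x = j \<and> G j z \<in> S j)" by simp
          also have "\<dots> \<longleftrightarrow> z \<in> ?R" using True unfolding JI by (simp, blast)
          finally show ?thesis .
        next
          case False
          then show ?thesis by blast
        qed
      qed
      also have "\<dots> \<in> sets lebesgue"
        by (rule sets.countable_UN'', simp, rule sets.Int, rule meas[OF Gm So], rule sets.Diff, rule Vm,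
            rule sets.finite_UN, simp, rule Vm)
      finally show "cmap c ` (D -` W \<inter> cdom c) \<in> sets lebesgue" .
    qed
    then show "D -` W \<inter> space (lebesgue_algebra A) \<in> sets (lebesgue_algebra A)" by simp
  qed
  have chain: "AE_manifold A (\<lambda>x. \<forall>v\<in>tangent_space A x. \<omega> x v = differential B f (u x) (U x v))"
    if f: "f \<in> C1_compact_support B" and \<omega>: "has_weak_derivative A (f \<circ> u) \<omega>" for f \<omega>
  proof -
    have fC: "C1_fun B f" using f by (simp add: C1_compact_support_def)
    have "AE_manifold A (\<lambda>x. \<forall>j\<in>UNIV. u x \<in> V j \<longrightarrow> (\<forall>v\<in>tangent_space A x.
       \<omega> x v = frechet_derivative (f \<circ> cinv (C j)) (at (cmap (C j) (u x))) (\<chi> i. \<omega>F j i x v - F j i (u x) * \<omega>\<eta> j x v)))"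
      by (rule M.AE_manifold_countable, simp, rule weak_derivative_local_coordinates[OF cov(1) \<eta> F cov(3) fC \<omega>\<eta> \<omega>F \<omega>])
    then show ?thesis
    proof (rule M.AE_manifold_mono, intro ballI)
      fix x v
      assume a: "\<forall>j\<in>UNIV. u x \<in> V j \<longrightarrow> (\<forall>v\<in>tangent_space A x.
        \<omega> x v = frechet_derivative (f \<circ> cinv (C j)) (at (cmap (C j) (u x))) (\<chi> i. \<omega>F j i x v - F j i (u x) * \<omega>\<eta> j x v))"
        and v: "v \<in> tangent_space A x"
      have "\<omega> x v = frechet_derivative (f \<circ> cinv (C (J x))) (at (cmap (C (J x)) (u x))) (T (J x) x v)"
        unfolding T_def using a JV[of x] v by blast
      also have "\<dots> = differential B f (u x) (U x v)"
        using v N.differential_eq[OF fC cov(1) JC N.tvec_of_in_tangent_space[OF cov(1) JC]]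
        by (simp add: U_def N.tvec_of_apply_self[OF cov(1) JC])
      finally show "\<omega> x v = differential B f (u x) (U x v)" .
    qed
  qed
  have "is_colocal_weak_derivative A B u D"
    unfolding is_colocal_weak_derivative_def
    by (rule exI[of _ U], intro conjI allI ballI impI) (rule D_def, rule Uh, rule Dm, rule chain)
  then show "\<exists>D. is_colocal_weak_derivative A B u D" by (rule exI[of _ D])
  qed
qed

lemma colocal_weak_derivative_is:
  "colocally_weakly_differentiable A B u \<Longrightarrow> is_colocal_weak_derivative A B u (colocal_weak_derivative A B u)"
  unfolding colocal_weak_derivative_def by (rule someI_ex[OF colocal_weak_derivative_exists])

text \<open>On V j the function F j i is the i-th coordinate, so its differential reads off the i-th
  component of a tangent vector. Countably many test functions thus determine the derivative.
  Allowing two maps that agree almost everywhere makes the derivative well defined on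
  classes.\<close>

lemma colocal_weak_derivative_unique:
  assumes u: "colocally_weakly_differentiable A B u"
    and D: "is_colocal_weak_derivative A B u D" and D': "is_colocal_weak_derivative A B v D'"
    and uv: "AE_manifold A (\<lambda>x. u x = v x)"
  shows "AE_manifold A (\<lambda>x. D x = D' x)"
proof -
  obtain U where U: "\<And>x. D x = (x, u x, U x)" "\<And>x. U x \<in> hom_space A B x (u x)"
    "\<And>f \<omega>. f \<in> C1_compact_support B \<Longrightarrow> has_weak_derivative A (f \<circ> u) \<omega> \<Longrightarrow>
       AE_manifold A (\<lambda>x. \<forall>v\<in>tangent_space A x. \<omega> x v = differential B f (u x) (U x v))"
    using D unfolding is_colocal_weak_derivative_def by blast
  obtain U' where U': "\<And>x. D' x = (x, v x, U' x)" "\<And>x. U' x \<in> hom_space A B x (v x)"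
    "\<And>f \<omega>. f \<in> C1_compact_support B \<Longrightarrow> has_weak_derivative A (f \<circ> v) \<omega> \<Longrightarrow>
       AE_manifold A (\<lambda>x. \<forall>w\<in>tangent_space A x. \<omega> x w = differential B f (v x) (U' x w))"
    using D' unfolding is_colocal_weak_derivative_def by blast
  show ?thesis
  proof (rule N.countable_coordinate_cover)
  fix C :: "nat \<Rightarrow> ('n, 'l) chart" and V \<eta> F
  assume cov: "\<And>j::nat. C j \<in> B" "\<And>j. open (V j)" "\<And>j. V j \<subseteq> cdom (C j)" "(\<Union>j. V j) = UNIV"
    and C1: "\<And>j. \<eta> j \<in> C1_compact_support B" "\<And>j i. F j i \<in> C1_compact_support B"
    and \<eta>: "\<And>j x. x \<in> V j \<Longrightarrow> \<eta> j x = 1" "\<And>j x. \<eta> j x \<noteq> 0 \<Longrightarrow> x \<in> cdom (C j)"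
    and F: "\<And>j x i. x \<in> cdom (C j) \<Longrightarrow> F j i x = \<eta> j x * cmap (C j) x $ i"
  have dF: "differential B (F j i) y w = w (C j) $ i" if y: "y \<in> V j" and w: "w \<in> tangent_space B y" for j i y w
  proof -
    have yc: "y \<in> cdom (C j)" using y by (rule subsetD[OF cov(3)])
    have FC: "C1_fun B (F j i)" using C1 by (simp add: C1_compact_support_def)
    have "(F j i \<circ> cinv (C j) has_derivative (\<lambda>h. h $ i)) (at (cmap (C j) y))"
    proof (rule has_derivative_transform_within_open[of "\<lambda>z. z $ i"])
      show "((\<lambda>z. z $ i) has_derivative (\<lambda>h. h $ i)) (at (cmap (C j) y))"
        by (rule bounded_linear_imp_has_derivative[OF bounded_linear_vec_nth])
      show "open (cmap (C j) ` (V j \<inter> cdom (C j)))" by (rule N.open_cmap_image[OF cov(1,2)])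
      show "cmap (C j) y \<in> cmap (C j) ` (V j \<inter> cdom (C j))" using y yc by (intro imageI IntI)
      fix z assume "z \<in> cmap (C j) ` (V j \<inter> cdom (C j))"
      then obtain y' where y': "z = cmap (C j) y'" "y' \<in> V j" "y' \<in> cdom (C j)" by (elim imageE IntE)
      show "z $ i = (F j i \<circ> cinv (C j)) z"
        using F[OF y'(3)] \<eta>(1)[OF y'(2)] N.cinv_cmap[OF cov(1) y'(3)] by (simp add: y'(1))
    qed
    from has_derivative_unique[OF this N.C1_fun_has_derivative[OF FC cov(1) yc]]
    show ?thesis unfolding N.differential_eq[OF FC cov(1) yc w] by (metis)
  qed
  have key: "AE_manifold A (\<lambda>x. \<forall>w\<in>tangent_space A x. differential B (F j i) (u x) (U x w) = differential B (F j i) (v x) (U' x w))" for j i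
  proof -
    have "weakly_differentiable A (F j i \<circ> u)" using u C1 by (simp add: colocally_weakly_differentiable_def)
    then obtain \<omega> where \<omega>: "has_weak_derivative A (F j i \<circ> u) \<omega>" unfolding weakly_differentiable_def by (elim exE)
    have \<omega>': "has_weak_derivative A (F j i \<circ> v) \<omega>"
      by (rule M.has_weak_derivative_cong_AE[OF \<omega>], rule M.AE_manifold_mono[OF uv]) simp
    show ?thesis
    proof (rule M.AE_manifold_mono[OF M.AE_manifold_conj[OF U(3)[OF C1(2) \<omega>] U'(3)[OF C1(2) \<omega>']]], elim conjE, rule ballI)
      fix x w
      assume "\<forall>w\<in>tangent_space A x. \<omega> x w = differential B (F j i) (u x) (U x w)"
        "\<forall>w\<in>tangent_space A x. \<omega> x w = differential B (F j i) (v x) (U' x w)" "w \<in> tangent_space A x"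
      from bspec[OF this(1,3)] bspec[OF this(2,3)]
      show "differential B (F j i) (u x) (U x w) = differential B (F j i) (v x) (U' x w)" by (rule trans[OF sym])
    qed
  qed
  have "AE_manifold A (\<lambda>x. \<forall>j\<in>UNIV. \<forall>i\<in>UNIV. \<forall>w\<in>tangent_space A x. differential B (F j i) (u x) (U x w) = differential B (F j i) (v x) (U' x w))"
    by (rule M.AE_manifold_countable[OF countableI_type], rule M.AE_manifold_countable[OF countable_finite[OF finite]], rule key)
  from M.AE_manifold_conj[OF this uv] show "AE_manifold A (\<lambda>x. D x = D' x)"
  proof (rule M.AE_manifold_mono, elim conjE)
    fix x
    assume a: "\<forall>j\<in>UNIV. \<forall>i\<in>UNIV. \<forall>w\<in>tangent_space A x. differential B (F j i) (u x) (U x w) = differential B (F j i) (v x) (U' x w)"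
      and e: "u x = v x"
    have "u x \<in> (\<Union>j. V j)" by (simp only: cov(4) UNIV_I)
    then obtain j where j: "u x \<in> V j" by (elim UN_E)
    have yc: "u x \<in> cdom (C j)" using j by (rule subsetD[OF cov(3)])
    have "U x w = U' x w" if w: "w \<in> tangent_space A x" for w
    proof -
      have t: "U x w \<in> tangent_space B (u x)" "U' x w \<in> tangent_space B (u x)"
        by (rule hom_space_in[OF U(2) w], unfold e, rule hom_space_in[OF U'(2) w])
      have "U x w (C j) $ i = U' x w (C j) $ i" for i
      proof -
        have "differential B (F j i) (u x) (U x w) = differential B (F j i) (v x) (U' x w)"
          by (rule a[rule_format, OF UNIV_I UNIV_I w])
        then show ?thesis unfolding e[symmetric] dF[OF j t(1), of i] dF[OF j t(2), of i] .
      qed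
      then have eq: "U x w (C j) = U' x w (C j)" unfolding vec_eq_iff ..
      have "U x w = tvec_of B (C j) (u x) (U x w (C j))" by (rule N.tvec_of_coordinates[OF t(1) cov(1) yc, symmetric])
      also have "\<dots> = tvec_of B (C j) (u x) (U' x w (C j))" by (simp only: eq)
      also have "\<dots> = U' x w" by (rule N.tvec_of_coordinates[OF t(2) cov(1) yc])
      finally show ?thesis .
    qed
    moreover have "U x \<in> tangent_space A x \<rightarrow>\<^sub>E tangent_space B (u x)" using U(2)[of x] by (rule hom_space_PiE)
    moreover have "U' x \<in> tangent_space A x \<rightarrow>\<^sub>E tangent_space B (u x)" unfolding e using U'(2)[of x] by (rule hom_space_PiE)
    ultimately have "U x = U' x" by (intro PiE_ext[of "U x" "tangent_space A x" "\<lambda>_. tangent_space B (u x)" "U' x"])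
    then show "D x = D' x" by (simp add: U(1) U'(1) e)
  qed
  qed
qed

end

section \<open>Passage to the limit\<close>

text \<open>Truncating at the limit \<open>e\<close> of the dominating functions reduces this to dominated convergence.\<close>

lemma integral_tendsto_dominated_L1:
  fixes G :: "nat \<Rightarrow> 'a \<Rightarrow> real"
  assumes m: "\<And>n. G n \<in> borel_measurable M" "g \<in> borel_measurable M" and E: "\<And>n. integrable M (E n)" "integrable M e"
    and lim: "AE x in M. (\<lambda>n. G n x) \<longlonglongrightarrow> g x" and bd: "\<And>n. AE x in M. \<bar>G n x\<bar> \<le> E n x" "AE x in M. \<bar>g x\<bar> \<le> e x"
    and L1: "(\<lambda>n. \<integral>x. \<bar>E n x - e x\<bar> \<partial>M) \<longlonglongrightarrow> 0"
  shows "(\<lambda>n. \<integral>x. G n x \<partial>M) \<longlonglongrightarrow> (\<integral>x. g x \<partial>M)"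
proof -
  note [measurable] = m
  have [measurable]: "e \<in> borel_measurable M" using E(2) by auto
  define H where "H n x = max (- e x) (min (e x) (G n x))" for n x
  have [measurable]: "H n \<in> borel_measurable M" for n unfolding H_def by measurable
  have e0: "AE x in M. e x \<ge> 0" using bd(2) by (rule eventually_mono) linarith
  have Hb: "AE x in M. norm (H n x) \<le> e x" for n
    using e0 by (rule eventually_mono) (auto simp: H_def)
  have Hl: "(\<lambda>n. \<integral>x. H n x \<partial>M) \<longlonglongrightarrow> (\<integral>x. g x \<partial>M)"
  proof (rule integral_dominated_convergence[where w=e])
    show "AE x in M. (\<lambda>n. H n x) \<longlonglongrightarrow> g x"
      using lim bd(2)
    proof eventually_elim
      case (elim x)
      have "(\<lambda>n. H n x) \<longlonglongrightarrow> max (- e x) (min (e x) (g x))" unfolding H_def by (intro tendsto_intros elim(1))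
      moreover have "max (- e x) (min (e x) (g x)) = g x" using elim(2) by (auto simp: max_def min_def)
      ultimately show ?case by simp
    qed
  qed (use E(2) Hb in auto)
  have Hi: "integrable M (H n)" for n
    by (rule Bochner_Integration.integrable_bound[OF E(2)]) (use Hb[of n] in \<open>auto elim!: eventually_mono\<close>)
  have Gi: "integrable M (G n)" for n
    by (rule Bochner_Integration.integrable_bound[OF E(1)[of n]]) (use bd(1)[of n] in \<open>auto elim!: eventually_mono\<close>)
  have d: "\<bar>(\<integral>x. G n x \<partial>M) - (\<integral>x. H n x \<partial>M)\<bar> \<le> (\<integral>x. \<bar>E n x - e x\<bar> \<partial>M)" for n
  proof -
    have "(\<integral>x. G n x \<partial>M) - (\<integral>x. H n x \<partial>M) = (\<integral>x. G n x - H n x \<partial>M)" using Gi Hi by simp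
    also have "\<bar>\<dots>\<bar> \<le> (\<integral>x. \<bar>G n x - H n x\<bar> \<partial>M)" by (rule integral_abs_bound)
    also have "\<dots> \<le> (\<integral>x. \<bar>E n x - e x\<bar> \<partial>M)"
    proof (rule integral_mono_AE)
      \<comment> \<open>Truncation changes G only where |G| exceeds e, and there the excess is at
        most E - e.\<close>
      show "AE x in M. \<bar>G n x - H n x\<bar> \<le> \<bar>E n x - e x\<bar>"
        using bd(1)[of n] e0 by eventually_elim (auto simp: H_def max_def min_def)
    qed (use Gi Hi E in auto)
    finally show ?thesis .
  qed
  have "(\<lambda>n. (\<integral>x. G n x \<partial>M) - (\<integral>x. H n x \<partial>M)) \<longlonglongrightarrow> 0"
    by (rule Lim_null_comparison[OF _ L1]) (use d in auto)
  from tendsto_add[OF this Hl] show ?thesis by simp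
qed

text \<open>For t > \<epsilon> write t as t^(1-p) t^p and use that 1 - p \<le> 0. On sets of finite
  measure this takes the place of the Hoelder inequality: it bounds an L1 norm by p-th powers up to
  an error proportional to \<epsilon>, for all p \<ge> 1 alike.\<close>

lemma le_add_powr:
  fixes t \<epsilon> p :: real assumes "t \<ge> 0" "\<epsilon> > 0" "p \<ge> 1"
  shows "t \<le> \<epsilon> + \<epsilon> powr (1 - p) * t powr p"
proof (cases "t \<le> \<epsilon>")
  case True
  then show ?thesis using assms by (simp add: add_increasing2)
next
  case False
  then have "t powr (1 - p) \<le> \<epsilon> powr (1 - p)" using assms by (intro powr_mono2') auto
  then have "t powr (1 - p) * t powr p \<le> \<epsilon> powr (1 - p) * t powr p" by (rule mult_right_mono) simp
  moreover have "t powr (1 - p) * t powr p = t" using False assms by (simp add: powr_add[symmetric])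
  ultimately show ?thesis using assms by linarith
qed

lemma (in C1_manifold) measurable_indicator_cinv:
  fixes F :: "'m \<Rightarrow> real"
  assumes F: "F \<in> borel_measurable (lebesgue_algebra A)" and c: "c \<in> A" and K: "K \<in> sets lebesgue" "K \<subseteq> cmap c ` cdom c"
  shows "(\<lambda>z. indicator K z * F (cinv c z)) \<in> borel_measurable lebesgue"
proof -
  have "(\<lambda>z. indicator (cmap c ` cdom c) z *\<^sub>R F (cinv c z)) \<in> borel_measurable lebesgue"
    using measurable_lebesgue_algebra_cinv[OF F c] cimage_lebesgue[OF c]
    by (subst (asm) borel_measurable_restrict_space_iff) simp_all
  then have "(\<lambda>z. indicator K z * (indicator (cmap c ` cdom c) z *\<^sub>R F (cinv c z))) \<in> borel_measurable lebesgue"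
    using K(1) by (intro borel_measurable_times borel_measurable_indicator)
  moreover have "(\<lambda>z. indicator K z * (indicator (cmap c ` cdom c) z *\<^sub>R F (cinv c z))) = (\<lambda>z. indicator K z * F (cinv c z))"
    using K(2) by (intro ext) (auto simp: indicator_def)
  ultimately show ?thesis by (rule subst[rotated])
qed

text \<open>\<open>m\<close> is the Lebesgue measure of K and \<open>C\<close> the constant of
  \<open>nn_integral_chart_le\<close>. Neither depends on F or \<epsilon>, so for a sequence tending
  to 0 in L^p(M) one can fix a small \<epsilon> first and then let n grow.\<close>

lemma (in riemannian) chart_Lp_L1:
  assumes c: "c \<in> A" and K: "compact K" "K \<subseteq> cmap c ` cdom c" and p: "p \<ge> 1"
  shows "\<exists>C m. C \<ge> 0 \<and> m \<ge> 0 \<and> (\<forall>(F :: 'm \<Rightarrow> real) (\<epsilon> :: real). F \<in> borel_measurable (lebesgue_algebra A) \<longrightarrow> (\<forall>x. F x \<ge> 0) \<longrightarrow>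
      integrable (riemannian_measure A g) (\<lambda>x. F x powr p) \<longrightarrow> \<epsilon> > 0 \<longrightarrow>
      integrable lebesgue (\<lambda>z. indicator K z * F (cinv c z)) \<and>
      (\<integral>z. indicator K z * F (cinv c z) \<partial>lebesgue) \<le> \<epsilon> * m + \<epsilon> powr (1 - p) * C * (\<integral>x. F x powr p \<partial>riemannian_measure A g))"
proof (rule nn_integral_chart_le[OF c K])
  fix C :: real
  assume C: "C > 0" "\<And>F :: 'm \<Rightarrow> ennreal. F \<in> borel_measurable (lebesgue_algebra A) \<Longrightarrow>
      (\<integral>\<^sup>+z. F (cinv c z) * indicator K z \<partial>lebesgue) \<le> ennreal C * (\<integral>\<^sup>+x. F x \<partial>riemannian_measure A g)"
  define m where "m = measure lebesgue K"
  have KL: "K \<in> lmeasurable" by (rule lmeasurable_compact[OF K(1)])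
  show ?thesis
  proof (rule exI[of _ C], rule exI[of _ m], intro conjI allI impI)
    show "C \<ge> 0" "m \<ge> 0" using C(1) by (simp_all add: m_def)
    fix F :: "'m \<Rightarrow> real" and \<epsilon> :: real
    assume Fm: "F \<in> borel_measurable (lebesgue_algebra A)" and F0: "\<forall>x. F x \<ge> 0"
      and Fi: "integrable (riemannian_measure A g) (\<lambda>x. F x powr p)" and \<epsilon>: "\<epsilon> > 0"
    have Fm': "(\<lambda>z. indicator K z * F (cinv c z)) \<in> borel_measurable lebesgue"
      by (rule measurable_indicator_cinv[OF Fm c fmeasurableD[OF KL] K(2)])
    have Fpm: "(\<lambda>z. indicator K z * F (cinv c z) powr p) \<in> borel_measurable lebesgue"
      by (rule measurable_indicator_cinv[OF _ c fmeasurableD[OF KL] K(2)]) (use Fm in measurable)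
    define I where "I = (\<integral>x. F x powr p \<partial>riemannian_measure A g)"
    have I: "I \<ge> 0" unfolding I_def by (rule integral_nonneg_AE) simp
    have "(\<integral>\<^sup>+z. ennreal (indicator K z * F (cinv c z) powr p) \<partial>lebesgue) = (\<integral>\<^sup>+z. ennreal (F (cinv c z) powr p) * indicator K z \<partial>lebesgue)"
      by (intro nn_integral_cong) (simp add: indicator_def)
    also have "\<dots> \<le> ennreal C * (\<integral>\<^sup>+x. ennreal (F x powr p) \<partial>riemannian_measure A g)"
      by (rule C(2)) (use Fm in measurable)
    also have "\<dots> = ennreal (C * I)"
      using nn_integral_eq_integral[OF Fi] C(1) by (simp add: I_def ennreal_mult')
    finally have nn: "(\<integral>\<^sup>+z. ennreal (indicator K z * F (cinv c z) powr p) \<partial>lebesgue) \<le> ennreal (C * I)" .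
    have Fpi: "integrable lebesgue (\<lambda>z. indicator K z * F (cinv c z) powr p)"
    proof (rule integrableI_nonneg[OF Fpm])
      show "(\<integral>\<^sup>+z. ennreal (indicator K z * F (cinv c z) powr p) \<partial>lebesgue) < \<infinity>"
        using nn by (rule order.strict_trans1) simp
    qed simp
    have Fpl: "(\<integral>z. indicator K z * F (cinv c z) powr p \<partial>lebesgue) \<le> C * I"
      using nn C(1) I by (subst (asm) nn_integral_eq_integral[OF Fpi]) simp_all
    have Ki: "integrable lebesgue (\<lambda>z. indicator K z :: real)" by (rule integrable_indicator_compact[OF K(1)])
    have bi: "integrable lebesgue (\<lambda>z. \<epsilon> * indicator K z + \<epsilon> powr (1 - p) * (indicator K z * F (cinv c z) powr p))"
      using Ki Fpi by (intro Bochner_Integration.integrable_add integrable_mult_right)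
    have pw: "indicator K z * F (cinv c z) \<le> \<epsilon> * indicator K z + \<epsilon> powr (1 - p) * (indicator K z * F (cinv c z) powr p)" for z
      using le_add_powr[of "F (cinv c z)", OF _ \<epsilon> p] F0 by (simp add: indicator_def)
    show ii: "integrable lebesgue (\<lambda>z. indicator K z * F (cinv c z))"
    proof (rule Bochner_Integration.integrable_bound[OF bi Fm'], rule AE_I2)
      fix z
      have "0 \<le> indicator K z * F (cinv c z)" using F0 by simp
      then show "norm (indicator K z * F (cinv c z)) \<le> norm (\<epsilon> * indicator K z + \<epsilon> powr (1 - p) * (indicator K z * F (cinv c z) powr p))"
        using pw[of z] by simp
    qed
    have "(\<integral>z. indicator K z * F (cinv c z) \<partial>lebesgue) \<le> (\<integral>z. \<epsilon> * indicator K z + \<epsilon> powr (1 - p) * (indicator K z * F (cinv c z) powr p) \<partial>lebesgue)"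
      by (rule integral_mono[OF ii bi pw])
    also have "\<dots> = \<epsilon> * m + \<epsilon> powr (1 - p) * (\<integral>z. indicator K z * F (cinv c z) powr p \<partial>lebesgue)"
      using Ki Fpi by (simp add: m_def)
    also have "\<dots> \<le> \<epsilon> * m + \<epsilon> powr (1 - p) * (C * I)" using Fpl by (intro add_left_mono mult_left_mono) simp_all
    finally show "(\<integral>z. indicator K z * F (cinv c z) \<partial>lebesgue) \<le> \<epsilon> * m + \<epsilon> powr (1 - p) * C * (\<integral>x. F x powr p \<partial>riemannian_measure A g)"
      by (simp add: I_def mult.assoc)
  qed
qed

context riemannian_pair begin

abbreviation "volM \<equiv> riemannian_measure A gM"

text \<open>\<open>R\<close> confines F to an open part of the bundle on which it makes sense, such
  as the part over a chart; only the limit is assumed to lie in it.\<close>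

lemma limitin_btop_tendsto:
  assumes lim: "limitin btop P Q sequentially" and F: "\<And>V. open V \<Longrightarrow> openin btop {P \<in> bundle. R P \<and> F P \<in> V}" and R: "R Q"
  shows "(\<lambda>n. F (P n)) \<longlonglongrightarrow> F Q"
proof (rule topological_tendstoI)
  fix V assume V: "open V" "F Q \<in> V"
  have "Q \<in> bundle" using lim unfolding limitin_def topspace_btop by (elim conjE)
  then have "Q \<in> {P \<in> bundle. R P \<and> F P \<in> V}" using R V(2) by (intro CollectI conjI)
  with F[OF V(1)] lim have "\<forall>\<^sub>F n in sequentially. P n \<in> {P \<in> bundle. R P \<and> F P \<in> V}"
    unfolding limitin_def by (elim conjE allE impE) (rule conjI)
  then show "\<forall>\<^sub>F n in sequentially. F (P n) \<in> V" by (rule eventually_mono) (elim CollectE conjE)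
qed

lemma continuous_on_target_param: "continuous_on S (\<lambda>q. fst (snd (param c c' q)))"
  unfolding fst_param by (intro continuous_intros)

lemma limitin_btop_target:
  assumes lim: "limitin btop P Q sequentially" shows "(\<lambda>n. fst (snd (P n))) \<longlonglongrightarrow> fst (snd Q)"
proof (rule limitin_btop_tendsto[OF lim, where R="\<lambda>P. fst P \<in> UNIV"])
  show "openin btop {P \<in> bundle. fst P \<in> UNIV \<and> fst (snd P) \<in> V}" if "open V" for V
    by (rule openin_bundle_Collect[OF open_UNIV that continuous_on_target_param])
qed simp

lemma limitin_btop_hnorm:
  assumes lim: "limitin btop P Q sequentially" shows "(\<lambda>n. hnorm (P n)) \<longlonglongrightarrow> hnorm Q"
proof (rule limitin_btop_tendsto[OF lim, where R="\<lambda>P. True"])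
  show "openin btop {P \<in> bundle. True \<and> hnorm P \<in> V}" if "open V" for V using openin_hnorm[OF that] by simp
qed simp

lemma linear_differential_hom:
  assumes f: "C1_fun B f" and \<xi>: "\<xi> \<in> hom_space A B x y" and c: "c \<in> A" "x \<in> cdom c"
  shows "linear (\<lambda>h. differential B f y (\<xi> (tvec_of A c x h)))"
proof (rule N.obtain_chart[of y])
  fix c' assume c': "c' \<in> B" "y \<in> cdom c'"
  have "(\<lambda>h. differential B f y (\<xi> (tvec_of A c x h))) =
    (\<lambda>w. frechet_derivative (f \<circ> cinv c') (at (cmap c' y)) w) \<circ> (\<lambda>h. \<xi> (tvec_of A c x h) c')"
    unfolding o_def
    by (rule ext, rule N.differential_eq[OF f c' hom_space_in[OF \<xi> M.tvec_of_in_tangent_space[OF c]], unfolded o_def])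
  then show ?thesis
    using linear_compose[OF linear_hom_coord[OF \<xi> c, of c'] has_derivative_linear[OF N.C1_fun_has_derivative[OF f c']]]
    by simp
qed

text \<open>In the integration by parts formula for f o un n, the side with f converges by dominated
  convergence, as f is bounded. On the other side the dominating functions are multiples of the
  norms of Dn n, which vary with n; on compact parts of a chart they converge in L1, so
  \<open>integral_tendsto_dominated_L1\<close> applies.\<close>

lemma has_weak_derivative_limit:
  fixes Dn :: "nat \<Rightarrow> 'm \<Rightarrow> ('m, 'k, 'n, 'l) hom_elem"
  assumes p: "p \<ge> 1"
    and un: "\<And>n. colocally_weakly_differentiable A B (un n)" and Dn: "\<And>n. is_colocal_weak_derivative A B (un n) (Dn n)"
    and Dm: "D \<in> measurable (lebesgue_algebra A) bborel" and D: "\<And>x. D x = (x, u x, U x)" "\<And>x. U x \<in> hom_space A B x (u x)"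
    and um: "u \<in> borel_measurable (lebesgue_algebra A)"
    and lim: "AE_manifold A (\<lambda>x. limitin btop (\<lambda>n. Dn n x) (D x) sequentially)"
    and Lpn: "\<And>n. integrable volM (\<lambda>x. hnorm (Dn n x) powr p)" and Lp: "integrable volM (\<lambda>x. hnorm (D x) powr p)"
    and Lpd: "\<And>n. integrable volM (\<lambda>x. \<bar>hnorm (Dn n x) - hnorm (D x)\<bar> powr p)"
    and conv: "(\<lambda>n. \<integral>x. \<bar>hnorm (Dn n x) - hnorm (D x)\<bar> powr p \<partial>volM) \<longlonglongrightarrow> 0"
    and f: "f \<in> C1_compact_support B"
  shows "has_weak_derivative A (f \<circ> u) (\<lambda>x v. differential B f (u x) (U x v))"
  unfolding has_weak_derivative_def
proof
  fix c assume c: "c \<in> A"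
  let ?\<Omega> = "cmap c ` cdom c"
  let ?g = "\<lambda>z h. differential B f (u (cinv c z)) (U (cinv c z) (tvec_of A c (cinv c z) h))"
  have fC: "C1_fun B f" using f by (simp add: C1_compact_support_def)
  have fcont: "continuous_on UNIV f" by (rule N.C1_fun_imp_continuous[OF fC])
  obtain b where b: "\<And>y. \<bar>f y\<bar> \<le> b" "b \<ge> 0" by (rule N.C1_compact_support_bounded[OF f]) blast
  obtain Cf where Cf: "Cf \<ge> 0" "\<And>x y \<xi> v. \<xi> \<in> hom_space A B x y \<Longrightarrow> v \<in> tangent_space A x \<Longrightarrow>
    \<bar>differential B f y (\<xi> v)\<bar> \<le> Cf * sqrt (gM x v v) * hnorm (x, y, \<xi>)"
    by (rule differential_comp_bound[OF f]) blast
  have Uq: "\<exists>Uq. \<forall>n x. Dn n x = (x, un n x, Uq n x) \<and> Uq n x \<in> hom_space A B x (un n x)"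
  proof -
    have "\<forall>n. \<exists>V. \<forall>x. Dn n x = (x, un n x, V x) \<and> V x \<in> hom_space A B x (un n x)"
      using Dn unfolding is_colocal_weak_derivative_def by blast
    from choice[OF this] show ?thesis .
  qed
  then obtain Uq where Uq: "\<And>n x. Dn n x = (x, un n x, Uq n x)" "\<And>n x. Uq n x \<in> hom_space A B x (un n x)" by blast
  have Dnm: "Dn n \<in> measurable (lebesgue_algebra A) bborel" for n
    using Dn[of n] unfolding is_colocal_weak_derivative_def by (elim exE conjE)
  \<comment> \<open>Over a compact part of the chart the tangent vectors with coordinates h have
    bounded length, so one constant serves all base points.\<close>
  have bound: "\<exists>C'\<ge>0. \<forall>z\<in>K. \<forall>y \<xi>. \<xi> \<in> hom_space A B (cinv c z) y \<longrightarrow>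
      \<bar>differential B f y (\<xi> (tvec_of A c (cinv c z) h))\<bar> \<le> C' * hnorm (cinv c z, y, \<xi>)"
    if K: "compact K" "K \<subseteq> ?\<Omega>" for K h
  proof -
    have L: "compact (cinv c ` K)"
      by (rule compact_continuous_image[OF continuous_on_subset[OF M.continuous_on_cinv[OF c] K(2)] K(1)])
    have Lc: "cinv c ` K \<subseteq> cdom c" using K(2) M.cinv_in[OF c] by (intro image_subsetI) (rule M.cinv_in[OF c], rule subsetD)
    obtain hi where hi: "\<And>x h. x \<in> cinv c ` K \<Longrightarrow> M.gc c x h h \<le> hi * (norm h)\<^sup>2"
      by (rule M.gc_bounds[OF c L Lc]) blast
    have "\<bar>differential B f y (\<xi> (tvec_of A c (cinv c z) h))\<bar> \<le> (Cf * sqrt (max 0 (hi * (norm h)\<^sup>2))) * hnorm (cinv c z, y, \<xi>)"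
      if z: "z \<in> K" and \<xi>: "\<xi> \<in> hom_space A B (cinv c z) y" for z y \<xi>
    proof -
      have x: "cinv c z \<in> cdom c" using Lc z by blast
      have n0: "0 \<le> hnorm (cinv c z, y, \<xi>)" by (rule hnorm_nonneg) (simp add: hom_bundle_def \<xi>)
      have "\<bar>differential B f y (\<xi> (tvec_of A c (cinv c z) h))\<bar> \<le> Cf * sqrt (M.gc c (cinv c z) h h) * hnorm (cinv c z, y, \<xi>)"
        unfolding M.gc_def by (rule Cf(2)[OF \<xi> M.tvec_of_in_tangent_space[OF c x]])
      also have "\<dots> \<le> (Cf * sqrt (max 0 (hi * (norm h)\<^sup>2))) * hnorm (cinv c z, y, \<xi>)"
        using hi[of "cinv c z" h] z by (intro mult_right_mono mult_left_mono real_sqrt_le_mono Cf(1) n0) (simp add: max.coboundedI2)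
      finally show ?thesis .
    qed
    then show ?thesis using Cf(1) by (intro exI[of _ "Cf * sqrt (max 0 (hi * (norm h)\<^sup>2))"]) simp
  qed
  have gm: "(\<lambda>z. ?g z h) \<in> borel_measurable (lebesgue_on ?\<Omega>)" for h
  proof (rule borel_measurableI)
    fix V :: "real set" assume "open V"
    have Dc: "(\<lambda>z. D (cinv c z)) \<in> measurable (lebesgue_on ?\<Omega>) bborel" by (rule M.measurable_lebesgue_algebra_cinv[OF Dm c])
    from measurable_bborel_open[OF Dc openin_differential[OF fC c \<open>open V\<close>, of h]]
    have "{z \<in> space (lebesgue_on ?\<Omega>). D (cinv c z) \<in> {P \<in> bundle. fst P \<in> cdom c \<and> differential B f (fst (snd P)) (snd (snd P) (tvec_of A c (fst P) h)) \<in> V}}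
      \<in> sets (lebesgue_on ?\<Omega>)" .
    also have "{z \<in> space (lebesgue_on ?\<Omega>). D (cinv c z) \<in> {P \<in> bundle. fst P \<in> cdom c \<and> differential B f (fst (snd P)) (snd (snd P) (tvec_of A c (fst P) h)) \<in> V}} =
      (\<lambda>z. ?g z h) -` V \<inter> space (lebesgue_on ?\<Omega>)"
    proof (intro set_eqI iffI)
      fix z assume "z \<in> (\<lambda>z. ?g z h) -` V \<inter> space (lebesgue_on ?\<Omega>)"
      then have z: "?g z h \<in> V" "z \<in> space (lebesgue_on ?\<Omega>)" "z \<in> ?\<Omega>" by (simp_all add: space_restrict_space)
      show "z \<in> {z \<in> space (lebesgue_on ?\<Omega>). D (cinv c z) \<in> {P \<in> bundle. fst P \<in> cdom c \<and> differential B f (fst (snd P)) (snd (snd P) (tvec_of A c (fst P) h)) \<in> V}}"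
        using z M.cinv_in[OF c z(3)] D(2)[of "cinv c z"] by (simp add: D(1) hom_bundle_def)
    qed (simp add: D(1))
    finally show "(\<lambda>z. ?g z h) -` V \<inter> space (lebesgue_on ?\<Omega>) \<in> sets (lebesgue_on ?\<Omega>)" .
  qed
  have toind: "(\<lambda>z. indicator ?\<Omega> z *\<^sub>R G z) \<in> borel_measurable lebesgue" if "G \<in> borel_measurable (lebesgue_on ?\<Omega>)" for G :: "_ \<Rightarrow> real"
    using that M.cimage_lebesgue[OF c] by (subst (asm) borel_measurable_restrict_space_iff) simp_all
  have toK: "(\<lambda>z. indicator K z *\<^sub>R G z) \<in> borel_measurable lebesgue" if G: "G \<in> borel_measurable (lebesgue_on ?\<Omega>)" and K: "compact K" "K \<subseteq> ?\<Omega>" for G :: "_ \<Rightarrow> real" and K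
  proof -
    have "(\<lambda>z. indicator K z * (indicator ?\<Omega> z *\<^sub>R G z)) \<in> borel_measurable lebesgue"
      using K(1) toind[OF G] by (intro borel_measurable_times borel_measurable_indicator) (simp_all add: lmeasurable_compact fmeasurableD)
    moreover have "(\<lambda>z. indicator K z * (indicator ?\<Omega> z *\<^sub>R G z)) = (\<lambda>z. indicator K z *\<^sub>R G z)"
      using K(2) by (intro ext) (auto simp: indicator_def)
    ultimately show ?thesis by (rule subst[rotated])
  qed
  have hDm: "(\<lambda>x. hnorm (D x)) \<in> borel_measurable (lebesgue_algebra A)" by (rule hnorm_measurable[OF Dm])
  have hDnm: "(\<lambda>x. hnorm (Dn n x)) \<in> borel_measurable (lebesgue_algebra A)" for n by (rule hnorm_measurable[OF Dnm])
  have hD0: "hnorm (D x) \<ge> 0" for x by (rule hnorm_nonneg) (use D(2) in \<open>simp add: D(1) hom_bundle_def\<close>)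
  have hDn0: "hnorm (Dn n x) \<ge> 0" for n x by (rule hnorm_nonneg) (use Uq(2) in \<open>simp add: Uq(1) hom_bundle_def\<close>)
  have hint: "integrable lebesgue (\<lambda>z. indicator K z * hnorm (D (cinv c z)))" "\<And>n. integrable lebesgue (\<lambda>z. indicator K z * hnorm (Dn n (cinv c z)))"
    "(\<lambda>n. \<integral>z. indicator K z * \<bar>hnorm (Dn n (cinv c z)) - hnorm (D (cinv c z))\<bar> \<partial>lebesgue) \<longlonglongrightarrow> 0"
    if K: "compact K" "K \<subseteq> ?\<Omega>" for K
  proof -
    obtain C m where C: "C \<ge> 0" "m \<ge> 0" and Cm: "\<forall>F \<epsilon>. F \<in> borel_measurable (lebesgue_algebra A) \<longrightarrow> (\<forall>x. F x \<ge> 0) \<longrightarrow>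
      integrable volM (\<lambda>x. F x powr p) \<longrightarrow> \<epsilon> > 0 \<longrightarrow>
      integrable lebesgue (\<lambda>z. indicator K z * F (cinv c z)) \<and>
      (\<integral>z. indicator K z * F (cinv c z) \<partial>lebesgue) \<le> \<epsilon> * m + \<epsilon> powr (1 - p) * C * (\<integral>x. F x powr p \<partial>volM)"
      using M.chart_Lp_L1[OF c K p] by (elim exE conjE)
    show "integrable lebesgue (\<lambda>z. indicator K z * hnorm (D (cinv c z)))"
      by (rule Cm[rule_format, THEN conjunct1, OF hDm hD0 Lp zero_less_one])
    show "integrable lebesgue (\<lambda>z. indicator K z * hnorm (Dn n (cinv c z)))" for n
      by (rule Cm[rule_format, THEN conjunct1, OF hDnm hDn0 Lpn zero_less_one])
    let ?a = "\<lambda>n. \<integral>x. \<bar>hnorm (Dn n x) - hnorm (D x)\<bar> powr p \<partial>volM"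
    let ?I = "\<lambda>n. \<integral>z. indicator K z * \<bar>hnorm (Dn n (cinv c z)) - hnorm (D (cinv c z))\<bar> \<partial>lebesgue"
    have dm: "(\<lambda>x. \<bar>hnorm (Dn n x) - hnorm (D x)\<bar>) \<in> borel_measurable (lebesgue_algebra A)" for n
      using hDm hDnm[of n] by measurable
    have le: "?I n \<le> \<epsilon> * m + \<epsilon> powr (1 - p) * C * ?a n" if "\<epsilon> > 0" for \<epsilon> n
      by (rule Cm[rule_format, THEN conjunct2, OF dm abs_ge_zero Lpd that])
    have I0: "?I n \<ge> 0" for n by (rule integral_nonneg_AE) simp
    show "?I \<longlonglongrightarrow> 0"
    proof (rule LIMSEQ_I)
      fix \<delta> :: real assume \<delta>: "\<delta> > 0"
      \<comment> \<open>With this choice \<epsilon> * m stays below \<delta> / 2; the remaining term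
        tends to 0 with n for fixed \<epsilon>.\<close>
      define \<epsilon> where "\<epsilon> = \<delta> / (2 * (m + 1))"
      have \<epsilon>: "\<epsilon> > 0" using \<delta> C(2) by (simp add: \<epsilon>_def)
      have em: "\<epsilon> * m < \<delta> / 2 + 0" using \<delta> C(2) by (simp add: \<epsilon>_def field_simps)
      have "(\<lambda>n. \<epsilon> * m + \<epsilon> powr (1 - p) * C * ?a n) \<longlonglongrightarrow> \<epsilon> * m + \<epsilon> powr (1 - p) * C * 0"
        by (intro tendsto_intros conv)
      moreover have "\<epsilon> * m + \<epsilon> powr (1 - p) * C * 0 < \<delta>" using em \<delta> by simp
      ultimately have "\<forall>\<^sub>F n in sequentially. \<epsilon> * m + \<epsilon> powr (1 - p) * C * ?a n < \<delta>" by (rule order_tendstoD(2))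
      then obtain N where N: "\<And>n. n \<ge> N \<Longrightarrow> \<epsilon> * m + \<epsilon> powr (1 - p) * C * ?a n < \<delta>" unfolding eventually_sequentially by blast
      show "\<exists>no. \<forall>n\<ge>no. norm (?I n - 0) < \<delta>"
      proof (intro exI[of _ N] allI impI)
        fix n assume "N \<le> n"
        from N[OF this] le[OF \<epsilon>, of n] I0[of n] show "norm (?I n - 0) < \<delta>" by simp
      qed
    qed
  qed
  have fum: "(\<lambda>z. f (v (cinv c z))) \<in> borel_measurable (lebesgue_on ?\<Omega>)" if "v \<in> borel_measurable (lebesgue_algebra A)" for v
    by (rule measurable_compose[OF M.measurable_lebesgue_algebra_cinv[OF that c] borel_measurable_continuous_onI[OF fcont]])
  show "has_weak_derivative_on ?\<Omega> (f \<circ> u \<circ> cinv c) ?g"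
    unfolding has_weak_derivative_on_def
  proof (intro conjI ballI allI impI)
    show "locally_integrable_on ?\<Omega> (f \<circ> u \<circ> cinv c)"
      unfolding locally_integrable_on_def
    proof (intro allI impI, elim conjE)
      fix K assume K: "compact K" "K \<subseteq> ?\<Omega>"
      show "(f \<circ> u \<circ> cinv c) absolutely_integrable_on K"
        unfolding set_integrable_def o_def
      proof (rule Bochner_Integration.integrable_bound[OF integrable_mult_right[OF integrable_indicator_compact[OF K(1)], of b] toK[OF fum[OF um] K]], rule AE_I2)
        show "norm (indicator K z *\<^sub>R f (u (cinv c z))) \<le> norm (b * indicator K z)" for z
          using b(1)[of "u (cinv c z)"] by (simp add: indicator_def)
      qed
    qed
  next
    fix z assume "z \<in> ?\<Omega>"
    then show "linear (?g z)" by (intro linear_differential_hom[OF fC D(2) c] M.cinv_in[OF c])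
  next
    fix h
    show "locally_integrable_on ?\<Omega> (\<lambda>z. ?g z h)"
      unfolding locally_integrable_on_def
    proof (intro allI impI, elim conjE)
      fix K assume K: "compact K" "K \<subseteq> ?\<Omega>"
      obtain C' where C': "C' \<ge> 0" "\<forall>z\<in>K. \<forall>y \<xi>. \<xi> \<in> hom_space A B (cinv c z) y \<longrightarrow>
        \<bar>differential B f y (\<xi> (tvec_of A c (cinv c z) h))\<bar> \<le> C' * hnorm (cinv c z, y, \<xi>)"
        using bound[OF K, of h] by (elim exE conjE)
      show "(\<lambda>z. ?g z h) absolutely_integrable_on K"
        unfolding set_integrable_def
      proof (rule Bochner_Integration.integrable_bound[OF integrable_mult_right[OF hint(1)[OF K], of C'] toK[OF gm K]], rule AE_I2)
        show "norm (indicator K z *\<^sub>R ?g z h) \<le> norm (C' * (indicator K z * hnorm (D (cinv c z))))" for z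
          using C'(1) C'(2)[rule_format, OF _ D(2), of z] hD0[of "cinv c z"] by (simp add: indicator_def D(1) abs_mult)
      qed
    qed
  next
    fix \<phi> :: "real^'k \<Rightarrow> real" and h
    assume "C1_on UNIV \<phi> \<and> compact (closure {z. \<phi> z \<noteq> 0}) \<and> closure {z. \<phi> z \<noteq> 0} \<subseteq> ?\<Omega>"
    then have \<phi>: "C1_on UNIV \<phi>" and K0: "compact (closure {z. \<phi> z \<noteq> 0})" "closure {z. \<phi> z \<noteq> 0} \<subseteq> ?\<Omega>" by blast+
    define K where "K = closure {z. \<phi> z \<noteq> 0}"
    have K: "compact K" "K \<subseteq> ?\<Omega>" using K0 by (simp_all add: K_def)
    have \<phi>0: "\<phi> z = 0" if "z \<notin> K" for z using that closure_subset[of "{z. \<phi> z \<noteq> 0}"] unfolding K_def by auto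
    have \<phi>c: "continuous_on UNIV \<phi>" by (rule C1_on_imp_continuous_on[OF \<phi>])
    have \<phi>m: "\<phi> \<in> borel_measurable lebesgue" by (rule continuous_imp_borel_measurable_lebesgue[OF \<phi>c])
    let ?d = "\<lambda>z. frechet_derivative \<phi> (at z) h"
    have dc: "continuous_on UNIV ?d" by (rule C1_on_frechet_continuous[OF \<phi>])
    have dm: "?d \<in> borel_measurable lebesgue" by (rule continuous_imp_borel_measurable_lebesgue[OF dc])
    have d0: "?d z = 0" if "z \<notin> K" for z
    proof -
      have "(\<phi> has_derivative (\<lambda>h. 0)) (at z)"
      proof (rule has_derivative_transform_within_open[of "\<lambda>_. 0"])
        show "open (- K)" unfolding K_def by auto
        show "0 = \<phi> x" if "x \<in> - K" for x using \<phi>0[of x] that by simp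
      qed (use that in simp_all)
      from frechet_derivative_at[OF this] show "?d z = 0" by metis
    qed
    obtain \<beta> where \<beta>: "\<And>z. z \<in> K \<Longrightarrow> \<bar>\<phi> z\<bar> \<le> \<beta>"
      using compact_imp_bounded[OF compact_continuous_image[OF continuous_on_subset[OF \<phi>c] K(1)]]
      unfolding bounded_iff by (metis imageI real_norm_def subset_UNIV)
    obtain \<gamma> where \<gamma>: "\<And>z. z \<in> K \<Longrightarrow> \<bar>?d z\<bar> \<le> \<gamma>"
      using compact_imp_bounded[OF compact_continuous_image[OF continuous_on_subset[OF dc] K(1)]]
      unfolding bounded_iff by (metis imageI real_norm_def subset_UNIV)
    obtain C' where C': "C' \<ge> 0" "\<forall>z\<in>K. \<forall>y \<xi>. \<xi> \<in> hom_space A B (cinv c z) y \<longrightarrow>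
      \<bar>differential B f y (\<xi> (tvec_of A c (cinv c z) h))\<bar> \<le> C' * hnorm (cinv c z, y, \<xi>)"
      using bound[OF K, of h] by (elim exE conjE)
    have limc: "AE z in lebesgue. z \<in> ?\<Omega> \<longrightarrow> limitin btop (\<lambda>n. Dn n (cinv c z)) (D (cinv c z)) sequentially"
      using lim c by (simp add: M.AE_manifold_iff)
    \<comment> \<open>Any weak derivative of f o un n will do: it agrees almost everywhere with the
      one computed from Dn n, for which the norm bound is known.\<close>
    define \<omega> where "\<omega> n = (SOME \<omega>. has_weak_derivative A (f \<circ> un n) \<omega>)" for n
    have \<omega>: "has_weak_derivative A (f \<circ> un n) (\<omega> n)" for n
    proof -
      have "\<exists>\<omega>. has_weak_derivative A (f \<circ> un n) \<omega>"
        using un[of n] f unfolding colocally_weakly_differentiable_def weakly_differentiable_def by blast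
      then show ?thesis unfolding \<omega>_def by (rule someI_ex)
    qed
    let ?w = "\<lambda>n z. \<omega> n (cinv c z) (tvec_of A c (cinv c z) h)"
    have \<omega>eq: "AE z in lebesgue. z \<in> ?\<Omega> \<longrightarrow> ?w n z = differential B f (un n (cinv c z)) (Uq n (cinv c z) (tvec_of A c (cinv c z) h))" for n
    proof -
      obtain V where V: "\<forall>x. Dn n x = (x, un n x, V x)"
        "\<forall>f\<in>C1_compact_support B. \<forall>\<omega>. has_weak_derivative A (f \<circ> un n) \<omega> \<longrightarrow>
           AE_manifold A (\<lambda>x. \<forall>v\<in>tangent_space A x. \<omega> x v = differential B f (un n x) (V x v))"
        using Dn[of n] unfolding is_colocal_weak_derivative_def by (elim exE conjE)
      have "V = Uq n" using V(1) Uq(1)[of n] by (auto simp: fun_eq_iff)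
      have "AE_manifold A (\<lambda>x. \<forall>v\<in>tangent_space A x. \<omega> n x v = differential B f (un n x) (Uq n x v))"
        using V(2) f \<omega>[of n] unfolding \<open>V = Uq n\<close> by blast
      then have "AE z in lebesgue. z \<in> ?\<Omega> \<longrightarrow> (\<forall>v\<in>tangent_space A (cinv c z). \<omega> n (cinv c z) v = differential B f (un n (cinv c z)) (Uq n (cinv c z) v))"
        using c by (simp add: M.AE_manifold_iff)
      then show ?thesis
      proof (rule eventually_mono, intro impI)
        fix z assume a: "z \<in> ?\<Omega> \<longrightarrow> (\<forall>v\<in>tangent_space A (cinv c z). \<omega> n (cinv c z) v = differential B f (un n (cinv c z)) (Uq n (cinv c z) v))" and z: "z \<in> ?\<Omega>"
        show "?w n z = differential B f (un n (cinv c z)) (Uq n (cinv c z) (tvec_of A c (cinv c z) h))"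
          by (rule bspec[OF mp[OF a z] M.tvec_of_in_tangent_space[OF c M.cinv_in[OF c z]]])
      qed
    qed
    have unm: "un n \<in> borel_measurable (lebesgue_algebra A)" for n using un[of n] by (simp add: colocally_weakly_differentiable_def)
    have L1: "(\<lambda>n. LINT z:?\<Omega>|lebesgue. (f \<circ> un n \<circ> cinv c) z * ?d z) \<longlonglongrightarrow> (LINT z:?\<Omega>|lebesgue. (f \<circ> u \<circ> cinv c) z * ?d z)"
      unfolding set_lebesgue_integral_def
    proof (rule integral_dominated_convergence[where w="\<lambda>z. b * \<gamma> * indicator K z"])
      have fm: "(\<lambda>z. indicator ?\<Omega> z *\<^sub>R ((f \<circ> v \<circ> cinv c) z * ?d z)) \<in> borel_measurable lebesgue" if "v \<in> borel_measurable (lebesgue_algebra A)" for v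
      proof -
        have "(\<lambda>z. (indicator ?\<Omega> z *\<^sub>R f (v (cinv c z))) * ?d z) \<in> borel_measurable lebesgue"
          by (rule borel_measurable_times[OF toind[OF fum[OF that]] dm])
        then show ?thesis by (simp add: mult.assoc)
      qed
      show "(\<lambda>z. indicator ?\<Omega> z *\<^sub>R ((f \<circ> u \<circ> cinv c) z * ?d z)) \<in> borel_measurable lebesgue" by (rule fm[OF um])
      show "(\<lambda>z. indicator ?\<Omega> z *\<^sub>R ((f \<circ> un n \<circ> cinv c) z * ?d z)) \<in> borel_measurable lebesgue" for n by (rule fm[OF unm])
      show "integrable lebesgue (\<lambda>z. b * \<gamma> * indicator K z)"
        by (rule integrable_mult_right[OF integrable_indicator_compact[OF K(1)]])
      show "AE z in lebesgue. (\<lambda>n. indicator ?\<Omega> z *\<^sub>R ((f \<circ> un n \<circ> cinv c) z * ?d z)) \<longlonglongrightarrow> indicator ?\<Omega> z *\<^sub>R ((f \<circ> u \<circ> cinv c) z * ?d z)"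
        using limc
      proof (rule eventually_mono)
        fix z assume a: "z \<in> ?\<Omega> \<longrightarrow> limitin btop (\<lambda>n. Dn n (cinv c z)) (D (cinv c z)) sequentially"
        show "(\<lambda>n. indicator ?\<Omega> z *\<^sub>R ((f \<circ> un n \<circ> cinv c) z * ?d z)) \<longlonglongrightarrow> indicator ?\<Omega> z *\<^sub>R ((f \<circ> u \<circ> cinv c) z * ?d z)"
        proof (cases "z \<in> ?\<Omega>")
          case True
          have "(\<lambda>n. un n (cinv c z)) \<longlonglongrightarrow> u (cinv c z)"
            using limitin_btop_target[OF mp[OF a True]] by (simp add: Uq(1) D(1))
          then have "(\<lambda>n. f (un n (cinv c z))) \<longlonglongrightarrow> f (u (cinv c z))"
            by (rule continuous_on_tendsto_compose[OF fcont]) simp_all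
          then show ?thesis unfolding o_def by (intro tendsto_intros)
        qed simp
      qed
      show "AE z in lebesgue. norm (indicator ?\<Omega> z *\<^sub>R ((f \<circ> un n \<circ> cinv c) z * ?d z)) \<le> b * \<gamma> * indicator K z" for n
      proof (rule AE_I2)
        fix z
        show "norm (indicator ?\<Omega> z *\<^sub>R ((f \<circ> un n \<circ> cinv c) z * ?d z)) \<le> b * \<gamma> * indicator K z"
        proof (cases "z \<in> K")
          case True
          have "\<bar>f (un n (cinv c z))\<bar> * \<bar>?d z\<bar> \<le> b * \<gamma>" by (rule mult_mono[OF b(1) \<gamma>[OF True] b(2) abs_ge_zero])
          then show ?thesis using True subsetD[OF K(2) True] by (simp add: abs_mult)
        qed (simp add: d0)
      qed
    qed
    have L2: "(\<lambda>n. LINT z:?\<Omega>|lebesgue. ?w n z * \<phi> z) \<longlonglongrightarrow> (LINT z:?\<Omega>|lebesgue. ?g z h * \<phi> z)"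
      unfolding set_lebesgue_integral_def
    proof (rule integral_tendsto_dominated_L1[where E="\<lambda>n z. (C' * \<bar>\<beta>\<bar>) * (indicator K z * hnorm (Dn n (cinv c z)))"
          and e="\<lambda>z. (C' * \<bar>\<beta>\<bar>) * (indicator K z * hnorm (D (cinv c z)))"])
      have wm: "(\<lambda>z. indicator ?\<Omega> z *\<^sub>R (G z * \<phi> z)) \<in> borel_measurable lebesgue" if "G \<in> borel_measurable (lebesgue_on ?\<Omega>)" for G
      proof -
        have "(\<lambda>z. (indicator ?\<Omega> z *\<^sub>R G z) * \<phi> z) \<in> borel_measurable lebesgue"
          by (rule borel_measurable_times[OF toind[OF that] \<phi>m])
        then show ?thesis by (simp add: mult.assoc)
      qed
      show "(\<lambda>z. indicator ?\<Omega> z *\<^sub>R (?w n z * \<phi> z)) \<in> borel_measurable lebesgue" for n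
        by (rule wm[OF M.weak_derivative_measurable[OF \<omega> c]])
      show "(\<lambda>z. indicator ?\<Omega> z *\<^sub>R (?g z h * \<phi> z)) \<in> borel_measurable lebesgue" by (rule wm[OF gm])
      show "integrable lebesgue (\<lambda>z. (C' * \<bar>\<beta>\<bar>) * (indicator K z * hnorm (Dn n (cinv c z))))" for n
        by (rule integrable_mult_right[OF hint(2)[OF K]])
      show "integrable lebesgue (\<lambda>z. (C' * \<bar>\<beta>\<bar>) * (indicator K z * hnorm (D (cinv c z))))"
        by (rule integrable_mult_right[OF hint(1)[OF K]])
      have bnd: "\<bar>indicator ?\<Omega> z *\<^sub>R (differential B f y (\<xi> (tvec_of A c (cinv c z) h)) * \<phi> z)\<bar> \<le> (C' * \<bar>\<beta>\<bar>) * (indicator K z * hnorm (cinv c z, y, \<xi>))"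
        if \<xi>: "\<xi> \<in> hom_space A B (cinv c z) y" for z y \<xi>
      proof (cases "z \<in> K")
        case True
        have "0 \<le> hnorm (cinv c z, y, \<xi>)" by (rule hnorm_nonneg) (simp add: hom_bundle_def \<xi>)
        then have "\<bar>differential B f y (\<xi> (tvec_of A c (cinv c z) h))\<bar> * \<bar>\<phi> z\<bar> \<le> (C' * hnorm (cinv c z, y, \<xi>)) * \<bar>\<beta>\<bar>"
          using C'(2)[rule_format, OF True \<xi>] \<beta>[OF True] C'(1) by (intro mult_mono) simp_all
        then show ?thesis using True subsetD[OF K(2) True] by (simp add: abs_mult mult_ac)
      qed (simp add: \<phi>0)
      show "AE z in lebesgue. \<bar>indicator ?\<Omega> z *\<^sub>R (?w n z * \<phi> z)\<bar> \<le> (C' * \<bar>\<beta>\<bar>) * (indicator K z * hnorm (Dn n (cinv c z)))" for n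
        using \<omega>eq[of n]
      proof (rule eventually_mono)
        fix z assume a: "z \<in> ?\<Omega> \<longrightarrow> ?w n z = differential B f (un n (cinv c z)) (Uq n (cinv c z) (tvec_of A c (cinv c z) h))"
        have e: "indicator ?\<Omega> z *\<^sub>R (?w n z * \<phi> z) = indicator ?\<Omega> z *\<^sub>R (differential B f (un n (cinv c z)) (Uq n (cinv c z) (tvec_of A c (cinv c z) h)) * \<phi> z)"
          using a by (cases "z \<in> ?\<Omega>") simp_all
        show "\<bar>indicator ?\<Omega> z *\<^sub>R (?w n z * \<phi> z)\<bar> \<le> (C' * \<bar>\<beta>\<bar>) * (indicator K z * hnorm (Dn n (cinv c z)))"
          unfolding e Uq(1) by (rule bnd[OF Uq(2)])
      qed
      show "AE z in lebesgue. \<bar>indicator ?\<Omega> z *\<^sub>R (?g z h * \<phi> z)\<bar> \<le> (C' * \<bar>\<beta>\<bar>) * (indicator K z * hnorm (D (cinv c z)))"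
        unfolding D(1) by (rule AE_I2) (rule bnd[OF D(2)])
      have "AE z in lebesgue. \<forall>n\<in>UNIV. z \<in> ?\<Omega> \<longrightarrow> ?w n z = differential B f (un n (cinv c z)) (Uq n (cinv c z) (tvec_of A c (cinv c z) h))"
        by (subst AE_ball_countable[OF countableI_type], rule ballI, rule \<omega>eq)
      then show "AE z in lebesgue. (\<lambda>n. indicator ?\<Omega> z *\<^sub>R (?w n z * \<phi> z)) \<longlonglongrightarrow> indicator ?\<Omega> z *\<^sub>R (?g z h * \<phi> z)"
        using limc
      proof (rule eventually_elim2)
        fix z
        assume w: "\<forall>n\<in>UNIV. z \<in> ?\<Omega> \<longrightarrow> ?w n z = differential B f (un n (cinv c z)) (Uq n (cinv c z) (tvec_of A c (cinv c z) h))"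
          and a: "z \<in> ?\<Omega> \<longrightarrow> limitin btop (\<lambda>n. Dn n (cinv c z)) (D (cinv c z)) sequentially"
        show "(\<lambda>n. indicator ?\<Omega> z *\<^sub>R (?w n z * \<phi> z)) \<longlonglongrightarrow> indicator ?\<Omega> z *\<^sub>R (?g z h * \<phi> z)"
        proof (cases "z \<in> ?\<Omega>")
          case True
          have "(\<lambda>n. differential B f (fst (snd (Dn n (cinv c z)))) (snd (snd (Dn n (cinv c z))) (tvec_of A c (fst (Dn n (cinv c z))) h)))
             \<longlonglongrightarrow> differential B f (fst (snd (D (cinv c z)))) (snd (snd (D (cinv c z))) (tvec_of A c (fst (D (cinv c z))) h))"
            by (rule limitin_btop_tendsto[OF mp[OF a True] openin_differential[OF fC c]], assumption, unfold D(1) fst_conv, rule M.cinv_in[OF c True])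
          then have "(\<lambda>n. ?w n z) \<longlonglongrightarrow> ?g z h" using w True by (simp add: Uq(1) D(1))
          then show ?thesis by (intro tendsto_intros)
        qed simp
      qed
      have "(\<lambda>n. (C' * \<bar>\<beta>\<bar>) * (\<integral>z. indicator K z * \<bar>hnorm (Dn n (cinv c z)) - hnorm (D (cinv c z))\<bar> \<partial>lebesgue)) \<longlonglongrightarrow> (C' * \<bar>\<beta>\<bar>) * 0"
        by (intro tendsto_intros hint(3)[OF K])
      moreover have "(\<integral>z. \<bar>(C' * \<bar>\<beta>\<bar>) * (indicator K z * hnorm (Dn n (cinv c z))) - (C' * \<bar>\<beta>\<bar>) * (indicator K z * hnorm (D (cinv c z)))\<bar> \<partial>lebesgue) =
         (C' * \<bar>\<beta>\<bar>) * (\<integral>z. indicator K z * \<bar>hnorm (Dn n (cinv c z)) - hnorm (D (cinv c z))\<bar> \<partial>lebesgue)" for n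
      proof -
        have "\<bar>(C' * \<bar>\<beta>\<bar>) * (indicator K z * hnorm (Dn n (cinv c z))) - (C' * \<bar>\<beta>\<bar>) * (indicator K z * hnorm (D (cinv c z)))\<bar> =
          (C' * \<bar>\<beta>\<bar>) * (indicator K z * \<bar>hnorm (Dn n (cinv c z)) - hnorm (D (cinv c z))\<bar>)" for z
          using C'(1) by (simp add: right_diff_distrib[symmetric] abs_mult)
        then show ?thesis by simp
      qed
      ultimately show "(\<lambda>n. \<integral>z. \<bar>(C' * \<bar>\<beta>\<bar>) * (indicator K z * hnorm (Dn n (cinv c z))) - (C' * \<bar>\<beta>\<bar>) * (indicator K z * hnorm (D (cinv c z)))\<bar> \<partial>lebesgue) \<longlonglongrightarrow> 0"
        by simp
    qed
    have eq: "(LINT z:?\<Omega>|lebesgue. (f \<circ> un n \<circ> cinv c) z * ?d z) = - (LINT z:?\<Omega>|lebesgue. ?w n z * \<phi> z)" for n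
      using M.has_weak_derivativeD[OF \<omega>[of n] c] \<phi> K0 unfolding has_weak_derivative_on_def by blast
    show "(LINT z:?\<Omega>|lebesgue. (f \<circ> u \<circ> cinv c) z * ?d z) = - (LINT z:?\<Omega>|lebesgue. ?g z h * \<phi> z)"
      by (rule LIMSEQ_unique[OF L1]) (unfold eq, rule tendsto_minus[OF L2])
  qed
qed

end

section \<open>The spaces $L^p$\<close>

lemma powr_convex_combination:
  fixes s t l p :: real
  assumes p: "p \<ge> 1" and st: "s \<ge> 0" "t \<ge> 0" and l: "0 \<le> l" "l \<le> 1"
  shows "((1 - l) * s + l * t) powr p \<le> (1 - l) * s powr p + l * t powr p"
proof (cases "s = 0 \<or> t = 0")
  case True
  \<comment> \<open>If one of the two points is 0, the claim reduces to a^p \<le> a for a in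
    [0, 1].\<close>
  have *: "a powr p * b powr p \<le> a * b powr p" if "0 \<le> a" "a \<le> 1" for a b :: real
    using that p powr_mono'[of 1 p a] by (intro mult_right_mono) auto
  show ?thesis using True
  proof
    assume "s = 0"
    then show ?thesis using *[of l t] l st by (simp add: powr_mult)
  next
    assume "t = 0"
    then show ?thesis using *[of "1 - l" s] l st by (simp add: powr_mult)
  qed
next
  case False
  then show ?thesis using convex_onD[OF powr_convex[OF p], of l s t] st l by simp
qed

lemma abs_add_powr_le:
  fixes a b p :: real
  assumes p: "p \<ge> 1"
  shows "\<bar>a + b\<bar> powr p \<le> 2 powr p * (\<bar>a\<bar> powr p + \<bar>b\<bar> powr p)"
proof -
  have "\<bar>a + b\<bar> powr p \<le> (2 * max \<bar>a\<bar> \<bar>b\<bar>) powr p" using p by (intro powr_mono2) auto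
  also have "\<dots> = 2 powr p * max \<bar>a\<bar> \<bar>b\<bar> powr p" by (simp add: powr_mult)
  also have "\<dots> \<le> 2 powr p * (\<bar>a\<bar> powr p + \<bar>b\<bar> powr p)"
    by (intro mult_left_mono) (auto simp: max_def)
  finally show ?thesis .
qed

lemma integrable_powr_add:
  fixes f g :: "'a \<Rightarrow> real"
  assumes p: "p \<ge> 1" and m: "f \<in> borel_measurable M" "g \<in> borel_measurable M"
    and i: "integrable M (\<lambda>x. \<bar>f x\<bar> powr p)" "integrable M (\<lambda>x. \<bar>g x\<bar> powr p)"
  shows "integrable M (\<lambda>x. \<bar>f x + g x\<bar> powr p)"
proof (rule Bochner_Integration.integrable_bound[OF integrable_mult_right[OF Bochner_Integration.integrable_add[OF i], of "2 powr p"]])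
  show "(\<lambda>x. \<bar>f x + g x\<bar> powr p) \<in> borel_measurable M" using m by measurable
  show "AE x in M. norm (\<bar>f x + g x\<bar> powr p) \<le> norm (2 powr p * (\<bar>f x\<bar> powr p + \<bar>g x\<bar> powr p))"
    using abs_add_powr_le[OF p] by (intro AE_I2) simp
qed

lemma integrable_powr_diff:
  fixes f g :: "'a \<Rightarrow> real"
  assumes p: "p \<ge> 1" and m: "f \<in> borel_measurable M" "g \<in> borel_measurable M"
    and i: "integrable M (\<lambda>x. \<bar>f x\<bar> powr p)" "integrable M (\<lambda>x. \<bar>g x\<bar> powr p)"
  shows "integrable M (\<lambda>x. \<bar>f x - g x\<bar> powr p)"
  using integrable_powr_add[OF p m(1) borel_measurable_uminus[OF m(2)] i(1)] i(2) by simp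

lemma Lp_norm_nonneg: "Lp_norm M p f \<ge> 0"
  unfolding Lp_norm_def by simp

lemma Lp_norm_powr: "p \<ge> 1 \<Longrightarrow> Lp_norm M p f powr p = (\<integral>x. \<bar>f x\<bar> powr p \<partial>M)"
  unfolding Lp_norm_def by (simp add: powr_powr integral_nonneg_AE)

lemma Lp_norm_le:
  assumes p: "p \<ge> 1" and c: "c \<ge> 0" and le: "(\<integral>x. \<bar>f x\<bar> powr p \<partial>M) \<le> c powr p"
  shows "Lp_norm M p f \<le> c"
proof -
  have "(\<integral>x. \<bar>f x\<bar> powr p \<partial>M) powr (1 / p) \<le> (c powr p) powr (1 / p)"
    by (rule powr_mono2) (use le p in \<open>simp_all add: integral_nonneg_AE\<close>)
  then show ?thesis using p c by (simp add: Lp_norm_def powr_powr)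
qed

text \<open>Convexity of t^p is applied to |f| / a and |g| / b with weights a / (a + b) and b / (a +
  b). When a and b bound the two norms, the integrals of the p-th powers of these quotients are at
  most 1. The added e / 2 keeps a and b positive, which covers vanishing norms.\<close>

lemma Minkowski:
  fixes f g :: "'a \<Rightarrow> real"
  assumes p: "p \<ge> 1" and m: "f \<in> borel_measurable M" "g \<in> borel_measurable M"
    and i: "integrable M (\<lambda>x. \<bar>f x\<bar> powr p)" "integrable M (\<lambda>x. \<bar>g x\<bar> powr p)"
  shows "Lp_norm M p (\<lambda>x. f x + g x) \<le> Lp_norm M p f + Lp_norm M p g"
proof (rule field_le_epsilon)
  fix e :: real assume e: "e > 0"
  define a where "a = Lp_norm M p f + e / 2"
  define b where "b = Lp_norm M p g + e / 2"
  have a: "a > 0" and b: "b > 0" using e Lp_norm_nonneg[of M p f] Lp_norm_nonneg[of M p g] by (simp_all add: a_def b_def add_nonneg_pos)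
  define l where "l = b / (a + b)"
  have l: "0 \<le> l" "l \<le> 1" "1 - l = a / (a + b)" using a b by (simp_all add: l_def field_simps)
  have fa: "(\<integral>x. \<bar>f x\<bar> powr p \<partial>M) \<le> a powr p"
    unfolding Lp_norm_powr[OF p, symmetric] using e p Lp_norm_nonneg[of M p f] by (intro powr_mono2) (auto simp: a_def)
  have gb: "(\<integral>x. \<bar>g x\<bar> powr p \<partial>M) \<le> b powr p"
    unfolding Lp_norm_powr[OF p, symmetric] using e p Lp_norm_nonneg[of M p g] by (intro powr_mono2) (auto simp: b_def)
  have pw: "\<bar>f x + g x\<bar> powr p \<le> (a + b) powr p * ((1 - l) / a powr p * \<bar>f x\<bar> powr p + l / b powr p * \<bar>g x\<bar> powr p)" for x
  proof -
    have "\<bar>f x + g x\<bar> powr p \<le> (\<bar>f x\<bar> + \<bar>g x\<bar>) powr p" using p by (intro powr_mono2) auto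
    also have "\<bar>f x\<bar> + \<bar>g x\<bar> = (a + b) * ((1 - l) * (\<bar>f x\<bar> / a) + l * (\<bar>g x\<bar> / b))"
    proof -
      have "(a + b) * (1 - l) = a" "(a + b) * l = b" unfolding l(3) using a b by (simp_all add: l_def)
      then have "(a + b) * (1 - l) * (\<bar>f x\<bar> / a) + (a + b) * l * (\<bar>g x\<bar> / b) = \<bar>f x\<bar> + \<bar>g x\<bar>" using a b by simp
      then show ?thesis by (simp only: distrib_left mult.assoc)
    qed
    also have "\<dots> powr p = (a + b) powr p * ((1 - l) * (\<bar>f x\<bar> / a) + l * (\<bar>g x\<bar> / b)) powr p"
      by (rule powr_mult)
    also have "\<dots> \<le> (a + b) powr p * ((1 - l) * (\<bar>f x\<bar> / a) powr p + l * (\<bar>g x\<bar> / b) powr p)"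
      using a b l by (intro mult_left_mono powr_convex_combination[OF p]) auto
    finally show ?thesis using a b by (simp add: powr_divide)
  qed
  have "(\<integral>x. \<bar>f x + g x\<bar> powr p \<partial>M) \<le> (\<integral>x. (a + b) powr p * ((1 - l) / a powr p * \<bar>f x\<bar> powr p + l / b powr p * \<bar>g x\<bar> powr p) \<partial>M)"
    by (rule integral_mono[OF integrable_powr_add[OF p m i] _ pw])
       (intro integrable_mult_right Bochner_Integration.integrable_add i)
  also have "\<dots> = (a + b) powr p * ((1 - l) / a powr p * (\<integral>x. \<bar>f x\<bar> powr p \<partial>M) + l / b powr p * (\<integral>x. \<bar>g x\<bar> powr p \<partial>M))"
    using i by simp
  also have "\<dots> \<le> (a + b) powr p * ((1 - l) / a powr p * a powr p + l / b powr p * b powr p)"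
    using a b l fa gb by (intro mult_left_mono add_mono) auto
  also have "\<dots> = (a + b) powr p" using a b by simp
  finally have "Lp_norm M p (\<lambda>x. f x + g x) \<le> a + b" using a b by (intro Lp_norm_le[OF p]) auto
  then show "Lp_norm M p (\<lambda>x. f x + g x) \<le> Lp_norm M p f + Lp_norm M p g + e" by (simp add: a_def b_def)
qed

lemma Lp_norm_minus_commute: "Lp_norm M p (\<lambda>x. f x - g x) = Lp_norm M p (\<lambda>x. g x - f x)"
  unfolding Lp_norm_def by (simp add: abs_minus_commute)

lemma Lp_norm_tendsto_0_iff:
  assumes p: "p \<ge> 1"
  shows "(\<lambda>n. Lp_norm M p (f n)) \<longlonglongrightarrow> 0 \<longleftrightarrow> (\<lambda>n. \<integral>x. \<bar>f n x\<bar> powr p \<partial>M) \<longlonglongrightarrow> 0"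
proof
  assume "(\<lambda>n. Lp_norm M p (f n)) \<longlonglongrightarrow> 0"
  then have "(\<lambda>n. Lp_norm M p (f n) powr p) \<longlonglongrightarrow> 0"
    by (rule tendsto_zero_powrI[OF _ tendsto_const]) (use p in \<open>simp_all add: Lp_norm_nonneg\<close>)
  then show "(\<lambda>n. \<integral>x. \<bar>f n x\<bar> powr p \<partial>M) \<longlonglongrightarrow> 0" by (simp add: Lp_norm_powr[OF p])
next
  assume "(\<lambda>n. \<integral>x. \<bar>f n x\<bar> powr p \<partial>M) \<longlonglongrightarrow> 0"
  then show "(\<lambda>n. Lp_norm M p (f n)) \<longlonglongrightarrow> 0"
    unfolding Lp_norm_def by (rule tendsto_zero_powrI[OF _ tendsto_const]) (use p in \<open>auto simp: integral_nonneg_AE\<close>)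
qed

section \<open>Rapidly convergent sequences\<close>

text \<open>Markov's inequality bounds the measure of the exceptional set by (1/4)^n / (1/2)^n =
  (1/2)^n, which is summable, and the Borel-Cantelli lemma applies. This is the origin of the rate
  1/4 required of the subsequence.\<close>

lemma AE_eventually_less_geometric:
  fixes f :: "nat \<Rightarrow> 'a \<Rightarrow> real"
  assumes f: "\<And>n. integrable M (f n)" "\<And>n x. f n x \<ge> 0" and le: "\<And>n. (\<integral>x. f n x \<partial>M) \<le> (1/4) ^ n"
  shows "AE x in M. \<forall>\<^sub>F n in sequentially. f n x < (1/2) ^ n"
proof -
  note [measurable] = borel_measurable_integrable[OF f(1)]
  define S where "S n = {x \<in> space M. f n x \<ge> (1/2) ^ n}" for n
  have [measurable]: "S n \<in> sets M" for n unfolding S_def by measurable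
  have em: "emeasure M (S n) \<le> ennreal ((1/2) ^ n)" for n
  proof -
    have "emeasure M (S n) \<le> ennreal ((1 / (1/2) ^ n) * (\<integral>x. f n x \<partial>M))"
      unfolding S_def by (rule integral_Markov_inequality) (use f in auto)
    also have "\<dots> \<le> ennreal ((1 / (1/2) ^ n) * (1/4) ^ n)" by (intro ennreal_leI mult_left_mono le) simp
    also have "(1 / (1/2) ^ n) * (1/4) ^ n = (1/2 :: real) ^ n"
    proof -
      have "(1/4 :: real) ^ n = (1/2) ^ n * (1/2) ^ n" unfolding power_mult_distrib[symmetric] by simp
      then show ?thesis by simp
    qed
    finally show ?thesis .
  qed
  have "AE x in M. \<forall>\<^sub>F n in sequentially. x \<in> space M - S n"
  proof (rule borel_cantelli_AE1)
    show "emeasure M (S n) < \<infinity>" for n using em[of n] by (rule order.strict_trans1) simp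
    have "measure M (S n) \<le> (1/2) ^ n" for n
      using em[of n] by (simp add: measure_def enn2real_leI)
    then show "summable (\<lambda>n. measure M (S n))"
      by (intro summable_comparison_test'[OF summable_geometric[of "1/2 :: real"], of 0]) auto
  qed measurable
  then show ?thesis
  proof (rule eventually_mono)
    fix x assume "\<forall>\<^sub>F n in sequentially. x \<in> space M - S n"
    then show "\<forall>\<^sub>F n in sequentially. f n x < (1/2) ^ n" by (rule eventually_mono) (auto simp: S_def)
  qed
qed

lemma convergent_geometric:
  fixes a :: "nat \<Rightarrow> real"
  assumes r: "0 \<le> r" "r < 1" and le: "\<forall>\<^sub>F n in sequentially. \<bar>a n - a (Suc n)\<bar> \<le> r ^ n"
  shows "convergent a"
proof -
  have "summable (\<lambda>n. a (Suc n) - a n)"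
    by (rule summable_comparison_test_ev[OF _ summable_geometric[of r]])
       (use le r in \<open>auto elim!: eventually_mono simp: abs_minus_commute\<close>)
  then have "convergent (\<lambda>n. a n - a 0)" unfolding summable_iff_convergent sum_lessThan_telescope .
  then have "convergent (\<lambda>n. (a n - a 0) + a 0)" by (intro convergent_add convergent_const)
  then show ?thesis by simp
qed

lemma (in Metric_space) MCauchy_geometric:
  assumes \<sigma>: "range \<sigma> \<subseteq> M" and le: "\<forall>\<^sub>F n in sequentially. d (\<sigma> n) (\<sigma> (Suc n)) \<le> 2 * (1/2) ^ n"
  shows "MCauchy \<sigma>"
  unfolding MCauchy_def
proof (intro conjI allI impI \<sigma>)
  fix e :: real assume e: "e > 0"
  obtain N where N: "\<And>n. n \<ge> N \<Longrightarrow> d (\<sigma> n) (\<sigma> (Suc n)) \<le> 2 * (1/2) ^ n" using le unfolding eventually_sequentially by blast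
  have in_M: "\<sigma> n \<in> M" for n using \<sigma> by blast
  \<comment> \<open>Since 2 (1/2)^n = 4 (1/2)^n - 4 (1/2)^(n+1), the bounds telescope.\<close>
  have step: "d (\<sigma> n) (\<sigma> (n + k)) \<le> 4 * (1/2) ^ n - 4 * (1/2) ^ (n + k)" if "n \<ge> N" for n k
  proof (induction k)
    case (Suc k)
    have "d (\<sigma> n) (\<sigma> (n + Suc k)) \<le> d (\<sigma> n) (\<sigma> (n + k)) + d (\<sigma> (n + k)) (\<sigma> (Suc (n + k)))"
      using triangle[of "\<sigma> n" "\<sigma> (n + k)" "\<sigma> (Suc (n + k))"] in_M by simp
    also have "\<dots> \<le> 4 * (1/2) ^ n - 4 * (1/2) ^ (n + k) + 2 * (1/2) ^ (n + k)"
      using Suc N[of "n + k"] that by (intro add_mono) auto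
    finally show ?case by simp
  qed (simp add: in_M)
  have "(\<lambda>n. 4 * (1/2 :: real) ^ n) \<longlonglongrightarrow> 4 * 0" by (intro tendsto_intros) simp
  from order_tendstoD(2)[OF this, of e] e obtain N' where N': "\<And>n. n \<ge> N' \<Longrightarrow> 4 * (1/2) ^ n < e"
    unfolding eventually_sequentially by auto
  have 1: "d (\<sigma> n) (\<sigma> n') < e" if "max N N' \<le> n" "n \<le> n'" for n n'
  proof -
    have "d (\<sigma> n) (\<sigma> n') \<le> 4 * (1/2) ^ n - 4 * (1/2) ^ n'" using step[of n "n' - n"] that by simp
    also have "\<dots> \<le> 4 * (1/2) ^ n" by simp
    also have "\<dots> < e" using N' that by simp
    finally show ?thesis .
  qed
  show "\<exists>N. \<forall>n n'. N \<le> n \<longrightarrow> N \<le> n' \<longrightarrow> d (\<sigma> n) (\<sigma> n') < e"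
  proof (intro exI[of _ "max N N'"] allI impI)
    fix n n' assume "max N N' \<le> n" "max N N' \<le> n'"
    then show "d (\<sigma> n) (\<sigma> n') < e" using 1[of n n'] 1[of n' n] commute[of "\<sigma> n" "\<sigma> n'"] by (cases "n \<le> n'") auto
  qed
qed

lemma div_one_plus_mono: "0 \<le> s \<Longrightarrow> s \<le> t \<Longrightarrow> s / (1 + s) \<le> t / (1 + t)" for s t :: real
  by (simp add: field_simps)

text \<open>Together with monotonicity this gives the triangle inequality for d / (1 + d).\<close>

lemma div_one_plus_subadditive: "s / (1 + s) + t / (1 + t) \<ge> (s + t) / (1 + (s + t))" if "0 \<le> s" "0 \<le> t" for s t :: real
proof -
  have "s / (1 + (s + t)) \<le> s / (1 + s)" "t / (1 + (s + t)) \<le> t / (1 + t)"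
    using that by (auto intro!: divide_left_mono mult_pos_pos)
  then show ?thesis by (simp add: add_divide_distrib)
qed

section \<open>Sections of the bundle of linear maps\<close>

context riemannian_pair begin

lemma volM_measurable: "f \<in> measurable (lebesgue_algebra A) L \<Longrightarrow> f \<in> measurable volM L"
  unfolding riemannian_measure_def by (rule M.measurable_lebesgue_algebra_completion[OF M.chartwise_abs_cont_riemannian])

lemma volM_AE: "AE_manifold A P \<longleftrightarrow> (AE x in volM. P x)"
  unfolding riemannian_measure_def by (rule M.AE_manifold_iff_AE_completion[OF M.chartwise_abs_cont_riemannian])

lemma in_bundle: "D \<in> measurable (lebesgue_algebra A) bborel \<Longrightarrow> D x \<in> bundle"
  using measurable_space[of D "lebesgue_algebra A" bborel x] by (simp add: bborel_sets(2))

text \<open>That D x lies over x is not built in; it is the separate assumption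
  \<open>fst (D x) = x\<close> where it matters. The power is taken without absolute value because
  the norm is nonnegative on the bundle.\<close>

definition Lp_sections :: "real \<Rightarrow> ('m \<Rightarrow> ('m, 'k, 'n, 'l) hom_elem) set" where
  "Lp_sections p = {D \<in> measurable (lebesgue_algebra A) bborel. integrable volM (\<lambda>x. hnorm (D x) powr p)}"

definition section_dist where
  "section_dist p d \<mu> D E = (\<integral>x. d (D x) (E x) / (1 + d (D x) (E x)) \<partial>completion \<mu>) +
     Lp_norm volM p (\<lambda>x. hnorm (D x) - hnorm (E x))"

lemma Lp_sectionsD:
  assumes "D \<in> Lp_sections p"
  shows "D \<in> measurable (lebesgue_algebra A) bborel" "D x \<in> bundle"
    "(\<lambda>x. hnorm (D x)) \<in> borel_measurable volM" "integrable volM (\<lambda>x. \<bar>hnorm (D x)\<bar> powr p)"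
proof -
  show 1: "D \<in> measurable (lebesgue_algebra A) bborel" for x using assms by (simp add: Lp_sections_def)
  show "D x \<in> bundle" for x by (rule in_bundle[OF 1])
  then have "hnorm (D x) \<ge> 0" for x by (rule hnorm_nonneg)
  then show "integrable volM (\<lambda>x. \<bar>hnorm (D x)\<bar> powr p)" using assms by (simp add: Lp_sections_def)
  show "(\<lambda>x. hnorm (D x)) \<in> borel_measurable volM" by (rule volM_measurable[OF hnorm_measurable[OF 1]])
qed

context
  fixes p :: real and d :: "('m, 'k, 'n, 'l) hom_elem \<Rightarrow> ('m, 'k, 'n, 'l) hom_elem \<Rightarrow> real" and \<mu> :: "'m measure"
  assumes p: "p \<ge> 1" and d: "continuous_distance A B d" and \<mu>: "finite_positive_abs_cont A \<mu>"
begin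

interpretation md: Metric_space "bundle" d by (rule metric_d[OF d])

abbreviation "\<rho> D E x \<equiv> d (D x) (E x) / (1 + d (D x) (E x))"

abbreviation "hdiff D E x \<equiv> hnorm (D x) - hnorm (E x)"

lemma \<mu>_abs_cont: "chartwise_abs_cont A \<mu>"
  using \<mu> unfolding finite_positive_abs_cont_def chartwise_abs_cont_def by (elim conjE) (intro conjI)

lemma finite_completion: "finite_measure (completion \<mu>)"
proof -
  have "finite_measure \<mu>" using \<mu> unfolding finite_positive_abs_cont_def by (elim conjE)
  then show ?thesis by (intro finite_measureI) (simp add: finite_measure.emeasure_finite)
qed

lemma \<mu>_AE: "AE_manifold A P \<longleftrightarrow> (AE x in completion \<mu>. P x)"
  by (rule M.AE_manifold_iff_AE_completion[OF \<mu>_abs_cont])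

lemma \<rho>_bounds: "0 \<le> \<rho> D E x" "\<rho> D E x \<le> 1"
proof -
  have "0 < 1 + d (D x) (E x)" using md.nonneg[of "D x" "E x"] by linarith
  then show "0 \<le> \<rho> D E x" "\<rho> D E x \<le> 1" by (simp_all add: divide_le_eq_1)
qed

lemma \<rho>_measurable:
  assumes "D \<in> measurable (lebesgue_algebra A) bborel" "E \<in> measurable (lebesgue_algebra A) bborel"
  shows "\<rho> D E \<in> borel_measurable (completion \<mu>)"
proof -
  have "(\<lambda>x. d (D x) (E x)) \<in> borel_measurable (completion \<mu>)"
    by (rule M.measurable_lebesgue_algebra_completion[OF \<mu>_abs_cont distance_measurable[OF d assms]])
  then show ?thesis by measurable
qed

lemma \<rho>_integrable:
  assumes "D \<in> measurable (lebesgue_algebra A) bborel" "E \<in> measurable (lebesgue_algebra A) bborel"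
  shows "integrable (completion \<mu>) (\<rho> D E)"
  by (rule finite_measure.integrable_const_bound[OF finite_completion _ \<rho>_measurable[OF assms], of 1])
     (intro AE_I2, use \<rho>_bounds in simp)

lemma hdiff_integrable:
  assumes "D \<in> Lp_sections p" "E \<in> Lp_sections p"
  shows "hdiff D E \<in> borel_measurable volM" "integrable volM (\<lambda>x. \<bar>hdiff D E x\<bar> powr p)"
  using Lp_sectionsD(3)[OF assms(1)] Lp_sectionsD(3)[OF assms(2)]
    integrable_powr_diff[OF p Lp_sectionsD(3)[OF assms(1)] Lp_sectionsD(3)[OF assms(2)] Lp_sectionsD(4)[OF assms(1)] Lp_sectionsD(4)[OF assms(2)]]
  by simp_all

lemma section_dist_parts:
  "0 \<le> (\<integral>x. \<rho> D E x \<partial>completion \<mu>)" "(\<integral>x. \<rho> D E x \<partial>completion \<mu>) \<le> section_dist p d \<mu> D E"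
  "Lp_norm volM p (hdiff D E) \<le> section_dist p d \<mu> D E" "0 \<le> section_dist p d \<mu> D E"
proof -
  show 1: "0 \<le> (\<integral>x. \<rho> D E x \<partial>completion \<mu>)" by (rule integral_nonneg_AE) (intro AE_I2 \<rho>_bounds)
  show "(\<integral>x. \<rho> D E x \<partial>completion \<mu>) \<le> section_dist p d \<mu> D E" "Lp_norm volM p (hdiff D E) \<le> section_dist p d \<mu> D E" "0 \<le> section_dist p d \<mu> D E"
    using 1 Lp_norm_nonneg[of volM p "hdiff D E"] by (simp_all add: section_dist_def)
qed

lemma section_dist_commute: "section_dist p d \<mu> D E = section_dist p d \<mu> E D"
  unfolding section_dist_def by (simp add: md.commute Lp_norm_minus_commute[of volM p "\<lambda>x. hnorm (D x)"])

lemma section_dist_triangle: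
  assumes D: "D \<in> Lp_sections p" and E: "E \<in> Lp_sections p" and F: "F \<in> Lp_sections p"
  shows "section_dist p d \<mu> D F \<le> section_dist p d \<mu> D E + section_dist p d \<mu> E F"
proof -
  note m = Lp_sectionsD(1)[OF D] Lp_sectionsD(1)[OF E] Lp_sectionsD(1)[OF F]
  have "\<rho> D F x \<le> \<rho> D E x + \<rho> E F x" for x
  proof -
    have "\<rho> D F x \<le> (d (D x) (E x) + d (E x) (F x)) / (1 + (d (D x) (E x) + d (E x) (F x)))"
      by (rule div_one_plus_mono) (simp_all add: md.triangle in_bundle m)
    also have "\<dots> \<le> \<rho> D E x + \<rho> E F x" by (rule div_one_plus_subadditive) simp_all
    finally show ?thesis .
  qed
  then have "(\<integral>x. \<rho> D F x \<partial>completion \<mu>) \<le> (\<integral>x. \<rho> D E x + \<rho> E F x \<partial>completion \<mu>)"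
    by (intro integral_mono Bochner_Integration.integrable_add \<rho>_integrable m)
  also have "\<dots> = (\<integral>x. \<rho> D E x \<partial>completion \<mu>) + (\<integral>x. \<rho> E F x \<partial>completion \<mu>)"
    by (intro Bochner_Integration.integral_add \<rho>_integrable m)
  finally have 1: "(\<integral>x. \<rho> D F x \<partial>completion \<mu>) \<le> (\<integral>x. \<rho> D E x \<partial>completion \<mu>) + (\<integral>x. \<rho> E F x \<partial>completion \<mu>)" .
  have "Lp_norm volM p (hdiff D F) = Lp_norm volM p (\<lambda>x. hdiff D E x + hdiff E F x)" by simp
  also have "\<dots> \<le> Lp_norm volM p (hdiff D E) + Lp_norm volM p (hdiff E F)"
    by (rule Minkowski[OF p hdiff_integrable(1)[OF D E] hdiff_integrable(1)[OF E F] hdiff_integrable(2)[OF D E] hdiff_integrable(2)[OF E F]])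
  finally show ?thesis using 1 by (simp add: section_dist_def)
qed

lemma section_dist_0_imp:
  assumes D: "D \<in> Lp_sections p" and E: "E \<in> Lp_sections p" and 0: "section_dist p d \<mu> D E = 0"
  shows "AE_manifold A (\<lambda>x. D x = E x)"
  unfolding \<mu>_AE
proof -
  note m = Lp_sectionsD(1)[OF D] Lp_sectionsD(1)[OF E]
  have "(\<integral>x. \<rho> D E x \<partial>completion \<mu>) = 0" using section_dist_parts(1)[of D E] section_dist_parts(2)[of D E] 0 by linarith
  then have "AE x in completion \<mu>. \<rho> D E x = 0"
    by (subst (asm) integral_nonneg_eq_0_iff_AE[OF \<rho>_integrable[OF m]]) (intro AE_I2 \<rho>_bounds)
  then show "AE x in completion \<mu>. D x = E x"
  proof (rule eventually_mono)
    fix x assume "\<rho> D E x = 0"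
    then have "d (D x) (E x) = 0" using md.nonneg[of "D x" "E x"] by (auto simp: divide_eq_0_iff)
    then show "D x = E x" using md.zero[OF in_bundle[OF m(1)] in_bundle[OF m(2)]] by simp
  qed
qed

lemma section_dist_cong_AE:
  assumes D: "D \<in> Lp_sections p" and D': "D' \<in> Lp_sections p" and E: "E \<in> Lp_sections p"
    and eq: "AE_manifold A (\<lambda>x. D x = D' x)"
  shows "section_dist p d \<mu> D E = section_dist p d \<mu> D' E"
proof -
  have "AE x in completion \<mu>. \<rho> D E x = \<rho> D' E x" using eq unfolding \<mu>_AE by (rule eventually_mono) simp
  then have 1: "(\<integral>x. \<rho> D E x \<partial>completion \<mu>) = (\<integral>x. \<rho> D' E x \<partial>completion \<mu>)"
    by (intro integral_cong_AE \<rho>_measurable Lp_sectionsD(1)[OF D] Lp_sectionsD(1)[OF D'] Lp_sectionsD(1)[OF E])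
  have "AE x in volM. \<bar>hdiff D E x\<bar> powr p = \<bar>hdiff D' E x\<bar> powr p" using eq unfolding volM_AE by (rule eventually_mono) simp
  then have "(\<integral>x. \<bar>hdiff D E x\<bar> powr p \<partial>volM) = (\<integral>x. \<bar>hdiff D' E x\<bar> powr p \<partial>volM)"
    by (intro integral_cong_AE borel_measurable_integrable hdiff_integrable D D' E)
  with 1 show ?thesis by (simp add: section_dist_def Lp_norm_def)
qed

lemma section_dist_self: "D \<in> Lp_sections p \<Longrightarrow> section_dist p d \<mu> D D = 0"
  using p Lp_sectionsD(2)[of D p] by (simp add: section_dist_def Lp_norm_def)

text \<open>The first summand of the distance is an integral against \<mu>, the second against the
  Riemannian measure. Each gives a geometric bound almost everywhere for its own measure, and both
  become statements about the same null sets of M.\<close>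

lemma rapid_AE_Cauchy:
  assumes D: "\<And>n. D n \<in> Lp_sections p" and le: "\<And>n. section_dist p d \<mu> (D n) (D (Suc n)) \<le> (1/4) ^ n"
  shows "AE_manifold A (\<lambda>x. md.MCauchy (\<lambda>n. D n x) \<and> convergent (\<lambda>n. hnorm (D n x)))"
proof (rule M.AE_manifold_conj)
  have "AE x in completion \<mu>. \<forall>\<^sub>F n in sequentially. \<rho> (D n) (D (Suc n)) x < (1/2) ^ n"
    by (rule AE_eventually_less_geometric)
       (rule \<rho>_integrable[OF Lp_sectionsD(1)[OF D] Lp_sectionsD(1)[OF D]], rule \<rho>_bounds, rule order_trans[OF section_dist_parts(2) le])
  then show "AE_manifold A (\<lambda>x. md.MCauchy (\<lambda>n. D n x))"
    unfolding \<mu>_AE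
  proof (rule eventually_mono)
    fix x assume "\<forall>\<^sub>F n in sequentially. \<rho> (D n) (D (Suc n)) x < (1/2) ^ n"
    \<comment> \<open>n \<ge> 1 gives (1/2)^n \<le> 1/2, so that t < (1/2)^n * (1 + t) can be solved
      for t with the factor 2. In this way a bound on d / (1 + d) becomes a bound on d.\<close>
    then have ev: "\<forall>\<^sub>F n in sequentially. \<rho> (D n) (D (Suc n)) x < (1/2) ^ n \<and> n \<ge> 1"
      using eventually_ge_at_top by (rule eventually_conj)
    show "md.MCauchy (\<lambda>n. D n x)"
    proof (rule md.MCauchy_geometric)
      show "range (\<lambda>n. D n x) \<subseteq> bundle" using Lp_sectionsD(2)[OF D] by (rule image_subsetI)
      show "\<forall>\<^sub>F n in sequentially. d (D n x) (D (Suc n) x) \<le> 2 * (1/2) ^ n"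
        using ev
      proof (rule eventually_mono, elim conjE)
        fix n :: nat assume l: "\<rho> (D n) (D (Suc n)) x < (1/2) ^ n" and n: "n \<ge> 1"
        let ?t = "d (D n x) (D (Suc n) x)" let ?s = "(1/2) ^ n :: real"
        have s: "?s \<le> 1/2" using power_decreasing[OF n, of "1/2 :: real"] by simp
        have t: "?t \<ge> 0" by simp
        have "?t < ?s * (1 + ?t)" using l t by (simp add: divide_less_eq)
        also have "?s * (1 + ?t) \<le> ?s + 1/2 * ?t" using mult_right_mono[OF s t] by (simp add: distrib_left)
        finally show "?t \<le> 2 * ?s" by simp
      qed
    qed
  qed
next
  have "AE x in volM. \<forall>\<^sub>F n in sequentially. \<bar>hdiff (D n) (D (Suc n)) x\<bar> powr p < (1/2) ^ n"
  proof (rule AE_eventually_less_geometric)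
    show "integrable volM (\<lambda>x. \<bar>hdiff (D n) (D (Suc n)) x\<bar> powr p)" for n by (rule hdiff_integrable(2)[OF D D])
    show "(\<integral>x. \<bar>hdiff (D n) (D (Suc n)) x\<bar> powr p \<partial>volM) \<le> (1/4) ^ n" for n
    proof -
      have "Lp_norm volM p (hdiff (D n) (D (Suc n))) powr p \<le> ((1/4) ^ n) powr p"
        by (rule powr_mono2[OF _ Lp_norm_nonneg order_trans[OF section_dist_parts(3) le]]) (use p in simp)
      also have "\<dots> \<le> ((1/4) ^ n) powr 1" by (rule powr_mono'[OF p]) (simp_all add: power_le_one)
      finally show ?thesis unfolding Lp_norm_powr[OF p] by simp
    qed
  qed simp
  then show "AE_manifold A (\<lambda>x. convergent (\<lambda>n. hnorm (D n x)))"
    unfolding volM_AE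
  proof (rule eventually_mono)
    fix x assume ev: "\<forall>\<^sub>F n in sequentially. \<bar>hdiff (D n) (D (Suc n)) x\<bar> powr p < (1/2) ^ n"
    show "convergent (\<lambda>n. hnorm (D n x))"
    proof (rule convergent_geometric)
      \<comment> \<open>The bound concerns p-th powers; its p-th root is again geometric, with ratio
        (1/2)^(1/p).\<close>
      show "0 \<le> (1/2 :: real) powr (1 / p)" by simp
      show "(1/2 :: real) powr (1 / p) < 1" using powr_less_mono2[of "1 / p" "1/2 :: real" 1] p by simp
      show "\<forall>\<^sub>F n in sequentially. \<bar>hdiff (D n) (D (Suc n)) x\<bar> \<le> ((1/2) powr (1 / p)) ^ n"
        using ev
      proof (rule eventually_mono)
        fix n assume "\<bar>hdiff (D n) (D (Suc n)) x\<bar> powr p < (1/2) ^ n"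
        then have "(\<bar>hdiff (D n) (D (Suc n)) x\<bar> powr p) powr (1 / p) \<le> ((1/2) ^ n) powr (1 / p)"
          using p by (intro powr_mono2) auto
        moreover have "(\<bar>hdiff (D n) (D (Suc n)) x\<bar> powr p) powr (1 / p) = \<bar>hdiff (D n) (D (Suc n)) x\<bar>"
          using p by (simp add: powr_powr)
        moreover have "((1/2 :: real) ^ n) powr (1 / p) = ((1/2) powr (1 / p)) ^ n"
          by (simp add: powr_realpow[symmetric] powr_powr mult.commute)
        ultimately show "\<bar>hdiff (D n) (D (Suc n)) x\<bar> \<le> ((1/2) powr (1 / p)) ^ n" by simp
      qed
    qed
  qed
qed

text \<open>For n beyond the Cauchy index, Fatou's lemma in m bounds the L^p norm of the difference
  of the norms of D n and E, which also yields integrability for E. The other summand converges by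
  dominated convergence with the constant 1, integrable because \<mu> is finite.\<close>

lemma Cauchy_AE_limit:
  assumes D: "\<And>n. D n \<in> Lp_sections p" and E: "E \<in> measurable (lebesgue_algebra A) bborel"
    and lim: "AE_manifold A (\<lambda>x. limitin btop (\<lambda>n. D n x) (E x) sequentially)"
    and Cauchy: "\<And>e. e > 0 \<Longrightarrow> \<exists>N. \<forall>m\<ge>N. \<forall>n\<ge>N. section_dist p d \<mu> (D m) (D n) < e"
  shows "E \<in> Lp_sections p" "(\<lambda>n. \<integral>x. \<bar>hdiff (D n) E x\<bar> powr p \<partial>volM) \<longlonglongrightarrow> 0"
    "(\<lambda>n. section_dist p d \<mu> (D n) E) \<longlonglongrightarrow> 0"
proof -
  have Em: "(\<lambda>x. hnorm (E x)) \<in> borel_measurable volM" by (rule volM_measurable[OF hnorm_measurable[OF E]])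
  have E0: "hnorm (E x) \<ge> 0" for x by (rule hnorm_nonneg[OF in_bundle[OF E]])
  have dm: "(\<lambda>x. \<bar>hdiff (D n) E x\<bar> powr p) \<in> borel_measurable volM" for n
    using Lp_sectionsD(3)[OF D[of n]] Em by measurable
  have key: "\<exists>N. \<forall>n\<ge>N. integrable volM (\<lambda>x. \<bar>hdiff (D n) E x\<bar> powr p) \<and> (\<integral>x. \<bar>hdiff (D n) E x\<bar> powr p \<partial>volM) \<le> e powr p"
    if e: "e > 0" for e
  proof -
    obtain N where N: "\<And>m n. m \<ge> N \<Longrightarrow> n \<ge> N \<Longrightarrow> section_dist p d \<mu> (D m) (D n) < e" using Cauchy[OF e] by blast
    show ?thesis
    proof (rule exI[of _ N], intro allI impI)
      fix n assume n: "n \<ge> N"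
      have le: "(\<integral>x. \<bar>hdiff (D n) (D m) x\<bar> powr p \<partial>volM) \<le> e powr p" if "m \<ge> N" for m
        unfolding Lp_norm_powr[OF p, symmetric]
        by (rule powr_mono2[OF _ Lp_norm_nonneg order_trans[OF section_dist_parts(3) less_imp_le[OF N[OF n that]]]]) (use p in simp)
      have l: "AE x in volM. (\<lambda>m. \<bar>hdiff (D n) (D m) x\<bar> powr p) \<longlonglongrightarrow> \<bar>hdiff (D n) E x\<bar> powr p"
        using lim unfolding volM_AE
      proof (rule eventually_mono)
        fix x assume "limitin btop (\<lambda>n. D n x) (E x) sequentially"
        then have "(\<lambda>m. hnorm (D m x)) \<longlonglongrightarrow> hnorm (E x)" by (rule limitin_btop_hnorm)
        then have "(\<lambda>m. \<bar>hdiff (D n) (D m) x\<bar>) \<longlonglongrightarrow> \<bar>hdiff (D n) E x\<bar>" by (intro tendsto_intros)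
        then show "(\<lambda>m. \<bar>hdiff (D n) (D m) x\<bar> powr p) \<longlonglongrightarrow> \<bar>hdiff (D n) E x\<bar> powr p"
          by (rule tendsto_powr'[OF _ tendsto_const]) (use p in simp)
      qed
      have "(\<integral>\<^sup>+x. ennreal (\<bar>hdiff (D n) E x\<bar> powr p) \<partial>volM) = (\<integral>\<^sup>+x. liminf (\<lambda>m. ennreal (\<bar>hdiff (D n) (D m) x\<bar> powr p)) \<partial>volM)"
      proof (rule nn_integral_cong_AE, use l in \<open>rule eventually_mono\<close>)
        fix x assume "(\<lambda>m. \<bar>hdiff (D n) (D m) x\<bar> powr p) \<longlonglongrightarrow> \<bar>hdiff (D n) E x\<bar> powr p"
        then have "(\<lambda>m. ennreal (\<bar>hdiff (D n) (D m) x\<bar> powr p)) \<longlonglongrightarrow> ennreal (\<bar>hdiff (D n) E x\<bar> powr p)" by (rule tendsto_ennrealI)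
        from lim_imp_Liminf[OF sequentially_bot this] show "ennreal (\<bar>hdiff (D n) E x\<bar> powr p) = liminf (\<lambda>m. ennreal (\<bar>hdiff (D n) (D m) x\<bar> powr p))" by simp
      qed
      also have "\<dots> \<le> liminf (\<lambda>m. \<integral>\<^sup>+x. ennreal (\<bar>hdiff (D n) (D m) x\<bar> powr p) \<partial>volM)"
        by (rule nn_integral_liminf) (rule measurable_compose[OF borel_measurable_integrable[OF hdiff_integrable(2)[OF D D]] measurable_ennreal])
      also have "\<dots> \<le> liminf (\<lambda>m :: nat. ennreal (e powr p))"
      proof (rule Liminf_mono)
        show "\<forall>\<^sub>F m in sequentially. (\<integral>\<^sup>+x. ennreal (\<bar>hdiff (D n) (D m) x\<bar> powr p) \<partial>volM) \<le> ennreal (e powr p)"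
          using eventually_ge_at_top[of N]
        proof (rule eventually_mono)
          fix m assume "N \<le> m"
          then show "(\<integral>\<^sup>+x. ennreal (\<bar>hdiff (D n) (D m) x\<bar> powr p) \<partial>volM) \<le> ennreal (e powr p)"
            using le by (subst nn_integral_eq_integral[OF hdiff_integrable(2)[OF D D]]) (auto intro: ennreal_leI)
        qed
      qed
      also have "\<dots> = ennreal (e powr p)" by (simp add: Liminf_const)
      finally have nn: "(\<integral>\<^sup>+x. ennreal (\<bar>hdiff (D n) E x\<bar> powr p) \<partial>volM) \<le> ennreal (e powr p)" .
      have i: "integrable volM (\<lambda>x. \<bar>hdiff (D n) E x\<bar> powr p)"
      proof (rule integrableI_nonneg[OF dm])
        show "(\<integral>\<^sup>+x. ennreal (\<bar>hdiff (D n) E x\<bar> powr p) \<partial>volM) < \<infinity>" using nn by (rule order.strict_trans1) simp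
      qed simp
      show "integrable volM (\<lambda>x. \<bar>hdiff (D n) E x\<bar> powr p) \<and> (\<integral>x. \<bar>hdiff (D n) E x\<bar> powr p \<partial>volM) \<le> e powr p"
        using i nn by (subst (asm) nn_integral_eq_integral[OF i]) auto
    qed
  qed
  obtain n where "integrable volM (\<lambda>x. \<bar>hdiff (D n) E x\<bar> powr p)" using key[OF zero_less_one] by blast
  from integrable_powr_diff[OF p Lp_sectionsD(3)[OF D[of n]] _ Lp_sectionsD(4)[OF D[of n]] this]
  have "integrable volM (\<lambda>x. \<bar>hnorm (D n x) - hdiff (D n) E x\<bar> powr p)"
    using Lp_sectionsD(3)[OF D[of n]] Em by simp
  then show ELp: "E \<in> Lp_sections p" using E E0 by (simp add: Lp_sections_def)
  have Lp0: "(\<lambda>n. Lp_norm volM p (hdiff (D n) E)) \<longlonglongrightarrow> 0"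
  proof (rule LIMSEQ_I)
    fix e :: real assume e: "e > 0"
    then obtain N where N: "\<And>n. n \<ge> N \<Longrightarrow> (\<integral>x. \<bar>hdiff (D n) E x\<bar> powr p \<partial>volM) \<le> (e / 2) powr p"
      using key[of "e / 2"] by auto
    show "\<exists>N. \<forall>n\<ge>N. norm (Lp_norm volM p (hdiff (D n) E) - 0) < e"
    proof (rule exI[of _ N], intro allI impI)
      fix n assume "N \<le> n"
      from Lp_norm_le[OF p _ N[OF this]] e Lp_norm_nonneg[of volM p "hdiff (D n) E"]
      show "norm (Lp_norm volM p (hdiff (D n) E) - 0) < e" by simp
    qed
  qed
  then show "(\<lambda>n. \<integral>x. \<bar>hdiff (D n) E x\<bar> powr p \<partial>volM) \<longlonglongrightarrow> 0" unfolding Lp_norm_tendsto_0_iff[OF p] .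
  have "(\<lambda>n. \<integral>x. \<rho> (D n) E x \<partial>completion \<mu>) \<longlonglongrightarrow> (\<integral>x. 0 \<partial>completion \<mu>)"
  proof (rule integral_dominated_convergence[where w="\<lambda>_. 1"])
    show "AE x in completion \<mu>. (\<lambda>n. \<rho> (D n) E x) \<longlonglongrightarrow> 0"
      using lim unfolding \<mu>_AE
    proof (rule eventually_mono)
      fix x assume "limitin btop (\<lambda>n. D n x) (E x) sequentially"
      then have "(\<lambda>n. d (D n x) (E x)) \<longlonglongrightarrow> 0"
        unfolding mtopology_d[OF d, symmetric] md.limitin_metric_dist_null by blast
      then have "(\<lambda>n. \<rho> (D n) E x) \<longlonglongrightarrow> 0 / (1 + 0)" by (intro tendsto_intros) simp_all
      then show "(\<lambda>n. \<rho> (D n) E x) \<longlonglongrightarrow> 0" by simp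
    qed
    show "integrable (completion \<mu>) (\<lambda>_. 1 :: real)" by (rule finite_measure.integrable_const[OF finite_completion])
    show "AE x in completion \<mu>. norm (\<rho> (D n) E x) \<le> 1" for n
      using \<rho>_bounds by (intro AE_I2) simp
    show "\<rho> (D n) E \<in> borel_measurable (completion \<mu>)" for n by (rule \<rho>_measurable[OF Lp_sectionsD(1)[OF D] E])
  qed simp
  from tendsto_add[OF this Lp0] show "(\<lambda>n. section_dist p d \<mu> (D n) E) \<longlonglongrightarrow> 0"
    by (simp add: section_dist_def)
qed

end

end

section \<open>Completeness\<close>

context riemannian_pair begin

text \<open>Completeness provides a limit within the zero section over x. To obtain convergence of
  the targets in N, it is read as convergence in the bundle topology, on which the target is a
  continuous function.\<close>

lemma zero_section_Cauchy_limit: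
  assumes d: "continuous_distance A B d"
    and nonexp: "\<forall>P\<in>bundle. \<forall>Q\<in>bundle. d (hom_bundle_proj A B P) (hom_bundle_proj A B Q) \<le> d P Q"
    and compl: "Metric_space.mcomplete (range (zero_hom A B x)) d"
    and D: "\<And>n. D n \<in> bundle" "\<And>n. fst (D n) = x" and C: "Metric_space.MCauchy bundle d D"
  shows "\<exists>y. (\<lambda>n. fst (snd (D n))) \<longlonglongrightarrow> y"
proof -
  interpret md: Metric_space "bundle" d by (rule metric_d[OF d])
  have Z: "range (zero_hom A B x) \<subseteq> bundle" using zero_hom_in by (rule image_subsetI)
  interpret mz: Metric_space "range (zero_hom A B x)" d by (rule md.subspace[OF Z])
  have proj: "hom_bundle_proj A B (D n) = zero_hom A B x (fst (snd (D n)))" for n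
    using D(2)[of n] by (cases "D n") (simp add: hom_bundle_proj_def)
  have "mz.MCauchy (\<lambda>n. zero_hom A B x (fst (snd (D n))))"
    unfolding mz.MCauchy_def
  proof (intro conjI allI impI)
    show "range (\<lambda>n. zero_hom A B x (fst (snd (D n)))) \<subseteq> range (zero_hom A B x)" by (intro image_subsetI rangeI)
    fix e :: real assume "e > 0"
    then obtain N where N: "\<And>n n'. N \<le> n \<Longrightarrow> N \<le> n' \<Longrightarrow> d (D n) (D n') < e" using C unfolding md.MCauchy_def by blast
    show "\<exists>N. \<forall>n n'. N \<le> n \<longrightarrow> N \<le> n' \<longrightarrow> d (zero_hom A B x (fst (snd (D n)))) (zero_hom A B x (fst (snd (D n')))) < e"
    proof (rule exI[of _ N], intro allI impI)
      fix n n' assume "N \<le> n" "N \<le> n'"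
      from le_less_trans[OF nonexp[rule_format, OF D(1) D(1)] N[OF this]]
      show "d (zero_hom A B x (fst (snd (D n)))) (zero_hom A B x (fst (snd (D n')))) < e" unfolding proj .
    qed
  qed
  then obtain l where l: "limitin mz.mtopology (\<lambda>n. zero_hom A B x (fst (snd (D n)))) l sequentially"
    using compl unfolding mz.mcomplete_def by blast
  then obtain y where y: "l = zero_hom A B x y" unfolding mz.limitin_metric_dist_null by blast
  have "limitin btop (\<lambda>n. zero_hom A B x (fst (snd (D n)))) (zero_hom A B x y) sequentially"
    unfolding mtopology_d[OF d, symmetric] md.limitin_metric_dist_null
  proof (intro conjI zero_hom_in always_eventually allI)
    show "(\<lambda>n. d (zero_hom A B x (fst (snd (D n)))) (zero_hom A B x y)) \<longlonglongrightarrow> 0"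
      using l unfolding y mz.limitin_metric_dist_null by (elim conjE)
  qed
  from limitin_btop_target[OF this] show ?thesis by (intro exI[of _ y]) (simp add: zero_hom_def)
qed

lemma fibre_Cauchy_limit:
  assumes d: "continuous_distance A B d"
    and nonexp: "\<forall>P\<in>bundle. \<forall>Q\<in>bundle. d (hom_bundle_proj A B P) (hom_bundle_proj A B Q) \<le> d P Q"
    and compl: "Metric_space.mcomplete (range (zero_hom A B x)) d"
    and D: "\<And>n. D n \<in> bundle" "\<And>n. fst (D n) = x" and C: "Metric_space.MCauchy bundle d D"
    and h: "convergent (\<lambda>n. hnorm (D n))"
  shows "\<exists>P. limitin btop D P sequentially"
proof -
  interpret md: Metric_space "bundle" d by (rule metric_d[OF d])
  obtain y where y: "(\<lambda>n. fst (snd (D n))) \<longlonglongrightarrow> y" using zero_section_Cauchy_limit[OF d nonexp compl D C] by blast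
  have De: "D n = (x, fst (snd (D n)), snd (snd (D n)))" for n using D(2)[of n] by (cases "D n") simp
  have hom: "snd (snd (D n)) \<in> hom_space A B x (fst (snd (D n)))" for n
    using D(1)[of n] De[of n] unfolding hom_bundle_def by (cases "D n") simp
  obtain R where R: "\<And>n. norm (hnorm (D n)) \<le> R"
    using convergent_imp_Bseq[OF h] unfolding Bseq_def by blast
  have bd: "hnorm (x, fst (snd (D n)), snd (snd (D n))) \<le> R" for n
    using R[of n] De[of n] by simp
  show ?thesis
  proof (rule bundle_bounded_subsequence[OF y hom bd])
    fix r :: "nat \<Rightarrow> nat" and P
    assume r: "strict_mono r" and P: "limitin btop (\<lambda>n. (x, fst (snd (D (r n))), snd (snd (D (r n))))) P sequentially"
    have "limitin md.mtopology (D \<circ> r) P sequentially" using P unfolding De[symmetric] mtopology_d[OF d] o_def .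
    from md.MCauchy_convergent_subsequence[OF C r this] show ?thesis unfolding mtopology_d[OF d] by (rule exI)
  qed
qed

text \<open>A limit lies in an open set exactly if the sequence eventually keeps a fixed distance
  from the complement. The right-hand side uses only countably many conditions, each about one term
  and one open set, and so makes pointwise limits of measurable sections measurable.\<close>

lemma limitin_btop_open_iff:
  assumes d: "continuous_distance A B d" and lim: "limitin btop D P sequentially" and D: "\<And>n. D n \<in> bundle"
    and W: "openin btop W"
  shows "P \<in> W \<longleftrightarrow> (\<exists>j N. \<forall>n\<ge>N. D n \<notin> (\<Union>Q\<in>bundle - W. Metric_space.mball bundle d Q (1 / real (Suc j))))"
proof -
  interpret md: Metric_space "bundle" d by (rule metric_d[OF d])
  have P: "P \<in> bundle" and dP: "(\<lambda>n. d (D n) P) \<longlonglongrightarrow> 0"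
    using lim unfolding mtopology_d[OF d, symmetric] md.limitin_metric_dist_null by blast+
  show ?thesis
  proof
    assume "P \<in> W"
    then obtain r where r: "r > 0" "md.mball P r \<subseteq> W" using W unfolding mtopology_d[OF d, symmetric] md.openin_mtopology by blast
    obtain j where j: "1 / real (Suc j) < r / 2" using reals_Archimedean[of "r / 2"] r(1) by (auto simp: inverse_eq_divide)
    obtain N where N: "\<And>n. n \<ge> N \<Longrightarrow> d (D n) P < r / 2"
      using order_tendstoD(2)[OF dP, of "r / 2"] r(1) unfolding eventually_sequentially by auto
    have "D n \<notin> md.mball Q (1 / real (Suc j))" if n: "n \<ge> N" and Q: "Q \<in> bundle - W" for n Q
    proof
      assume "D n \<in> md.mball Q (1 / real (Suc j))"
      then have "d Q (D n) < r / 2" using j by auto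
      then have "d P Q < r" using md.triangle[OF P D[of n], of Q] N[OF n] Q by (simp add: md.commute)
      then show False using r(2) P Q by auto
    qed
    then show "\<exists>j N. \<forall>n\<ge>N. D n \<notin> (\<Union>Q\<in>bundle - W. md.mball Q (1 / real (Suc j)))" by blast
  next
    assume "\<exists>j N. \<forall>n\<ge>N. D n \<notin> (\<Union>Q\<in>bundle - W. md.mball Q (1 / real (Suc j)))"
    then obtain j N where N: "\<And>n Q. n \<ge> N \<Longrightarrow> Q \<in> bundle - W \<Longrightarrow> D n \<notin> md.mball Q (1 / real (Suc j))" by blast
    show "P \<in> W"
    proof (rule ccontr)
      assume "P \<notin> W"
      obtain N' where N': "\<And>n. n \<ge> N' \<Longrightarrow> d (D n) P < 1 / real (Suc j)"
        using order_tendstoD(2)[OF dP, of "1 / real (Suc j)"] unfolding eventually_sequentially by auto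
      have "D (max N N') \<in> md.mball P (1 / real (Suc j))"
        using N'[of "max N N'"] P D by (simp add: md.commute)
      then show False using N[of "max N N'" P] P \<open>P \<notin> W\<close> by simp
    qed
  qed
qed

lemma measurable_limit:
  fixes D :: "nat \<Rightarrow> 'm \<Rightarrow> ('m, 'k, 'n, 'l) hom_elem"
  assumes d: "continuous_distance A B d" and D: "\<And>n. D n \<in> measurable (lebesgue_algebra A) bborel"
    and fstD: "\<And>n x. fst (D n x) = x" and ae: "AE_manifold A (\<lambda>x. \<exists>P. limitin btop (\<lambda>n. D n x) P sequentially)"
  shows "\<exists>E \<in> measurable (lebesgue_algebra A) bborel. (\<forall>x. fst (E x) = x) \<and> AE_manifold A (\<lambda>x. limitin btop (\<lambda>n. D n x) (E x) sequentially)"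
proof -
  interpret md: Metric_space "bundle" d by (rule metric_d[OF d])
  define C where "C = {x. \<exists>P. limitin btop (\<lambda>n. D n x) P sequentially}"
  have Cs: "C \<in> sets (lebesgue_algebra A)" unfolding C_def by (rule M.AE_manifold_sets[OF ae])
  \<comment> \<open>Off the convergence set C the zero map with one fixed arbitrary target keeps E x
    in the bundle and over x. The set C is measurable because its complement is null.\<close>
  define E where "E x = (if x \<in> C then SOME P. limitin btop (\<lambda>n. D n x) P sequentially else zero_hom A B x undefined)" for x
  have lim: "limitin btop (\<lambda>n. D n x) (E x) sequentially" if "x \<in> C" for x
  proof -
    have "\<exists>P. limitin btop (\<lambda>n. D n x) P sequentially" using that by (simp add: C_def)
    from someI_ex[OF this] show ?thesis using that by (simp add: E_def)
  qed
  have fstE: "fst (E x) = x" for x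
  proof (cases "x \<in> C")
    case True
    have "(\<lambda>n. fst (D n x)) \<longlonglongrightarrow> fst (E x)"
    proof (rule limitin_btop_tendsto[OF lim[OF True], where R="\<lambda>P. True"])
      fix V :: "'m set" assume V: "open V"
      have "openin btop {P \<in> bundle. fst P \<in> V \<and> fst P \<in> UNIV}"
      proof (rule openin_bundle_Collect[OF V open_UNIV])
        show "continuous_on S (\<lambda>q. fst (param c c' q))" for S c c'
          unfolding fst_param by (intro continuous_intros)
      qed
      then show "openin btop {P \<in> bundle. True \<and> fst P \<in> V}" by simp
    qed simp
    then have "(\<lambda>n :: nat. x) \<longlonglongrightarrow> fst (E x)" unfolding fstD .
    then show ?thesis by (rule LIMSEQ_unique[OF _ tendsto_const])
  qed (simp add: E_def zero_hom_def)
  have Eb: "E x \<in> bundle" for x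
    using lim[of x] zero_hom_in by (cases "x \<in> C") (simp_all add: limitin_def topspace_btop E_def)
  have "E \<in> measurable (lebesgue_algebra A) bborel"
  proof (rule measurable_bborelI[OF Eb])
    fix W assume W: "openin btop W"
    define O' where "O' j = (\<Union>Q\<in>bundle - W. md.mball Q (1 / real (Suc j)))" for j
    have O': "openin btop (O' j)" for j
      unfolding O'_def mtopology_d[OF d, symmetric] by (rule openin_Union) (use md.openin_mball in blast)
    have s1: "{x. D n x \<in> O' j} \<in> sets (lebesgue_algebra A)" for n j
      using measurable_bborel_open[OF D O'] by simp
    have s2: "{x. zero_hom A B x undefined \<in> W} \<in> sets (lebesgue_algebra A)"
      using M.borel_subset_lebesgue_algebra borel_open[OF open_zero_section[OF W]] by (rule subsetD)
    have "(\<Union>j. \<Union>N. \<Inter>n\<in>{N..}. space (lebesgue_algebra A) - {x. D n x \<in> O' j}) \<in> sets (lebesgue_algebra A)"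
    proof (intro sets.countable_UN'' sets.countable_INT'' sets.compl_sets s1 countableI_type)
      show "UNIV \<in> sets (lebesgue_algebra A)" using sets.top[of "lebesgue_algebra A"] by simp
    qed
    then have s3: "C \<inter> (\<Union>j. \<Union>N. \<Inter>n\<in>{N..}. space (lebesgue_algebra A) - {x. D n x \<in> O' j}) \<in> sets (lebesgue_algebra A)"
      using Cs by blast
    have s4: "(space (lebesgue_algebra A) - C) \<inter> {x. zero_hom A B x undefined \<in> W} \<in> sets (lebesgue_algebra A)"
      using Cs s2 by blast
    have "E -` W \<inter> space (lebesgue_algebra A) = C \<inter> (\<Union>j. \<Union>N. \<Inter>n\<in>{N..}. space (lebesgue_algebra A) - {x. D n x \<in> O' j}) \<union>
       ((space (lebesgue_algebra A) - C) \<inter> {x. zero_hom A B x undefined \<in> W})" (is "?L = ?R")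
    proof (rule set_eqI)
      fix x
      show "x \<in> ?L \<longleftrightarrow> x \<in> ?R"
      proof (cases "x \<in> C")
        case True
        have "E x \<in> W \<longleftrightarrow> (\<exists>j N. \<forall>n\<ge>N. D n x \<notin> O' j)"
          unfolding O'_def by (rule limitin_btop_open_iff[OF d lim[OF True] in_bundle[OF D] W])
        then show ?thesis using True by (simp add: Ball_def)
      qed (simp add: E_def)
    qed
    then show "E -` W \<inter> space (lebesgue_algebra A) \<in> sets (lebesgue_algebra A)" using s3 s4 by simp
  qed
  moreover have "AE_manifold A (\<lambda>x. limitin btop (\<lambda>n. D n x) (E x) sequentially)"
    by (rule M.AE_manifold_mono[OF ae]) (rule lim, simp add: C_def)
  ultimately show ?thesis using fstE by blast
qed

lemma Lp_sections_complete:
  fixes D :: "nat \<Rightarrow> 'm \<Rightarrow> ('m, 'k, 'n, 'l) hom_elem"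
  assumes p: "p \<ge> 1" and d: "continuous_distance A B d" and \<mu>: "finite_positive_abs_cont A \<mu>"
    and nonexp: "\<forall>P\<in>bundle. \<forall>Q\<in>bundle. d (hom_bundle_proj A B P) (hom_bundle_proj A B Q) \<le> d P Q"
    and compl: "AE_manifold A (\<lambda>x. Metric_space.mcomplete (range (zero_hom A B x)) d)"
    and D: "\<And>n. D n \<in> Lp_sections p" and fstD: "\<And>n x. fst (D n x) = x"
    and Cauchy: "\<And>e. e > 0 \<Longrightarrow> \<exists>N. \<forall>m\<ge>N. \<forall>n\<ge>N. section_dist p d \<mu> (D m) (D n) < e"
  shows "\<exists>k E. strict_mono k \<and> E \<in> Lp_sections p \<and> (\<forall>x. fst (E x) = x) \<and>
    AE_manifold A (\<lambda>x. limitin btop (\<lambda>n. D (k n) x) (E x) sequentially) \<and>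
    (\<lambda>n. \<integral>x. \<bar>hnorm (D (k n) x) - hnorm (E x)\<bar> powr p \<partial>volM) \<longlonglongrightarrow> 0 \<and>
    (\<lambda>n. section_dist p d \<mu> (D (k n)) E) \<longlonglongrightarrow> 0"
proof -
  have "\<forall>j. \<exists>N. \<forall>m\<ge>N. \<forall>n\<ge>N. section_dist p d \<mu> (D m) (D n) < (1/4) ^ j" by (intro allI Cauchy) simp
  from choice[OF this] obtain N :: "nat \<Rightarrow> nat"
    where N: "\<And>j m n. m \<ge> N j \<Longrightarrow> n \<ge> N j \<Longrightarrow> section_dist p d \<mu> (D m) (D n) < (1/4) ^ j" by blast
  \<comment> \<open>The summand j makes k strictly increasing, and the partial sum dominates N
    j.\<close>
  define k where "k j = j + sum N {..j}" for j
  have k: "strict_mono k" by (rule strict_mono_Suc_iff[THEN iffD2]) (simp add: k_def)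
  have kN: "k j \<ge> N j" for j using member_le_sum[of j "{..j}" N] by (simp add: k_def)
  have rapid: "section_dist p d \<mu> (D (k j)) (D (k (Suc j))) \<le> (1/4) ^ j" for j
    by (rule less_imp_le, rule N[OF kN order_trans[OF kN]]) (rule less_imp_le, rule strict_monoD[OF k], simp)
  have "AE_manifold A (\<lambda>x. (Metric_space.MCauchy bundle d (\<lambda>n. D (k n) x) \<and> convergent (\<lambda>n. hnorm (D (k n) x))) \<and>
     Metric_space.mcomplete (range (zero_hom A B x)) d)"
    by (rule M.AE_manifold_conj[OF rapid_AE_Cauchy[OF p d \<mu>] compl]) (rule D, rule rapid)
  then have ae: "AE_manifold A (\<lambda>x. \<exists>P. limitin btop (\<lambda>n. D (k n) x) P sequentially)"
  proof (rule M.AE_manifold_mono, elim conjE)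
    fix x assume *: "Metric_space.MCauchy bundle d (\<lambda>n. D (k n) x)" "convergent (\<lambda>n. hnorm (D (k n) x))"
      "Metric_space.mcomplete (range (zero_hom A B x)) d"
    show "\<exists>P. limitin btop (\<lambda>n. D (k n) x) P sequentially"
      by (rule fibre_Cauchy_limit[OF d nonexp *(3) _ _ *(1,2)]) (rule Lp_sectionsD(2)[OF D], rule fstD)
  qed
  obtain E where E: "E \<in> measurable (lebesgue_algebra A) bborel" "\<forall>x. fst (E x) = x"
    "AE_manifold A (\<lambda>x. limitin btop (\<lambda>n. D (k n) x) (E x) sequentially)"
    using measurable_limit[OF d Lp_sectionsD(1)[OF D] fstD ae] by blast
  have kC: "\<exists>N. \<forall>m\<ge>N. \<forall>n\<ge>N. section_dist p d \<mu> (D (k m)) (D (k n)) < e" if e: "e > 0" for e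
  proof -
    obtain N where "\<And>m n. m \<ge> N \<Longrightarrow> n \<ge> N \<Longrightarrow> section_dist p d \<mu> (D m) (D n) < e" using Cauchy[OF e] by blast
    then have "\<forall>m\<ge>N. \<forall>n\<ge>N. section_dist p d \<mu> (D (k m)) (D (k n)) < e"
      using seq_suble[OF k] order_trans by blast
    then show ?thesis by blast
  qed
  note L = Cauchy_AE_limit[OF p d \<mu> D E(1,3) kC]
  show ?thesis
    by (intro exI[of _ k] exI[of _ E] conjI k L E)
qed

text \<open>The limit map is the target component of the limit section. A colocal derivative must
  match every weak derivative of f o u; \<open>has_weak_derivative_limit\<close> exhibits one of
  them, and uniqueness reduces the others to it.\<close>

lemma colocal_weak_derivative_limit:
  fixes Dn :: "nat \<Rightarrow> 'm \<Rightarrow> ('m, 'k, 'n, 'l) hom_elem"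
  assumes p: "p \<ge> 1" and un: "\<And>n. colocally_weakly_differentiable A B (un n)"
    and Dn: "\<And>n. is_colocal_weak_derivative A B (un n) (Dn n)" "\<And>n. Dn n \<in> Lp_sections p"
    and D: "D \<in> Lp_sections p" "\<And>x. fst (D x) = x"
    and lim: "AE_manifold A (\<lambda>x. limitin btop (\<lambda>n. Dn n x) (D x) sequentially)"
    and conv: "(\<lambda>n. \<integral>x. \<bar>hnorm (Dn n x) - hnorm (D x)\<bar> powr p \<partial>volM) \<longlonglongrightarrow> 0"
  shows "colocally_weakly_differentiable A B (\<lambda>x. fst (snd (D x)))" "is_colocal_weak_derivative A B (\<lambda>x. fst (snd (D x))) D"
proof -
  define u where "u = (\<lambda>x. fst (snd (D x)))"
  define U where "U x = snd (snd (D x))" for x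
  note Dm = Lp_sectionsD(1)[OF D(1)]
  have Dx: "D x = (x, u x, U x)" for x using D(2)[of x] by (simp add: u_def U_def prod_eq_iff)
  have Ux: "U x \<in> hom_space A B x (u x)" for x using in_bundle[OF Dm, of x] unfolding Dx hom_bundle_def by simp
  have um: "u \<in> borel_measurable (lebesgue_algebra A)"
  proof (rule borel_measurableI)
    fix V :: "'n set" assume V: "open V"
    have "openin btop {P \<in> bundle. fst P \<in> UNIV \<and> fst (snd P) \<in> V}"
      by (rule openin_bundle_Collect[OF open_UNIV V continuous_on_target_param])
    from measurable_bborel_open[OF Dm this]
    show "u -` V \<inter> space (lebesgue_algebra A) \<in> sets (lebesgue_algebra A)"
      using in_bundle[OF Dm] by (simp add: u_def vimage_def)
  qed
  have nonneg: "hnorm P = \<bar>hnorm P\<bar>" if "P \<in> bundle" for P using hnorm_nonneg[OF that] by simp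
  have int: "integrable volM (\<lambda>x. hnorm (F x) powr p)" if "F \<in> Lp_sections p" for F
    using that by (simp add: Lp_sections_def)
  have wd: "has_weak_derivative A (f \<circ> u) (\<lambda>x v. differential B f (u x) (U x v))" if f: "f \<in> C1_compact_support B" for f
    by (rule has_weak_derivative_limit[OF p un Dn(1) Dm Dx Ux um lim int[OF Dn(2)] int[OF D(1)]
      integrable_powr_diff[OF p Lp_sectionsD(3)[OF Dn(2)] Lp_sectionsD(3)[OF D(1)] Lp_sectionsD(4)[OF Dn(2)] Lp_sectionsD(4)[OF D(1)]] conv f])
  show "colocally_weakly_differentiable A B (\<lambda>x. fst (snd (D x)))"
    unfolding u_def[symmetric] colocally_weakly_differentiable_def weakly_differentiable_def using um wd by blast
  show "is_colocal_weak_derivative A B (\<lambda>x. fst (snd (D x))) D"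
    unfolding u_def[symmetric] is_colocal_weak_derivative_def
  proof (intro exI[of _ U] conjI allI ballI impI Dx Ux Dm)
    fix f \<omega> assume f: "f \<in> C1_compact_support B" and \<omega>: "has_weak_derivative A (f \<circ> u) \<omega>"
    show "AE_manifold A (\<lambda>x. \<forall>v\<in>tangent_space A x. \<omega> x v = differential B f (u x) (U x v))"
      by (rule M.weak_derivative_unique[OF \<omega> wd[OF f]])
  qed
qed

section \<open>Sobolev maps and their derivatives as sections\<close>

lemma is_colocal_weak_derivativeD:
  assumes "is_colocal_weak_derivative A B u D"
  shows "D \<in> measurable (lebesgue_algebra A) bborel" "fst (D x) = x" "fst (snd (D x)) = u x"
  using assms unfolding is_colocal_weak_derivative_def by (elim exE conjE, simp)+

lemma sobolev_mapsD:
  assumes u: "u \<in> sobolev_maps A gM B gN p"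
  shows "colocally_weakly_differentiable A B u" "is_colocal_weak_derivative A B u (colocal_weak_derivative A B u)"
    "colocal_weak_derivative A B u \<in> Lp_sections p"
proof -
  show 1: "colocally_weakly_differentiable A B u" using u by (simp add: sobolev_maps_def)
  show 2: "is_colocal_weak_derivative A B u (colocal_weak_derivative A B u)" by (rule colocal_weak_derivative_is[OF 1])
  note m = is_colocal_weak_derivativeD(1)[OF 2]
  have "integrable volM (\<lambda>x. \<bar>hnorm (colocal_weak_derivative A B u x)\<bar> powr p)" using u by (simp add: sobolev_maps_def in_Lp_def)
  then show "colocal_weak_derivative A B u \<in> Lp_sections p"
    using m hnorm_nonneg[OF in_bundle[OF m]] by (simp add: Lp_sections_def)
qed

text \<open>\<open>colocal_weak_derivative\<close> is picked by \<open>SOME\<close>, so a derivative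
  found by other means agrees with it only almost everywhere; this is enough to transfer
  integrability of the norm.\<close>

lemma sobolev_mapsI:
  assumes u: "colocally_weakly_differentiable A B u" and D: "is_colocal_weak_derivative A B u D" "D \<in> Lp_sections p"
  shows "u \<in> sobolev_maps A gM B gN p" "AE_manifold A (\<lambda>x. D x = colocal_weak_derivative A B u x)"
proof -
  note 1 = colocal_weak_derivative_is[OF u]
  have refl: "AE_manifold A (\<lambda>x. u x = u x)" unfolding volM_AE by simp
  show eq: "AE_manifold A (\<lambda>x. D x = colocal_weak_derivative A B u x)"
    by (rule colocal_weak_derivative_unique[OF u D(1) 1 refl])
  have m: "(\<lambda>x. hnorm (colocal_weak_derivative A B u x)) \<in> borel_measurable volM"
    by (rule volM_measurable[OF hnorm_measurable[OF is_colocal_weak_derivativeD(1)[OF 1]]])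
  have ae: "AE x in volM. \<bar>hnorm (D x)\<bar> powr p = \<bar>hnorm (colocal_weak_derivative A B u x)\<bar> powr p"
    using eq unfolding volM_AE by (rule eventually_mono) simp
  have "integrable volM (\<lambda>x. \<bar>hnorm (colocal_weak_derivative A B u x)\<bar> powr p)"
    using Lp_sectionsD(4)[OF D(2)]
    by (subst integrable_cong_AE[OF _ _ ae, symmetric]) (use m Lp_sectionsD(3)[OF D(2)] in measurable)
  then show "u \<in> sobolev_maps A gM B gN p" using u m by (simp add: sobolev_maps_def in_Lp_def)
qed

end

context riemannian_pair begin

abbreviation "sob_rel p \<equiv> {(u, v). u \<in> sobolev_maps A gM B gN p \<and> v \<in> sobolev_maps A gM B gN p \<and> AE_manifold A (\<lambda>x. u x = v x)}"

abbreviation "cwd \<equiv> colocal_weak_derivative A B"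

lemma equiv_sob_rel: "equiv (sobolev_maps A gM B gN p) (sob_rel p)"
proof (rule equivI)
  show "refl_on (sobolev_maps A gM B gN p) (sob_rel p)" by (rule refl_onI) (simp add: volM_AE)
  show "sym (sob_rel p)"
  proof (rule symI, elim CollectE case_prodE Pair_inject conjE, hypsubst, intro CollectI case_prodI conjI)
    fix u v assume "AE_manifold A (\<lambda>x. u x = v x)"
    then show "AE_manifold A (\<lambda>x. v x = u x)" by (rule M.AE_manifold_mono) (rule sym)
  qed
  show "trans (sob_rel p)"
  proof (rule transI, elim CollectE case_prodE Pair_inject conjE, hypsubst, intro CollectI case_prodI conjI)
    fix u v w assume "AE_manifold A (\<lambda>x. u x = v x)" "AE_manifold A (\<lambda>x. v x = w x)"
    from M.AE_manifold_conj[OF this] show "AE_manifold A (\<lambda>x. u x = w x)" by (rule M.AE_manifold_mono) simp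
  qed
qed auto

text \<open>The derivative carries its map as the target component, and conversely derivatives are
  unique almost everywhere. Hence vanishing distance of the derivatives identifies exactly the
  classes of maps.\<close>

lemma cwd_AE_iff:
  assumes u: "u \<in> sobolev_maps A gM B gN p" and v: "v \<in> sobolev_maps A gM B gN p"
  shows "AE_manifold A (\<lambda>x. cwd u x = cwd v x) \<longleftrightarrow> AE_manifold A (\<lambda>x. u x = v x)"
proof
  assume "AE_manifold A (\<lambda>x. cwd u x = cwd v x)"
  then show "AE_manifold A (\<lambda>x. u x = v x)"
  proof (rule M.AE_manifold_mono)
    fix x assume "cwd u x = cwd v x"
    then have "fst (snd (cwd u x)) = fst (snd (cwd v x))" by simp
    then show "u x = v x"
      unfolding is_colocal_weak_derivativeD(3)[OF sobolev_mapsD(2)[OF u]] is_colocal_weak_derivativeD(3)[OF sobolev_mapsD(2)[OF v]] .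
  qed
qed (rule colocal_weak_derivative_unique[OF sobolev_mapsD(1)[OF u] sobolev_mapsD(2)[OF u] sobolev_mapsD(2)[OF v]])

theorem sobolev_space_complete:
  assumes p: "p \<ge> 1" and d: "continuous_distance A B d" and \<mu>: "finite_positive_abs_cont A \<mu>"
    and compl: "AE_manifold A (\<lambda>x. Metric_space.mcomplete (range (zero_hom A B x)) d)"
    and nonexp: "\<forall>P\<in>bundle. \<forall>Q\<in>bundle. d (hom_bundle_proj A B P) (hom_bundle_proj A B Q) \<le> d P Q"
  shows "Metric_space (sobolev_space A gM B gN p) (sobolev_dist A gM B gN p d \<mu>) \<and>
    Metric_space.mcomplete (sobolev_space A gM B gN p) (sobolev_dist A gM B gN p d \<mu>)"
proof -
  let ?S = "sobolev_maps A gM B gN p" and ?Q = "sobolev_space A gM B gN p" and ?\<delta> = "sobolev_dist A gM B gN p d \<mu>"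
  \<comment> \<open>The representative on which \<open>sobolev_dist\<close> is evaluated; with it
    the distance of two classes is literally a distance of sections.\<close>
  let ?r = "\<lambda>X. SOME u :: 'm \<Rightarrow> 'n. u \<in> X"
  have Q: "?Q = ?S // sob_rel p" by (simp add: sobolev_space_def)
  have rS: "?r X \<in> ?S" if "X \<in> ?Q" for X using equiv_Eps_preserves[OF equiv_sob_rel] that unfolding Q .
  have rX: "sob_rel p `` {?r X} = X" if "X \<in> ?Q" for X using proj_Eps[OF equiv_sob_rel] that unfolding Q proj_def .
  have \<delta>: "?\<delta> X Y = section_dist p d \<mu> (cwd (?r X)) (cwd (?r Y))" for X Y
    unfolding sobolev_dist_def sobolev_delta_def section_dist_def Let_def by (rule refl)
  have cL: "cwd (?r X) \<in> Lp_sections p" if "X \<in> ?Q" for X by (rule sobolev_mapsD(3)[OF rS[OF that]])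
  have ms: "Metric_space ?Q ?\<delta>"
  proof
    show "0 \<le> ?\<delta> X Y" for X Y unfolding \<delta> by (rule section_dist_parts(4)[OF p d \<mu>])
    show "?\<delta> X Y = ?\<delta> Y X" for X Y unfolding \<delta> by (rule section_dist_commute[OF p d \<mu>])
    show "?\<delta> X Z \<le> ?\<delta> X Y + ?\<delta> Y Z" if "X \<in> ?Q" "Y \<in> ?Q" "Z \<in> ?Q" for X Y Z
      unfolding \<delta> by (rule section_dist_triangle[OF p d \<mu> cL cL cL]) (rule that)+
    show "?\<delta> X Y = 0 \<longleftrightarrow> X = Y" if X: "X \<in> ?Q" and Y: "Y \<in> ?Q" for X Y
    proof
      assume "?\<delta> X Y = 0"
      then have "AE_manifold A (\<lambda>x. cwd (?r X) x = cwd (?r Y) x)"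
        unfolding \<delta> by (rule section_dist_0_imp[OF p d \<mu> cL[OF X] cL[OF Y]])
      then have "AE_manifold A (\<lambda>x. ?r X x = ?r Y x)" unfolding cwd_AE_iff[OF rS[OF X] rS[OF Y]] .
      then have "(?r X, ?r Y) \<in> sob_rel p" using rS[OF X] rS[OF Y] by (intro CollectI case_prodI conjI)
      from equiv_class_eq[OF equiv_sob_rel this] show "X = Y" unfolding rX[OF X] rX[OF Y] .
    next
      assume "X = Y"
      then show "?\<delta> X Y = 0" unfolding \<delta> using section_dist_self[OF p d \<mu> cL[OF X]] by simp
    qed
  qed
  interpret s: Metric_space ?Q ?\<delta> by (rule ms)
  have "s.mcomplete"
    unfolding s.mcomplete_def
  proof (intro allI impI)
    fix \<sigma> assume \<sigma>: "s.MCauchy \<sigma>"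
    have \<sigma>Q: "\<sigma> n \<in> ?Q" for n using \<sigma> unfolding s.MCauchy_def by blast
    define D where "D n = cwd (?r (\<sigma> n))" for n
    have Dc: "colocally_weakly_differentiable A B (?r (\<sigma> n))" "is_colocal_weak_derivative A B (?r (\<sigma> n)) (D n)" "D n \<in> Lp_sections p" for n
      unfolding D_def by (rule sobolev_mapsD[OF rS[OF \<sigma>Q]])+
    have C: "\<exists>N. \<forall>m\<ge>N. \<forall>n\<ge>N. section_dist p d \<mu> (D m) (D n) < e" if e: "e > 0" for e
    proof -
      have "\<forall>e>0. \<exists>N. \<forall>n n'. N \<le> n \<longrightarrow> N \<le> n' \<longrightarrow> section_dist p d \<mu> (D n) (D n') < e"
        using \<sigma> unfolding s.MCauchy_def \<delta> D_def by (rule conjunct2)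
      from this[rule_format, OF e] show ?thesis by (elim exE, intro exI allI impI, elim allE impE)
    qed
    have "\<exists>k E. strict_mono k \<and> E \<in> Lp_sections p \<and> (\<forall>x. fst (E x) = x) \<and>
      AE_manifold A (\<lambda>x. limitin btop (\<lambda>n. D (k n) x) (E x) sequentially) \<and>
      (\<lambda>n. \<integral>x. \<bar>hnorm (D (k n) x) - hnorm (E x)\<bar> powr p \<partial>volM) \<longlonglongrightarrow> 0 \<and>
      (\<lambda>n. section_dist p d \<mu> (D (k n)) E) \<longlonglongrightarrow> 0"
      by (rule Lp_sections_complete[OF p d \<mu> nonexp compl Dc(3) is_colocal_weak_derivativeD(2)[OF Dc(2)]]) (rule C)
    then obtain k E where k: "strict_mono k" and E: "E \<in> Lp_sections p" "\<forall>x. fst (E x) = x"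
      and lim: "AE_manifold A (\<lambda>x. limitin btop (\<lambda>n. D (k n) x) (E x) sequentially)"
      and conv: "(\<lambda>n. \<integral>x. \<bar>hnorm (D (k n) x) - hnorm (E x)\<bar> powr p \<partial>volM) \<longlonglongrightarrow> 0"
      and dist: "(\<lambda>n. section_dist p d \<mu> (D (k n)) E) \<longlonglongrightarrow> 0"
      by (elim exE conjE)
    define u where "u = (\<lambda>x. fst (snd (E x)))"
    note u = colocal_weak_derivative_limit[OF p Dc(1) Dc(2) Dc(3) E(1) E(2)[rule_format] lim conv, folded u_def]
    note uS = sobolev_mapsI[OF u E(1)]
    define X where "X = sob_rel p `` {u}"
    have X: "X \<in> ?Q" unfolding Q X_def by (rule quotientI[OF uS(1)])
    have "?r X \<in> X" using equiv_Eps_in[OF equiv_sob_rel] X unfolding Q .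
    then have "AE_manifold A (\<lambda>x. u x = ?r X x)" unfolding X_def by (elim ImageE CollectE case_prodE Pair_inject conjE) simp
    then have "AE_manifold A (\<lambda>x. cwd u x = cwd (?r X) x)" unfolding cwd_AE_iff[OF uS(1) rS[OF X]] .
    from M.AE_manifold_conj[OF uS(2) this] have eq: "AE_manifold A (\<lambda>x. E x = cwd (?r X) x)" by (rule M.AE_manifold_mono) simp
    \<comment> \<open>The limit section E need not be the derivative picked by \<open>SOME\<close>,
      nor u the chosen representative of X; equality almost everywhere suffices for the
      distance.\<close>
    have "?\<delta> (\<sigma> (k n)) X = section_dist p d \<mu> (D (k n)) E" for n
    proof -
      have "?\<delta> (\<sigma> (k n)) X = section_dist p d \<mu> (cwd (?r X)) (D (k n))"
        unfolding \<delta> D_def by (rule section_dist_commute[OF p d \<mu>])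
      also have "\<dots> = section_dist p d \<mu> E (D (k n))"
        by (rule section_dist_cong_AE[OF p d \<mu> E(1) cL[OF X] Dc(3) eq, symmetric])
      also have "\<dots> = section_dist p d \<mu> (D (k n)) E" by (rule section_dist_commute[OF p d \<mu>])
      finally show ?thesis .
    qed
    with dist have "(\<lambda>n. ?\<delta> ((\<sigma> \<circ> k) n) X) \<longlonglongrightarrow> 0" unfolding o_def by simp
    then have "limitin s.mtopology (\<sigma> \<circ> k) X sequentially"
      unfolding s.limitin_metric_dist_null using X \<sigma>Q by (intro conjI always_eventually allI) simp_all
    from s.MCauchy_convergent_subsequence[OF \<sigma> k this] show "\<exists>X. limitin s.mtopology \<sigma> X sequentially" by (rule exI)
  qed
  with ms show ?thesis by (rule conjI)
qed

end

theorem proposition4p3: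
  fixes A :: "('m::{second_countable_topology, t2_space}, 'k::finite) chart set"
    and gM :: "'m \<Rightarrow> ('m, 'k) tvec \<Rightarrow> ('m, 'k) tvec \<Rightarrow> real"
    and B :: "('n::{second_countable_topology, t2_space}, 'l::finite) chart set"
    and gN :: "'n \<Rightarrow> ('n, 'l) tvec \<Rightarrow> ('n, 'l) tvec \<Rightarrow> real"
    and p :: real
    and d :: "('m, 'k, 'n, 'l) hom_elem \<Rightarrow> ('m, 'k, 'n, 'l) hom_elem \<Rightarrow> real"
    and \<mu> :: "'m measure"
  assumes "riemannian_manifold A gM"
    and "riemannian_manifold B gN"
    and "1 \<le> p"
    and "continuous_distance A B d"
    and "finite_positive_abs_cont A \<mu>"
    and "AE_manifold A (\<lambda>x. Metric_space.mcomplete (range (zero_hom A B x)) d)"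
    and "\<forall>P\<in>hom_bundle A B. \<forall>Q\<in>hom_bundle A B.
           d (hom_bundle_proj A B P) (hom_bundle_proj A B Q) \<le> d P Q"
  shows "Metric_space (sobolev_space A gM B gN p) (sobolev_dist A gM B gN p d \<mu>) \<and>
         Metric_space.mcomplete (sobolev_space A gM B gN p) (sobolev_dist A gM B gN p d \<mu>)"
proof -
  interpret riemannian_pair A gM B gN
    by (intro riemannian_pair.intro riemannian.intro assms(1,2))
  show ?thesis by (rule sobolev_space_complete[OF assms(3-7)])
qed

end
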